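(* Let $R$ be a unital commutative ring and $D$ an associative unital $R$-superdialgebra with an $R$-basis containing the identity (the chosen bar-unit). Let $m,n$ be non-negative integers. Then, as $R$-supermodules (with $=$ meaning isomorphism), $$\mathrm{HL}_2\big(\mathfrak{sl}(m,n,D)\big)=\begin{cases}\mathrm{HHS}_1(D) & \text{for } m+n\ge 5 \text{ or } m=2,\ n=1,\\ \mathrm{HHS}_1(D)\oplus D_3^6 & \text{for } m=3,\ n=0,\\ \mathrm{HHS}_1(D)\oplus D_2^6 & \text{for } m=4,\ n=0,\\ \mathrm{HHS}_1(D)\oplus \Pi(D_2)^6 & \text{for } m=3,\ n=1,\\ \mathrm{HHS}_1(D)\oplus D_2^4\oplus D_0^2 & \text{for } m=2,\ n=2,\end{cases}$$ where $D_k$ is the quotient of $D$ by the ideal $kD+([D,D]\dashv D)$ and $\Pi$ is the parity change functor.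
   Context: $R$ is a fixed unital commutative ring; $|x|\in\mathbb{Z}_2$ denotes the degree of a homogeneous element, and formulas involving degrees are for homogeneous elements and extended linearly. An associative superdialgebra $D=D_{\bar 0}\oplus D_{\bar 1}$ is a $\mathbb{Z}_2$-graded $R$-module with two associative $R$-linear operations $\vdash,\dashv\colon D\otimes_R D\to D$, compatible with the grading, such that $a\dashv(b\dashv c)=a\dashv(b\vdash c)$, $(a\vdash b)\dashv c=a\vdash(b\dashv c)$, $(a\dashv b)\vdash c=(a\vdash b)\vdash c$. It is unital if it has a chosen bar-unit (identity), i.e. an (even) element $1$ with $a\dashv 1=a=1\vdash a$ for all $a$. $[D,D]$ is the $R$-submodule spanned by the elements $a\dashv b-(-1)^{|a||b|}b\vdash a$, and $[D,D]\dashv D$ is the $R$-submodule spanned by the products $x\dashv d$ with $x\in[D,D]$, $d\in D$; it is the (two-sided, for both operations) ideal of $D$ generated by $[D,D]$. The quotients $D_k$, $k\in\{0,2,3\}$ (not to be confused with the graded parts $D_{\bar 0},D_{\bar 1}$), carry the induced grading, $D_k^r$ is the direct sum of $r$ copies, and $\Pi$ exchanges even and odd parts of an $R$-supermodule. Hochschild homology: $d_n\colon D^{\otimes n+1}\to D^{\otimes n}$ (over $R$) is given by $$d_n(a_0\otimes\cdots\otimes a_n)=\sum_{i=0}^{n-1}(-1)^i\,a_0\otimes\cdots\otimes a_i\dashv a_{i+1}\otimes\cdots\otimes a_n+(-1)^{n+|a_n|\sum_{i=0}^{n-1}|a_i|}\,a_n\vdash a_0\otimes a_1\otimes\cdots\otimes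 a_{n-1},$$ and $\mathrm{HHS}_1(D)=\mathrm{Ker}\,d_1/(\mathrm{Im}\,d_2+I)$, where $I$ is the $R$-submodule of $D\otimes_R D$ generated by the elements $a\otimes(b\dashv c)-a\otimes(b\vdash c)$. A Leibniz superalgebra $L$ is an $R$-supermodule with an even $R$-linear map $[-,-]\colon L\otimes_R L\to L$ satisfying $[x,[y,z]]=[[x,y],z]-(-1)^{|y||z|}[[x,z],y]$. Its second Leibniz homology with trivial coefficients is $\mathrm{HL}_2(L)=\mathrm{Ker}\,\delta_2/\mathrm{Im}\,\delta_3$, where $\delta_2\colon L\otimes_R L\to L$, $\delta_2(x\otimes y)=[x,y]$, and $\delta_3\colon L^{\otimes 3}\to L^{\otimes 2}$, $\delta_3(x\otimes y\otimes z)=-[x,y]\otimes z+x\otimes[y,z]+(-1)^{|y||z|}[x,z]\otimes y$. For non-negative integers $m,n$ put $|i|=\bar 0$ for $1\le i\le m$ and $|i|=\bar 1$ for $m+1\le i\le m+n$. $\mathfrak{gl}(m,n,D)$ is the $R$-module of $(m+n)\times(m+n)$ matrices over $D$, where the matrix $E_{ij}(a)$ with $a$ in position $(i,j)$ and zeros elsewhere has degree $|i|+|j|+|a|$, with bracket $[x,y]=x\dashv y-(-1)^{|x||y|}y\vdash x$, where $(x\dashv y)_{ij}=\sum_k x_{ik}\dashv y_{kj}$ and $(x\vdash y)_{ij}=\sum_k x_{ik}\vdash y_{kj}$. $\mathfrak{sl}(m,n,D)=[\mathfrak{gl}(m,n,D),\mathfrak{gl}(m,n,D)]$. *)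

theory Defs
  imports
    Complex_Main
    "HOL-Library.Z2"
    "HOL-Library.Poly_Mapping"
    "HOL-Library.Set_Algebras"
    "HOL-Library.Function_Algebras"
    "HOL-Library.Product_Plus"
begin

section \<open>Supermodules\<close>

text \<open>
  The ground ring is a type of class \<^class>\<open>comm_ring_1\<close>; degrees live in the field \<^typ>\<open>bit\<close>
  with two elements. The addition of a supermodule is always the addition of the type of
  its elements. For quotients the elements are cosets, i.e. sets, and their sum is the
  elementwise sum of \<^theory>\<open>HOL-Library.Set_Algebras\<close>; the neutral element of a quotient by
  \<open>B\<close> is therefore the coset \<open>B\<close> and not the constant \<open>0\<close> of the type of sets. This is why
  \<open>mzero\<close> is used below.
\<close>

record ('r, 'a) supermodule =
  carrier :: "'a set"
  smult :: "'r \<Rightarrow> 'a \<Rightarrow> 'a"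
  part :: "bit \<Rightarrow> 'a set"

definition mzero :: "('r, 'a::comm_monoid_add, 'z) supermodule_scheme \<Rightarrow> 'a" where
  "mzero M = (THE z. z \<in> carrier M \<and> (\<forall>x\<in>carrier M. z + x = x))"

definition component :: "('r, 'a::comm_monoid_add, 'z) supermodule_scheme \<Rightarrow> bit \<Rightarrow> 'a \<Rightarrow> 'a" where
  "component M p x = (THE y. y \<in> part M p \<and> (\<exists>z\<in>part M (p + 1). x = y + z))"

definition submod :: "('r, 'a::comm_monoid_add, 'z) supermodule_scheme \<Rightarrow> 'a set \<Rightarrow> bool" where
  "submod M N \<longleftrightarrow> N \<subseteq> carrier M \<and> mzero M \<in> N \<and>
    (\<forall>x\<in>N. \<forall>y\<in>N. x + y \<in> N) \<and> (\<forall>c. \<forall>x\<in>N. smult M c x \<in> N)"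

definition generated :: "('r, 'a::comm_monoid_add, 'z) supermodule_scheme \<Rightarrow> 'a set \<Rightarrow> 'a set" where
  "generated M S = \<Inter> {N. submod M N \<and> S \<subseteq> N}"

definition restr :: "('r, 'a, 'z) supermodule_scheme \<Rightarrow> 'a set \<Rightarrow> ('r, 'a) supermodule" where
  "restr M K = \<lparr>carrier = K, smult = smult M, part = (\<lambda>p. part M p \<inter> K)\<rparr>"

definition quot :: "('r, 'a::comm_monoid_add, 'z) supermodule_scheme \<Rightarrow> 'a set \<Rightarrow> ('r, 'a set) supermodule" where
  "quot M B = \<lparr>carrier = (\<lambda>x. x +o B) ` carrier M,
     smult = (\<lambda>c X. smult M c ` X + B),
     part = (\<lambda>p. (\<lambda>x. x +o B) ` part M p)\<rparr>"

definition dsum :: "('r, 'a) supermodule \<Rightarrow> ('r, 'b) supermodule \<Rightarrow> ('r, 'a \<times> 'b) supermodule"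
    (infixr "\<oplus>" 65) where
  "M \<oplus> N = \<lparr>carrier = carrier M \<times> carrier N,
     smult = (\<lambda>c (x, y). (smult M c x, smult N c y)),
     part = (\<lambda>p. part M p \<times> part N p)\<rparr>"

text \<open>The direct sum of \<open>r\<close> copies; the entries at positions \<open>\<ge> r\<close> carry no information.\<close>

definition mpower :: "('r, 'a::zero) supermodule \<Rightarrow> nat \<Rightarrow> ('r, nat \<Rightarrow> 'a) supermodule" where
  "mpower M r = \<lparr>carrier = {f. (\<forall>i<r. f i \<in> carrier M) \<and> (\<forall>i\<ge>r. f i = 0)},
     smult = (\<lambda>c f i. if i < r then smult M c (f i) else 0),
     part = (\<lambda>p. {f. (\<forall>i<r. f i \<in> part M p) \<and> (\<forall>i\<ge>r. f i = 0)})\<rparr>"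

definition Pi_shift :: "('r, 'a) supermodule \<Rightarrow> ('r, 'a) supermodule" where
  "Pi_shift M = M\<lparr>part := (\<lambda>p. part M (p + 1))\<rparr>"

definition iso :: "('r, 'a::plus) supermodule \<Rightarrow> ('r, 'b::plus) supermodule \<Rightarrow> bool" (infix "\<cong>" 50) where
  "M \<cong> N \<longleftrightarrow> (\<exists>f. bij_betw f (carrier M) (carrier N) \<and>
     (\<forall>x\<in>carrier M. \<forall>y\<in>carrier M. f (x + y) = f x + f y) \<and>
     (\<forall>c. \<forall>x\<in>carrier M. f (smult M c x) = smult N c (f x)) \<and>
     (\<forall>p. f ` part M p = part N p))"

section \<open>Tensor powers\<close>

text \<open>
  The \<open>n\<close>-fold tensor power of \<open>M\<close> is the free module on the lists of \<open>n\<close> elements of \<open>M\<close>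
  modulo the relations of multilinearity. In \<open>free_lists\<close> the field \<open>part\<close> only provides
  representatives for the homogeneous elements of the quotient.
\<close>

definition fscale :: "'r::comm_ring_1 \<Rightarrow> ('b \<Rightarrow>\<^sub>0 'r) \<Rightarrow> ('b \<Rightarrow>\<^sub>0 'r)" where
  "fscale c p = Poly_Mapping.map ((*) c) p"

lemma lookup_fscale [simp]: "Poly_Mapping.lookup (fscale c p) k = c * Poly_Mapping.lookup p k"
  unfolding fscale_def by (transfer, auto simp: when_def)

lemma module_fscale: "module fscale"
  by unfold_locales (auto intro!: poly_mapping_eqI simp: lookup_add algebra_simps)

abbreviation gen :: "'b \<Rightarrow> ('b \<Rightarrow>\<^sub>0 'r::comm_ring_1)" where
  "gen xs \<equiv> Poly_Mapping.single xs 1"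

definition tlists :: "('r, 'a, 'z) supermodule_scheme \<Rightarrow> nat \<Rightarrow> 'a list set" where
  "tlists M n = {xs. length xs = n \<and> set xs \<subseteq> carrier M}"

definition free_lists :: "('r::comm_ring_1, 'a, 'z) supermodule_scheme \<Rightarrow> nat \<Rightarrow>
    ('r, 'a list \<Rightarrow>\<^sub>0 'r) supermodule" where
  "free_lists M n = \<lparr>carrier = {p. Poly_Mapping.keys p \<subseteq> tlists M n},
     smult = fscale,
     part = (\<lambda>d. module.span fscale {gen xs | xs. xs \<in> tlists M n \<and>
       (\<exists>ds. list_all2 (\<lambda>x p. x \<in> part M p) xs ds \<and> sum_list ds = d)})\<rparr>"

definition tensor_rel :: "('r::comm_ring_1, 'a::comm_monoid_add, 'z) supermodule_scheme \<Rightarrow> nat \<Rightarrow>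
    ('a list \<Rightarrow>\<^sub>0 'r) set" where
  "tensor_rel M n = module.span fscale
    ({gen (xs @ (x + y) # ys) - gen (xs @ x # ys) - gen (xs @ y # ys) | xs ys x y.
        xs @ x # ys \<in> tlists M n \<and> y \<in> carrier M} \<union>
     {gen (xs @ smult M c x # ys) - fscale c (gen (xs @ x # ys)) | xs ys x c.
        xs @ x # ys \<in> tlists M n})"

definition tensor :: "('r::comm_ring_1, 'a::comm_monoid_add, 'z) supermodule_scheme \<Rightarrow> nat \<Rightarrow>
    ('r, ('a list \<Rightarrow>\<^sub>0 'r) set) supermodule" where
  "tensor M n = quot (free_lists M n) (tensor_rel M n)"

definition tens :: "('r::comm_ring_1, 'a::comm_monoid_add, 'z) supermodule_scheme \<Rightarrow> 'a list \<Rightarrow>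
    ('a list \<Rightarrow>\<^sub>0 'r) set" where
  "tens M xs = gen xs +o tensor_rel M (length xs)"

text \<open>
  The linear map from a tensor power to \<open>N\<close> that sends the elementary tensor of \<open>xs\<close> to \<open>f xs\<close>,
  for multilinear \<open>f\<close>: all representatives \<open>p\<close> of the coset \<open>X\<close> have the same image. The
  summand \<open>mzero N\<close> only matters for \<open>p = 0\<close>, see the remark on \<open>mzero\<close> above.
\<close>

definition tlift :: "('r::comm_ring_1, 'b::comm_monoid_add, 'z) supermodule_scheme \<Rightarrow> ('a list \<Rightarrow> 'b) \<Rightarrow>
    ('a list \<Rightarrow>\<^sub>0 'r) set \<Rightarrow> 'b" where
  "tlift N f X = the_elem
     ((\<lambda>p. mzero N + (\<Sum>xs\<in>Poly_Mapping.keys p. smult N (Poly_Mapping.lookup p xs) (f xs))) ` X)"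

text \<open>
  Linear extension of a formula \<open>f ds xs\<close> that is given for lists \<open>xs\<close> of homogeneous elements,
  of degrees \<open>ds\<close>.
\<close>

definition hlift :: "('r::comm_ring_1, 'a::comm_monoid_add, 'y) supermodule_scheme \<Rightarrow>
    ('r, 'b::comm_monoid_add, 'z) supermodule_scheme \<Rightarrow>
    (bit list \<Rightarrow> 'a list \<Rightarrow> 'b) \<Rightarrow> ('a list \<Rightarrow>\<^sub>0 'r) set \<Rightarrow> 'b" where
  "hlift M N f = tlift N (\<lambda>xs. \<Sum>ds | length ds = length xs. f ds (map2 (component M) ds xs))"

definition ker :: "('r, 'a, 'y) supermodule_scheme \<Rightarrow> ('r, 'b::comm_monoid_add, 'z) supermodule_scheme \<Rightarrow>
    ('a \<Rightarrow> 'b) \<Rightarrow> 'a set" where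
  "ker M N f = {x \<in> carrier M. f x = mzero N}"

text \<open>\<open>(-1)^p\<close> for a degree \<open>p\<close>.\<close>

definition eps :: "bit \<Rightarrow> 'r::comm_ring_1" where
  "eps p = (if p = 0 then 1 else - 1)"

section \<open>Superdialgebras\<close>

record ('r, 'd) superdialgebra = "('r, 'd) supermodule" +
  lprod :: "'d \<Rightarrow> 'd \<Rightarrow> 'd" (infixl "\<stileturn>\<index>" 70)
  rprod :: "'d \<Rightarrow> 'd \<Rightarrow> 'd" (infixl "\<turnstile>\<index>" 70)
  barunit :: 'd ("\<one>\<index>")

text \<open>The underlying \<open>R\<close>-module of \<open>D\<close> is a whole type.\<close>

locale unital_superdialgebra =
  fixes D :: "('r::comm_ring_1, 'd::ab_group_add) superdialgebra" (structure)
  assumes module: "module (smult D)"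
    and carrier: "carrier D = UNIV"
    and part_subspace: "module.subspace (smult D) (part D p)"
    and grading: "\<exists>!(y, z). y \<in> part D 0 \<and> z \<in> part D 1 \<and> x = y + z"
    and lprod_linear: "module_hom (smult D) (smult D) (\<lambda>b. a \<stileturn> b)"
      "module_hom (smult D) (smult D) (\<lambda>a. a \<stileturn> b)"
    and rprod_linear: "module_hom (smult D) (smult D) (\<lambda>b. a \<turnstile> b)"
      "module_hom (smult D) (smult D) (\<lambda>a. a \<turnstile> b)"
    and lprod_degree: "a \<in> part D p \<Longrightarrow> b \<in> part D q \<Longrightarrow> a \<stileturn> b \<in> part D (p + q)"
    and rprod_degree: "a \<in> part D p \<Longrightarrow> b \<in> part D q \<Longrightarrow> a \<turnstile> b \<in> part D (p + q)"
    and lprod_assoc: "(a \<stileturn> b) \<stileturn> c = a \<stileturn> (b \<stileturn> c)"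
    and rprod_assoc: "(a \<turnstile> b) \<turnstile> c = a \<turnstile> (b \<turnstile> c)"
    and dialgebra: "a \<stileturn> (b \<stileturn> c) = a \<stileturn> (b \<turnstile> c)"
      "(a \<turnstile> b) \<stileturn> c = a \<turnstile> (b \<stileturn> c)"
      "(a \<stileturn> b) \<turnstile> c = (a \<turnstile> b) \<turnstile> c"
    and barunit_even: "\<one> \<in> part D 0"
    and barunit: "a \<stileturn> \<one> = a" "\<one> \<turnstile> a = a"

definition is_basis :: "('r::comm_ring_1, 'd::ab_group_add) superdialgebra \<Rightarrow> 'd set \<Rightarrow> bool" where
  "is_basis D B \<longleftrightarrow> \<not> module.dependent (smult D) B \<and> module.span (smult D) B = carrier D"

definition commutators :: "('r::comm_ring_1, 'd::ab_group_add) superdialgebra \<Rightarrow> 'd set" where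
  "commutators D = module.span (smult D)
     {a \<stileturn>\<^bsub>D\<^esub> b - smult D (eps (p * q)) (b \<turnstile>\<^bsub>D\<^esub> a) | a b p q. a \<in> part D p \<and> b \<in> part D q}"

definition commutator_ideal :: "('r::comm_ring_1, 'd::ab_group_add) superdialgebra \<Rightarrow> 'd set" where
  "commutator_ideal D = module.span (smult D) {x \<stileturn>\<^bsub>D\<^esub> d | x d. x \<in> commutators D \<and> d \<in> carrier D}"

definition Dquot :: "('r::comm_ring_1, 'd::ab_group_add) superdialgebra \<Rightarrow> nat \<Rightarrow> ('r, 'd set) supermodule" where
  "Dquot D k = quot D (smult D (of_nat k) ` carrier D + commutator_ideal D)"

section \<open>Hochschild homology\<close>

text \<open>\<open>D\<close> itself, as the target of \<open>d_1\<close>, is taken as the tensor power \<open>tensor D 1\<close>.\<close>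

text \<open>The map \<open>d_n\<close>, for \<open>n \<ge> 1\<close>. The list \<open>as\<close> is \<open>[a_0, \<dots>, a_n]\<close>.\<close>

definition hoch :: "('r::comm_ring_1, 'd::ab_group_add) superdialgebra \<Rightarrow> nat \<Rightarrow>
    ('d list \<Rightarrow>\<^sub>0 'r) set \<Rightarrow> ('d list \<Rightarrow>\<^sub>0 'r) set" where
  "hoch D n = hlift D (tensor D n) (\<lambda>ds as.
     (\<Sum>i<n. smult (tensor D n) ((- 1) ^ i)
        (tens D (take i as @ [as ! i \<stileturn>\<^bsub>D\<^esub> as ! Suc i] @ drop (i + 2) as))) +
     smult (tensor D n) ((- 1) ^ n * eps (ds ! n * (\<Sum>i<n. ds ! i)))
        (tens D ((as ! n \<turnstile>\<^bsub>D\<^esub> as ! 0) # tl (butlast as))))"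

definition hoch_I :: "('r::comm_ring_1, 'd::ab_group_add) superdialgebra \<Rightarrow> ('d list \<Rightarrow>\<^sub>0 'r) set set" where
  "hoch_I D = generated (tensor D 2)
     {tens D [a, b \<stileturn>\<^bsub>D\<^esub> c] + smult (tensor D 2) (- 1) (tens D [a, b \<turnstile>\<^bsub>D\<^esub> c]) | a b c.
        a \<in> carrier D \<and> b \<in> carrier D \<and> c \<in> carrier D}"

definition HHS1 :: "('r::comm_ring_1, 'd::ab_group_add) superdialgebra \<Rightarrow>
    ('r, ('d list \<Rightarrow>\<^sub>0 'r) set set) supermodule" where
  "HHS1 D = quot (restr (tensor D 2) (ker (tensor D 2) (tensor D 1) (hoch D 1)))
     (hoch D 2 ` carrier (tensor D 3) + hoch_I D)"

section \<open>Leibniz homology\<close>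

record ('r, 'a) leibniz = "('r, 'a) supermodule" +
  brac :: "'a \<Rightarrow> 'a \<Rightarrow> 'a"

definition delta2 :: "('r::comm_ring_1, 'a::ab_group_add) leibniz \<Rightarrow> ('a list \<Rightarrow>\<^sub>0 'r) set \<Rightarrow> 'a" where
  "delta2 L = tlift L (\<lambda>xs. brac L (xs ! 0) (xs ! 1))"

definition delta3 :: "('r::comm_ring_1, 'a::ab_group_add) leibniz \<Rightarrow>
    ('a list \<Rightarrow>\<^sub>0 'r) set \<Rightarrow> ('a list \<Rightarrow>\<^sub>0 'r) set" where
  "delta3 L = hlift L (tensor L 2) (\<lambda>ds xs.
     let x = xs ! 0; y = xs ! 1; z = xs ! 2 in
       smult (tensor L 2) (- 1) (tens L [brac L x y, z])
       + tens L [x, brac L y z]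
       + smult (tensor L 2) (eps (ds ! 1 * ds ! 2)) (tens L [brac L x z, y]))"

definition HL2 :: "('r::comm_ring_1, 'a::ab_group_add) leibniz \<Rightarrow>
    ('r, ('a list \<Rightarrow>\<^sub>0 'r) set set) supermodule" where
  "HL2 L = quot (restr (tensor L 2) (ker (tensor L 2) L (delta2 L)))
     (delta3 L ` carrier (tensor L 3))"

section \<open>Matrices\<close>

text \<open>Matrices are indexed by \<open>{1..m + n}\<close> and vanish outside this range.\<close>

definition idx :: "nat \<Rightarrow> nat \<Rightarrow> bit" where
  "idx m i = (if i \<le> m then 0 else 1)"

definition mat_scale :: "('r, 'd, 'z) supermodule_scheme \<Rightarrow> 'r \<Rightarrow> (nat \<Rightarrow> nat \<Rightarrow> 'd) \<Rightarrow> nat \<Rightarrow> nat \<Rightarrow> 'd" where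
  "mat_scale D c A = (\<lambda>i j. smult D c (A i j))"

definition mat :: "nat \<Rightarrow> nat \<Rightarrow> ('r::comm_ring_1, 'd::ab_group_add) superdialgebra \<Rightarrow>
    ('r, nat \<Rightarrow> nat \<Rightarrow> 'd) supermodule" where
  "mat m n D = \<lparr>
     carrier = {A. (\<forall>i j. A i j \<in> carrier D) \<and>
       (\<forall>i j. i \<notin> {1..m + n} \<or> j \<notin> {1..m + n} \<longrightarrow> A i j = 0)},
     smult = mat_scale D,
     part = (\<lambda>p. {A. (\<forall>i\<in>{1..m + n}. \<forall>j\<in>{1..m + n}. A i j \<in> part D (idx m i + idx m j + p)) \<and>
       (\<forall>i j. i \<notin> {1..m + n} \<or> j \<notin> {1..m + n} \<longrightarrow> A i j = 0)})\<rparr>"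

definition mat_lprod :: "nat \<Rightarrow> nat \<Rightarrow> ('r::comm_ring_1, 'd::ab_group_add) superdialgebra \<Rightarrow>
    (nat \<Rightarrow> nat \<Rightarrow> 'd) \<Rightarrow> (nat \<Rightarrow> nat \<Rightarrow> 'd) \<Rightarrow> nat \<Rightarrow> nat \<Rightarrow> 'd" where
  "mat_lprod m n D x y = (\<lambda>i j. \<Sum>k = 1..m + n. x i k \<stileturn>\<^bsub>D\<^esub> y k j)"

definition mat_rprod :: "nat \<Rightarrow> nat \<Rightarrow> ('r::comm_ring_1, 'd::ab_group_add) superdialgebra \<Rightarrow>
    (nat \<Rightarrow> nat \<Rightarrow> 'd) \<Rightarrow> (nat \<Rightarrow> nat \<Rightarrow> 'd) \<Rightarrow> nat \<Rightarrow> nat \<Rightarrow> 'd" where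
  "mat_rprod m n D x y = (\<lambda>i j. \<Sum>k = 1..m + n. x i k \<turnstile>\<^bsub>D\<^esub> y k j)"

definition gl :: "nat \<Rightarrow> nat \<Rightarrow> ('r::comm_ring_1, 'd::ab_group_add) superdialgebra \<Rightarrow>
    ('r, nat \<Rightarrow> nat \<Rightarrow> 'd) leibniz" where
  "gl m n D = supermodule.extend (mat m n D)
     \<lparr>brac = (\<lambda>x y. \<Sum>p\<in>UNIV. \<Sum>q\<in>UNIV.
        mat_lprod m n D (component (mat m n D) p x) (component (mat m n D) q y)
        - mat_scale D (eps (p * q))
            (mat_rprod m n D (component (mat m n D) q y) (component (mat m n D) p x)))\<rparr>"

definition sl :: "nat \<Rightarrow> nat \<Rightarrow> ('r::comm_ring_1, 'd::ab_group_add) superdialgebra \<Rightarrow>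
    ('r, nat \<Rightarrow> nat \<Rightarrow> 'd) leibniz" where
  "sl m n D = (let G = gl m n D;
     S = module.span (smult G) {brac G x y | x y. x \<in> carrier G \<and> y \<in> carrier G} in
     \<lparr>carrier = S, smult = smult G, part = (\<lambda>p. part G p \<inter> S), brac = brac G\<rparr>)"

end

theory Submission
  imports Defs
begin

text \<open>
  Modulo the image of \<open>\<delta>\<^sub>3\<close>, the Leibniz relation for \<open>x\<close>, \<open>y\<close> and a Cartan element multiplies
  \<open>x \<otimes> y\<close> by its weight. This reduces \<open>HL\<^sub>2\<close> to weight zero and to a few exceptional weights, those
  of pairs of commuting root vectors.

  In weight zero every \<open>E\<^sub>i\<^sub>j(a) \<otimes> E\<^sub>j\<^sub>i(b)\<close> is the value at \<open>a \<otimes> b\<close> of one map from \<open>D \<otimes> D\<close>, up to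
  terms that are determined by their brackets. The cocycle \<open>x \<otimes> y \<mapsto> \<Sum> \<plusminus> x\<^sub>i\<^sub>j \<otimes> y\<^sub>j\<^sub>i\<close> is inverse to
  this map, with values in \<open>D \<otimes> D\<close> modulo the Hochschild boundaries and \<open>I\<close>.

  Exceptional weights only survive for \<open>m + n \<le> 4\<close>, where there is no further index to write one of the
  root vectors as a bracket. Such a weight space is spanned by the classes of \<open>E\<^sub>i\<^sub>j(a) \<otimes> E\<^sub>k\<^sub>l(1)\<close>, in
  which \<open>a\<close> matters only modulo \<open>kD + [D, D] \<stileturn> D\<close>. It is detected by polarized two by two minors
  (\<open>m + n = 4\<close>) or alternating forms in the entries of one row or column (\<open>m + n = 3\<close>), which are
  cocycles with values in that quotient since the products of \<open>D\<close> are supercommutative there.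
\<close>

text \<open>The isomorphism is defined out of \<open>HL2\<close>, as a family of cocycles, and its
  bijectivity comes from a normal form: every tensor is congruent modulo boundaries to a term fixed
  by its bracket, plus a Hochschild term, plus one term per exceptional weight. The cocycles recover
  the last two up to the relations that they satisfy.

  The moduli are Cartan weights. On a pair \<open>E i j\<close>, \<open>E k l\<close> with four
  distinct indices these are 0 or 2 up to sign, and only 0 when the rows have one parity and the
  columns the other. On a pair in one row or column of even 3 by 3 matrices they are 0 or 3 up to
  sign. There are six slots since there are six choices of two rows out of four, or three rows and
  three columns.

  A bar-unit is a unit on one side of each product only. Units and Cartan elements therefore enter
  as right factors of brackets wherever possible, where just \<open>a \<stileturn> \<one>\<close>
  and \<open>\<one> \<turnstile> a\<close> occur; the relation that generates \<open>I\<close> makes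
  up for the other side.\<close>

declare add_bit_eq_xor [simp del] mult_bit_eq_and [simp del]

section \<open>Presentations of iterated quotients\<close>

interpretation fs: module fscale
  by (rule module_fscale)

context module
begin

lemma coset_eq_iff:
  assumes "subspace B"
  shows "x +o B = y +o B \<longleftrightarrow> x - y \<in> B"
proof
  assume "x +o B = y +o B"
  moreover have "x \<in> x +o B"
    using subspace_0[OF assms] by (force simp: elt_set_plus_def)
  ultimately show "x - y \<in> B"
    by (auto simp: elt_set_plus_def)
next
  assume d: "x - y \<in> B"
  show "x +o B = y +o B"
  proof (intro set_eqI iffI)
    fix z
    assume "z \<in> x +o B"
    then obtain b where "b \<in> B" "z = x + b"
      by (auto simp: elt_set_plus_def)
    then have "z = y + ((x - y) + b)" "(x - y) + b \<in> B"
      using d assms by (auto intro: subspace_add)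
    then show "z \<in> y +o B"
      unfolding elt_set_plus_def by blast
  next
    fix z
    assume "z \<in> y +o B"
    then obtain b where "b \<in> B" "z = y + b"
      by (auto simp: elt_set_plus_def)
    then have "z = x + (b - (x - y))" "b - (x - y) \<in> B"
      using d assms by (auto intro: subspace_diff)
    then show "z \<in> x +o B"
      unfolding elt_set_plus_def by blast
  qed
qed

lemma coset_self: "subspace B \<Longrightarrow> x \<in> x +o B"
  using subspace_0 by (force simp: elt_set_plus_def)

lemma set_plus_absorb:
  assumes "subspace B" "A \<subseteq> B" "0 \<in> A"
  shows "A + B = B"
proof
  show "A + B \<subseteq> B"
    using assms subspace_add unfolding set_plus_def by blast
  show "B \<subseteq> A + B"
    using assms(3) by (rule set_zero_plus2)
qed

lemma coset_add:
  assumes "subspace B"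
  shows "(x +o B) + (y +o B) = (x + y) +o B"
  using set_plus_absorb[OF assms order_refl subspace_0[OF assms]]
  by (simp add: set_plus_rearrange)

lemma coset_scale:
  assumes "subspace B"
  shows "scale c ` (x +o B) + B = scale c x +o B"
proof -
  have *: "scale c ` (x +o B) = scale c x +o (scale c ` B)"
  proof -
    have "x +o B = (\<lambda>b. x + b) ` B"
      unfolding elt_set_plus_def by blast
    moreover have "scale c x +o (scale c ` B) = (\<lambda>b. scale c x + scale c b) ` B"
      unfolding elt_set_plus_def by blast
    ultimately show ?thesis
      by (metis (no_types, lifting) image_cong image_image scale_right_distrib)
  qed
  have "scale c ` B + B = B"
    using assms subspace_0[OF assms] by (intro set_plus_absorb) (auto intro: subspace_scale intro!: image_eqI[of _ _ 0])
  then show ?thesis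
    by (simp add: * set_plus_rearrange3)
qed

text \<open>The leading \<open>B\<close> is for empty \<open>K\<close>: there the sum of sets is
  \<open>{0}\<close> instead of the neutral coset. The variant for nonempty \<open>K\<close> below
  can do without it.\<close>

lemma coset_sum:
  assumes "subspace B" "finite K"
  shows "B + (\<Sum>k\<in>K. f k +o B) = (\<Sum>k\<in>K. f k) +o B"
  using assms(2)
proof (induction K rule: finite_induct)
  case (insert k K)
  have "B + ((f k +o B) + (\<Sum>k\<in>K. f k +o B)) = (f k +o B) + (B + (\<Sum>k\<in>K. f k +o B))"
    by (simp add: add.left_commute)
  then show ?case
    using insert assms(1) by (simp add: coset_add)
qed simp

lemma coset_sum_nonempty:
  assumes "subspace B" "finite K" "K \<noteq> {}"
  shows "(\<Sum>k\<in>K. f k +o B) = (\<Sum>k\<in>K. f k) +o B"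
  using assms(2,3)
proof (induction K rule: finite_ne_induct)
  case (insert k K)
  then show ?case
    using assms(1) by (simp add: coset_add)
qed simp

lemma mzero_quot:
  assumes "carrier F = C" "subspace C" "subspace B" "B \<subseteq> C"
  shows "mzero (quot F B) = B"
  unfolding mzero_def
proof (rule the_equality)
  show "B \<in> carrier (quot F B) \<and> (\<forall>x\<in>carrier (quot F B). B + x = x)"
  proof -
    have "0 +o B \<in> carrier (quot F B)"
      using assms subspace_0 unfolding quot_def by (simp del: set_zero_plus)
    moreover have "B + x = x" if "x \<in> carrier (quot F B)" for x
      using that coset_add[OF assms(3), of 0] by (auto simp: quot_def)
    ultimately show ?thesis
      by simp
  qed
next
  fix z
  assume z: "z \<in> carrier (quot F B) \<and> (\<forall>x\<in>carrier (quot F B). z + x = x)"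
  then obtain c where c: "z = c +o B"
    by (auto simp: quot_def)
  have "0 +o B \<in> carrier (quot F B)"
    using assms subspace_0 unfolding quot_def by (simp del: set_zero_plus)
  then have "z + (0 +o B) = 0 +o B"
    using z by blast
  then show "z = B"
    using coset_add[OF assms(3), of c 0] c by simp
qed

end

text \<open>A description of \<open>M\<close> as the subquotient \<open>K / B\<close> of a plain
  module, with class map \<open>cl\<close>. The homology modules consist of cosets of cosets, whose
  types have a \<open>0\<close> that is not neutral; through such a description all calculations
  take place among representatives. \<open>P p\<close> has to contain only one representative of
  each homogeneous class.\<close>

definition presents :: "('r::comm_ring_1, 'b::plus) supermodule \<Rightarrow> ('r \<Rightarrow> 'v::ab_group_add \<Rightarrow> 'v) \<Rightarrow>
    'v set \<Rightarrow> 'v set \<Rightarrow> (bit \<Rightarrow> 'v set) \<Rightarrow> ('v \<Rightarrow> 'b) \<Rightarrow> bool" where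
  "presents M s K B P cl \<longleftrightarrow> module s \<and> module.subspace s K \<and> module.subspace s B \<and>
     carrier M = cl ` K \<and>
     (\<forall>x\<in>K. \<forall>y\<in>K. cl (x + y) = cl x + cl y \<and> (cl x = cl y \<longleftrightarrow> x - y \<in> B)) \<and>
     (\<forall>c. \<forall>x\<in>K. smult M c (cl x) = cl (s c x)) \<and>
     (\<forall>p. P p \<subseteq> K \<and> part M p = cl ` P p)"

text \<open>As \<open>P1 p\<close> and \<open>P2 p\<close> are mere sets of representatives, the
  degree conditions are stated up to \<open>B2\<close>, and so is surjectivity. The isomorphism
  picks a representative by \<open>SOME\<close>; the equivalence between \<open>B2\<close> and
  \<open>B1\<close> gives both independence of this choice and injectivity.\<close>

lemma presents_iso:
  assumes M: "presents M s1 K1 B1 P1 cl1" and N: "presents N s2 K2 B2 P2 cl2"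
    and hom: "module_hom s1 s2 \<phi>"
    and K: "\<And>x. x \<in> K1 \<Longrightarrow> \<phi> x \<in> K2"
    and B: "\<And>x. x \<in> K1 \<Longrightarrow> \<phi> x \<in> B2 \<longleftrightarrow> x \<in> B1"
    and surj: "\<And>y. y \<in> K2 \<Longrightarrow> \<exists>x\<in>K1. \<phi> x - y \<in> B2"
    and P: "\<And>p x. x \<in> P1 p \<Longrightarrow> \<exists>y\<in>P2 p. \<phi> x - y \<in> B2"
    and Psurj: "\<And>p y. y \<in> P2 p \<Longrightarrow> \<exists>x\<in>P1 p. \<phi> x - y \<in> B2"
  shows "M \<cong> N"
proof -
  interpret h: module_hom s1 s2 \<phi> by (rule hom)
  define f where "f X = cl2 (\<phi> (SOME x. x \<in> K1 \<and> cl1 x = X))" for X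
  have M': "carrier M = cl1 ` K1" "h.m1.subspace K1" "\<And>p. P1 p \<subseteq> K1" "\<And>p. part M p = cl1 ` P1 p"
    and Me: "\<And>x y. x \<in> K1 \<Longrightarrow> y \<in> K1 \<Longrightarrow> cl1 x = cl1 y \<longleftrightarrow> x - y \<in> B1"
    and Ma: "\<And>x y. x \<in> K1 \<Longrightarrow> y \<in> K1 \<Longrightarrow> cl1 x + cl1 y = cl1 (x + y)"
    and Ms: "\<And>c x. x \<in> K1 \<Longrightarrow> smult M c (cl1 x) = cl1 (s1 c x)"
    using M unfolding presents_def by auto
  have N': "carrier N = cl2 ` K2" "h.m2.subspace K2" "\<And>p. P2 p \<subseteq> K2" "\<And>p. part N p = cl2 ` P2 p"
    and Ne: "\<And>x y. x \<in> K2 \<Longrightarrow> y \<in> K2 \<Longrightarrow> cl2 x = cl2 y \<longleftrightarrow> x - y \<in> B2"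
    and Na: "\<And>x y. x \<in> K2 \<Longrightarrow> y \<in> K2 \<Longrightarrow> cl2 (x + y) = cl2 x + cl2 y"
    and Ns: "\<And>c x. x \<in> K2 \<Longrightarrow> smult N c (cl2 x) = cl2 (s2 c x)"
    using N unfolding presents_def by auto
  have f: "f (cl1 x) = cl2 (\<phi> x)" if "x \<in> K1" for x
  proof -
    define y where "y = (SOME y. y \<in> K1 \<and> cl1 y = cl1 x)"
    have y: "y \<in> K1 \<and> cl1 y = cl1 x"
      unfolding y_def by (rule someI[of _ x]) (use that in auto)
    then have "y - x \<in> B1" "y - x \<in> K1"
      using Me that h.m1.subspace_diff[OF M'(2)] by auto
    then have "\<phi> y - \<phi> x \<in> B2"
      using B h.diff by metis
    then show ?thesis
      using Ne K y that by (auto simp: f_def y_def)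
  qed
  have add: "\<forall>x\<in>carrier M. \<forall>y\<in>carrier M. f (x + y) = f x + f y"
    by (auto simp: M' Ma f h.m1.subspace_add[OF M'(2)] h.add Na K)
  have scale: "\<forall>c. \<forall>x\<in>carrier M. f (smult M c x) = smult N c (f x)"
    by (auto simp: M' Ms f h.m1.subspace_scale[OF M'(2)] h.scale Ns K)
  have inj: "inj_on f (carrier M)"
  proof (rule inj_onI)
    fix X Y
    assume "X \<in> carrier M" "Y \<in> carrier M" and e: "f X = f Y"
    then obtain x y where xy: "X = cl1 x" "Y = cl1 y" "x \<in> K1" "y \<in> K1"
      by (auto simp: M')
    then have "\<phi> x - \<phi> y \<in> B2"
      using e Ne K by (simp add: f)
    then have "x - y \<in> B1"
      using B[of "x - y"] xy h.m1.subspace_diff[OF M'(2)] by (simp add: h.diff)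
    then show "X = Y"
      using Me xy by simp
  qed
  \<comment> \<open>Serves twice: for the whole carriers and for each homogeneous part.\<close>
  have surjP: "f ` cl1 ` A = cl2 ` C"
    if A: "A \<subseteq> K1" and C: "C \<subseteq> K2" and AC: "\<And>x. x \<in> A \<Longrightarrow> \<exists>y\<in>C. \<phi> x - y \<in> B2"
      and CA: "\<And>y. y \<in> C \<Longrightarrow> \<exists>x\<in>A. \<phi> x - y \<in> B2" for A C
  proof (intro set_eqI iffI)
    fix z
    assume "z \<in> f ` cl1 ` A"
    then obtain x where x: "x \<in> A" "z = cl2 (\<phi> x)"
      using A f by auto
    then obtain y where y: "y \<in> C" "\<phi> x - y \<in> B2"
      using AC by blast
    then have "z = cl2 y"
      using Ne[of "\<phi> x" y] x A C K by auto
    then show "z \<in> cl2 ` C"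
      using y by auto
  next
    fix z
    assume "z \<in> cl2 ` C"
    then obtain y where y: "y \<in> C" "z = cl2 y"
      by auto
    then obtain x where x: "x \<in> A" "\<phi> x - y \<in> B2"
      using CA by blast
    moreover have "x \<in> K1" "y \<in> K2"
      using x y A C by auto
    ultimately have "z = f (cl1 x)"
      using Ne[of "\<phi> x" y] f[of x] y(2) x(2) K[of x] by metis
    then show "z \<in> f ` cl1 ` A"
      using x by auto
  qed
  have "f ` carrier M = carrier N"
    unfolding M' N'
  proof (rule surjP)
    show "\<exists>y\<in>K2. \<phi> x - y \<in> B2" if "x \<in> K1" for x
      using K[OF that] N h.m2.subspace_0 by (auto simp: presents_def intro!: bexI[of _ "\<phi> x"])
  qed (use surj in auto)
  moreover have "f ` part M p = part N p" for p
    unfolding M' N' by (rule surjP) (use P Psurj M' N' in auto)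
  ultimately show ?thesis
    unfolding iso_def bij_betw_def using inj add scale by blast
qed

lemma smult_quot: "smult (quot M B) c X = smult M c ` X + B"
  by (simp add: quot_def)

text \<open>The shape of both homology modules: cycles \<open>K\<close> and boundaries
  \<open>B\<close> inside a quotient by the tensor relations \<open>R\<close>. Because of
  \<open>R \<subseteq> B\<close>, two cosets of cosets agree iff their representatives differ by an
  element of \<open>B\<close>.\<close>

lemma presents_quot_quot:
  fixes F :: "('r::comm_ring_1, 'v::ab_group_add) supermodule"
  assumes mod: "module s" and s: "s = smult F" and C: "carrier F = C" "module.subspace s C" and P: "\<And>p. part F p \<subseteq> C"
    and R: "module.subspace s R" and K: "module.subspace s K" and B: "module.subspace s B"
    and inc: "R \<subseteq> B" "B \<subseteq> K" "K \<subseteq> C"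
  shows "presents (quot (restr (quot F R) ((\<lambda>x. x +o R) ` K)) ((\<lambda>x. x +o R) ` B))
    s K B (\<lambda>p. part F p \<inter> K) (\<lambda>x. (x +o R) +o ((\<lambda>x. x +o R) ` B))"
proof -
  interpret module s by (rule mod)
  define cl where "cl x = x +o R" for x :: 'v
  have cl2: "cl x +o (cl ` B) = {cl (x + b) | b. b \<in> B}" for x
  proof -
    have "cl x +o (cl ` B) = (\<lambda>b. cl x + cl b) ` B"
      unfolding elt_set_plus_def by blast
    also have "\<dots> = (\<lambda>b. cl (x + b)) ` B"
      unfolding image_image by (simp only: cl_def coset_add[OF R])
    finally show ?thesis
      by auto
  qed
  have cle: "cl x = cl y \<longleftrightarrow> x - y \<in> R" for x y
    by (simp add: cl_def coset_eq_iff[OF R])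
  have K0: "x + b \<in> K" if "x \<in> K" "b \<in> B" for x b
    using that inc K subspace_add by blast
  have eq: "cl x +o (cl ` B) = cl y +o (cl ` B) \<longleftrightarrow> x - y \<in> B" for x y
  proof
    assume "cl x +o (cl ` B) = cl y +o (cl ` B)"
    moreover have "cl (x + 0) \<in> cl x +o (cl ` B)"
      unfolding cl2 using subspace_0[OF B] by blast
    ultimately obtain b where "b \<in> B" "cl x = cl (y + b)"
      unfolding cl2 by auto
    then have "x - (y + b) \<in> B" "b \<in> B"
      using inc by (auto simp: cle)
    then show "x - y \<in> B"
      using subspace_add[OF B, of "x - (y + b)" b] by simp
  next
    assume d: "x - y \<in> B"
    have sub: "cl u +o (cl ` B) \<subseteq> cl v +o (cl ` B)" if "u - v \<in> B" for u v
    proof -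
      have "cl (u + b) \<in> {cl (v + b) | b. b \<in> B}" if "b \<in> B" for b
        using \<open>u - v \<in> B\<close> that subspace_add[OF B, of "u - v" b]
        by (intro CollectI exI[of _ "u - v + b"]) auto
      then show ?thesis
        unfolding cl2 by blast
    qed
    have "y - x \<in> B"
      using subspace_neg[OF B d] by simp
    then show "cl x +o (cl ` B) = cl y +o (cl ` B)"
      using sub d by blast
  qed
  have add: "cl (x + y) +o (cl ` B) = (cl x +o (cl ` B)) + (cl y +o (cl ` B))" for x y
  proof (intro set_eqI iffI)
    fix z
    assume "z \<in> cl (x + y) +o (cl ` B)"
    then obtain b where b: "b \<in> B" "z = cl (x + y + b)"
      by (auto simp: cl2)
    have "z = cl (x + b) + cl (y + 0)"
      using b by (simp add: cl_def coset_add[OF R] ac_simps)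
    then show "z \<in> (cl x +o (cl ` B)) + (cl y +o (cl ` B))"
      unfolding cl2 set_plus_def using b subspace_0[OF B] by blast
  next
    fix z
    assume "z \<in> (cl x +o (cl ` B)) + (cl y +o (cl ` B))"
    then obtain b b' where b: "b \<in> B" "b' \<in> B" "z = cl (x + b) + cl (y + b')"
      unfolding cl2 set_plus_def by blast
    then have "z = cl (x + y + (b + b'))"
      by (simp add: cl_def coset_add[OF R] ac_simps)
    then show "z \<in> cl (x + y) +o (cl ` B)"
      unfolding cl2 using b subspace_add[OF B] by blast
  qed
  have sc: "smult (quot F R) c (cl x) = cl (s c x)" for c x
    using coset_scale[OF R] by (simp add: quot_def cl_def s)
  have scB: "smult (quot F R) c ` (cl x +o (cl ` B)) + cl ` B = cl (s c x) +o (cl ` B)" for c x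
  proof (intro set_eqI iffI)
    fix z
    assume "z \<in> smult (quot F R) c ` (cl x +o (cl ` B)) + cl ` B"
    then obtain b b' where b: "b \<in> B" "b' \<in> B" "z = cl (s c (x + b)) + cl b'"
      unfolding cl2 set_plus_def by (auto simp: sc)
    then have "z = cl (s c x + (s c b + b'))"
      by (simp add: cl_def coset_add[OF R] scale_right_distrib ac_simps)
    then show "z \<in> cl (s c x) +o (cl ` B)"
      unfolding cl2 using b subspace_add[OF B] subspace_scale[OF B] by blast
  next
    fix z
    assume "z \<in> cl (s c x) +o (cl ` B)"
    then obtain b where b: "b \<in> B" "z = cl (s c x + b)"
      unfolding cl2 by blast
    then have "z = smult (quot F R) c (cl (x + 0)) + cl b"
      by (simp add: sc) (simp add: cl_def coset_add[OF R])
    moreover have "cl (x + 0) \<in> cl x +o (cl ` B)"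
      unfolding cl2 using subspace_0[OF B] by blast
    ultimately show "z \<in> smult (quot F R) c ` (cl x +o (cl ` B)) + cl ` B"
      using b unfolding set_plus_def by blast
  qed
  \<comment> \<open>A homogeneous element whose coset meets \<open>K\<close> lies in
    \<open>K\<close> itself, as \<open>R \<subseteq> K\<close>.\<close>
  have part: "cl ` part F p \<inter> cl ` K = cl ` (part F p \<inter> K)" for p
  proof -
    have "x \<in> K" if "cl x = cl k" "k \<in> K" for x k
    proof -
      have "x - k \<in> K"
        using that inc by (auto simp: cle)
      then show ?thesis
        using subspace_add[OF K _ that(2), of "x - k"] by simp
    qed
    then show ?thesis
      by (intro set_eqI) blast
  qed
  have cl': "(\<lambda>x. x +o R) = cl"
    by (rule ext) (simp only: cl_def)
  show ?thesis
    unfolding presents_def cl'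
  proof (intro conjI allI ballI)
    show "carrier (quot (restr (quot F R) (cl ` K)) (cl ` B)) = (\<lambda>x. (x +o R) +o (cl ` B)) ` K"
      by (simp add: quot_def restr_def image_image cl_def[symmetric] del: image_add_0)
    show "part (quot (restr (quot F R) (cl ` K)) (cl ` B)) p = (\<lambda>x. (x +o R) +o (cl ` B)) ` (part F p \<inter> K)" for p
      using part[of p] by (simp add: quot_def restr_def cl' image_image cl_def[symmetric])
    show "smult (quot (restr (quot F R) (cl ` K)) (cl ` B)) c ((x +o R) +o (cl ` B)) = (s c x +o R) +o (cl ` B)"
      for c x
      using scB[of c x] by (simp add: smult_quot restr_def cl_def[symmetric])
  qed (use K B eq add mod in \<open>auto simp: cl_def[symmetric]\<close>)
qed

section \<open>Linear extension and tensor powers\<close>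

definition lin :: "('r::comm_ring_1 \<Rightarrow> 'v::ab_group_add \<Rightarrow> 'v) \<Rightarrow> ('k \<Rightarrow> 'v) \<Rightarrow> ('k \<Rightarrow>\<^sub>0 'r) \<Rightarrow> 'v" where
  "lin s g p = (\<Sum>k\<in>Poly_Mapping.keys p. s (Poly_Mapping.lookup p k) (g k))"

lemma lin_superset:
  assumes "module s" "finite A" "Poly_Mapping.keys p \<subseteq> A"
  shows "lin s g p = (\<Sum>k\<in>A. s (Poly_Mapping.lookup p k) (g k))"
proof -
  interpret module s by fact
  show ?thesis
    unfolding lin_def by (rule sum.mono_neutral_left) (use assms in \<open>auto simp: in_keys_iff\<close>)
qed

lemma module_hom_lin:
  fixes s :: "'r::comm_ring_1 \<Rightarrow> 'v::ab_group_add \<Rightarrow> 'v" and g :: "'k \<Rightarrow> 'v"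
  assumes "module s"
  shows "module_hom fscale s (lin s g)"
proof -
  interpret module s by fact
  show ?thesis
  proof (unfold_locales)
    fix x y :: "'k \<Rightarrow>\<^sub>0 'r"
    let ?A = "Poly_Mapping.keys x \<union> Poly_Mapping.keys y"
    have "lin s g (x + y) = (\<Sum>k\<in>?A. s (Poly_Mapping.lookup (x + y) k) (g k))"
      by (rule lin_superset[OF assms]) (simp_all add: Poly_Mapping.keys_add)
    also have "\<dots> = (\<Sum>k\<in>?A. s (Poly_Mapping.lookup x k) (g k)) + (\<Sum>k\<in>?A. s (Poly_Mapping.lookup y k) (g k))"
      by (simp add: lookup_add scale_left_distrib sum.distrib)
    also have "\<dots> = lin s g x + lin s g y"
      by (simp add: lin_superset[OF assms, of ?A])
    finally show "lin s g (x + y) = lin s g x + lin s g y" .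
  next
    fix c and x :: "'k \<Rightarrow>\<^sub>0 'r"
    have "lin s g (fscale c x) = (\<Sum>k\<in>Poly_Mapping.keys x. s (Poly_Mapping.lookup (fscale c x) k) (g k))"
      by (rule lin_superset[OF assms]) (auto simp: in_keys_iff)
    then show "lin s g (fscale c x) = s c (lin s g x)"
      by (simp add: lin_def scale_sum_right)
  qed
qed

lemma lin_gen [simp]: "module s \<Longrightarrow> lin s g (gen k) = g k"
  by (simp add: lin_def module.scale_one)

lemma free_span:
  fixes A :: "'k set"
  shows "{p :: 'k \<Rightarrow>\<^sub>0 'r::comm_ring_1. Poly_Mapping.keys p \<subseteq> A} = fs.span (gen ` A)"
proof (intro set_eqI iffI)
  fix p :: "'k \<Rightarrow>\<^sub>0 'r"
  assume p: "p \<in> {p. Poly_Mapping.keys p \<subseteq> A}"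
  have "p = (\<Sum>k\<in>Poly_Mapping.keys p. fscale (Poly_Mapping.lookup p k) (gen k))"
    by (rule poly_mapping_eqI) (auto simp: lookup_sum lookup_single when_def in_keys_iff if_distrib sum.delta' cong: if_cong)
  also have "\<dots> \<in> fs.span (gen ` A)"
    using p by (intro fs.span_sum fs.span_scale fs.span_base) auto
  finally show "p \<in> fs.span (gen ` A)" .
next
  fix p :: "'k \<Rightarrow>\<^sub>0 'r"
  assume "p \<in> fs.span (gen ` A)"
  moreover have "fs.subspace {p :: 'k \<Rightarrow>\<^sub>0 'r. Poly_Mapping.keys p \<subseteq> A}"
  proof (rule fs.subspaceI)
    fix x y :: "'k \<Rightarrow>\<^sub>0 'r" and c
    show "x \<in> {p. Poly_Mapping.keys p \<subseteq> A} \<Longrightarrow> y \<in> {p. Poly_Mapping.keys p \<subseteq> A} \<Longrightarrow>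
        x + y \<in> {p. Poly_Mapping.keys p \<subseteq> A}"
      using Poly_Mapping.keys_add[of x y] by blast
    have "Poly_Mapping.keys (fscale c x) \<subseteq> Poly_Mapping.keys x"
      by (auto simp: in_keys_iff)
    then show "x \<in> {p. Poly_Mapping.keys p \<subseteq> A} \<Longrightarrow> fscale c x \<in> {p. Poly_Mapping.keys p \<subseteq> A}"
      by blast
  qed simp
  moreover have "gen ` A \<subseteq> {p :: 'k \<Rightarrow>\<^sub>0 'r. Poly_Mapping.keys p \<subseteq> A}"
    by auto
  ultimately show "p \<in> {p. Poly_Mapping.keys p \<subseteq> A}"
    using fs.span_minimal by blast
qed

lemma subspace_lin_vimage:
  assumes "module s" "module.subspace s B"
  shows "fs.subspace {p. lin s g p \<in> B}"
  using module_hom.subspace_linear_preimage[OF module_hom_lin[OF assms(1)] assms(2)] .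

lemma lin_in_subspace:
  assumes "module s" "module.subspace s B" "p \<in> fs.span S" "\<And>x. x \<in> S \<Longrightarrow> lin s g x \<in> B"
  shows "lin s g p \<in> B"
  using fs.span_minimal[OF _ subspace_lin_vimage[OF assms(1,2)], of S g] assms(3,4) by blast

lemma sum_lists_bit:
  "(\<Sum>ds | length ds = Suc n. f (ds :: bit list)) = (\<Sum>p\<in>UNIV. \<Sum>ds | length ds = n. f (p # ds))"
proof -
  have "{ds :: bit list. length ds = Suc n} = (\<lambda>(p, ds). p # ds) ` (UNIV \<times> {ds. length ds = n})"
    by (auto simp: length_Suc_conv image_iff)
  moreover have "inj_on (\<lambda>(p, ds). p # ds) (UNIV \<times> {ds :: bit list. length ds = n})"
    by (auto simp: inj_on_def)
  ultimately show ?thesis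
    by (simp add: sum.reindex sum.cartesian_product case_prod_unfold)
qed

lemma UNIV_bit: "(UNIV :: bit set) = {0, 1}"
  by (auto intro: bit.exhaust)

lemma finite_lists_bit [simp]: "finite {ds :: bit list. length ds = n}"
proof -
  have "finite (UNIV :: bit set)"
    by (simp add: UNIV_bit)
  from finite_lists_length_eq[OF this, of n] show ?thesis
    by simp
qed

section \<open>Graded modules, homogeneous components and multilinear maps\<close>

locale smod =
  fixes M :: "('r::comm_ring_1, 'a::ab_group_add, 'z) supermodule_scheme"
  assumes mod: "module (smult M)"
    and carrier_sub: "module.subspace (smult M) (carrier M)"
    and part_sub: "module.subspace (smult M) (part M p)"
    and part_le: "part M p \<subseteq> carrier M"
    and decomp: "x \<in> carrier M \<Longrightarrow> \<exists>y\<in>part M 0. \<exists>z\<in>part M 1. x = y + z"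
    and indep: "x \<in> part M 0 \<Longrightarrow> x \<in> part M 1 \<Longrightarrow> x = 0"
begin

sublocale md: module "smult M"
  by (rule mod)

abbreviation "cmp \<equiv> component M"

lemma component_eqI:
  assumes "y \<in> part M p" "z \<in> part M (p + 1)"
  shows "cmp p (y + z) = y"
  unfolding component_def
proof (rule the_equality)
  fix y'
  assume "y' \<in> part M p \<and> (\<exists>z'\<in>part M (p + 1). y + z = y' + z')"
  then obtain z' where z: "y' \<in> part M p" "z' \<in> part M (p + 1)" "y + z = y' + z'"
    by blast
  then have e: "y' - y = z - z'"
    by (simp add: algebra_simps)
  have "y' - y \<in> part M p" "z - z' \<in> part M (p + 1)"
    using z assms part_sub md.subspace_diff by auto
  then have "y' - y \<in> part M 0 \<and> y' - y \<in> part M 1"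
    using e by (cases p) auto
  then show "y' = y"
    using indep by fastforce
qed (use assms in blast)

lemma component_same: "x \<in> part M p \<Longrightarrow> cmp p x = x"
  using component_eqI[of x p 0] part_sub md.subspace_0 by fastforce

lemma component_other: "x \<in> part M p \<Longrightarrow> q \<noteq> p \<Longrightarrow> cmp q x = 0"
  using component_eqI[of 0 q x] part_sub md.subspace_0 by (cases p; cases q) fastforce+

lemma decomp_p:
  assumes "x \<in> carrier M"
  obtains y z where "y \<in> part M p" "z \<in> part M (p + 1)" "x = y + z"
  using decomp[OF assms] by (cases p) (auto simp: add.commute)

lemma component_in: "x \<in> carrier M \<Longrightarrow> cmp p x \<in> part M p"
  by (metis decomp_p component_eqI)

lemma component_add:
  assumes "x \<in> carrier M" "y \<in> carrier M"
  shows "cmp p (x + y) = cmp p x + cmp p y"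
proof -
  obtain a b where x: "a \<in> part M p" "b \<in> part M (p + 1)" "x = a + b"
    by (rule decomp_p[OF assms(1)])
  obtain c d where y: "c \<in> part M p" "d \<in> part M (p + 1)" "y = c + d"
    by (rule decomp_p[OF assms(2)])
  have "a + c \<in> part M p" "b + d \<in> part M (p + 1)"
    using x y part_sub md.subspace_add by auto
  then have "cmp p ((a + c) + (b + d)) = a + c"
    by (rule component_eqI)
  then show ?thesis
    using x y component_eqI by (simp add: ac_simps)
qed

lemma component_scale:
  assumes "x \<in> carrier M"
  shows "cmp p (smult M c x) = smult M c (cmp p x)"
proof -
  obtain a b where x: "a \<in> part M p" "b \<in> part M (p + 1)" "x = a + b"
    by (rule decomp_p[OF assms])
  have "smult M c a \<in> part M p" "smult M c b \<in> part M (p + 1)"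
    using x part_sub md.subspace_scale by auto
  then have "cmp p (smult M c a + smult M c b) = smult M c a"
    by (rule component_eqI)
  then show ?thesis
    using x component_eqI by (simp add: md.scale_right_distrib)
qed

lemma component_sum_eq: "x \<in> carrier M \<Longrightarrow> cmp 0 x + cmp 1 x = x"
proof -
  assume "x \<in> carrier M"
  then obtain a b where x: "a \<in> part M 0" "b \<in> part M (0 + 1)" "x = a + b"
    by (rule decomp_p)
  then have "cmp 0 x = a" "cmp 1 x = b"
    using component_eqI[of a 0 b] component_eqI[of b 1 a] by (simp_all add: add.commute)
  then show ?thesis
    using x by simp
qed

lemma component_in_carrier: "x \<in> carrier M \<Longrightarrow> cmp p x \<in> carrier M"
  using component_in part_le by blast

abbreviation "FL \<equiv> \<lambda>n. carrier (free_lists M n)"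
abbreviation "Rel \<equiv> tensor_rel M"

lemma FL_span: "FL n = fs.span (gen ` tlists M n)"
  unfolding free_lists_def using free_span by simp

lemma FL_sub: "fs.subspace (FL n)"
  by (simp add: FL_span)

lemma gen_FL: "xs \<in> tlists M n \<Longrightarrow> gen xs \<in> FL n"
  by (simp add: FL_span fs.span_base)

lemma Rel_sub: "fs.subspace (Rel n)"
  by (simp add: tensor_rel_def)

lemma tlists_upd:
  "xs @ x # ys \<in> tlists M n \<Longrightarrow> y \<in> carrier M \<Longrightarrow> xs @ y # ys \<in> tlists M n"
  by (auto simp: tlists_def)

lemma tlists_carrier: "xs @ x # ys \<in> tlists M n \<Longrightarrow> x \<in> carrier M"
  by (auto simp: tlists_def)

lemma Rel_FL: "Rel n \<subseteq> FL n"
  unfolding tensor_rel_def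
proof (rule fs.span_minimal[OF _ FL_sub], safe)
  fix xs ys x y
  assume a: "xs @ x # ys \<in> tlists M n" "y \<in> carrier M"
  then have "xs @ (x + y) # ys \<in> tlists M n" "xs @ y # ys \<in> tlists M n"
    using carrier_sub md.subspace_add tlists_upd tlists_carrier by blast+
  then show "gen (xs @ (x + y) # ys) - gen (xs @ x # ys) - gen (xs @ y # ys) \<in> FL n"
    using a by (intro fs.subspace_diff[OF FL_sub] gen_FL) auto
next
  fix xs ys x c
  assume a: "xs @ x # ys \<in> tlists M n"
  then have "xs @ smult M c x # ys \<in> tlists M n"
    using carrier_sub md.subspace_scale tlists_upd tlists_carrier by blast
  then show "gen (xs @ smult M c x # ys) - fscale c (gen (xs @ x # ys)) \<in> FL n"
    using a by (intro fs.subspace_diff[OF FL_sub] fs.subspace_scale[OF FL_sub] gen_FL) auto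
qed

lemma Rel_add:
  "xs @ x # ys \<in> tlists M n \<Longrightarrow> y \<in> carrier M \<Longrightarrow>
     gen (xs @ (x + y) # ys) - gen (xs @ x # ys) - gen (xs @ y # ys) \<in> Rel n"
  unfolding tensor_rel_def by (rule fs.span_base) blast

lemma Rel_scale:
  "xs @ x # ys \<in> tlists M n \<Longrightarrow> gen (xs @ smult M c x # ys) - fscale c (gen (xs @ x # ys)) \<in> Rel n"
  unfolding tensor_rel_def by (rule fs.span_base) blast

text \<open>Multilinearity only modulo \<open>B\<close>: most maps below take values in a free
  module and become multilinear after division by the relations there. It is what makes
  \<open>lin s g\<close> send \<open>Rel n\<close> into \<open>B\<close>.\<close>

definition mlin :: "nat \<Rightarrow> ('r \<Rightarrow> 'v \<Rightarrow> 'v) \<Rightarrow> 'v set \<Rightarrow> ('a list \<Rightarrow> 'v::ab_group_add) \<Rightarrow> bool" where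
  "mlin n s B g \<longleftrightarrow> (\<forall>xs x ys. xs @ x # ys \<in> tlists M n \<longrightarrow>
     (\<forall>y\<in>carrier M. g (xs @ (x + y) # ys) - g (xs @ x # ys) - g (xs @ y # ys) \<in> B) \<and>
     (\<forall>c. g (xs @ smult M c x # ys) - s c (g (xs @ x # ys)) \<in> B))"

lemma lin_Rel:
  assumes "module s" "module.subspace s B" "mlin n s B g" "p \<in> Rel n"
  shows "lin s g p \<in> B"
proof (rule lin_in_subspace[OF assms(1,2)])
  interpret h: module_hom fscale s "lin s g"
    by (rule module_hom_lin[OF assms(1)])
  show "p \<in> fs.span ({gen (xs @ (x + y) # ys) - gen (xs @ x # ys) - gen (xs @ y # ys) | xs ys x y.
        xs @ x # ys \<in> tlists M n \<and> y \<in> carrier M} \<union>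
     {gen (xs @ smult M c x # ys) - fscale c (gen (xs @ x # ys)) | xs ys x c.
        xs @ x # ys \<in> tlists M n})"
    using assms(4) by (simp add: tensor_rel_def)
  show "lin s g x \<in> B" if "x \<in> {gen (xs @ (x + y) # ys) - gen (xs @ x # ys) - gen (xs @ y # ys) | xs ys x y.
        xs @ x # ys \<in> tlists M n \<and> y \<in> carrier M} \<union>
     {gen (xs @ smult M c x # ys) - fscale c (gen (xs @ x # ys)) | xs ys x c.
        xs @ x # ys \<in> tlists M n}" for x
    using that assms(1,3) unfolding mlin_def
    by (auto simp: h.diff h.scale)
qed

lemma mlin_lists1I:
  assumes "\<And>x y. x \<in> carrier M \<Longrightarrow> y \<in> carrier M \<Longrightarrow> g [x + y] - g [x] - g [y] \<in> B"
    and "\<And>c x. x \<in> carrier M \<Longrightarrow> g [smult M c x] - s c (g [x]) \<in> B"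
  shows "mlin 1 s B g"
  unfolding mlin_def
proof (intro allI impI, goal_cases)
  case (1 xs x ys)
  then have "xs = []" "ys = []"
    by (auto simp: tlists_def)
  then show ?case
    using 1 assms by (auto simp: tlists_def)
qed

lemma mlin_lists2I:
  assumes "\<And>x y z. x \<in> carrier M \<Longrightarrow> y \<in> carrier M \<Longrightarrow> z \<in> carrier M \<Longrightarrow> g [x + y, z] - g [x, z] - g [y, z] \<in> B"
    and "\<And>x y z. x \<in> carrier M \<Longrightarrow> y \<in> carrier M \<Longrightarrow> z \<in> carrier M \<Longrightarrow> g [z, x + y] - g [z, x] - g [z, y] \<in> B"
    and "\<And>c x z. x \<in> carrier M \<Longrightarrow> z \<in> carrier M \<Longrightarrow> g [smult M c x, z] - s c (g [x, z]) \<in> B"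
    and "\<And>c x z. x \<in> carrier M \<Longrightarrow> z \<in> carrier M \<Longrightarrow> g [z, smult M c x] - s c (g [z, x]) \<in> B"
  shows "mlin 2 s B g"
  unfolding mlin_def
proof (intro allI impI, goal_cases)
  case (1 xs x ys)
  then have "length xs + length ys = 1"
    by (auto simp: tlists_def)
  then have "(\<exists>z. xs = [] \<and> ys = [z]) \<or> (\<exists>z. xs = [z] \<and> ys = [])"
    by (cases xs) (auto simp: length_Suc_conv)
  then show ?case
    using 1 assms by (auto simp: tlists_def)
qed

lemma mlin_lists3I:
  assumes "\<And>x y z w. x \<in> carrier M \<Longrightarrow> y \<in> carrier M \<Longrightarrow> z \<in> carrier M \<Longrightarrow> w \<in> carrier M \<Longrightarrow>
      g [x + y, z, w] - g [x, z, w] - g [y, z, w] \<in> B"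
    and "\<And>x y z w. x \<in> carrier M \<Longrightarrow> y \<in> carrier M \<Longrightarrow> z \<in> carrier M \<Longrightarrow> w \<in> carrier M \<Longrightarrow>
      g [z, x + y, w] - g [z, x, w] - g [z, y, w] \<in> B"
    and "\<And>x y z w. x \<in> carrier M \<Longrightarrow> y \<in> carrier M \<Longrightarrow> z \<in> carrier M \<Longrightarrow> w \<in> carrier M \<Longrightarrow>
      g [z, w, x + y] - g [z, w, x] - g [z, w, y] \<in> B"
    and "\<And>c x z w. x \<in> carrier M \<Longrightarrow> z \<in> carrier M \<Longrightarrow> w \<in> carrier M \<Longrightarrow>
      g [smult M c x, z, w] - s c (g [x, z, w]) \<in> B"
    and "\<And>c x z w. x \<in> carrier M \<Longrightarrow> z \<in> carrier M \<Longrightarrow> w \<in> carrier M \<Longrightarrow>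
      g [z, smult M c x, w] - s c (g [z, x, w]) \<in> B"
    and "\<And>c x z w. x \<in> carrier M \<Longrightarrow> z \<in> carrier M \<Longrightarrow> w \<in> carrier M \<Longrightarrow>
      g [z, w, smult M c x] - s c (g [z, w, x]) \<in> B"
  shows "mlin 3 s B g"
  unfolding mlin_def
proof (intro allI impI, goal_cases)
  case (1 xs x ys)
  then have l: "length xs + length ys = 2"
    by (auto simp: tlists_def)
  then consider "length xs = 0" "length ys = 2" | "length xs = 1" "length ys = 1" | "length xs = 2" "length ys = 0"
    by linarith
  then have "(\<exists>z w. xs = [] \<and> ys = [z, w]) \<or> (\<exists>z w. xs = [z] \<and> ys = [w]) \<or> (\<exists>z w. xs = [z, w] \<and> ys = [])"
    by cases (auto simp: length_Suc_conv numeral_2_eq_2)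
  then show ?case
    using 1 assms by (auto simp: tlists_def)
qed

text \<open>This is the map behind \<open>hlift\<close>. It inherits multilinearity because
  components depend linearly on their argument; the list of degrees is cut at the position that
  varies.\<close>

lemma mlin_components:
  assumes s: "module s" "module.subspace s B" and m: "\<And>ds. length ds = n \<Longrightarrow> mlin n s B (g ds)"
  shows "mlin n s B (\<lambda>xs. \<Sum>ds | length ds = n. g ds (map2 cmp ds xs))"
  unfolding mlin_def
proof (intro allI impI conjI ballI, goal_cases)
  interpret v: module s by fact
  {
    case (1 xs x ys y)
    have "(\<Sum>ds | length ds = n. g ds (map2 cmp ds (xs @ (x + y) # ys)) - g ds (map2 cmp ds (xs @ x # ys)) -
        g ds (map2 cmp ds (xs @ y # ys))) \<in> B"
    proof (rule v.subspace_sum[OF s(2)], safe)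
      fix ds :: "bit list"
      assume n: "n = length ds"
      define as d bs where "as = take (length xs) ds" and "d = ds ! length xs" and "bs = drop (Suc (length xs)) ds"
      have l: "length (xs @ x # ys) = length ds" and set: "set (xs @ x # ys) \<subseteq> carrier M"
        using 1 n by (auto simp: tlists_def)
      then have ds: "ds = as @ d # bs" "length as = length xs" "length bs = length ys"
        by (auto simp: as_def d_def bs_def Cons_nth_drop_Suc)
      have "map2 cmp as xs @ cmp d x # map2 cmp bs ys \<in> tlists M n" "cmp d y \<in> carrier M"
        using n l set ds 1 component_in_carrier by (auto simp: tlists_def subset_iff dest!: set_zip_rightD)
      then show "g ds (map2 cmp ds (xs @ (x + y) # ys)) - g ds (map2 cmp ds (xs @ x # ys)) -
          g ds (map2 cmp ds (xs @ y # ys)) \<in> B"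
        using m[of ds] n 1 tlists_carrier[OF 1(1)] unfolding mlin_def by (simp add: ds component_add)
    qed
    then show ?case
      by (simp add: sum_subtractf)
  next
    case (2 xs x ys c)
    have "(\<Sum>ds | length ds = n. g ds (map2 cmp ds (xs @ smult M c x # ys)) - s c (g ds (map2 cmp ds (xs @ x # ys)))) \<in> B"
    proof (rule v.subspace_sum[OF s(2)], safe)
      fix ds :: "bit list"
      assume n: "n = length ds"
      define as d bs where "as = take (length xs) ds" and "d = ds ! length xs" and "bs = drop (Suc (length xs)) ds"
      have l: "length (xs @ x # ys) = length ds" and set: "set (xs @ x # ys) \<subseteq> carrier M"
        using 2 n by (auto simp: tlists_def)
      then have ds: "ds = as @ d # bs" "length as = length xs" "length bs = length ys"
        by (auto simp: as_def d_def bs_def Cons_nth_drop_Suc)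
      have "map2 cmp as xs @ cmp d x # map2 cmp bs ys \<in> tlists M n"
        using n l set ds 2 component_in_carrier by (auto simp: tlists_def subset_iff dest!: set_zip_rightD)
      then show "g ds (map2 cmp ds (xs @ smult M c x # ys)) - s c (g ds (map2 cmp ds (xs @ x # ys))) \<in> B"
        using m[of ds] n 2 tlists_carrier[OF 2(1)] unfolding mlin_def by (simp add: ds component_scale)
    qed
    then show ?case
      by (simp add: sum_subtractf v.scale_sum_right)
  }
qed

lemma map2_cmp_tlists: "xs \<in> tlists M n \<Longrightarrow> length ds = n \<Longrightarrow> map2 cmp ds xs \<in> tlists M n"
  using component_in_carrier by (auto simp: tlists_def subset_iff dest!: set_zip_rightD)

lemma the_elem_image_const:
  assumes "X \<noteq> {}" "\<And>x. x \<in> X \<Longrightarrow> f x = y"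
  shows "the_elem (f ` X) = y"
proof -
  have "f ` X = {y}"
    using assms by auto
  then show ?thesis
    by simp
qed

text \<open>\<open>tlift\<close> takes the common value on all representatives of a coset. Two of
  them differ by an element of \<open>Rel n\<close>, which multilinearity sends into
  \<open>Rel k\<close>, so the value at \<open>p\<close> is this common value.\<close>

lemma tlift_tensor:
  assumes g: "mlin n fscale (Rel k) g"
    and f: "\<And>xs. xs \<in> tlists M n \<Longrightarrow> f xs = g xs +o Rel k"
    and p: "p \<in> FL n"
  shows "tlift (tensor M k) f (p +o Rel n) = lin fscale g p +o Rel k"
  unfolding tlift_def
proof (rule the_elem_image_const)
  show "p +o Rel n \<noteq> {}"
    using fs.coset_self[OF Rel_sub] by blast
  fix q
  assume "q \<in> p +o Rel n"
  then obtain r where q: "q = p + r" "r \<in> Rel n"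
    by (auto simp: elt_set_plus_def)
  interpret h: module_hom fscale fscale "lin fscale g"
    by (rule module_hom_lin[OF module_fscale])
  have "q \<in> FL n"
    using p q Rel_FL FL_sub fs.subspace_add by blast
  then have keys: "xs \<in> tlists M n" if "xs \<in> Poly_Mapping.keys q" for xs
    using that by (auto simp: free_lists_def)
  have "mzero (tensor M k) = Rel k"
    unfolding tensor_def by (rule fs.mzero_quot[OF refl FL_sub Rel_sub Rel_FL])
  moreover have "smult (tensor M k) (Poly_Mapping.lookup q xs) (f xs) = fscale (Poly_Mapping.lookup q xs) (g xs) +o Rel k"
    if "xs \<in> Poly_Mapping.keys q" for xs
    using f[OF keys[OF that]] fs.coset_scale[OF Rel_sub]
    by (simp add: tensor_def quot_def free_lists_def)
  ultimately have "mzero (tensor M k) + (\<Sum>xs\<in>Poly_Mapping.keys q. smult (tensor M k) (Poly_Mapping.lookup q xs) (f xs))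
      = lin fscale g q +o Rel k"
    by (simp add: lin_def fs.coset_sum[OF Rel_sub])
  also have "\<dots> = lin fscale g p +o Rel k"
    using lin_Rel[OF module_fscale Rel_sub g q(2)] by (simp add: fs.coset_eq_iff[OF Rel_sub] q h.add)
  finally show "mzero (tensor M k) + (\<Sum>xs\<in>Poly_Mapping.keys q. smult (tensor M k) (Poly_Mapping.lookup q xs) (f xs))
      = lin fscale g p +o Rel k" .
qed

lemma hlift_tensor:
  assumes g: "\<And>ds. length ds = n \<Longrightarrow> mlin n fscale (Rel k) (g ds)"
    and f: "\<And>ds xs. length ds = n \<Longrightarrow> xs \<in> tlists M n \<Longrightarrow> f ds xs = g ds xs +o Rel k"
    and p: "p \<in> FL n"
  shows "hlift M (tensor M k) f (p +o Rel n) =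
    lin fscale (\<lambda>xs. \<Sum>ds | length ds = n. g ds (map2 cmp ds xs)) p +o Rel k"
  unfolding hlift_def
proof (rule tlift_tensor[OF mlin_components[OF module_fscale Rel_sub g] _ p])
  fix xs
  assume xs: "xs \<in> tlists M n"
  then have l: "length xs = n"
    by (simp add: tlists_def)
  \<comment> \<open>Cosets are summed over all lists of degrees, never over the empty set; hence no
    neutral coset has to be added.\<close>
  have ne: "{ds :: bit list. length ds = n} \<noteq> {}"
    using length_replicate[of n "0 :: bit"] by (auto simp del: length_replicate)
  have "(\<Sum>ds | length ds = n. f ds (map2 cmp ds xs)) = (\<Sum>ds | length ds = n. g ds (map2 cmp ds xs) +o Rel k)"
  proof (rule sum.cong[OF refl])
    fix ds :: "bit list"
    assume "ds \<in> {ds. length ds = n}"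
    then have "length ds = n"
      by simp
    then show "f ds (map2 cmp ds xs) = g ds (map2 cmp ds xs) +o Rel k"
      using f[OF _ map2_cmp_tlists[OF xs]] by blast
  qed
  also have "\<dots> = (\<Sum>ds | length ds = n. g ds (map2 cmp ds xs)) +o Rel k"
    by (rule fs.coset_sum_nonempty[OF Rel_sub finite_lists_bit ne])
  finally show "(\<Sum>ds | length ds = length xs. f ds (map2 cmp ds xs)) =
      (\<Sum>ds | length ds = n. g ds (map2 cmp ds xs)) +o Rel k"
    unfolding l .
qed

lemma mzero_self: "mzero M = 0"
  unfolding mzero_def
proof (rule the_equality)
  show "0 \<in> carrier M \<and> (\<forall>x\<in>carrier M. 0 + x = x)"
    using md.subspace_0[OF carrier_sub] by simp
next
  fix z
  assume "z \<in> carrier M \<and> (\<forall>x\<in>carrier M. z + x = x)"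
  then show "z = 0"
    using md.subspace_0[OF carrier_sub] by fastforce
qed

lemma tlift_self:
  assumes g: "mlin n (smult M) {0} g" and p: "p \<in> FL n"
  shows "tlift M g (p +o Rel n) = lin (smult M) g p"
  unfolding tlift_def
proof (rule the_elem_image_const)
  show "p +o Rel n \<noteq> {}"
    using fs.coset_self[OF Rel_sub] by blast
  fix q
  assume "q \<in> p +o Rel n"
  then obtain r where q: "q = p + r" "r \<in> Rel n"
    by (auto simp: elt_set_plus_def)
  interpret h: module_hom fscale "smult M" "lin (smult M) g"
    by (rule module_hom_lin[OF mod])
  show "mzero M + (\<Sum>xs\<in>Poly_Mapping.keys q. smult M (Poly_Mapping.lookup q xs) (g xs)) = lin (smult M) g p"
    using lin_Rel[OF mod md.subspace_single_0 g q(2)]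
    by (simp add: mzero_self lin_def[symmetric] q h.add)
qed

lemma tensor_simps: "carrier (tensor M n) = (\<lambda>x. x +o Rel n) ` FL n"
  "x \<in> FL n \<Longrightarrow> smult (tensor M n) c (x +o Rel n) = fscale c x +o Rel n"
  "mzero (tensor M n) = Rel n"
  using fs.mzero_quot[OF refl FL_sub Rel_sub Rel_FL] fs.coset_scale[OF Rel_sub]
  by (auto simp: tensor_def quot_def free_lists_def)

lemma smult_tens: "smult (tensor M n) c (gen xs +o Rel n) = fscale c (gen xs) +o Rel n"
  using fs.coset_scale[OF Rel_sub] by (auto simp: tensor_def quot_def free_lists_def)

lemma mlin_combine:
  assumes "module s" "module.subspace s B" "mlin n s B g" "mlin n s B h"
  shows "mlin n s B (\<lambda>xs. g xs + h xs)" "mlin n s B (\<lambda>xs. g xs - h xs)"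
proof -
  interpret v: module s by fact
  note sub = assms(2) and g = assms(3)[unfolded mlin_def] and h = assms(4)[unfolded mlin_def]
  show "mlin n s B (\<lambda>xs. g xs + h xs)"
    unfolding mlin_def
  proof (intro allI impI conjI ballI)
    fix xs x ys y c
    assume 1: "xs @ x # ys \<in> tlists M n"
    {
      assume 2: "y \<in> carrier M"
      show "g (xs @ (x + y) # ys) + h (xs @ (x + y) # ys) - (g (xs @ x # ys) + h (xs @ x # ys)) -
          (g (xs @ y # ys) + h (xs @ y # ys)) \<in> B"
        using v.subspace_add[OF sub conjunct1[OF g[rule_format, OF 1], rule_format, OF 2]
            conjunct1[OF h[rule_format, OF 1], rule_format, OF 2]] by (simp add: algebra_simps)
    }
    show "g (xs @ smult M c x # ys) + h (xs @ smult M c x # ys) - s c (g (xs @ x # ys) + h (xs @ x # ys)) \<in> B"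
      using v.subspace_add[OF sub conjunct2[OF g[rule_format, OF 1], rule_format, of c]
            conjunct2[OF h[rule_format, OF 1], rule_format, of c]] by (simp add: algebra_simps v.scale_right_distrib)
  qed
  show "mlin n s B (\<lambda>xs. g xs - h xs)"
    unfolding mlin_def
  proof (intro allI impI conjI ballI)
    fix xs x ys y c
    assume 1: "xs @ x # ys \<in> tlists M n"
    {
      assume 2: "y \<in> carrier M"
      show "g (xs @ (x + y) # ys) - h (xs @ (x + y) # ys) - (g (xs @ x # ys) - h (xs @ x # ys)) -
          (g (xs @ y # ys) - h (xs @ y # ys)) \<in> B"
        using v.subspace_diff[OF sub conjunct1[OF g[rule_format, OF 1], rule_format, OF 2]
            conjunct1[OF h[rule_format, OF 1], rule_format, OF 2]] by (simp add: algebra_simps)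
    }
    show "g (xs @ smult M c x # ys) - h (xs @ smult M c x # ys) - s c (g (xs @ x # ys) - h (xs @ x # ys)) \<in> B"
      using v.subspace_diff[OF sub conjunct2[OF g[rule_format, OF 1], rule_format, of c]
            conjunct2[OF h[rule_format, OF 1], rule_format, of c]] by (simp add: algebra_simps v.scale_right_diff_distrib)
  qed
qed

lemma mlin_scale:
  assumes "module s" "module.subspace s B" "mlin n s B g"
  shows "mlin n s B (\<lambda>xs. s c (g xs))"
proof -
  interpret v: module s by fact
  note sub = assms(2) and g = assms(3)[unfolded mlin_def]
  show "mlin n s B (\<lambda>xs. s c (g xs))"
    unfolding mlin_def
  proof (intro allI impI conjI ballI)
    fix xs x ys y d
    assume 1: "xs @ x # ys \<in> tlists M n"
    {
      assume 2: "y \<in> carrier M"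
      show "s c (g (xs @ (x + y) # ys)) - s c (g (xs @ x # ys)) - s c (g (xs @ y # ys)) \<in> B"
        using v.subspace_scale[OF sub conjunct1[OF g[rule_format, OF 1], rule_format, OF 2], of c]
        by (simp add: v.scale_right_diff_distrib)
    }
    show "s c (g (xs @ smult M d x # ys)) - s d (s c (g (xs @ x # ys))) \<in> B"
      using v.subspace_scale[OF sub conjunct2[OF g[rule_format, OF 1], rule_format, of d], of c]
      by (simp add: v.scale_right_diff_distrib mult.commute)
  qed
qed

definition hom_image :: "nat \<Rightarrow> (bit list \<Rightarrow> 'a list \<Rightarrow> 'v) \<Rightarrow> 'v set" where
  "hom_image n g = {g ds xs | ds xs. length ds = n \<and> xs \<in> tlists M n \<and> list_all2 (\<lambda>x p. x \<in> part M p) xs ds}"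

lemma mlin_zero:
  assumes "module s" "mlin n s B g" "xs \<in> tlists M n" "0 \<in> set xs"
  shows "g xs \<in> B"
proof -
  interpret v: module s by fact
  obtain ys zs where xs: "xs = ys @ 0 # zs"
    using assms(4) by (auto simp: in_set_conv_decomp)
  then have "g (ys @ smult M 0 0 # zs) - s 0 (g (ys @ 0 # zs)) \<in> B"
    using assms(2,3) unfolding mlin_def by blast
  then show ?thesis
    by (simp add: xs)
qed

lemma map2_cmp_same: "list_all2 (\<lambda>x p. x \<in> part M p) xs ds \<Longrightarrow> map2 cmp ds xs = xs"
  by (induction rule: list_all2_induct) (simp_all add: component_same)

lemma map2_cmp_other:
  "list_all2 (\<lambda>x p. x \<in> part M p) xs ds \<Longrightarrow> length es = length ds \<Longrightarrow> es \<noteq> ds \<Longrightarrow> 0 \<in> set (map2 cmp es xs)"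
proof (induction arbitrary: es rule: list_all2_induct)
  case (Cons x xs d ds)
  then obtain e es' where es: "es = e # es'" "length es' = length ds"
    by (cases es) auto
  show ?case
  proof (cases "e = d")
    case True
    then show ?thesis
      using Cons es by auto
  next
    case False
    then show ?thesis
      using Cons es component_other by auto
  qed
qed simp

lemma map2_cmp_hom: "xs \<in> tlists M n \<Longrightarrow> length ds = n \<Longrightarrow> list_all2 (\<lambda>x p. x \<in> part M p) (map2 cmp ds xs) ds"
  by (auto simp: list_all2_conv_all_nth tlists_def subset_iff intro!: component_in)

text \<open>Boundaries are thus spanned by the formulas at homogeneous lists. On such a list the sum
  over all degree lists collapses modulo \<open>Rel k\<close>, since every wrong degree list
  produces a vanishing component; conversely the components of any list form homogeneous
  lists.\<close>

lemma hlift_image: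
  assumes g: "\<And>ds. length ds = n \<Longrightarrow> mlin n fscale (Rel k) (g ds)"
    and f: "\<And>ds xs. length ds = n \<Longrightarrow> xs \<in> tlists M n \<Longrightarrow> f ds xs = g ds xs +o Rel k"
  shows "hlift M (tensor M k) f ` carrier (tensor M n) = (\<lambda>x. x +o Rel k) ` fs.span (Rel k \<union> hom_image n g)"
    (is "?l = ?cl ` ?S")
proof -
  let ?G = "\<lambda>xs. \<Sum>ds | length ds = n. g ds (map2 cmp ds xs)"
  interpret h: module_hom fscale fscale "lin fscale ?G"
    by (rule module_hom_lin[OF module_fscale])
  have l: "?l = ?cl ` lin fscale ?G ` FL n"
    unfolding tensor_simps image_image
    by (rule image_cong[OF refl]) (rule hlift_tensor[OF g f])
  have G: "?G xs \<in> ?S" if "xs \<in> tlists M n" for xs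
  proof (rule fs.span_sum)
    fix ds :: "bit list"
    assume "ds \<in> {ds. length ds = n}"
    then have "g ds (map2 cmp ds xs) \<in> hom_image n g"
      unfolding hom_image_def using map2_cmp_tlists[OF that] map2_cmp_hom[OF that] by blast
    then show "g ds (map2 cmp ds xs) \<in> ?S"
      by (intro fs.span_base) blast
  qed
  have 1: "lin fscale ?G p \<in> ?S" if "p \<in> FL n" for p
  proof (rule lin_in_subspace[OF module_fscale fs.subspace_span])
    show "p \<in> fs.span (gen ` tlists M n)"
      using that by (simp add: FL_span)
    show "lin fscale ?G x \<in> ?S" if "x \<in> gen ` tlists M n" for x
      using that G by (auto simp: module_fscale)
  qed
  have 2: "\<exists>p\<in>FL n. u - lin fscale ?G p \<in> Rel k" if "u \<in> ?S" for u
    using that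
  proof (induction u rule: fs.span_induct_alt)
    case base
    show ?case
      using fs.subspace_0[OF FL_sub] fs.subspace_0[OF Rel_sub] by (intro bexI[of _ 0]) auto
  next
    case (step c x y)
    have "\<exists>p\<in>FL n. x - lin fscale ?G p \<in> Rel k"
      using step(1)
    proof
      assume "x \<in> Rel k"
      then show ?thesis
        using fs.subspace_0[OF FL_sub] by (intro bexI[of _ 0]) auto
    next
      assume "x \<in> hom_image n g"
      then obtain ds xs where x: "x = g ds xs" "length ds = n" "xs \<in> tlists M n" "list_all2 (\<lambda>x p. x \<in> part M p) xs ds"
        unfolding hom_image_def by blast
      have "?G xs = g ds (map2 cmp ds xs) + (\<Sum>es\<in>{es. length es = n} - {ds}. g es (map2 cmp es xs))"
        by (rule sum.remove) (use x in auto)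
      also have "g ds (map2 cmp ds xs) = x"
        using map2_cmp_same[OF x(4)] x(1) by simp
      finally have "x - ?G xs = - (\<Sum>es\<in>{es. length es = n} - {ds}. g es (map2 cmp es xs))"
        by simp
      also have "\<dots> \<in> Rel k"
      proof (rule fs.subspace_neg[OF Rel_sub], rule fs.subspace_sum[OF Rel_sub])
        fix es
        assume es: "es \<in> {es. length es = n} - {ds}"
        show "g es (map2 cmp es xs) \<in> Rel k"
          by (rule mlin_zero[OF module_fscale g map2_cmp_tlists[OF x(3)]])
            (use es x map2_cmp_other[OF x(4)] in auto)
      qed
      finally show ?thesis
        using x(3) by (intro bexI[of _ "gen xs"]) (auto simp: module_fscale gen_FL)
    qed
    then obtain p where p: "p \<in> FL n" "x - lin fscale ?G p \<in> Rel k"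
      by blast
    obtain q where q: "q \<in> FL n" "y - lin fscale ?G q \<in> Rel k"
      using step by blast
    have "fscale c x + y - lin fscale ?G (fscale c p + q) = fscale c (x - lin fscale ?G p) + (y - lin fscale ?G q)"
      by (simp add: h.add h.scale fs.scale_right_diff_distrib)
    also have "\<dots> \<in> Rel k"
      using p q by (intro fs.subspace_add[OF Rel_sub] fs.subspace_scale[OF Rel_sub])
    finally show ?case
      using p q fs.subspace_add[OF FL_sub] fs.subspace_scale[OF FL_sub] by blast
  qed
  show ?thesis
    unfolding l
  proof (intro set_eqI iffI)
    fix z
    assume "z \<in> ?cl ` ?S"
    then obtain u where u: "u \<in> ?S" "z = u +o Rel k"
      by blast
    then obtain p where p: "p \<in> FL n" "u - lin fscale ?G p \<in> Rel k"
      using 2 by blast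
    then have "z = lin fscale ?G p +o Rel k"
      using u by (simp add: fs.coset_eq_iff[OF Rel_sub])
    then show "z \<in> ?cl ` lin fscale ?G ` FL n"
      using p by blast
  qed (use 1 in blast)
qed

end

lemma eps_simps [simp]: "eps 0 = 1" "eps 1 = - 1" "eps p * eps p = (1 :: 'r::comm_ring_1)"
  by (auto simp: eps_def)

lemma sum_bit: "(\<Sum>p\<in>UNIV. f (p :: bit)) = f 0 + f 1"
  by (simp add: UNIV_bit)

section \<open>Hochschild homology\<close>

context unital_superdialgebra
begin

sublocale smod D
proof (rule smod.intro)
  interpret module "smult D" by (rule module)
  show "module (smult D)" by (rule module)
  show "subspace (supermodule.carrier D)" by (simp add: carrier)
  show "subspace (part D p)" for p by (rule part_subspace)
  show "part D p \<subseteq> supermodule.carrier D" for p by (simp add: carrier)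
  show "\<exists>y\<in>part D 0. \<exists>z\<in>part D 1. x = y + z" for x
    using grading[of x] by auto
  show "x = 0" if "x \<in> part D 0" "x \<in> part D 1" for x
  proof -
    have "0 \<in> part D 0" "0 \<in> part D 1"
      using part_subspace subspace_0 by auto
    obtain u where "\<And>v. (case v of (y, z) \<Rightarrow> y \<in> part D 0 \<and> z \<in> part D 1 \<and> x = y + z) \<Longrightarrow> v = u"
      using grading[of x] by (elim ex1E) blast
    \<comment> \<open>An element of both parts has the two decompositions \<open>x + 0\<close> and
      \<open>0 + x\<close>.\<close>
    from this[of "(x, 0)"] this[of "(0, x)"] have "(x, 0) = (0, x)"
      using that \<open>0 \<in> part D 0\<close> \<open>0 \<in> part D 1\<close> by simp
    then show ?thesis
      by simp
  qed
qed

lemma lmul_simps: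
  "(a + b) \<stileturn> c = a \<stileturn> c + b \<stileturn> c" "a \<stileturn> (b + c) = a \<stileturn> b + a \<stileturn> c"
  "(a - b) \<stileturn> c = a \<stileturn> c - b \<stileturn> c" "a \<stileturn> (b - c) = a \<stileturn> b - a \<stileturn> c"
  "(- a) \<stileturn> c = - (a \<stileturn> c)" "a \<stileturn> (- c) = - (a \<stileturn> c)"
  "0 \<stileturn> c = 0" "a \<stileturn> 0 = 0"
  "smult D r a \<stileturn> c = smult D r (a \<stileturn> c)" "a \<stileturn> smult D r c = smult D r (a \<stileturn> c)"
  using module_hom.add[OF lprod_linear(1)] module_hom.add[OF lprod_linear(2)]
    module_hom.diff[OF lprod_linear(1)] module_hom.diff[OF lprod_linear(2)]
    module_hom.neg[OF lprod_linear(1)] module_hom.neg[OF lprod_linear(2)]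
    module_hom.zero[OF lprod_linear(1)] module_hom.zero[OF lprod_linear(2)]
    module_hom.scale[OF lprod_linear(1)] module_hom.scale[OF lprod_linear(2)] by auto

lemma rmul_simps:
  "(a + b) \<turnstile> c = a \<turnstile> c + b \<turnstile> c" "a \<turnstile> (b + c) = a \<turnstile> b + a \<turnstile> c"
  "(a - b) \<turnstile> c = a \<turnstile> c - b \<turnstile> c" "a \<turnstile> (b - c) = a \<turnstile> b - a \<turnstile> c"
  "(- a) \<turnstile> c = - (a \<turnstile> c)" "a \<turnstile> (- c) = - (a \<turnstile> c)"
  "0 \<turnstile> c = 0" "a \<turnstile> 0 = 0"
  "smult D r a \<turnstile> c = smult D r (a \<turnstile> c)" "a \<turnstile> smult D r c = smult D r (a \<turnstile> c)"
  using module_hom.add[OF rprod_linear(1)] module_hom.add[OF rprod_linear(2)]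
    module_hom.diff[OF rprod_linear(1)] module_hom.diff[OF rprod_linear(2)]
    module_hom.neg[OF rprod_linear(1)] module_hom.neg[OF rprod_linear(2)]
    module_hom.zero[OF rprod_linear(1)] module_hom.zero[OF rprod_linear(2)]
    module_hom.scale[OF rprod_linear(1)] module_hom.scale[OF rprod_linear(2)] by auto

lemmas mul_simps = lmul_simps rmul_simps

lemma lmul_sum: "sum f A \<stileturn> c = (\<Sum>k\<in>A. f k \<stileturn> c)" "a \<stileturn> sum f A = (\<Sum>k\<in>A. a \<stileturn> f k)"
  using module_hom.sum[OF lprod_linear(1)] module_hom.sum[OF lprod_linear(2)] by auto

lemma rmul_sum: "sum f A \<turnstile> c = (\<Sum>k\<in>A. f k \<turnstile> c)" "a \<turnstile> sum f A = (\<Sum>k\<in>A. a \<turnstile> f k)"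
  using module_hom.sum[OF rprod_linear(1)] module_hom.sum[OF rprod_linear(2)] by auto

lemma in_carrier [simp]: "x \<in> supermodule.carrier D"
  by (simp add: carrier)

lemma tlists_D: "xs \<in> tlists D n \<longleftrightarrow> length xs = n"
  by (simp add: tlists_def carrier)

lemma cmp_simps [simp]:
  "cmp p (x + y) = cmp p x + cmp p y" "cmp p (smult D c x) = smult D c (cmp p x)"
  "cmp p x \<in> part D p"
  by (simp_all add: component_add component_scale component_in)

lemma zero_in_part [simp]: "0 \<in> part D p"
  by (rule md.subspace_0[OF part_sub])

lemma cmp_zero [simp]: "cmp p 0 = 0"
  by (rule component_same) simp

lemma cmp_hom: "x \<in> part D p \<Longrightarrow> cmp q x = (if q = p then x else 0)"
  using component_same component_other by auto

lemma cmp_sum_eq: "cmp 0 x + cmp 1 x = x" "cmp 1 x + cmp 0 x = x"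
  by (simp_all add: component_sum_eq add.commute[of "cmp 1 x"])

lemma part_closed:
  "x \<in> part D p \<Longrightarrow> y \<in> part D p \<Longrightarrow> x + y \<in> part D p"
  "x \<in> part D p \<Longrightarrow> y \<in> part D p \<Longrightarrow> x - y \<in> part D p"
  "x \<in> part D p \<Longrightarrow> smult D c x \<in> part D p"
  using md.subspace_add[OF part_sub] md.subspace_diff[OF part_sub] md.subspace_scale[OF part_sub] by auto

lemma part_sum: "(\<And>k. k \<in> A \<Longrightarrow> f k \<in> part D p) \<Longrightarrow> sum f A \<in> part D p"
  by (rule md.subspace_sum[OF part_sub])

text \<open>The sign makes sense for homogeneous elements only; the sum over components extends it,
  so that \<open>a \<stileturn> b - rev a b\<close> is the differential \<open>d_1\<close> on all of
  \<open>D \<otimes> D\<close>.\<close>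

definition rev :: "'d \<Rightarrow> 'd \<Rightarrow> 'd" where
  "rev a b = (\<Sum>p\<in>UNIV. \<Sum>q\<in>UNIV. smult D (eps (p * q)) (cmp q b \<turnstile> cmp p a))"

lemma rev_hom: "a \<in> part D p \<Longrightarrow> b \<in> part D q \<Longrightarrow> rev a b = smult D (eps (p * q)) (b \<turnstile> a)"
  unfolding rev_def sum_bit
  by (cases p; cases q) (simp_all add: cmp_hom mul_simps)

lemma rev_simps:
  "rev (a + b) c = rev a c + rev b c" "rev a (b + c) = rev a b + rev a c"
  "rev (smult D r a) c = smult D r (rev a c)" "rev a (smult D r c) = smult D r (rev a c)"
  by (simp_all add: rev_def sum_bit mul_simps md.scale_right_distrib mult.commute algebra_simps)

lemma rev_part: "a \<in> part D p \<Longrightarrow> b \<in> part D q \<Longrightarrow> rev a b \<in> part D (p + q)"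
  using rprod_degree[of b q a p] by (simp add: rev_hom part_closed add.commute)

text \<open>In \<open>rev\<close> the product of \<open>b\<close> and \<open>c\<close> stands to the
  left of \<open>\<turnstile>\<close>, where the third dialgebra identity makes the two products
  agree. Together with the first identity for the other term of \<open>d_1\<close> this yields that
  \<open>d_1\<close> vanishes on \<open>I\<close>.\<close>

lemma rev_bar: "rev a (b \<stileturn> c) = rev a (b \<turnstile> c)"
proof -
  have 1: "cmp p (b \<stileturn> c) \<turnstile> d = cmp p (b \<turnstile> c) \<turnstile> d" for p d
  proof -
    have "cmp p (x \<stileturn> y) \<turnstile> d = cmp p (x \<turnstile> y) \<turnstile> d" if "x \<in> part D q" "y \<in> part D r" for x y q r
      using lprod_degree[OF that] rprod_degree[OF that] dialgebra by (simp add: cmp_hom mul_simps)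
    from this[of "cmp 0 b" 0 "cmp 0 c" 0] this[of "cmp 0 b" 0 "cmp 1 c" 1]
      this[of "cmp 1 b" 1 "cmp 0 c" 0] this[of "cmp 1 b" 1 "cmp 1 c" 1]
    have "cmp p ((cmp 0 b + cmp 1 b) \<stileturn> (cmp 0 c + cmp 1 c)) \<turnstile> d = cmp p ((cmp 0 b + cmp 1 b) \<turnstile> (cmp 0 c + cmp 1 c)) \<turnstile> d"
      by (simp add: mul_simps)
    then show ?thesis
      by (simp only: cmp_sum_eq)
  qed
  show ?thesis
    by (simp add: rev_def 1)
qed

definition hd1 :: "'d list \<Rightarrow> 'd" where
  "hd1 xs = xs ! 0 \<stileturn> xs ! 1 - rev (xs ! 0) (xs ! 1)"

definition hd2 :: "bit list \<Rightarrow> 'd list \<Rightarrow> 'd list \<Rightarrow>\<^sub>0 'r" where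
  "hd2 ds xs = gen [xs ! 0 \<stileturn> xs ! 1, xs ! 2] - gen [xs ! 0, xs ! 1 \<stileturn> xs ! 2]
     + fscale (eps (ds ! 2 * (ds ! 0 + ds ! 1))) (gen [xs ! 2 \<turnstile> xs ! 0, xs ! 1])"

definition Igen :: "('d list \<Rightarrow>\<^sub>0 'r) set" where
  "Igen = {gen [a, b \<stileturn> c] - gen [a, b \<turnstile> c] | a b c. True}"

text \<open>Cycles and boundaries on the level of the free module. The tensor relations are part of
  \<open>BH\<close>, so that \<open>HHS1\<close> becomes \<open>KH / BH\<close>.\<close>

definition "KH = {q \<in> FL 2. lin (smult D) hd1 q = 0}"

definition "BH = fs.span (Rel 2 \<union> hom_image 3 hd2 \<union> Igen)"

lemma Rel2_add: "gen [x + y, z] - gen [x, z] - gen [y, z] \<in> Rel 2"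
  "gen [z, x + y] - gen [z, x] - gen [z, y] \<in> Rel 2"
  using Rel_add[of "[]" x "[z]" 2 y] Rel_add[of "[z]" x "[]" 2 y] by (simp_all add: tlists_D)

lemma Rel2_scale: "gen [smult D c x, z] - fscale c (gen [x, z]) \<in> Rel 2"
  "gen [z, smult D c x] - fscale c (gen [z, x]) \<in> Rel 2"
  using Rel_scale[of "[]" x "[z]" 2 c] Rel_scale[of "[z]" x "[]" 2 c] by (simp_all add: tlists_D)

lemma mlin_hd1: "mlin 2 (smult D) {0} hd1"
  by (rule mlin_lists2I)
    (simp_all add: hd1_def mul_simps rev_simps md.scale_right_diff_distrib algebra_simps)

lemma mlin_hd2: "mlin 3 fscale (Rel 2) (hd2 ds)"
  unfolding hd2_def
  by (intro mlin_combine mlin_scale module_fscale Rel_sub mlin_lists3I)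
    (simp_all add: mul_simps Rel2_add Rel2_scale)

lemma hoch2_image: "hoch D 2 ` supermodule.carrier (tensor D 3) = (\<lambda>x. x +o Rel 2) ` fs.span (Rel 2 \<union> hom_image 3 hd2)"
  unfolding hoch_def
proof (rule hlift_image[OF mlin_hd2])
  fix ds :: "bit list" and xs
  assume "length ds = 3" "xs \<in> tlists D 3"
  then obtain p q r a b c where e: "ds = [p, q, r]" "xs = [a, b, c]"
    by (auto simp: tlists_D numeral_3_eq_3 length_Suc_conv)
  show "(\<Sum>i<2. smult (tensor D 2) ((- 1) ^ i) (tens D (take i xs @ [xs ! i \<stileturn> xs ! Suc i] @ drop (i + 2) xs))) +
      smult (tensor D 2) ((- 1) ^ 2 * eps (ds ! 2 * (\<Sum>i<2. ds ! i))) (tens D ((xs ! 2 \<turnstile> xs ! 0) # tl (butlast xs))) =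
      hd2 ds xs +o Rel 2"
    by (simp add: e lessThan_Suc numeral_2_eq_2 tens_def smult_tens[where n = "Suc (Suc 0)"] hd2_def fs.coset_add[OF Rel_sub])
      (simp add: numeral_2_eq_2 algebra_simps)
qed

definition hg1 :: "bit list \<Rightarrow> 'd list \<Rightarrow> 'd list \<Rightarrow>\<^sub>0 'r" where
  "hg1 ds xs = gen [xs ! 0 \<stileturn> xs ! 1] - fscale (eps (ds ! 1 * ds ! 0)) (gen [xs ! 1 \<turnstile> xs ! 0])"

lemma Rel1_add: "gen [x + y] - gen [x] - gen [y] \<in> Rel 1"
  using Rel_add[of "[]" x "[]" 1 y] by (simp add: tlists_D)

lemma Rel1_scale: "gen [smult D c x] - fscale c (gen [x]) \<in> Rel 1"
  using Rel_scale[of "[]" x "[]" 1 c] by (simp add: tlists_D)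

lemma mlin_hg1: "mlin 2 fscale (Rel 1) (hg1 ds)"
  unfolding hg1_def
  by (intro mlin_combine mlin_scale module_fscale Rel_sub mlin_lists2I)
    (use Rel1_add Rel1_scale in \<open>simp_all add: mul_simps\<close>)

lemma hoch1: "p \<in> FL 2 \<Longrightarrow> hoch D 1 (p +o Rel 2) =
    lin fscale (\<lambda>xs. \<Sum>ds | length ds = 2. hg1 ds (map2 cmp ds xs)) p +o Rel 1"
  unfolding hoch_def
proof (rule hlift_tensor[OF mlin_hg1])
  fix ds :: "bit list" and xs
  assume "length ds = 2" "xs \<in> tlists D 2"
  then obtain p q a b where e: "ds = [p, q]" "xs = [a, b]"
    by (auto simp: tlists_D numeral_2_eq_2 length_Suc_conv)
  show "(\<Sum>i<1. smult (tensor D 1) ((- 1) ^ i) (tens D (take i xs @ [xs ! i \<stileturn> xs ! Suc i] @ drop (i + 2) xs))) +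
      smult (tensor D 1) ((- 1) ^ 1 * eps (ds ! 1 * (\<Sum>i<1. ds ! i))) (tens D ((xs ! 1 \<turnstile> xs ! 0) # tl (butlast xs))) =
      hg1 ds xs +o Rel 1"
    using smult_tens[of 1]
    by (simp add: e lessThan_Suc tens_def hg1_def fs.coset_add[OF Rel_sub] fs.scale_minus_left)
qed

text \<open>The first tensor power of a module is the module: every \<open>x\<close> is congruent to
  the generator of its evaluation \<open>?ev x\<close>. This turns the kernel of \<open>d_1\<close>,
  whose target is \<open>tensor D 1\<close>, into the kernel of \<open>hd1\<close> with values in
  \<open>D\<close>.\<close>

lemma Rel1_iff:
  assumes "x \<in> FL 1"
  shows "x \<in> Rel 1 \<longleftrightarrow> lin (smult D) (\<lambda>xs. xs ! 0) x = 0"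
proof
  let ?ev = "lin (smult D) (\<lambda>xs. xs ! 0)"
  interpret h: module_hom fscale "smult D" ?ev
    by (rule module_hom_lin[OF module])
  have "mlin 1 (smult D) {0} (\<lambda>xs. xs ! 0)"
    by (rule mlin_lists1I) simp_all
  then show "?ev x = 0" if "x \<in> Rel 1"
    using lin_Rel[OF module md.subspace_single_0] that by blast
  have "x - gen [?ev x] \<in> Rel 1"
    using assms unfolding FL_span
  proof (induction x rule: fs.span_induct_alt)
    case base
    have "gen [smult D 0 0] - fscale 0 (gen [0]) \<in> Rel 1"
      by (rule Rel1_scale)
    then show ?case
      using fs.subspace_neg[OF Rel_sub] by force
  next
    case (step c x y)
    then obtain a where x: "x = gen [a]"
      by (auto simp: tlists_D length_Suc_conv)
    have "fscale c x + y - gen [?ev (fscale c x + y)] =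
        (y - gen [?ev y]) - (gen [smult D c a + ?ev y] - gen [smult D c a] - gen [?ev y])
        - (gen [smult D c a] - fscale c (gen [a]))"
      by (simp add: h.add h.scale x module)
    also have "\<dots> \<in> Rel 1"
      by (rule fs.subspace_diff[OF Rel_sub fs.subspace_diff[OF Rel_sub step(2) Rel1_add] Rel1_scale])
    finally show ?case .
  qed
  moreover have "gen [0 :: 'd] \<in> Rel 1"
    using Rel1_scale[of 0 0] by simp
  ultimately show "x \<in> Rel 1" if "?ev x = 0"
    using that fs.subspace_add[OF Rel_sub, of "x - gen [0]" _ "gen [0]"] by simp
qed

lemma ker_hoch1: "ker (tensor D 2) (tensor D 1) (hoch D 1) = (\<lambda>x. x +o Rel 2) ` KH"
proof -
  let ?G = "\<lambda>xs. \<Sum>ds | length ds = 2. hg1 ds (map2 cmp ds xs)"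
  let ?ev = "lin (smult D) (\<lambda>xs. xs ! 0)"
  interpret h: module_hom fscale "smult D" ?ev
    by (rule module_hom_lin[OF module])
  interpret g: module_hom fscale fscale "lin fscale ?G"
    by (rule module_hom_lin[OF module_fscale])
  interpret k: module_hom fscale "smult D" "lin (smult D) hd1"
    by (rule module_hom_lin[OF module])
  \<comment> \<open>Summing over all degrees recombines the components; the signs are those in
    \<open>rev\<close>.\<close>
  have G: "?ev (?G [a, b]) = hd1 [a, b]" for a b
    by (simp add: numeral_2_eq_2 sum_lists_bit sum_bit hg1_def hd1_def h.add h.diff h.scale module rev_def)
      (simp add: mul_simps[symmetric] cmp_sum_eq algebra_simps)
  have ev: "lin fscale ?G p \<in> FL 1 \<and> ?ev (lin fscale ?G p) = lin (smult D) hd1 p" if "p \<in> FL 2" for p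
    using that unfolding FL_span[of 2]
  proof (induction p rule: fs.span_induct_alt)
    case base
    show ?case
      using fs.subspace_0[OF FL_sub] by simp
  next
    case (step c x y)
    then obtain a b where x: "x = gen [a, b]"
      by (auto simp: tlists_D length_Suc_conv numeral_2_eq_2)
    have "?G [a, b] \<in> FL 1"
      by (intro fs.subspace_sum[OF FL_sub])
        (auto simp: hg1_def tlists_D intro!: fs.subspace_diff[OF FL_sub] fs.subspace_scale[OF FL_sub] gen_FL)
    then show ?case
      using step fs.subspace_add[OF FL_sub] fs.subspace_scale[OF FL_sub]
      by (simp add: h.add h.scale g.add g.scale k.add k.scale x module module_fscale G del: One_nat_def)
  qed
  have "hoch D 1 (p +o Rel 2) = mzero (tensor D 1) \<longleftrightarrow> lin (smult D) hd1 p = 0" if "p \<in> FL 2" for p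
  proof -
    have "hoch D 1 (p +o Rel 2) = mzero (tensor D 1) \<longleftrightarrow> lin fscale ?G p +o Rel 1 = 0 +o Rel 1"
      by (simp add: hoch1[OF that] tensor_simps del: One_nat_def)
    also have "\<dots> \<longleftrightarrow> lin fscale ?G p \<in> Rel 1"
      by (subst fs.coset_eq_iff[OF Rel_sub]) simp
    finally show ?thesis
      using Rel1_iff ev[OF that] by simp
  qed
  then show ?thesis
    unfolding ker_def KH_def tensor_simps by blast
qed

text \<open>\<open>generated\<close> is an intersection of submodules of the quotient. Their
  preimages in the free module are submodules containing \<open>Rel 2\<close> and
  \<open>Igen\<close>, and the span is the least of these.\<close>

lemma hoch_I_image: "hoch_I D = (\<lambda>x. x +o Rel 2) ` fs.span (Rel 2 \<union> Igen)"
proof -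
  let ?cl = "\<lambda>x. x +o Rel 2"
  let ?S = "{tens D [a, b \<stileturn> c] + smult (tensor D 2) (- 1) (tens D [a, b \<turnstile> c]) | a b c.
        a \<in> supermodule.carrier D \<and> b \<in> supermodule.carrier D \<and> c \<in> supermodule.carrier D}"
  have gens: "tens D [a, b \<stileturn> c] + smult (tensor D 2) (- 1) (tens D [a, b \<turnstile> c]) =
      (gen [a, b \<stileturn> c] - gen [a, b \<turnstile> c]) +o Rel 2" for a b c
    using smult_tens[of 2]
    by (simp add: tens_def numeral_2_eq_2 fs.coset_add[OF Rel_sub] fs.scale_minus_left)
  have sub: "fs.span (Rel 2 \<union> Igen) \<subseteq> FL 2"
    using Rel_FL by (intro fs.span_minimal[OF _ FL_sub])
      (auto simp: Igen_def tlists_D intro!: fs.subspace_diff[OF FL_sub] gen_FL)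
  have A: "submod (tensor D 2) (?cl ` fs.span (Rel 2 \<union> Igen))"
    unfolding submod_def tensor_simps
  proof (intro conjI ballI allI)
    show "?cl ` fs.span (Rel 2 \<union> Igen) \<subseteq> ?cl ` FL 2"
      using sub by blast
    show "Rel 2 \<in> ?cl ` fs.span (Rel 2 \<union> Igen)"
      by (rule image_eqI[of _ _ 0]) (simp_all add: fs.span_zero)
    show "x + y \<in> ?cl ` fs.span (Rel 2 \<union> Igen)"
      if xy: "x \<in> ?cl ` fs.span (Rel 2 \<union> Igen)" "y \<in> ?cl ` fs.span (Rel 2 \<union> Igen)" for x y
    proof -
      obtain u v where uv: "u \<in> fs.span (Rel 2 \<union> Igen)" "v \<in> fs.span (Rel 2 \<union> Igen)" "x = ?cl u" "y = ?cl v"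
        using xy by blast
      then have "x + y = ?cl (u + v)"
        by (simp add: fs.coset_add[OF Rel_sub])
      then show ?thesis
        using uv fs.span_add by blast
    qed
    show "smult (tensor D 2) c x \<in> ?cl ` fs.span (Rel 2 \<union> Igen)"
      if "x \<in> ?cl ` fs.span (Rel 2 \<union> Igen)" for c x
    proof -
      obtain u where u: "u \<in> fs.span (Rel 2 \<union> Igen)" "x = ?cl u"
        using \<open>x \<in> _\<close> by blast
      then have "smult (tensor D 2) c x = ?cl (fscale c u)"
        using sub by (simp add: tensor_simps subset_iff)
      then show ?thesis
        using u fs.span_scale by blast
    qed
  qed
  have B: "?S \<subseteq> ?cl ` fs.span (Rel 2 \<union> Igen)"
    unfolding gens by (auto simp: Igen_def intro!: imageI fs.span_base)
  have C: "?cl ` fs.span (Rel 2 \<union> Igen) \<subseteq> N" if N: "submod (tensor D 2) N" "?S \<subseteq> N" for N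
  proof -
    have "fs.subspace {p \<in> FL 2. ?cl p \<in> N}"
    proof (rule fs.subspaceI)
      show "0 \<in> {p \<in> FL 2. ?cl p \<in> N}"
        using N fs.subspace_0[OF FL_sub] by (simp add: submod_def tensor_simps)
      show "x + y \<in> {p \<in> FL 2. ?cl p \<in> N}" if "x \<in> {p \<in> FL 2. ?cl p \<in> N}" "y \<in> {p \<in> FL 2. ?cl p \<in> N}" for x y
        using N that fs.subspace_add[OF FL_sub] by (auto simp: submod_def fs.coset_add[OF Rel_sub, symmetric])
      show "fscale c x \<in> {p \<in> FL 2. ?cl p \<in> N}" if "x \<in> {p \<in> FL 2. ?cl p \<in> N}" for c x
        using N that fs.subspace_scale[OF FL_sub] by (auto simp: submod_def tensor_simps(2)[symmetric])
    qed
    moreover have "Rel 2 \<union> Igen \<subseteq> {p \<in> FL 2. ?cl p \<in> N}"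
    proof
      fix u
      assume u: "u \<in> Rel 2 \<union> Igen"
      then have "u \<in> FL 2"
        using sub fs.span_base by blast
      moreover have "?cl u \<in> N"
        using u
      proof
        assume "u \<in> Rel 2"
        then have "?cl u = ?cl 0"
          by (subst fs.coset_eq_iff[OF Rel_sub]) simp
        then show ?thesis
          using N by (simp add: submod_def tensor_simps)
      next
        assume "u \<in> Igen"
        then obtain a b c where "u = gen [a, b \<stileturn> c] - gen [a, b \<turnstile> c]"
          by (auto simp: Igen_def)
        then show ?thesis
          using N(2) gens by auto
      qed
      ultimately show "u \<in> {p \<in> FL 2. ?cl p \<in> N}"
        by simp
    qed
    ultimately show ?thesis
      using fs.span_minimal by blast
  qed
  show ?thesis
    unfolding hoch_I_def generated_def
    by (rule equalityI[OF Inter_lower Inter_greatest]) (use A B C in simp_all)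
qed

lemma FL_parts: "part (free_lists D n) p \<subseteq> FL n"
  unfolding FL_span by (auto simp: free_lists_def intro: fs.span_mono[THEN subsetD, rotated])

lemma KH_sub: "fs.subspace KH"
proof -
  have e: "KH = FL 2 \<inter> {q. lin (smult D) hd1 q \<in> {0}}"
    by (auto simp: KH_def)
  show ?thesis
    unfolding e by (rule fs.subspace_inter[OF FL_sub subspace_lin_vimage[OF module md.subspace_single_0]])
qed

lemma BH_sub: "fs.subspace BH"
  by (simp add: BH_def)

lemma Rel_BH: "Rel 2 \<subseteq> BH"
  by (auto simp: BH_def intro: fs.span_base)

lemma gen2_FL [simp]: "gen [a, b] \<in> FL 2"
  by (rule gen_FL) (simp add: tlists_D)

text \<open>\<open>d_1 d_2 = 0\<close> follows from associativity and the mixed dialgebra identities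
  once the degrees of the products make all values of \<open>rev\<close> explicit.\<close>

lemma BH_KH: "BH \<subseteq> KH"
proof -
  interpret h: module_hom fscale "smult D" "lin (smult D) hd1"
    by (rule module_hom_lin[OF module])
  have "u \<in> KH" if u: "u \<in> hom_image 3 hd2" for u
  proof -
    obtain ds xs where "u = hd2 ds xs" "length ds = 3" "length xs = 3" and h: "list_all2 (\<lambda>x p. x \<in> part D p) xs ds"
      using u unfolding hom_image_def tlists_D by blast
    then obtain p q r a b c where e: "ds = [p, q, r]" "xs = [a, b, c]"
      by (auto simp: numeral_3_eq_3 length_Suc_conv)
    have abc: "a \<in> part D p" "b \<in> part D q" "c \<in> part D r"
      using h by (auto simp: e)
    have eq: "eps ((p + q) * r) = (eps (r * (p + q)) :: 'r)"
      "eps (p * (q + r)) = (eps (p * q) * eps (r * p) :: 'r)" "eps (q * (r + p)) * eps (r * (p + q)) = (eps (p * q) * eps (p * r) :: 'r)"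
      by (cases p; cases q; cases r; simp add: eps_def)+
    have "lin (smult D) hd1 u = 0"
      using abc lprod_degree[OF abc(1,2)] lprod_degree[OF abc(2,3)] rprod_degree[OF abc(3,1)]
      by (simp add: \<open>u = _\<close> e hd2_def h.add h.diff h.scale module hd1_def rev_hom lprod_assoc rprod_assoc
          dialgebra eq md.scale_right_diff_distrib mult.commute)
    moreover have "u \<in> FL 2"
      by (simp add: \<open>u = _\<close> e hd2_def fs.subspace_add[OF FL_sub] fs.subspace_diff[OF FL_sub] fs.subspace_scale[OF FL_sub])
    ultimately show ?thesis
      by (simp add: KH_def)
  qed
  moreover have "u \<in> KH" if "u \<in> Igen" for u
  proof -
    obtain a b c where u: "u = gen [a, b \<stileturn> c] - gen [a, b \<turnstile> c]"
      using \<open>u \<in> Igen\<close> by (auto simp: Igen_def)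
    have "hd1 [a, b \<stileturn> c] = hd1 [a, b \<turnstile> c]"
      by (simp add: hd1_def rev_bar dialgebra(1))
    then show ?thesis
      by (simp add: KH_def u h.diff module fs.subspace_diff[OF FL_sub])
  qed
  moreover have "Rel 2 \<subseteq> KH"
    using Rel_FL lin_Rel[OF module md.subspace_single_0 mlin_hd1] by (auto simp: KH_def)
  ultimately show ?thesis
    unfolding BH_def by (intro fs.span_minimal[OF _ KH_sub]) blast
qed

definition "clH x = (x +o Rel 2) +o ((\<lambda>x. x +o Rel 2) ` BH)"

lemma presents_HHS1: "presents (HHS1 D) fscale KH BH (\<lambda>p. part (free_lists D 2) p \<inter> KH) clH"
proof -
  let ?cl = "\<lambda>x. x +o Rel 2"
  have "?cl ` fs.span (Rel 2 \<union> hom_image 3 hd2) + ?cl ` fs.span (Rel 2 \<union> Igen) = ?cl ` BH"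
  proof -
    have "BH = fs.span ((Rel 2 \<union> hom_image 3 hd2) \<union> (Rel 2 \<union> Igen))"
      unfolding BH_def by (rule arg_cong[of _ _ fs.span]) blast
    also have "\<dots> = {x + y |x y. x \<in> fs.span (Rel 2 \<union> hom_image 3 hd2) \<and> y \<in> fs.span (Rel 2 \<union> Igen)}"
      by (rule fs.span_Un)
    finally have BH: "?cl ` BH = {?cl (x + y) |x y. x \<in> fs.span (Rel 2 \<union> hom_image 3 hd2) \<and> y \<in> fs.span (Rel 2 \<union> Igen)}"
      by auto
    show ?thesis
      unfolding BH fs.coset_add[OF Rel_sub, symmetric] set_plus_def by blast
  qed
  then have "HHS1 D = quot (restr (quot (free_lists D 2) (Rel 2)) (?cl ` KH)) (?cl ` BH)"
    unfolding HHS1_def ker_hoch1 hoch2_image hoch_I_image by (simp add: tensor_def)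
  moreover have "supermodule.carrier (free_lists D 2) = FL 2" "smult (free_lists D 2) = fscale" "KH \<subseteq> FL 2"
    by (auto simp: free_lists_def KH_def)
  ultimately show ?thesis
    using presents_quot_quot[OF module_fscale _ refl FL_sub FL_parts Rel_sub KH_sub BH_sub Rel_BH BH_KH]
    by (simp add: clH_def[abs_def])
qed

end

section \<open>Matrices\<close>

locale sl_algebra = unital_superdialgebra D
  for D :: "('r::comm_ring_1, 'd::ab_group_add) superdialgebra" (structure) +
  fixes m n :: nat
begin

definition "I = {1..m + n}"
abbreviation "par \<equiv> idx m"
abbreviation "G \<equiv> gl m n D"
abbreviation "br \<equiv> brac G"

definition E :: "nat \<Rightarrow> nat \<Rightarrow> 'd \<Rightarrow> nat \<Rightarrow> nat \<Rightarrow> 'd" where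
  "E i j a = (\<lambda>u v. if u = i \<and> v = j then a else 0)"

lemma module_mat: "module (mat_scale D)"
  unfolding mat_scale_def
  by unfold_locales
    (simp_all add: fun_eq_iff md.scale_right_distrib md.scale_left_distrib)

lemma finite_I [simp]: "finite I"
  by (simp add: I_def)

lemma G_simps:
  "supermodule.carrier G = {A. \<forall>i j. i \<notin> I \<or> j \<notin> I \<longrightarrow> A i j = 0}"
  "smult G = mat_scale D"
  "part G p = {A. (\<forall>i j. A i j \<in> part D (par i + par j + p)) \<and> (\<forall>i j. i \<notin> I \<or> j \<notin> I \<longrightarrow> A i j = 0)}"
  "part (mat m n D) p = part G p"
proof -
  \<comment> \<open>Zero lies in every homogeneous part, so the degree condition may be imposed
    outside the index range as well.\<close>
  have "(\<forall>i\<in>I. \<forall>j\<in>I. A i j \<in> part D (par i + par j + p)) \<and> (\<forall>i j. i \<notin> I \<or> j \<notin> I \<longrightarrow> A i j = 0) \<longleftrightarrow>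
      (\<forall>i j. A i j \<in> part D (par i + par j + p)) \<and> (\<forall>i j. i \<notin> I \<or> j \<notin> I \<longrightarrow> A i j = 0)" for A
    by (metis zero_in_part)
  then show "part G p = {A. (\<forall>i j. A i j \<in> part D (par i + par j + p)) \<and> (\<forall>i j. i \<notin> I \<or> j \<notin> I \<longrightarrow> A i j = 0)}"
    unfolding gl_def mat_def supermodule.defs I_def[symmetric] by simp
qed (simp_all add: gl_def mat_def supermodule.defs I_def carrier)

lemma sum_apply: "(\<Sum>k\<in>A. f k) u = (\<Sum>k\<in>A. f k u)"
  by (induction A rule: infinite_finite_induct) simp_all

lemma bit_add_self [simp]: "(p :: bit) + p = 0" "p + (p + q) = q"
  by (cases p; cases q; simp)+

sublocale g: smod G
proof (rule smod.intro)
  interpret mm: module "mat_scale D" by (rule module_mat)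
  show "module (smult G)"
    by (simp add: G_simps module_mat)
  show "module.subspace (smult G) (supermodule.carrier G)"
    unfolding G_simps by (rule mm.subspaceI) (auto simp: mat_scale_def)
  show "module.subspace (smult G) (part G p)" for p
    unfolding G_simps by (rule mm.subspaceI) (auto simp: mat_scale_def part_closed)
  show "part G p \<subseteq> supermodule.carrier G" for p
    unfolding G_simps by auto
  show "\<exists>y\<in>part G 0. \<exists>z\<in>part G 1. x = y + z" if "x \<in> supermodule.carrier G" for x
  proof (intro bexI)
    show "x = (\<lambda>i j. cmp (par i + par j + 0) (x i j)) + (\<lambda>i j. cmp (par i + par j + 1) (x i j))"
    proof (intro ext)
      fix i j
      show "x i j = ((\<lambda>i j. cmp (par i + par j + 0) (x i j)) + (\<lambda>i j. cmp (par i + par j + 1) (x i j))) i j"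
        using cmp_sum_eq[of "x i j"] by (cases "par i"; cases "par j") simp_all
    qed
  qed (use that in \<open>auto simp: G_simps\<close>)
  show "x = 0" if "x \<in> part G 0" "x \<in> part G 1" for x
  proof (intro ext)
    fix i j
    have "x i j \<in> part D (par i + par j + 0)" "x i j \<in> part D (par i + par j + 1)"
      using that by (auto simp: G_simps simp del: add_0_right)
    then show "x i j = 0 i j"
      using indep[of "x i j"] by (cases "par i"; cases "par j") simp_all
  qed
qed

lemma g_cmp:
  assumes "x \<in> supermodule.carrier G"
  shows "g.cmp p x i j = cmp (par i + par j + p) (x i j)"
proof -
  have x: "x = (\<lambda>i j. cmp (par i + par j + p) (x i j)) + (\<lambda>i j. cmp (par i + par j + (p + 1)) (x i j))"
  proof (intro ext)
    fix i j
    show "x i j = ((\<lambda>i j. cmp (par i + par j + p) (x i j)) + (\<lambda>i j. cmp (par i + par j + (p + 1)) (x i j))) i j"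
      using cmp_sum_eq[of "x i j"] by (cases "par i"; cases "par j"; cases p) simp_all
  qed
  have "g.cmp p x = (\<lambda>i j. cmp (par i + par j + p) (x i j))"
    by (subst x, rule g.component_eqI) (use assms in \<open>auto simp: G_simps\<close>)
  then show ?thesis
    by simp
qed

lemma component_mat: "component (mat m n D) p x = g.cmp p x"
  by (simp add: component_def G_simps)

lemma br_def: "br x y = (\<Sum>p\<in>UNIV. \<Sum>q\<in>UNIV. mat_lprod m n D (g.cmp p x) (g.cmp q y)
    - mat_scale D (eps (p * q)) (mat_rprod m n D (g.cmp q y) (g.cmp p x)))"
  unfolding component_mat[symmetric] by (simp add: gl_def supermodule.defs)

lemma g_cmp_hom: "x \<in> part G p \<Longrightarrow> g.cmp q x = (if q = p then x else 0)"
  using g.component_same g.component_other by auto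

lemma mat_prod_zero [simp]: "mat_lprod m n D 0 y = 0" "mat_lprod m n D x 0 = 0"
  "mat_rprod m n D 0 y = 0" "mat_rprod m n D x 0 = 0" "mat_scale D c 0 = 0"
  by (simp_all add: mat_lprod_def mat_rprod_def mat_scale_def mul_simps fun_eq_iff)

lemma br_hom:
  assumes "x \<in> part G p" "y \<in> part G q"
  shows "br x y = mat_lprod m n D x y - mat_scale D (eps (p * q)) (mat_rprod m n D y x)"
  unfolding br_def sum_bit using assms by (cases p; cases q) (simp_all add: g_cmp_hom)

lemma br_hom_entry:
  assumes "x \<in> part G p" "y \<in> part G q"
  shows "br x y i j = (\<Sum>k\<in>I. x i k \<stileturn> y k j) - smult D (eps (p * q)) (\<Sum>k\<in>I. y i k \<turnstile> x k j)"
  by (simp add: br_hom[OF assms] mat_lprod_def mat_rprod_def mat_scale_def I_def)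

lemma mat_prod_add:
  "mat_lprod m n D (x + x') y = mat_lprod m n D x y + mat_lprod m n D x' y"
  "mat_lprod m n D x (y + y') = mat_lprod m n D x y + mat_lprod m n D x y'"
  "mat_rprod m n D (x + x') y = mat_rprod m n D x y + mat_rprod m n D x' y"
  "mat_rprod m n D x (y + y') = mat_rprod m n D x y + mat_rprod m n D x y'"
  "mat_scale D c (x + y) = mat_scale D c x + mat_scale D c y"
  by (simp_all add: mat_lprod_def mat_rprod_def mat_scale_def mul_simps fun_eq_iff sum.distrib md.scale_right_distrib)

lemma mat_prod_scale:
  "mat_lprod m n D (mat_scale D c x) y = mat_scale D c (mat_lprod m n D x y)"
  "mat_lprod m n D x (mat_scale D c y) = mat_scale D c (mat_lprod m n D x y)"
  "mat_rprod m n D (mat_scale D c x) y = mat_scale D c (mat_rprod m n D x y)"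
  "mat_rprod m n D x (mat_scale D c y) = mat_scale D c (mat_rprod m n D x y)"
  "mat_scale D d (mat_scale D c x) = mat_scale D c (mat_scale D d x)"
  by (simp_all add: mat_lprod_def mat_rprod_def mat_scale_def mul_simps fun_eq_iff md.scale_sum_right mult.commute)

lemma br_add:
  assumes "x \<in> supermodule.carrier G" "y \<in> supermodule.carrier G" "z \<in> supermodule.carrier G"
  shows "br (x + y) z = br x z + br y z" "br z (x + y) = br z x + br z y"
  using assms by (simp_all add: br_def sum_bit g.component_add mat_prod_add)

lemma br_scale:
  assumes "x \<in> supermodule.carrier G" "z \<in> supermodule.carrier G"
  shows "br (mat_scale D c x) z = mat_scale D c (br x z)" "br z (mat_scale D c x) = mat_scale D c (br z x)"
proof -
  interpret mm: module "mat_scale D" by (rule module_mat)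
  have 1: "g.cmp p (mat_scale D c x) = mat_scale D c (g.cmp p x)" for p
    using g.component_scale[OF assms(1)] by (simp add: G_simps)
  have 2: "mat_scale D c (u - v) = mat_scale D c u - mat_scale D c v" for u v
    by (rule mm.scale_right_diff_distrib)
  show "br (mat_scale D c x) z = mat_scale D c (br x z)" "br z (mat_scale D c x) = mat_scale D c (br z x)"
    by (simp_all only: br_def sum_bit 1 mat_prod_scale 2 mm.scale_right_distrib)
qed

lemma br_part:
  assumes "x \<in> part G p" "y \<in> part G q"
  shows "br x y \<in> part G (p + q)"
proof -
  have e: "par i + par k + p + (par k + par j + q) = par i + par j + (p + q)"
    "par i + par k + q + (par k + par j + p) = par i + par j + (p + q)" for i j k
    by (cases "par i"; cases "par j"; cases "par k"; cases p; cases q; simp)+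
  have "x i k \<stileturn> y k j \<in> part D (par i + par j + (p + q))" for i j k
    using lprod_degree[of "x i k" "par i + par k + p" "y k j" "par k + par j + q"] assms
    by (auto simp: G_simps e)
  moreover have "y i k \<turnstile> x k j \<in> part D (par i + par j + (p + q))" for i j k
    using rprod_degree[of "y i k" "par i + par k + q" "x k j" "par k + par j + p"] assms
    by (auto simp: G_simps e)
  ultimately have "br x y i j \<in> part D (par i + par j + (p + q))" for i j
    unfolding br_hom_entry[OF assms] by (intro part_closed part_sum)
  moreover have "br x y i j = 0" if "i \<notin> I \<or> j \<notin> I" for i j
    using that assms unfolding br_hom_entry[OF assms]
    by (auto simp: G_simps mul_simps)
  ultimately show ?thesis
    by (simp add: G_simps)
qed

lemma cmpG_sum: "x \<in> supermodule.carrier G \<Longrightarrow> g.cmp 0 x + g.cmp 1 x = x"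
  by (rule g.component_sum_eq)

lemma part_carrier: "x \<in> part G p \<Longrightarrow> x \<in> supermodule.carrier G"
  using g.part_le by blast

lemma carrier_closed:
  "x \<in> supermodule.carrier G \<Longrightarrow> y \<in> supermodule.carrier G \<Longrightarrow> x + y \<in> supermodule.carrier G"
  "x \<in> supermodule.carrier G \<Longrightarrow> y \<in> supermodule.carrier G \<Longrightarrow> x - y \<in> supermodule.carrier G"
  "x \<in> supermodule.carrier G \<Longrightarrow> - x \<in> supermodule.carrier G"
  "x \<in> supermodule.carrier G \<Longrightarrow> mat_scale D c x \<in> supermodule.carrier G"
  "0 \<in> supermodule.carrier G"
  by (auto simp: G_simps mat_scale_def)

lemma br_carrier:
  assumes "x \<in> supermodule.carrier G" "y \<in> supermodule.carrier G"
  shows "br x y \<in> supermodule.carrier G"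
proof -
  have c: "g.cmp p u \<in> part G p" "g.cmp p u \<in> supermodule.carrier G" if "u \<in> supermodule.carrier G" for p u
    using that g.component_in g.component_in_carrier by auto
  have "br x y = br (g.cmp 0 x + g.cmp 1 x) (g.cmp 0 y + g.cmp 1 y)"
    using assms by (simp add: cmpG_sum)
  also have "\<dots> = br (g.cmp 0 x) (g.cmp 0 y) + br (g.cmp 1 x) (g.cmp 0 y) + (br (g.cmp 0 x) (g.cmp 1 y) + br (g.cmp 1 x) (g.cmp 1 y))"
    using c assms by (simp add: br_add carrier_closed)
  finally show ?thesis
    using c assms br_part part_carrier by (metis carrier_closed(1))
qed

lemma br_zero: "x \<in> supermodule.carrier G \<Longrightarrow> br x 0 = 0" "x \<in> supermodule.carrier G \<Longrightarrow> br 0 x = 0"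
  using br_add[of 0 0 x] carrier_closed by auto

lemma br_diff:
  assumes "x \<in> supermodule.carrier G" "y \<in> supermodule.carrier G" "z \<in> supermodule.carrier G"
  shows "br (x - y) z = br x z - br y z" "br z (x - y) = br z x - br z y"
  using br_add[of "x - y" y z] assms carrier_closed by (auto simp: algebra_simps)

lemma E_simps: "E i j (a + b) = E i j a + E i j b" "E i j (a - b) = E i j a - E i j b"
  "E i j (- a) = - E i j a" "E i j 0 = 0" "E i j (smult D c a) = mat_scale D c (E i j a)"
  by (auto simp: E_def fun_eq_iff mat_scale_def)

lemma E_carrier [simp]: "i \<in> I \<Longrightarrow> j \<in> I \<Longrightarrow> E i j a \<in> supermodule.carrier G"
  by (auto simp: G_simps E_def)

lemma E_part: "i \<in> I \<Longrightarrow> j \<in> I \<Longrightarrow> a \<in> part D p \<Longrightarrow> E i j a \<in> part G (par i + par j + p)"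
  by (auto simp: G_simps E_def ac_simps)

lemma mat_expand:
  assumes "x \<in> supermodule.carrier G"
  shows "x = (\<Sum>i\<in>I. \<Sum>j\<in>I. E i j (x i j))"
proof (intro ext)
  fix u v
  have s: "(\<Sum>i\<in>I. f i) u v = (\<Sum>i\<in>I. f i u v)" for f :: "nat \<Rightarrow> nat \<Rightarrow> nat \<Rightarrow> 'd"
    by (simp only: sum_apply)
  have "(\<Sum>i\<in>I. \<Sum>j\<in>I. E i j (x i j)) u v = (\<Sum>i\<in>I. \<Sum>j\<in>I. if i = u then if j = v then x u v else 0 else 0)"
    unfolding s E_def by (intro sum.cong refl) auto
  also have "\<dots> = (\<Sum>i\<in>I. if i = u then (\<Sum>j\<in>I. if j = v then x u v else 0) else 0)"
    by (intro sum.cong refl) auto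
  also have "\<dots> = (if u \<in> I then if v \<in> I then x u v else 0 else 0)"
    by (simp add: sum.delta)
  finally show "x u v = (\<Sum>i\<in>I. \<Sum>j\<in>I. E i j (x i j)) u v"
    using assms by (auto simp: G_simps)
qed

lemma br_E:
  assumes "i \<in> I" "j \<in> I" "k \<in> I" "l \<in> I" "a \<in> part D p" "b \<in> part D q"
  shows "br (E i j a) (E k l b) = (if j = k then E i l (a \<stileturn> b) else 0)
    - (if i = l then E k j (smult D (eps ((par i + par j + p) * (par k + par l + q))) (b \<turnstile> a)) else 0)"
proof (intro ext)
  fix u v
  have 1: "(\<Sum>w\<in>I. E i j a u w \<stileturn> E k l b w v) = (if j = k then E i l (a \<stileturn> b) else 0) u v"
  proof -
    have "(\<Sum>w\<in>I. E i j a u w \<stileturn> E k l b w v) = (\<Sum>w\<in>I. if w = j then E i j a u j \<stileturn> E k l b j v else 0)"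
      by (intro sum.cong refl) (auto simp: E_def mul_simps)
    then show ?thesis
      using assms by (auto simp: E_def mul_simps)
  qed
  have 2: "(\<Sum>w\<in>I. E k l b u w \<turnstile> E i j a w v) = (if i = l then E k j (b \<turnstile> a) else 0) u v"
  proof -
    have "(\<Sum>w\<in>I. E k l b u w \<turnstile> E i j a w v) = (\<Sum>w\<in>I. if w = l then E k l b u l \<turnstile> E i j a l v else 0)"
      by (intro sum.cong refl) (auto simp: E_def mul_simps)
    then show ?thesis
      using assms by (auto simp: E_def mul_simps)
  qed
  show "br (E i j a) (E k l b) u v = ((if j = k then E i l (a \<stileturn> b) else 0)
    - (if i = l then E k j (smult D (eps ((par i + par j + p) * (par k + par l + q))) (b \<turnstile> a)) else 0)) u v"
    unfolding br_hom_entry[OF E_part[OF assms(1,2,5)] E_part[OF assms(3,4,6)]] 1 2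
    by (auto simp: E_simps mat_scale_def)
qed

text \<open>For \<open>i \<noteq> l\<close> only the term without a sign can survive, hence the
  entries may be inhomogeneous.\<close>

lemma br_E_gen:
  assumes "i \<in> I" "j \<in> I" "k \<in> I" "l \<in> I" "i \<noteq> l"
  shows "br (E i j a) (E k l b) = (if j = k then E i l (a \<stileturn> b) else 0)"
proof -
  have "br (E i j a) (E k l b) = br (E i j (cmp 0 a) + E i j (cmp 1 a)) (E k l (cmp 0 b) + E k l (cmp 1 b))"
    by (simp add: E_simps[symmetric] cmp_sum_eq)
  also have "\<dots> = (if j = k then E i l ((cmp 0 a + cmp 1 a) \<stileturn> (cmp 0 b + cmp 1 b)) else 0)"
    using assms by (simp add: br_add carrier_closed br_E[OF assms(1-4) cmp_simps(3) cmp_simps(3)] E_simps mul_simps)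
  finally show ?thesis
    by (simp add: cmp_sum_eq)
qed

abbreviation "L \<equiv> sl m n D"

lemma L_simps:
  "supermodule.carrier L = g.md.span {br x y | x y. x \<in> supermodule.carrier G \<and> y \<in> supermodule.carrier G}"
  "smult L = mat_scale D" "part L p = part G p \<inter> supermodule.carrier L" "brac L = br"
  unfolding sl_def Let_def by (simp_all add: G_simps(2))

definition "homE = {E i j a | i j a p. i \<in> I \<and> j \<in> I \<and> i \<noteq> j \<and> a \<in> part D p}"
definition "homH = {br (E i j a) (E j i b) | i j a b p q. i \<in> I \<and> j \<in> I \<and> i \<noteq> j \<and> a \<in> part D p \<and> b \<in> part D q}"

lemma G_span: "supermodule.carrier G = g.md.span {E i j a | i j a p. i \<in> I \<and> j \<in> I \<and> a \<in> part D p}"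
proof (intro set_eqI iffI)
  fix x
  assume x: "x \<in> supermodule.carrier G"
  have "E i j (x i j) \<in> g.md.span {E i j a | i j a p. i \<in> I \<and> j \<in> I \<and> a \<in> part D p}"
    if "i \<in> I" "j \<in> I" for i j
  proof -
    have "E i j (x i j) = E i j (cmp 0 (x i j)) + E i j (cmp 1 (x i j))"
      by (simp add: E_simps[symmetric] cmp_sum_eq)
    also have "\<dots> \<in> g.md.span {E i j a | i j a p. i \<in> I \<and> j \<in> I \<and> a \<in> part D p}"
      using that cmp_simps(3) by (intro g.md.span_add g.md.span_base) blast+
    finally show ?thesis .
  qed
  then show "x \<in> g.md.span {E i j a | i j a p. i \<in> I \<and> j \<in> I \<and> a \<in> part D p}"
    by (subst mat_expand[OF x]) (intro g.md.span_sum)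
next
  fix x
  assume "x \<in> g.md.span {E i j a | i j a p. i \<in> I \<and> j \<in> I \<and> a \<in> part D p}"
  moreover have "{E i j a | i j a p. i \<in> I \<and> j \<in> I \<and> a \<in> part D p} \<subseteq> supermodule.carrier G"
    by auto
  ultimately show "x \<in> supermodule.carrier G"
    using g.md.span_minimal[OF _ g.carrier_sub] by blast
qed

lemma bilinear_span:
  assumes S: "g.md.subspace S" and x: "x \<in> g.md.span A" and y: "y \<in> g.md.span B"
    and AB: "A \<subseteq> supermodule.carrier G" "B \<subseteq> supermodule.carrier G"
    and br: "\<And>a b. a \<in> A \<Longrightarrow> b \<in> B \<Longrightarrow> br a b \<in> S"
  shows "br x y \<in> S"
proof -
  have c: "g.md.span A \<subseteq> supermodule.carrier G" "g.md.span B \<subseteq> supermodule.carrier G"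
    using AB g.md.span_minimal[OF _ g.carrier_sub] by auto
  have 1: "br a y \<in> S" if a: "a \<in> A" for a
  proof -
    have "br a y \<in> S \<and> y \<in> supermodule.carrier G"
      using y
    proof (induction y rule: g.md.span_induct_alt)
      case base
      have "br a 0 = 0"
        using a AB by (intro br_zero) auto
      then show ?case
        using g.md.subspace_0[OF S] carrier_closed(5) by (simp only:)
    next
      case (step r b y)
      have c: "b \<in> supermodule.carrier G" "a \<in> supermodule.carrier G" "y \<in> supermodule.carrier G"
        using step a AB by auto
      have "br a (smult G r b + y) = smult G r (br a b) + br a y"
        using c by (simp only: G_simps(2) br_add br_scale carrier_closed)
      then show ?case
        using step a br[of a b] g.md.subspace_add[OF S] g.md.subspace_scale[OF S] c
        by (simp only: G_simps(2) carrier_closed)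
    qed
    then show ?thesis ..
  qed
  have "br x y \<in> S \<and> x \<in> supermodule.carrier G"
    using x
  proof (induction x rule: g.md.span_induct_alt)
    case base
    have "br 0 y = 0"
      using y c by (intro br_zero) auto
    then show ?case
      using g.md.subspace_0[OF S] carrier_closed(5) by (simp only:)
  next
    case (step r a x)
    have c: "y \<in> supermodule.carrier G" "a \<in> supermodule.carrier G" "x \<in> supermodule.carrier G"
      using step y AB c by auto
    have "br (smult G r a + x) y = smult G r (br a y) + br x y"
      using c by (simp only: G_simps(2) br_add br_scale carrier_closed)
    then show ?case
      using step 1[of a] g.md.subspace_add[OF S] g.md.subspace_scale[OF S] c
      by (simp only: G_simps(2) carrier_closed)
  qed
  then show ?thesis ..
qed

text \<open>The diagonal factor carries \<open>a\<close> and stands on the left, so that only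
  \<open>a \<stileturn> \<one> = a\<close> enters.\<close>

lemma E_in_L:
  assumes "i \<in> I" "j \<in> I" "i \<noteq> j"
  shows "E i j a \<in> supermodule.carrier L"
proof -
  have "E i j a = br (E i i a) (E i j \<one>)"
    using br_E_gen[of i i i j a \<one>] assms by (simp add: barunit)
  then show ?thesis
    unfolding L_simps using assms
    by (intro g.md.span_base CollectI exI[of _ "E i i a"] exI[of _ "E i j \<one>"]) simp
qed

lemma br_in_L: "x \<in> supermodule.carrier G \<Longrightarrow> y \<in> supermodule.carrier G \<Longrightarrow> br x y \<in> supermodule.carrier L"
  unfolding L_simps by (rule g.md.span_base) blast

lemma L_sub: "g.md.subspace (supermodule.carrier L)"
  by (simp add: L_simps)

lemma L_le_G: "supermodule.carrier L \<subseteq> supermodule.carrier G"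
  unfolding L_simps by (rule g.md.span_minimal[OF _ g.carrier_sub]) (auto intro: br_carrier)

lemma homEH_L: "homE \<union> homH \<subseteq> supermodule.carrier L"
  by (auto simp: homE_def homH_def intro: E_in_L br_in_L)

text \<open>The only nonzero brackets of matrix units outside the two families are those of two
  entries at one diagonal position. They are differences of brackets through a second position
  \<open>v\<close>.\<close>

lemma L_span:
  assumes "m + n \<ge> 2"
  shows "supermodule.carrier L = g.md.span (homE \<union> homH)"
proof
  show "g.md.span (homE \<union> homH) \<subseteq> supermodule.carrier L"
    using homEH_L by (rule g.md.span_minimal) (simp add: L_simps)
  let ?S = "g.md.span (homE \<union> homH)"
  have E: "E i j a \<in> ?S" if "i \<in> I" "j \<in> I" "i \<noteq> j" for i j a
  proof -
    have "E i j (cmp p a) \<in> ?S" for p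
      unfolding homE_def using that cmp_simps(3) by (intro g.md.span_base UnI1) blast
    then have "E i j (cmp 0 a) + E i j (cmp 1 a) \<in> ?S"
      by (intro g.md.span_add)
    then show ?thesis
      by (simp add: E_simps[symmetric] cmp_sum_eq)
  qed
  have H: "br (E i j a) (E j i b) \<in> ?S" if "i \<in> I" "j \<in> I" "i \<noteq> j" "a \<in> part D p" "b \<in> part D q" for i j a b p q
    using that unfolding homH_def by (intro g.md.span_base UnI2) blast
  have "br (E i j a) (E k l b) \<in> ?S"
    if ijkl: "i \<in> I" "j \<in> I" "k \<in> I" "l \<in> I" and ab: "a \<in> part D p" "b \<in> part D q" for i j k l a b p q
  proof (cases "j = k \<and> i = l")
    case False
    then show ?thesis
      using False E ijkl
      by (auto simp: br_E[OF ijkl ab] intro!: g.md.span_zero g.md.span_neg)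
  next
    case True
    show ?thesis
    proof (cases "i = j")
      case False
      then show ?thesis
        using True H ijkl ab by auto
    next
      case i: True
      obtain v where v: "v \<in> I" "v \<noteq> i"
        using assms by (cases "i = 1") (auto simp: I_def intro: that[of 1] that[of 2])
      have ba: "b \<turnstile> a \<in> part D (q + p)"
        by (rule rprod_degree[OF ab(2,1)])
      have sgn: "eps ((par i + par v + p) * (par v + par i + q)) = eps (p * q) * (eps ((par i + par v + (q + p)) * (par v + par i + 0)) :: 'r)"
        by (cases "par i"; cases "par v"; cases p; cases q) simp_all
      \<comment> \<open>The entries \<open>b \<turnstile> a\<close> at \<open>(v, v)\<close> cancel,
        and at \<open>(i, i)\<close> the second bracket supplies the missing term
        \<open>b \<turnstile> a\<close>, as \<open>\<one>\<close> is its right factor.\<close>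
      have "br (E i i a) (E i i b) = br (E i v a) (E v i b) - mat_scale D (eps (p * q)) (br (E i v (b \<turnstile> a)) (E v i \<one>))"
        unfolding br_E[OF ijkl(1) ijkl(1) ijkl(1) ijkl(1) ab] br_E[OF ijkl(1) v(1) v(1) ijkl(1) ab]
          br_E[OF ijkl(1) v(1) v(1) ijkl(1) ba barunit_even] sgn
        using v by (simp add: E_simps barunit g.md.scale_right_diff_distrib[unfolded G_simps]
            g.md.scale_scale[unfolded G_simps])
      also have "\<dots> \<in> ?S"
        using H[OF ijkl(1) v(1) _ ab] g.md.span_scale[OF H[OF ijkl(1) v(1) _ ba barunit_even], of "eps (p * q)"] v
        by (intro g.md.span_diff) (simp_all only: G_simps(2) not_sym simp_thms)
      finally have S: "br (E i i a) (E i i b) \<in> ?S" .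
      have "j = i" "k = i" "l = i"
        using True i by auto
      then show ?thesis
        using S by (simp only:)
    qed
  qed
  then have base: "br u v \<in> ?S"
    if "u \<in> {E i j a | i j a p. i \<in> I \<and> j \<in> I \<and> a \<in> part D p}"
      "v \<in> {E i j a | i j a p. i \<in> I \<and> j \<in> I \<and> a \<in> part D p}" for u v
    using that by blast
  have E_G: "{E i j a | i j a p. i \<in> I \<and> j \<in> I \<and> a \<in> part D p} \<subseteq> supermodule.carrier G"
    by auto
  have "br x y \<in> ?S" if "x \<in> supermodule.carrier G" "y \<in> supermodule.carrier G" for x y
    by (rule bilinear_span[OF g.md.subspace_span that[THEN equalityD1[OF G_span, THEN subsetD]] E_G E_G base])
  then show "supermodule.carrier L \<subseteq> ?S"
    unfolding L_simps by (intro g.md.span_minimal g.md.subspace_span) blast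
qed

text \<open>\<open>L\<close> is a graded submodule because a bracket is the sum of the brackets of
  components, each of which is homogeneous.\<close>

lemma g_cmp_L:
  assumes "x \<in> supermodule.carrier L"
  shows "g.cmp p x \<in> supermodule.carrier L"
proof -
  have "g.cmp p (br x y) \<in> supermodule.carrier L" if xy: "x \<in> supermodule.carrier G" "y \<in> supermodule.carrier G" for x y
  proof -
    have c: "g.cmp q u \<in> part G q" "g.cmp q u \<in> supermodule.carrier G" if "u \<in> supermodule.carrier G" for q u
      using that g.component_in g.component_in_carrier by auto
    have 1: "g.cmp p (br (g.cmp q x) (g.cmp r y)) \<in> supermodule.carrier L" for q r
      using br_part[OF c(1)[OF xy(1)] c(1)[OF xy(2)], of q r] br_in_L[OF c(2)[OF xy(1)] c(2)[OF xy(2)]]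
        g.md.subspace_0[OF L_sub] by (simp add: g_cmp_hom)
    have "br x y = br (g.cmp 0 x + g.cmp 1 x) (g.cmp 0 y + g.cmp 1 y)"
      using xy by (simp add: cmpG_sum)
    also have "\<dots> = br (g.cmp 0 x) (g.cmp 0 y) + br (g.cmp 1 x) (g.cmp 0 y) + (br (g.cmp 0 x) (g.cmp 1 y) + br (g.cmp 1 x) (g.cmp 1 y))"
      using c xy by (simp add: br_add carrier_closed)
    finally show ?thesis
      using 1 c xy g.md.subspace_add[OF L_sub] by (simp add: g.component_add br_carrier carrier_closed)
  qed
  moreover have "supermodule.carrier L \<subseteq> {x \<in> supermodule.carrier G. g.cmp p x \<in> supermodule.carrier L}"
  proof (subst L_simps, rule g.md.span_minimal)
    show "{br x y |x y. x \<in> supermodule.carrier G \<and> y \<in> supermodule.carrier G} \<subseteq>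
        {x \<in> supermodule.carrier G. g.cmp p x \<in> supermodule.carrier L}"
      using calculation br_carrier by auto
    show "g.md.subspace {x \<in> supermodule.carrier G. g.cmp p x \<in> supermodule.carrier L}"
      using g.md.subspace_0[OF L_sub] g.md.subspace_add[OF L_sub] g.md.subspace_scale[OF L_sub]
        g.md.subspace_0[OF g.carrier_sub] g.md.subspace_add[OF g.carrier_sub] g.md.subspace_scale[OF g.carrier_sub]
        g.component_same[OF g.md.subspace_0[OF g.part_sub]]
      by (intro g.md.subspaceI) (auto simp: g.component_add g.component_scale)
  qed
  ultimately show ?thesis
    using assms by blast
qed

sublocale l: smod L
proof (rule smod.intro)
  show "module (smult L)"
    by (simp add: L_simps module_mat)
  show "module.subspace (smult L) (supermodule.carrier L)"
    using L_sub by (simp add: L_simps(2) G_simps(2))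
  show "module.subspace (smult L) (part L p)" for p
    using g.md.subspace_inter[OF g.part_sub L_sub] by (simp add: L_simps(2,3) G_simps(2))
  show "part L p \<subseteq> supermodule.carrier L" for p
    by (simp add: L_simps(3))
  show "\<exists>y\<in>part L 0. \<exists>z\<in>part L 1. x = y + z" if "x \<in> supermodule.carrier L" for x
  proof (intro bexI)
    show "x = g.cmp 0 x + g.cmp 1 x"
      using that L_le_G by (simp add: cmpG_sum subset_iff)
    show "g.cmp 0 x \<in> part L 0" "g.cmp 1 x \<in> part L 1"
      using g_cmp_L[OF that] g.component_in L_le_G that by (auto simp: L_simps(3))
  qed
  show "x = 0" if "x \<in> part L 0" "x \<in> part L 1" for x
    using that g.indep by (auto simp: L_simps(3))
qed

end

section \<open>Leibniz homology of the special linear algebra\<close>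

context sl_algebra
begin

lemma mat_prod_assoc:
  "mat_lprod m n D (mat_lprod m n D x y) z = mat_lprod m n D x (mat_lprod m n D y z)"
  "mat_rprod m n D (mat_rprod m n D x y) z = mat_rprod m n D x (mat_rprod m n D y z)"
  "mat_lprod m n D x (mat_rprod m n D y z) = mat_lprod m n D x (mat_lprod m n D y z)"
  "mat_lprod m n D (mat_rprod m n D x y) z = mat_rprod m n D x (mat_lprod m n D y z)"
  "mat_rprod m n D (mat_lprod m n D x y) z = mat_rprod m n D x (mat_rprod m n D y z)"
proof -
  have sw: "(\<Sum>k\<in>A. \<Sum>l\<in>A. f k l) = (\<Sum>l\<in>A. \<Sum>k\<in>A. f k l)" for A :: "nat set" and f :: "nat \<Rightarrow> nat \<Rightarrow> 'd"
    by (rule sum.swap)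
  show "mat_lprod m n D (mat_lprod m n D x y) z = mat_lprod m n D x (mat_lprod m n D y z)"
    unfolding mat_lprod_def lmul_sum lprod_assoc by (intro ext) (rule sw)
  show "mat_rprod m n D (mat_rprod m n D x y) z = mat_rprod m n D x (mat_rprod m n D y z)"
    unfolding mat_rprod_def rmul_sum rprod_assoc by (intro ext) (rule sw)
  show "mat_lprod m n D x (mat_rprod m n D y z) = mat_lprod m n D x (mat_lprod m n D y z)"
    unfolding mat_rprod_def mat_lprod_def lmul_sum dialgebra(1) ..
  show "mat_lprod m n D (mat_rprod m n D x y) z = mat_rprod m n D x (mat_lprod m n D y z)"
    unfolding mat_rprod_def mat_lprod_def lmul_sum rmul_sum dialgebra(2) by (intro ext) (rule sw)
  show "mat_rprod m n D (mat_lprod m n D x y) z = mat_rprod m n D x (mat_rprod m n D y z)"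
    unfolding mat_rprod_def mat_lprod_def lmul_sum rmul_sum dialgebra(3) rprod_assoc by (intro ext) (rule sw)
qed

lemma mat_prod_diff:
  "mat_lprod m n D (x - x') y = mat_lprod m n D x y - mat_lprod m n D x' y"
  "mat_lprod m n D x (y - y') = mat_lprod m n D x y - mat_lprod m n D x y'"
  "mat_rprod m n D (x - x') y = mat_rprod m n D x y - mat_rprod m n D x' y"
  "mat_rprod m n D x (y - y') = mat_rprod m n D x y - mat_rprod m n D x y'"
  by (simp_all add: mat_lprod_def mat_rprod_def mul_simps fun_eq_iff sum_subtractf)

text \<open>Matrices inherit the dialgebra identities, so this is the usual passage from a dialgebra
  to a Leibniz algebra, with signs.\<close>

lemma leibniz_identity:
  assumes "x \<in> part G p" "y \<in> part G q" "z \<in> part G r"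
  shows "br x (br y z) = br (br x y) z - mat_scale D (eps (q * r)) (br (br x z) y)"
proof -
  interpret mm: module "mat_scale D" by (rule module_mat)
  have sgn: "eps (p * (q + r)) = (eps (p * q) * eps (p * r) :: 'r)" "eps ((p + q) * r) = (eps (p * r) * eps (q * r) :: 'r)"
    "eps ((p + r) * q) = (eps (p * q) * eps (q * r) :: 'r)"
    by (cases p; cases q; cases r; simp)+
  have sq: "eps s * (eps s * c) = (c :: 'r)" for s c
    by (cases s) simp_all
  show ?thesis
    unfolding br_hom[OF assms(1) br_part[OF assms(2,3)]] br_hom[OF br_part[OF assms(1,2)] assms(3)]
      br_hom[OF br_part[OF assms(1,3)] assms(2)]
    unfolding br_hom[OF assms(1,2)] br_hom[OF assms(2,3)] br_hom[OF assms(1,3)]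
    by (simp add: mat_prod_diff mat_prod_scale(1-4) mat_prod_assoc mm.scale_right_diff_distrib sgn)
      (simp add: sq ac_simps)
qed

definition brl :: "(nat \<Rightarrow> nat \<Rightarrow> 'd) list \<Rightarrow> nat \<Rightarrow> nat \<Rightarrow> 'd" where
  "brl xs = br (xs ! 0) (xs ! 1)"

definition d3 :: "bit list \<Rightarrow> (nat \<Rightarrow> nat \<Rightarrow> 'd) list \<Rightarrow> (nat \<Rightarrow> nat \<Rightarrow> 'd) list \<Rightarrow>\<^sub>0 'r" where
  "d3 ds xs = gen [xs ! 0, br (xs ! 1) (xs ! 2)] - gen [br (xs ! 0) (xs ! 1), xs ! 2]
     + fscale (eps (ds ! 1 * ds ! 2)) (gen [br (xs ! 0) (xs ! 2), xs ! 1])"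

definition "KL = {u \<in> l.FL 2. lin (mat_scale D) brl u = 0}"
definition "BL = fs.span (l.Rel 2 \<union> l.hom_image 3 d3)"
definition "clL x = (x +o l.Rel 2) +o ((\<lambda>x. x +o l.Rel 2) ` BL)"

lemma L_G: "x \<in> supermodule.carrier L \<Longrightarrow> x \<in> supermodule.carrier G"
  using L_le_G by blast

lemma L_closed:
  "x \<in> supermodule.carrier L \<Longrightarrow> y \<in> supermodule.carrier L \<Longrightarrow> x + y \<in> supermodule.carrier L"
  "x \<in> supermodule.carrier L \<Longrightarrow> y \<in> supermodule.carrier L \<Longrightarrow> x - y \<in> supermodule.carrier L"
  "x \<in> supermodule.carrier L \<Longrightarrow> - x \<in> supermodule.carrier L"
  "x \<in> supermodule.carrier L \<Longrightarrow> mat_scale D c x \<in> supermodule.carrier L"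
  "0 \<in> supermodule.carrier L"
  "x \<in> supermodule.carrier L \<Longrightarrow> y \<in> supermodule.carrier L \<Longrightarrow> br x y \<in> supermodule.carrier L"
  using g.md.subspace_add[OF L_sub] g.md.subspace_diff[OF L_sub] g.md.subspace_neg[OF L_sub]
    g.md.subspace_scale[OF L_sub] g.md.subspace_0[OF L_sub] br_in_L L_G by (auto simp: G_simps(2))

lemma RelL2_add:
  assumes "x \<in> supermodule.carrier L" "y \<in> supermodule.carrier L" "z \<in> supermodule.carrier L"
  shows "gen [x + y, z] - gen [x, z] - gen [y, z] \<in> l.Rel 2" "gen [z, x + y] - gen [z, x] - gen [z, y] \<in> l.Rel 2"
  using l.Rel_add[of "[]" x "[z]" 2 y] l.Rel_add[of "[z]" x "[]" 2 y] assms by (simp_all add: tlists_def)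

lemma RelL2_scale:
  assumes "x \<in> supermodule.carrier L" "z \<in> supermodule.carrier L"
  shows "gen [mat_scale D c x, z] - fscale c (gen [x, z]) \<in> l.Rel 2"
    "gen [z, mat_scale D c x] - fscale c (gen [z, x]) \<in> l.Rel 2"
  using l.Rel_scale[of "[]" x "[z]" 2 c] l.Rel_scale[of "[z]" x "[]" 2 c] assms by (simp_all add: tlists_def L_simps(2))

lemma mlin_d3: "l.mlin 3 fscale (l.Rel 2) (d3 ds)"
  unfolding d3_def
  by (intro l.mlin_combine l.mlin_scale module_fscale l.Rel_sub l.mlin_lists3I)
    (simp_all only: L_simps(2) nth_Cons_0 nth_Cons_numeral numeral_2_eq_2 numeral_1_eq_Suc_0 nth_Cons_Suc One_nat_def
        br_add br_scale L_G L_closed RelL2_add[unfolded numeral_2_eq_2] RelL2_scale[unfolded numeral_2_eq_2])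

lemma mlin_brl: "l.mlin 2 (mat_scale D) {0} brl"
  by (rule l.mlin_lists2I) (simp_all add: brl_def br_add br_scale L_G L_simps(2))

lemma delta3_image: "delta3 L ` supermodule.carrier (tensor L 3) = (\<lambda>x. x +o l.Rel 2) ` BL"
  unfolding delta3_def BL_def Let_def
proof (rule l.hlift_image[OF mlin_d3])
  fix ds :: "bit list" and xs
  assume "length ds = 3" "xs \<in> tlists L 3"
  then obtain p q r x y z where e: "ds = [p, q, r]" "xs = [x, y, z]"
    by (auto simp: tlists_def numeral_3_eq_3 length_Suc_conv)
  show "smult (tensor L 2) (- 1) (tens L [brac L (xs ! 0) (xs ! 1), xs ! 2]) + tens L [xs ! 0, brac L (xs ! 1) (xs ! 2)] +
      smult (tensor L 2) (eps (ds ! 1 * ds ! 2)) (tens L [brac L (xs ! 0) (xs ! 2), xs ! 1]) = d3 ds xs +o l.Rel 2"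
    using l.smult_tens[of 2]
    by (simp add: e tens_def d3_def L_simps(4) numeral_2_eq_2 fs.coset_add[OF l.Rel_sub])
qed

lemma ker_delta2: "ker (tensor L 2) L (delta2 L) = (\<lambda>x. x +o l.Rel 2) ` KL"
proof -
  have "delta2 L (p +o l.Rel 2) = lin (mat_scale D) brl p" if "p \<in> l.FL 2" for p
    using l.tlift_self[OF _ that, of brl] mlin_brl unfolding delta2_def L_simps brl_def by simp
  then show ?thesis
    unfolding ker_def KL_def l.tensor_simps l.mzero_self by auto
qed

lemma KL_sub: "fs.subspace KL"
proof -
  have e: "KL = l.FL 2 \<inter> {q. lin (mat_scale D) brl q \<in> {0}}"
    by (auto simp: KL_def)
  show ?thesis
    unfolding e
    by (rule fs.subspace_inter[OF l.FL_sub subspace_lin_vimage[OF module_mat module.subspace_single_0[OF module_mat]]])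
qed

lemma BL_sub: "fs.subspace BL"
  by (simp add: BL_def)

lemma Rel_BL: "l.Rel 2 \<subseteq> BL"
  by (auto simp: BL_def intro: fs.span_base)

lemma genL_FL: "x \<in> supermodule.carrier L \<Longrightarrow> y \<in> supermodule.carrier L \<Longrightarrow> gen [x, y] \<in> l.FL 2"
  by (rule l.gen_FL) (simp add: tlists_def)

lemma L_part: "x \<in> part L p \<longleftrightarrow> x \<in> part G p \<and> x \<in> supermodule.carrier L"
  by (simp add: L_simps(3))

lemma hom_image_d3: "u \<in> l.hom_image 3 d3 \<longleftrightarrow>
  (\<exists>p q r. \<exists>x\<in>part L p. \<exists>y\<in>part L q. \<exists>z\<in>part L r. u = d3 [p, q, r] [x, y, z])"
proof
  assume "u \<in> l.hom_image 3 d3"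
  then obtain ds xs where u: "u = d3 ds xs" "length ds = 3" "xs \<in> tlists L 3" and h: "list_all2 (\<lambda>x p. x \<in> part L p) xs ds"
    unfolding l.hom_image_def by blast
  then obtain p q r x y z where e: "ds = [p, q, r]" "xs = [x, y, z]"
    by (auto simp: tlists_def numeral_3_eq_3 length_Suc_conv)
  then show "\<exists>p q r. \<exists>x\<in>part L p. \<exists>y\<in>part L q. \<exists>z\<in>part L r. u = d3 [p, q, r] [x, y, z]"
  proof -
    have "x \<in> part L p" "y \<in> part L q" "z \<in> part L r" "u = d3 [p, q, r] [x, y, z]"
      using u h e by auto
    then show ?thesis
      by blast
  qed
next
  assume "\<exists>p q r. \<exists>x\<in>part L p. \<exists>y\<in>part L q. \<exists>z\<in>part L r. u = d3 [p, q, r] [x, y, z]"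
  then obtain p q r x y z where e: "x \<in> part L p" "y \<in> part L q" "z \<in> part L r" "u = d3 [p, q, r] [x, y, z]"
    by blast
  then show "u \<in> l.hom_image 3 d3"
    unfolding l.hom_image_def
    by (intro CollectI exI[of _ "[p, q, r]"] exI[of _ "[x, y, z]"]) (auto simp: tlists_def L_part)
qed

lemma BL_KL: "BL \<subseteq> KL"
proof -
  interpret h: module_hom fscale "mat_scale D" "lin (mat_scale D) brl"
    by (rule module_hom_lin[OF module_mat])
  have "u \<in> KL" if u: "u \<in> l.hom_image 3 d3" for u
  proof -
    obtain p q r x y z where e: "x \<in> part L p" "y \<in> part L q" "z \<in> part L r" "u = d3 [p, q, r] [x, y, z]"
      using u unfolding hom_image_d3 by blast
    have "lin (mat_scale D) brl u = 0"
      using leibniz_identity[of x p y q z r] e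
      by (simp add: d3_def h.add h.diff h.scale module_mat brl_def L_part)
    moreover have "u \<in> l.FL 2"
      using e
      by (simp add: d3_def fs.subspace_add[OF l.FL_sub] fs.subspace_diff[OF l.FL_sub] fs.subspace_scale[OF l.FL_sub]
          genL_FL L_part L_closed)
    ultimately show ?thesis
      by (simp add: KL_def)
  qed
  moreover have "u \<in> KL" if "u \<in> l.Rel 2" for u
    using that l.Rel_FL[of 2] l.lin_Rel[OF module_mat module.subspace_single_0[OF module_mat] mlin_brl that]
    by (auto simp: KL_def)
  ultimately show ?thesis
    unfolding BL_def by (intro fs.span_minimal[OF _ KL_sub]) blast
qed

lemma presents_HL2: "presents (HL2 L) fscale KL BL (\<lambda>p. part (free_lists L 2) p \<inter> KL) clL"
proof -
  let ?cl = "\<lambda>x. x +o l.Rel 2"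
  have "HL2 L = quot (restr (quot (free_lists L 2) (l.Rel 2)) (?cl ` KL)) (?cl ` BL)"
    unfolding HL2_def ker_delta2 delta3_image by (simp add: tensor_def)
  moreover have "supermodule.carrier (free_lists L 2) = l.FL 2" "smult (free_lists L 2) = fscale" "KL \<subseteq> l.FL 2"
    by (auto simp: free_lists_def KL_def)
  moreover have "part (free_lists L 2) p \<subseteq> l.FL 2" for p
    unfolding l.FL_span by (auto simp: free_lists_def intro: fs.span_mono[THEN subsetD, rotated])
  ultimately show ?thesis
    using presents_quot_quot[OF module_fscale _ refl l.FL_sub _ l.Rel_sub KL_sub BL_sub Rel_BL BL_KL]
    by (simp add: clL_def[abs_def])
qed

section \<open>Congruence modulo the Leibniz boundaries\<close>

abbreviation pr :: "(nat \<Rightarrow> nat \<Rightarrow> 'd) \<Rightarrow> (nat \<Rightarrow> nat \<Rightarrow> 'd) \<Rightarrow> (nat \<Rightarrow> nat \<Rightarrow> 'd) list \<Rightarrow>\<^sub>0 'r" where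
  "pr x y \<equiv> gen [x, y]"

definition eqB (infix "\<approx>" 50) where "u \<approx> v \<longleftrightarrow> u - v \<in> BL"

lemma eqB_refl [simp]: "u \<approx> u"
  by (simp add: eqB_def fs.subspace_0[OF BL_sub])

lemma eqB_sym: "u \<approx> v \<Longrightarrow> v \<approx> u"
  using fs.subspace_neg[OF BL_sub] by (fastforce simp: eqB_def)

lemma eqB_trans [trans]: "u \<approx> v \<Longrightarrow> v \<approx> w \<Longrightarrow> u \<approx> w"
  unfolding eqB_def using fs.subspace_add[OF BL_sub, of "u - v" "v - w"] by simp

lemma eqB_trans_eq [trans]: "u = v \<Longrightarrow> v \<approx> w \<Longrightarrow> u \<approx> w" "u \<approx> v \<Longrightarrow> v = w \<Longrightarrow> u \<approx> w"
  by simp_all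

lemma eqB_add: "u \<approx> v \<Longrightarrow> u' \<approx> v' \<Longrightarrow> u + u' \<approx> v + v'"
  unfolding eqB_def using fs.subspace_add[OF BL_sub, of "u - v" "u' - v'"] by (simp add: algebra_simps)

lemma eqB_diff: "u \<approx> v \<Longrightarrow> u' \<approx> v' \<Longrightarrow> u - u' \<approx> v - v'"
  unfolding eqB_def using fs.subspace_diff[OF BL_sub, of "u - v" "u' - v'"] by (simp add: algebra_simps)

lemma eqB_neg: "u \<approx> v \<Longrightarrow> - u \<approx> - v"
  using eqB_diff[of 0 0 u v] by simp

lemma eqB_scale: "u \<approx> v \<Longrightarrow> fscale c u \<approx> fscale c v"
  unfolding eqB_def using fs.subspace_scale[OF BL_sub, of "u - v" c] by (simp add: fs.scale_right_diff_distrib)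

lemma eqB_sum: "(\<And>k. k \<in> A \<Longrightarrow> f k \<approx> h k) \<Longrightarrow> sum f A \<approx> sum h A"
  unfolding eqB_def by (simp add: sum_subtractf[symmetric] fs.subspace_sum[OF BL_sub])

lemma eqB_0: "u \<approx> 0 \<longleftrightarrow> u \<in> BL"
  by (simp add: eqB_def)

lemma pr_lin:
  assumes "x \<in> supermodule.carrier L" "y \<in> supermodule.carrier L" "z \<in> supermodule.carrier L"
  shows "pr (x + y) z \<approx> pr x z + pr y z" "pr z (x + y) \<approx> pr z x + pr z y"
    "pr (x - y) z \<approx> pr x z - pr y z" "pr z (x - y) \<approx> pr z x - pr z y"
    "pr (mat_scale D c x) z \<approx> fscale c (pr x z)" "pr z (mat_scale D c x) \<approx> fscale c (pr z x)"
    "pr (- x) z \<approx> - pr x z" "pr z (- x) \<approx> - pr z x"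
    "pr 0 z \<approx> 0" "pr z 0 \<approx> 0"
proof -
  have a: "pr (x + y) z \<approx> pr x z + pr y z" "pr z (x + y) \<approx> pr z x + pr z y"
    if "x \<in> supermodule.carrier L" "y \<in> supermodule.carrier L" "z \<in> supermodule.carrier L" for x y z
    using RelL2_add[OF that] Rel_BL by (auto simp: eqB_def algebra_simps)
  show "pr (x + y) z \<approx> pr x z + pr y z" "pr z (x + y) \<approx> pr z x + pr z y"
    using a assms by auto
  show "pr (mat_scale D c x) z \<approx> fscale c (pr x z)" "pr z (mat_scale D c x) \<approx> fscale c (pr z x)"
    using RelL2_scale[OF assms(1,3)] Rel_BL by (auto simp: eqB_def)
  have d: "pr (x - y) z \<approx> pr x z - pr y z" "pr z (x - y) \<approx> pr z x - pr z y"
    if "x \<in> supermodule.carrier L" "y \<in> supermodule.carrier L" "z \<in> supermodule.carrier L" for x y z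
  proof -
    have "pr ((x - y) + y) z \<approx> pr (x - y) z + pr y z" "pr z ((x - y) + y) \<approx> pr z (x - y) + pr z y"
      using that by (intro a L_closed; simp)+
    from this[THEN eqB_diff[OF _ eqB_refl]]
    have "pr ((x - y) + y) z - pr y z \<approx> (pr (x - y) z + pr y z) - pr y z"
      "pr z ((x - y) + y) - pr z y \<approx> (pr z (x - y) + pr z y) - pr z y"
      by blast+
    then show "pr (x - y) z \<approx> pr x z - pr y z" "pr z (x - y) \<approx> pr z x - pr z y"
      by (simp_all add: eqB_sym)
  qed
  show "pr (x - y) z \<approx> pr x z - pr y z" "pr z (x - y) \<approx> pr z x - pr z y"
    using d assms by auto
  show z: "pr 0 z \<approx> 0" "pr z 0 \<approx> 0"
    using d[of 0 0 z] assms L_closed(5) by auto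
  show "pr (- x) z \<approx> - pr x z" "pr z (- x) \<approx> - pr z x"
    using eqB_trans[OF d(1)[of 0 x z] eqB_diff[OF z(1) eqB_refl]]
      eqB_trans[OF d(2)[of 0 x z] eqB_diff[OF z(2) eqB_refl]] assms L_closed(5) by simp_all
qed

lemmas pr_add = pr_lin(1,2)
lemmas pr_diff = pr_lin(3,4)

lemma pr_scale:
  assumes "x \<in> supermodule.carrier L" "z \<in> supermodule.carrier L"
  shows "pr (mat_scale D c x) z \<approx> fscale c (pr x z)" "pr z (mat_scale D c x) \<approx> fscale c (pr z x)"
  using pr_lin(5,6)[OF assms(1,1,2)] by auto

lemma pr_neg:
  assumes "x \<in> supermodule.carrier L" "z \<in> supermodule.carrier L"
  shows "pr (- x) z \<approx> - pr x z" "pr z (- x) \<approx> - pr z x"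
  using pr_lin(7,8)[OF assms(1,1,2)] by auto

lemma pr_zero:
  assumes "z \<in> supermodule.carrier L"
  shows "pr 0 z \<approx> 0" "pr z 0 \<approx> 0"
  using pr_lin(9,10)[OF assms assms assms] by auto

text \<open>The one relation from which all others are derived. Its sign involves the degrees of
  \<open>y\<close> and \<open>z\<close> only, so \<open>x\<close> may be inhomogeneous: the
  relations for its two components are added.\<close>

lemma leib:
  assumes "x \<in> supermodule.carrier L" "y \<in> part L p" "z \<in> part L q"
  shows "pr x (br y z) \<approx> pr (br x y) z - fscale (eps (p * q)) (pr (br x z) y)"
proof -
  have yz: "y \<in> supermodule.carrier L" "z \<in> supermodule.carrier L"
    using assms by (auto simp: L_part)
  have 1: "pr x (br y z) \<approx> pr (br x y) z - fscale (eps (p * q)) (pr (br x z) y)" if "x \<in> part L r" for x r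
  proof -
    have "d3 [r, p, q] [x, y, z] \<in> BL"
      unfolding BL_def by (rule fs.span_base, rule UnI2, unfold hom_image_d3) (use that assms in blast)
    then show ?thesis
      by (simp add: eqB_def d3_def algebra_simps)
  qed
  have c: "l.cmp r x \<in> part L r" "l.cmp r x \<in> supermodule.carrier L" for r
    using l.component_in l.component_in_carrier assms by auto
  have x: "x = l.cmp 0 x + l.cmp 1 x"
    using l.component_sum_eq[OF assms(1)] by simp
  have "pr (l.cmp 0 x + l.cmp 1 x) (br y z) \<approx> pr (l.cmp 0 x) (br y z) + pr (l.cmp 1 x) (br y z)"
    by (intro pr_add c L_closed yz)
  also have "\<dots> \<approx> (pr (br (l.cmp 0 x) y) z - fscale (eps (p * q)) (pr (br (l.cmp 0 x) z) y))
      + (pr (br (l.cmp 1 x) y) z - fscale (eps (p * q)) (pr (br (l.cmp 1 x) z) y))"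
    by (intro eqB_add 1[OF c(1)])
  also have "\<dots> = (pr (br (l.cmp 0 x) y) z + pr (br (l.cmp 1 x) y) z)
      - fscale (eps (p * q)) (pr (br (l.cmp 0 x) z) y + pr (br (l.cmp 1 x) z) y)"
    by (simp add: fs.scale_right_distrib algebra_simps)
  also have "\<dots> \<approx> pr (br (l.cmp 0 x) y + br (l.cmp 1 x) y) z
      - fscale (eps (p * q)) (pr (br (l.cmp 0 x) z + br (l.cmp 1 x) z) y)"
    by (intro eqB_diff eqB_scale pr_add[THEN eqB_sym] c L_closed yz)
  also have "\<dots> = pr (br x y) z - fscale (eps (p * q)) (pr (br x z) y)"
    using br_add[of "l.cmp 0 x" "l.cmp 1 x"] c L_G yz x by simp
  finally show ?thesis
    using x by simp
qed

end

section \<open>Weights\<close>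

locale sl3_algebra = sl_algebra D m n
  for D :: "('r::comm_ring_1, 'd::ab_group_add) superdialgebra" (structure) and m n :: nat +
  assumes N3: "m + n \<ge> 3"
begin

lemma eqB_move: "fscale c u \<approx> P - fscale d u \<Longrightarrow> fscale (d + c) u \<approx> P"
  by (simp add: eqB_def fs.scale_left_distrib algebra_simps)

lemma scale_nested: "fscale s (u - fscale c (- fscale d v)) = fscale s u + fscale (s * (c * d)) v"
  by (simp add: fs.scale_right_diff_distrib fs.scale_right_distrib)

lemma exists_third: "\<exists>k\<in>I. k \<noteq> i \<and> k \<noteq> j"
proof -
  have "1 \<in> I" "2 \<in> I" "3 \<in> I"
    using N3 by (auto simp: I_def)
  moreover have "(1 \<noteq> i \<and> 1 \<noteq> j) \<or> (2 \<noteq> i \<and> 2 \<noteq> j) \<or> (3 \<noteq> i \<and> 3 \<noteq> j)"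
    by auto
  ultimately show ?thesis
    by blast
qed

text \<open>An auxiliary index fixed once and for all, since the section \<open>thc\<close> below
  has to be built with the same Cartan element that appears in \<open>root1\<close> and
  \<open>root2\<close>.\<close>

definition "third i j = (SOME k. k \<in> I \<and> k \<noteq> i \<and> k \<noteq> j)"

lemma third: "third i j \<in> I" "third i j \<noteq> i" "third i j \<noteq> j"
  using someI_ex[of "\<lambda>k. k \<in> I \<and> k \<noteq> i \<and> k \<noteq> j"] exists_third unfolding third_def by blast+

lemma E_L [simp]: "i \<in> I \<Longrightarrow> j \<in> I \<Longrightarrow> i \<noteq> j \<Longrightarrow> E i j a \<in> supermodule.carrier L"
  by (rule E_in_L)

lemma E_partL: "i \<in> I \<Longrightarrow> j \<in> I \<Longrightarrow> i \<noteq> j \<Longrightarrow> a \<in> part D p \<Longrightarrow> E i j a \<in> part L (par i + par j + p)"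
  by (simp add: L_part E_part)

text \<open>A Cartan element of supertrace zero; the sign is the one that a bracket of two matrix
  units puts in front of \<open>E v v\<close>.\<close>

definition "hh u v = E u u \<one> - mat_scale D (eps (par u + par v)) (E v v \<one>)"

lemma hh_br: "u \<in> I \<Longrightarrow> v \<in> I \<Longrightarrow> u \<noteq> v \<Longrightarrow> hh u v = br (E u v \<one>) (E v u \<one>)"
  by (simp add: hh_def br_E[OF _ _ _ _ barunit_even barunit_even] barunit E_simps)
    (cases "par u"; cases "par v"; simp)

lemma hh_partL:
  assumes "u \<in> I" "v \<in> I" "u \<noteq> v"
  shows "hh u v \<in> part L 0"
proof -
  have "br (E u v \<one>) (E v u \<one>) \<in> part G ((par u + par v + 0) + (par v + par u + 0))"
    by (intro br_part E_part assms barunit_even)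
  then show ?thesis
    using assms by (simp add: L_part hh_br L_closed add.commute)
qed

lemma hh_L [simp]: "u \<in> I \<Longrightarrow> v \<in> I \<Longrightarrow> u \<noteq> v \<Longrightarrow> hh u v \<in> supermodule.carrier L"
  using hh_partL by (auto simp: L_part)

text \<open>The coefficient of \<open>E i i \<one>\<close> in \<open>hh u v\<close>.\<close>

definition wt :: "nat \<Rightarrow> nat \<Rightarrow> nat \<Rightarrow> 'r" where
  "wt u v i = (if i = u then 1 else if i = v then - eps (par u + par v) else 0)"

text \<open>With \<open>hh u v\<close> on the right the only products are
  \<open>a \<stileturn> \<one>\<close> and \<open>\<one> \<turnstile> a\<close>, so root vectors are
  eigenvectors for every coefficient \<open>a\<close>. With \<open>hh u v\<close> on the left they
  need not be.\<close>

lemma br_hh: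
  assumes "i \<in> I" "j \<in> I" "u \<in> I" "v \<in> I" "u \<noteq> v" "a \<in> part D p"
  shows "br (E i j a) (hh u v) = mat_scale D (wt u v j - wt u v i) (E i j a)"
proof -
  interpret mm: module "mat_scale D" by (rule module_mat)
  have 1: "br (E i j a) (E w w \<one>) = (if j = w then E i j a else 0) - (if i = w then E i j a else 0)" if "w \<in> I" for w
    using assms that by (simp add: br_E[OF _ _ _ _ _ barunit_even] barunit)
  have "br (E i j a) (hh u v) = br (E i j a) (E u u \<one>) - mat_scale D (eps (par u + par v)) (br (E i j a) (E v v \<one>))"
    unfolding hh_def using assms by (simp add: br_diff br_scale carrier_closed)
  also have "\<dots> = mat_scale D (wt u v j - wt u v i) (E i j a)"
    using assms(5) unfolding 1[OF assms(3)] 1[OF assms(4)]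
    by (auto simp: wt_def mm.scale_left_diff_distrib mm.scale_right_diff_distrib mm.scale_minus_left)
  finally show ?thesis .
qed

text \<open>The Leibniz relation with third element \<open>hh u v\<close>, where both brackets
  against \<open>hh u v\<close> are eigenvalues.\<close>

lemma weight:
  assumes ij: "i \<in> I" "j \<in> I" "i \<noteq> j" and kl: "k \<in> I" "l \<in> I" "k \<noteq> l" and uv: "u \<in> I" "v \<in> I" "u \<noteq> v"
    and ab: "a \<in> part D p" "b \<in> part D q"
  shows "fscale (wt u v j - wt u v i + wt u v l - wt u v k) (pr (E i j a) (E k l b)) \<approx> pr (br (E i j a) (E k l b)) (hh u v)"
proof -
  let ?x = "E i j a" and ?y = "E k l b"
  have "pr ?x (br ?y (hh u v)) \<approx> pr (br ?x ?y) (hh u v) - fscale (eps ((par k + par l + q) * 0)) (pr (br ?x (hh u v)) ?y)"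
    by (intro leib E_L E_partL hh_partL assms)
  also have "\<dots> = pr (br ?x ?y) (hh u v) - pr (mat_scale D (wt u v j - wt u v i) ?x) ?y"
    by (simp add: br_hh[OF ij(1,2) uv ab(1)])
  also have "\<dots> \<approx> pr (br ?x ?y) (hh u v) - fscale (wt u v j - wt u v i) (pr ?x ?y)"
    by (intro eqB_diff eqB_refl pr_scale) (use assms in simp_all)
  finally have 1: "pr ?x (br ?y (hh u v)) \<approx> pr (br ?x ?y) (hh u v) - fscale (wt u v j - wt u v i) (pr ?x ?y)" .
  have "pr ?x (br ?y (hh u v)) \<approx> fscale (wt u v l - wt u v k) (pr ?x ?y)"
    unfolding br_hh[OF kl(1,2) uv ab(2)] by (intro pr_scale) (use assms in simp_all)
  from eqB_trans[OF eqB_sym[OF this] 1]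
  have "fscale ((wt u v j - wt u v i) + (wt u v l - wt u v k)) (pr ?x ?y) \<approx> pr (br ?x ?y) (hh u v)"
    by (rule eqB_move)
  then show ?thesis
    by (simp only: add_diff_eq)
qed

lemma comm_weight:
  assumes "i \<in> I" "j \<in> I" "i \<noteq> j" "k \<in> I" "l \<in> I" "k \<noteq> l" "u \<in> I" "v \<in> I" "u \<noteq> v" "j \<noteq> k" "i \<noteq> l"
    and "a \<in> part D p" "b \<in> part D q"
  shows "fscale (wt u v j - wt u v i + wt u v l - wt u v k) (pr (E i j a) (E k l b)) \<approx> 0"
proof -
  have "pr (br (E i j a) (E k l b)) (hh u v) \<approx> 0"
    using assms pr_zero(1)[OF hh_L, of u v] by (simp add: br_E_gen)
  then show ?thesis
    using weight[OF assms(1-9,12,13)] eqB_trans by blast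
qed

text \<open>An index \<open>w\<close> outside \<open>{i, j, k, l}\<close> allows
  \<open>E k l b\<close> to be written as the bracket of \<open>E k w b\<close> and
  \<open>E w l \<one>\<close>, and \<open>E i j a\<close> has zero bracket with both.\<close>

lemma comm_disjoint:
  assumes ij: "i \<in> I" "j \<in> I" "i \<noteq> j" and kl: "k \<in> I" "l \<in> I" "k \<noteq> l" and ne: "j \<noteq> k" "i \<noteq> l"
    and w: "w \<in> I" "w \<noteq> i" "w \<noteq> j" "w \<noteq> k" "w \<noteq> l" and ab: "a \<in> part D p" "b \<in> part D q"
  shows "pr (E i j a) (E k l b) \<approx> 0"
proof -
  let ?x = "E i j a" and ?y = "E k w b" and ?z = "E w l \<one>"
  have "pr ?x (br ?y ?z) \<approx> pr (br ?x ?y) ?z - fscale (eps ((par k + par w + q) * (par w + par l + 0))) (pr (br ?x ?z) ?y)"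
    by (intro leib E_L E_partL assms barunit_even) (use w in auto)
  also have "\<dots> = pr 0 ?z - fscale (eps ((par k + par w + q) * (par w + par l + 0))) (pr 0 ?y)"
    using assms by (simp add: br_E_gen)
  also have "\<dots> \<approx> 0 - fscale (eps ((par k + par w + q) * (par w + par l + 0))) 0"
    by (intro eqB_diff eqB_scale pr_zero) (use assms L_closed in auto)
  finally show ?thesis
    using assms by (simp add: br_E_gen barunit)
qed

text \<open>The chosen Cartan element has weight 1 on this pair: \<open>l\<close> counts once, the
  two contributions of \<open>j\<close> cancel, and \<open>i\<close> does not occur in it.\<close>

lemma root1:
  assumes "i \<in> I" "j \<in> I" "l \<in> I" "i \<noteq> j" "j \<noteq> l" "i \<noteq> l" "a \<in> part D p" "b \<in> part D q"
  shows "pr (E i j a) (E j l b) \<approx> pr (E i l (a \<stileturn> b)) (hh l (third i l))"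
  using weight[of i j j l l "third i l" a p b q] assms third[of i l]
  by (simp add: br_E_gen wt_def)

lemma root2:
  assumes "i \<in> I" "j \<in> I" "k \<in> I" "i \<noteq> j" "j \<noteq> k" "i \<noteq> k" "a \<in> part D p" "b \<in> part D q"
  shows "pr (E i j a) (E k i b) \<approx> pr (br (E i j a) (E k i b)) (hh j (third k j))"
  using weight[of i j k i j "third k j" a p b q] assms third[of k j]
  by (simp add: wt_def)

text \<open>The Leibniz relations for \<open>x, y, z\<close> and for \<open>x, z, y\<close> have
  right-hand sides that are negatives of each other up to the sign of the exchange. So the second
  argument \<open>[y, z]\<close> may be replaced by the flipped bracket, and for these
  \<open>y\<close> and \<open>z\<close> the two brackets contain \<open>b \<stileturn> c\<close> and
  \<open>b \<turnstile> c\<close>. This is the counterpart of \<open>I\<close> on the Leibniz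
  side.\<close>

lemma bar_side:
  assumes x: "x \<in> supermodule.carrier L" and kl: "k \<in> I" "l \<in> I" "k \<noteq> l" and bc: "b \<in> part D q" "c \<in> part D r"
  shows "pr x (E k l (b \<stileturn> c)) \<approx> pr x (E k l (b \<turnstile> c))"
proof -
  define w where "w = third k l"
  have w: "w \<in> I" "w \<noteq> k" "w \<noteq> l"
    using third by (auto simp: w_def)
  let ?y = "E k w b" and ?z = "E w l c"
  let ?e = "eps ((par k + par w + q) * (par w + par l + r)) :: 'r"
  let ?e' = "eps ((par w + par l + r) * (par k + par w + q)) :: 'r"
  have e: "?e' = ?e"
    by (simp only: mult.commute)
  have ee: "?e * ?e = 1"
    by simp
  have yz: "br ?y ?z = E k l (b \<stileturn> c)"
    using w kl by (simp add: br_E_gen)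
  have zy: "br ?z ?y = - mat_scale D ?e (E k l (b \<turnstile> c))"
    using w kl by (simp add: br_E[OF _ _ _ _ bc(2,1)] E_simps e)
  have P: "?y \<in> part L (par k + par w + q)" "?z \<in> part L (par w + par l + r)"
    by (intro E_partL kl w bc; use w in blast)+
  have "pr x (br ?y ?z) \<approx> pr (br x ?y) ?z - fscale ?e (pr (br x ?z) ?y)"
    by (rule leib[OF x P])
  moreover have "pr x (br ?z ?y) \<approx> pr (br x ?z) ?y - fscale ?e (pr (br x ?y) ?z)"
    using leib[OF x P(2,1)] unfolding e .
  ultimately have "pr x (br ?y ?z) + fscale ?e (pr x (br ?z ?y)) \<approx>
      (pr (br x ?y) ?z - fscale ?e (pr (br x ?z) ?y)) + fscale ?e (pr (br x ?z) ?y - fscale ?e (pr (br x ?y) ?z))"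
    by (intro eqB_add eqB_scale)
  also have "\<dots> = 0"
    by (simp add: fs.scale_right_diff_distrib ee)
  finally have 1: "pr x (E k l (b \<stileturn> c)) + fscale ?e (pr x (br ?z ?y)) \<approx> 0"
    by (simp only: yz)
  have m: "mat_scale D ?e (E k l (b \<turnstile> c)) \<in> supermodule.carrier L"
    by (intro L_closed E_L kl)
  have "pr x (br ?z ?y) \<approx> - pr x (mat_scale D ?e (E k l (b \<turnstile> c)))"
    unfolding zy by (rule pr_neg(2)[OF m x])
  also have "\<dots> \<approx> - fscale ?e (pr x (E k l (b \<turnstile> c)))"
    by (intro eqB_neg pr_scale(2) E_L kl x)
  finally have "fscale ?e (pr x (br ?z ?y)) \<approx> fscale ?e (- fscale ?e (pr x (E k l (b \<turnstile> c))))"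
    by (rule eqB_scale)
  also have "\<dots> = - pr x (E k l (b \<turnstile> c))"
    by (simp add: ee fs.scale_minus_right)
  finally have 2: "fscale ?e (pr x (br ?z ?y)) \<approx> - pr x (E k l (b \<turnstile> c))" .
  have "pr x (E k l (b \<stileturn> c)) + fscale ?e (pr x (br ?z ?y)) - fscale ?e (pr x (br ?z ?y)) \<approx> 0 - (- pr x (E k l (b \<turnstile> c)))"
    by (rule eqB_diff[OF 1 2])
  then show ?thesis
    by simp
qed

section \<open>The weight zero part\<close>

text \<open>The sign with which the position \<open>i\<close> enters the supertrace of a matrix of degree \<open>d\<close>, normalized to \<open>1\<close>
  at the position \<open>1\<close>.\<close>

definition ssign :: "nat \<Rightarrow> bit \<Rightarrow> 'r" where
  "ssign i d = eps ((par i + par 1) * (1 + d))"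

lemma ssign_1 [simp]: "ssign 1 d = 1" "ssign (Suc 0) d = 1"
  by (simp_all add: ssign_def)

lemma ssign_square [simp]: "ssign i d * ssign i d = 1"
  by (simp add: ssign_def)

text \<open>With the sign \<open>ssign i d\<close> absorbed, the relations between these classes
  have coefficients that do not depend on the parities of the indices.\<close>

definition H :: "bit \<Rightarrow> nat \<Rightarrow> nat \<Rightarrow> 'd \<Rightarrow> 'd \<Rightarrow> (nat \<Rightarrow> nat \<Rightarrow> 'd) list \<Rightarrow>\<^sub>0 'r" where
  "H d i j a b = fscale (ssign i d) (pr (E i j a) (E j i b))"

text \<open>The Leibniz relation around a cycle of three positions; its terms are those of the
  Hochschild differential \<open>d_2\<close> at \<open>a, b, c\<close>.\<close>

lemma H_split:
  assumes ijk: "i \<in> I" "j \<in> I" "k \<in> I" "i \<noteq> j" "j \<noteq> k" "i \<noteq> k"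
    and abc: "a \<in> part D p" "b \<in> part D q" "c \<in> part D r"
  shows "H (p + q + r) i j a (b \<stileturn> c) \<approx> H (p + q + r) i k (a \<stileturn> b) c + fscale (eps (r * (p + q))) (H (p + q + r) k j (c \<turnstile> a) b)"
proof -
  let ?x = "E i j a" and ?y = "E j k b" and ?z = "E k i c"
  let ?eyz = "eps ((par j + par k + q) * (par k + par i + r)) :: 'r"
  let ?exz = "eps ((par i + par j + p) * (par k + par i + r)) :: 'r"
  let ?s = "\<lambda>i. ssign i (p + q + r)"
  have yz: "br ?y ?z = E j i (b \<stileturn> c)" and xy: "br ?x ?y = E i k (a \<stileturn> b)"
    using ijk by (simp_all add: br_E_gen)
  have xz: "br ?x ?z = - mat_scale D ?exz (E k j (c \<turnstile> a))"
    using ijk by (simp add: br_E[OF _ _ _ _ abc(1,3)] E_simps)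
  have kj: "E k j (c \<turnstile> a) \<in> supermodule.carrier L" "?y \<in> supermodule.carrier L"
    using ijk by auto
  have "pr (br ?x ?z) ?y \<approx> - pr (mat_scale D ?exz (E k j (c \<turnstile> a))) ?y"
    unfolding xz by (intro pr_neg(1) L_closed(4) kj)
  also have "\<dots> \<approx> - fscale ?exz (pr (E k j (c \<turnstile> a)) ?y)"
    by (intro eqB_neg pr_scale(1) kj)
  finally have 1: "pr (br ?x ?z) ?y \<approx> - fscale ?exz (pr (E k j (c \<turnstile> a)) ?y)" .
  have "pr ?x (br ?y ?z) \<approx> pr (br ?x ?y) ?z - fscale ?eyz (pr (br ?x ?z) ?y)"
    by (intro leib E_L E_partL ijk abc) (use ijk in auto)
  also have "\<dots> \<approx> pr (br ?x ?y) ?z - fscale ?eyz (- fscale ?exz (pr (E k j (c \<turnstile> a)) ?y))"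
    by (intro eqB_diff eqB_refl eqB_scale 1)
  finally have 2: "fscale (?s i) (pr ?x (E j i (b \<stileturn> c))) \<approx>
      fscale (?s i) (pr (E i k (a \<stileturn> b)) ?z - fscale ?eyz (- fscale ?exz (pr (E k j (c \<turnstile> a)) ?y)))"
    unfolding yz xy by (rule eqB_scale)
  \<comment> \<open>This identity dictates the normalization \<open>ssign\<close>: all other index
    parities cancel.\<close>
  have sgn: "?s i * (?eyz * ?exz) = eps (r * (p + q)) * ?s k"
    unfolding ssign_def
    by (cases "par i"; cases "par j"; cases "par k"; cases "par 1"; cases p; cases q; cases r) simp_all
  show ?thesis
    using 2 unfolding scale_nested sgn fs.scale_scale[symmetric] H_def .
qed

lemma H_left:
  assumes "i \<in> I" "j \<in> I" "k \<in> I" "i \<noteq> j" "j \<noteq> k" "i \<noteq> k" "a \<in> part D p" "b \<in> part D q"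
  shows "H (p + q) i j a b \<approx> H (p + q) i k (a \<stileturn> b) \<one> + H (p + q) k j a b"
  using H_split[OF assms barunit_even] by (simp add: barunit)

text \<open>Setting the middle entry of \<open>H_split\<close> to \<open>\<one>\<close> leaves
  \<open>\<one> \<stileturn> c\<close>, which may differ from \<open>c\<close>;
  \<open>bar_side\<close> exchanges it for \<open>\<one> \<turnstile> c\<close>.\<close>

lemma H_right:
  assumes ijk: "i \<in> I" "j \<in> I" "k \<in> I" "i \<noteq> j" "j \<noteq> k" "i \<noteq> k" and ac: "a \<in> part D p" "c \<in> part D r"
  shows "H (p + r) i j a c \<approx> H (p + r) i k a c + fscale (eps (r * p)) (H (p + r) k j (c \<turnstile> a) \<one>)"
proof -
  have "pr (E i j a) (E j i (\<one> \<stileturn> c)) \<approx> pr (E i j a) (E j i (\<one> \<turnstile> c))"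
    by (intro bar_side[OF _ _ _ _ barunit_even ac(2)] E_L ijk) (use ijk in auto)
  then have "H (p + r) i j a c \<approx> H (p + r) i j a (\<one> \<stileturn> c)"
    unfolding H_def by (intro eqB_scale) (simp add: barunit eqB_sym)
  also have "\<dots> \<approx> H (p + r) i k (a \<stileturn> \<one>) c + fscale (eps (r * p)) (H (p + r) k j (c \<turnstile> a) \<one>)"
    using H_split[OF ijk ac(1) barunit_even ac(2)] by simp
  finally show ?thesis
    by (simp add: barunit)
qed

text \<open>\<open>H_left\<close> goes from a third position \<open>i\<close> to \<open>j\<close>
  through \<open>k\<close>, and also to \<open>k\<close> through \<open>j\<close>; in the sum the
  terms at \<open>i\<close> cancel.\<close>

lemma H_anti:
  assumes "j \<in> I" "k \<in> I" "j \<noteq> k" "a \<in> part D p"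
  shows "H p j k a \<one> \<approx> - H p k j a \<one>"
proof -
  define i where "i = third j k"
  have i: "i \<in> I" "i \<noteq> j" "i \<noteq> k"
    using third by (auto simp: i_def)
  have "H p i j a \<one> \<approx> H p i k a \<one> + H p k j a \<one>" "H p i k a \<one> \<approx> H p i j a \<one> + H p j k a \<one>"
    using H_left[of i j k a p \<one> 0] H_left[of i k j a p \<one> 0] assms i barunit_even by (simp_all add: barunit)
  from fs.subspace_add[OF BL_sub this[unfolded eqB_def]]
  have "- (H p j k a \<one> - - H p k j a \<one>) \<in> BL"
    by (simp add: algebra_simps)
  from fs.subspace_neg[OF BL_sub this] show ?thesis
    by (simp only: eqB_def minus_minus)
qed

text \<open>A lift of \<open>E 1 1 (a \<stileturn> b - (-1)\<^bsup>|a||b|\<^esup> b \<turnstile> a)\<close>.\<close>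

definition sg :: "'d list \<Rightarrow> (nat \<Rightarrow> nat \<Rightarrow> 'd) list \<Rightarrow>\<^sub>0 'r" where
  "sg xs = pr (E 1 2 (xs ! 0)) (E 2 1 (xs ! 1)) - pr (E 1 2 (rev (xs ! 0) (xs ! 1))) (E 2 1 \<one>)"

text \<open>The classes in one variable, measured from the position 1. The value 0 at
  \<open>i = 1\<close> lets \<open>H_sg\<close> hold for every pair of positions.\<close>

definition Y :: "bit \<Rightarrow> nat \<Rightarrow> 'd \<Rightarrow> (nat \<Rightarrow> nat \<Rightarrow> 'd) list \<Rightarrow>\<^sub>0 'r" where
  "Y d i c = (if i = 1 then 0 else H d 1 i c \<one>)"

lemma I12: "1 \<in> I" "2 \<in> I" "3 \<in> I"
  using N3 by (auto simp: I_def)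

lemma sg_H:
  assumes "a \<in> part D p" "b \<in> part D q"
  shows "sg [a, b] \<approx> H (p + q) 1 2 a b - fscale (eps (p * q)) (Y (p + q) 2 (b \<turnstile> a))"
proof -
  have "sg [a, b] = pr (E 1 2 a) (E 2 1 b) - pr (mat_scale D (eps (p * q)) (E 1 2 (b \<turnstile> a))) (E 2 1 \<one>)"
    by (simp add: sg_def rev_hom[OF assms] E_simps)
  also have "\<dots> \<approx> pr (E 1 2 a) (E 2 1 b) - fscale (eps (p * q)) (pr (E 1 2 (b \<turnstile> a)) (E 2 1 \<one>))"
    by (intro eqB_diff eqB_refl pr_scale(1)) (use I12 in auto)
  finally show ?thesis
    by (simp add: H_def Y_def)
qed

lemma H_anti1:
  assumes "i \<in> I" "i \<noteq> 1" "a \<in> part D p"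
  shows "H p i 1 a \<one> \<approx> - Y p i a"
  using H_anti[of i 1 a p] assms I12 by (simp add: Y_def)

text \<open>The class of \<open>E i j a \<otimes> E j i b\<close> depends on \<open>i\<close> and \<open>j\<close> only through terms in one variable.\<close>

lemma H_sg:
  assumes ij: "i \<in> I" "j \<in> I" "i \<noteq> j" and ab: "a \<in> part D p" "b \<in> part D q"
  shows "H (p + q) i j a b \<approx> sg [a, b] - Y (p + q) i (a \<stileturn> b) + fscale (eps (p * q)) (Y (p + q) j (b \<turnstile> a))"
proof -
  have apb: "a \<stileturn> b \<in> part D (p + q)" "b \<turnstile> a \<in> part D (p + q)"
    using lprod_degree[OF ab] rprod_degree[OF ab(2,1)] by (simp_all add: add.commute)
  have first: "H (p + q) 1 j a b \<approx> sg [a, b] + fscale (eps (p * q)) (Y (p + q) j (b \<turnstile> a))" if j: "j \<in> I" "j \<noteq> 1" for j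
  proof (cases "j = 2")
    case True
    have "H (p + q) 1 2 a b - fscale (eps (p * q)) (Y (p + q) 2 (b \<turnstile> a)) + fscale (eps (p * q)) (Y (p + q) 2 (b \<turnstile> a)) \<approx>
        sg [a, b] + fscale (eps (p * q)) (Y (p + q) 2 (b \<turnstile> a))"
      by (intro eqB_add eqB_refl eqB_sym[OF sg_H[OF ab]])
    then show ?thesis
      using True by simp
  next
    case False
    \<comment> \<open>Moving the second position from \<open>j\<close> to 2 costs a one-variable
      term, which \<open>2\<close> expresses by classes that start at the position 1.\<close>
    have 1: "H (p + q) 1 j a b \<approx> H (p + q) 1 2 a b + fscale (eps (q * p)) (H (p + q) 2 j (b \<turnstile> a) \<one>)"
      by (intro H_right I12 ab j) (use j False in auto)
    have 2: "H (p + q) 1 j (b \<turnstile> a) \<one> \<approx> H (p + q) 1 2 (b \<turnstile> a) \<one> + H (p + q) 2 j (b \<turnstile> a) \<one>"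
      using H_left[of 1 j 2 "b \<turnstile> a" "p + q" \<one> 0] j False I12 apb barunit_even by (simp add: barunit)
    have "H (p + q) 1 j a b + (sg [a, b] + fscale (eps (p * q)) (H (p + q) 1 j (b \<turnstile> a) \<one>)) \<approx>
      (H (p + q) 1 2 a b + fscale (eps (q * p)) (H (p + q) 2 j (b \<turnstile> a) \<one>)) +
      ((H (p + q) 1 2 a b - fscale (eps (p * q)) (Y (p + q) 2 (b \<turnstile> a))) +
        fscale (eps (p * q)) (H (p + q) 1 j (b \<turnstile> a) \<one>))"
      by (intro eqB_add eqB_refl 1 sg_H ab)
    then have "H (p + q) 1 j a b - (sg [a, b] + fscale (eps (p * q)) (H (p + q) 1 j (b \<turnstile> a) \<one>)) \<in> BL"
      using 1 2[THEN eqB_scale, of "eps (p * q)"] sg_H[OF ab] unfolding eqB_def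
    proof -
      assume 1: "H (p + q) 1 j a b - (H (p + q) 1 2 a b + fscale (eps (q * p)) (H (p + q) 2 j (b \<turnstile> a) \<one>)) \<in> BL"
        and 2: "fscale (eps (p * q)) (H (p + q) 1 j (b \<turnstile> a) \<one>) -
          fscale (eps (p * q)) (H (p + q) 1 2 (b \<turnstile> a) \<one> + H (p + q) 2 j (b \<turnstile> a) \<one>) \<in> BL"
        and 3: "sg [a, b] - (H (p + q) 1 2 a b - fscale (eps (p * q)) (Y (p + q) 2 (b \<turnstile> a))) \<in> BL"
      show ?thesis
        using fs.subspace_diff[OF BL_sub fs.subspace_diff[OF BL_sub 1 2] 3]
        by (simp add: Y_def fs.scale_right_distrib algebra_simps)
    qed
    then show ?thesis
      using j by (simp add: Y_def eqB_def)
  qed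
  show ?thesis
  proof (cases "i = 1")
    case True
    then show ?thesis
      using first[of j] ij by (simp add: Y_def)
  next
    case i: False
    show ?thesis
    proof (cases "j = 1")
      case True
      \<comment> \<open>The position 1 as a target is reached through a third position
        \<open>k\<close>, so that the case of source 1 applies.\<close>
      define k where "k = third 1 i"
      have k: "k \<in> I" "k \<noteq> 1" "k \<noteq> i"
        using third by (auto simp: k_def)
      have "H (p + q) i 1 a b \<approx> H (p + q) i k a b + fscale (eps (q * p)) (H (p + q) k 1 (b \<turnstile> a) \<one>)"
        by (intro H_right ij I12 k ab) (use k i in auto)
      also have "\<dots> \<approx> (H (p + q) i 1 (a \<stileturn> b) \<one> + H (p + q) 1 k a b) + fscale (eps (q * p)) (- Y (p + q) k (b \<turnstile> a))"
        by (intro eqB_add eqB_scale H_anti1 H_left ij I12 k ab apb) (use k i in auto)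
      also have "\<dots> \<approx> (- Y (p + q) i (a \<stileturn> b) + (sg [a, b] + fscale (eps (p * q)) (Y (p + q) k (b \<turnstile> a))))
          + fscale (eps (q * p)) (- Y (p + q) k (b \<turnstile> a))"
        by (intro eqB_add eqB_refl H_anti1 first ij i k ab apb)
      finally show ?thesis
        using True by (simp add: Y_def fs.scale_minus_right algebra_simps)
    next
      case j: False
      have "H (p + q) i j a b \<approx> H (p + q) i 1 (a \<stileturn> b) \<one> + H (p + q) 1 j a b"
        by (intro H_left ij I12 ab) (use i j in auto)
      also have "\<dots> \<approx> - Y (p + q) i (a \<stileturn> b) + (sg [a, b] + fscale (eps (p * q)) (Y (p + q) j (b \<turnstile> a)))"
        by (intro eqB_add H_anti1 first ij i j apb)
      finally show ?thesis
        by (simp add: algebra_simps)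
    qed
  qed
qed

end

context sl3_algebra
begin

lemma E12_L [simp]: "E 1 2 a \<in> supermodule.carrier L" "E 2 1 a \<in> supermodule.carrier L"
    "E (Suc 0) 2 a \<in> supermodule.carrier L" "E 2 (Suc 0) a \<in> supermodule.carrier L"
  using E_L[OF I12(1,2)] E_L[OF I12(2,1)] by simp_all

lemma prE_add:
  assumes "x \<in> supermodule.carrier L" "k \<in> I" "l \<in> I" "k \<noteq> l"
  shows "pr x (E k l (b + c)) \<approx> pr x (E k l b) + pr x (E k l c)" "pr (E k l (b + c)) x \<approx> pr (E k l b) x + pr (E k l c) x"
    "pr x (E k l (smult D s c)) \<approx> fscale s (pr x (E k l c))" "pr (E k l (smult D s c)) x \<approx> fscale s (pr (E k l c) x)"
  unfolding E_simps using pr_add[of "E k l b" "E k l c" x] pr_scale[of "E k l c" x s] assms by auto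

lemma bar_side_gen:
  assumes x: "x \<in> supermodule.carrier L" "k \<in> I" "l \<in> I" "k \<noteq> l"
  shows "pr x (E k l (b \<stileturn> c)) \<approx> pr x (E k l (b \<turnstile> c))"
proof -
  have 4: "pr x (E k l (u1 + u2 + (u3 + u4))) \<approx> (pr x (E k l u1) + pr x (E k l u2)) + (pr x (E k l u3) + pr x (E k l u4))"
    for u1 u2 u3 u4
    by (rule eqB_trans[OF prE_add(1)[OF x] eqB_add[OF prE_add(1)[OF x] prE_add(1)[OF x]]])
  let ?b = "\<lambda>p. cmp p b" and ?c = "\<lambda>p. cmp p c"
  have m: "b \<stileturn> c = ?b 0 \<stileturn> ?c 0 + ?b 0 \<stileturn> ?c 1 + (?b 1 \<stileturn> ?c 0 + ?b 1 \<stileturn> ?c 1)"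
    "b \<turnstile> c = ?b 0 \<turnstile> ?c 0 + ?b 0 \<turnstile> ?c 1 + (?b 1 \<turnstile> ?c 0 + ?b 1 \<turnstile> ?c 1)"
    by (simp_all add: mul_simps(1,2,11,12)[symmetric] cmp_sum_eq)
  have s: "pr x (E k l (?b p \<stileturn> ?c q)) \<approx> pr x (E k l (?b p \<turnstile> ?c q))" for p q
    by (rule bar_side[OF x cmp_simps(3) cmp_simps(3)])
  have "pr x (E k l (b \<stileturn> c)) \<approx> (pr x (E k l (?b 0 \<turnstile> ?c 0)) + pr x (E k l (?b 0 \<turnstile> ?c 1)))
      + (pr x (E k l (?b 1 \<turnstile> ?c 0)) + pr x (E k l (?b 1 \<turnstile> ?c 1)))"
    unfolding m(1) by (rule eqB_trans[OF 4]) (intro eqB_add s)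
  moreover have "pr x (E k l (b \<turnstile> c)) \<approx> (pr x (E k l (?b 0 \<turnstile> ?c 0)) + pr x (E k l (?b 0 \<turnstile> ?c 1)))
      + (pr x (E k l (?b 1 \<turnstile> ?c 0)) + pr x (E k l (?b 1 \<turnstile> ?c 1)))"
    unfolding m(2) by (rule 4)
  ultimately show ?thesis
    using eqB_trans eqB_sym by blast
qed

lemma sg_add: "sg [a + b, c] \<approx> sg [a, c] + sg [b, c]" "sg [c, a + b] \<approx> sg [c, a] + sg [c, b]"
proof -
  have m: "(u + v) - (w + z) = (u - w) + (v - z)" for u v w z :: "(nat \<Rightarrow> nat \<Rightarrow> 'd) list \<Rightarrow>\<^sub>0 'r"
    by simp
  show "sg [a + b, c] \<approx> sg [a, c] + sg [b, c]"
    unfolding sg_def nth_Cons_0 nth_Cons_Suc One_nat_def m[symmetric] rev_simps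
    by (intro eqB_diff prE_add(2) I12[unfolded One_nat_def] E12_L[unfolded One_nat_def]) simp_all
  show "sg [c, a + b] \<approx> sg [c, a] + sg [c, b]"
    unfolding sg_def nth_Cons_0 nth_Cons_Suc One_nat_def m[symmetric] rev_simps
    by (intro eqB_diff prE_add(1,2) I12[unfolded One_nat_def] E12_L[unfolded One_nat_def]) simp_all
qed

lemma sg_scale: "sg [smult D s a, c] \<approx> fscale s (sg [a, c])" "sg [c, smult D s a] \<approx> fscale s (sg [c, a])"
proof -
  show "sg [smult D s a, c] \<approx> fscale s (sg [a, c])"
    unfolding sg_def nth_Cons_0 nth_Cons_Suc One_nat_def fs.scale_right_diff_distrib rev_simps
    by (intro eqB_diff prE_add(4) I12[unfolded One_nat_def] E12_L[unfolded One_nat_def]) simp_all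
  show "sg [c, smult D s a] \<approx> fscale s (sg [c, a])"
    unfolding sg_def nth_Cons_0 nth_Cons_Suc One_nat_def fs.scale_right_diff_distrib rev_simps
    by (intro eqB_diff prE_add(3,4) I12[unfolded One_nat_def] E12_L[unfolded One_nat_def]) simp_all
qed

lemma mlin_sg: "mlin 2 fscale BL sg"
  by (rule mlin_lists2I) (use sg_add sg_scale in \<open>simp_all add: eqB_def diff_diff_eq\<close>)

text \<open>\<open>H_split\<close> on the positions 1, 2, 3, each of its three terms rewritten by
  \<open>H_sg\<close>. The one-variable terms cancel: those at 2 by the third dialgebra identity and
  associativity, those at 3 because \<open>c \<turnstile> (a \<stileturn> b) = (c \<turnstile> a)
  \<stileturn> b\<close>.\<close>

lemma sg_hd2:
  assumes abc: "a \<in> part D p" "b \<in> part D q" "c \<in> part D r"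
  shows "sg [a \<stileturn> b, c] - sg [a, b \<stileturn> c] + fscale (eps (r * (p + q))) (sg [c \<turnstile> a, b]) \<in> BL"
proof -
  have deg: "a \<stileturn> b \<in> part D (p + q)" "b \<stileturn> c \<in> part D (q + r)" "c \<turnstile> a \<in> part D (r + p)"
    using lprod_degree rprod_degree abc by auto
  have d: "p + (q + r) = p + q + r" "r + p + q = p + q + r"
    by (simp_all only: ac_simps)
  have 0: "H (p + q + r) 1 2 a (b \<stileturn> c) \<approx> H (p + q + r) 1 3 (a \<stileturn> b) c + fscale (eps (r * (p + q))) (H (p + q + r) 3 2 (c \<turnstile> a) b)"
    by (intro H_split I12 abc) simp_all
  have 1: "H (p + q + r) 1 2 a (b \<stileturn> c) \<approx> sg [a, b \<stileturn> c] - Y (p + q + r) 1 (a \<stileturn> (b \<stileturn> c)) + fscale (eps (p * (q + r))) (Y (p + q + r) 2 ((b \<stileturn> c) \<turnstile> a))"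
    using H_sg[OF I12(1,2) _ abc(1) deg(2)] unfolding d by simp
  have 2: "H (p + q + r) 1 3 (a \<stileturn> b) c \<approx> sg [a \<stileturn> b, c] - Y (p + q + r) 1 ((a \<stileturn> b) \<stileturn> c) + fscale (eps ((p + q) * r)) (Y (p + q + r) 3 (c \<turnstile> (a \<stileturn> b)))"
    using H_sg[OF I12(1,3) _ deg(1) abc(3)] by simp
  have 3: "H (p + q + r) 3 2 (c \<turnstile> a) b \<approx> sg [c \<turnstile> a, b] - Y (p + q + r) 3 ((c \<turnstile> a) \<stileturn> b) + fscale (eps ((r + p) * q)) (Y (p + q + r) 2 (b \<turnstile> (c \<turnstile> a)))"
    using H_sg[OF I12(3,2) _ deg(3) abc(2)] unfolding d by simp
  have Y1: "Y d 1 u = 0" for d u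
    by (simp add: Y_def)
  have e: "eps ((p + q) * r) = (eps (r * (p + q)) :: 'r)" "eps (p * (q + r)) = (eps (r * (p + q)) * eps ((r + p) * q) :: 'r)"
    by (cases p; cases q; cases r; simp)+
  have m: "(b \<stileturn> c) \<turnstile> a = b \<turnstile> (c \<turnstile> a)" "c \<turnstile> (a \<stileturn> b) = (c \<turnstile> a) \<stileturn> b"
    by (simp_all add: dialgebra rprod_assoc)
  define E1 where "E1 = eps (r * (p + q)) * (1 :: 'r)"
  define E2 where "E2 = eps ((r + p) * q) * (1 :: 'r)"
  define X1 X2 X3 where "X1 = H (p + q + r) 1 2 a (b \<stileturn> c)" and "X2 = H (p + q + r) 1 3 (a \<stileturn> b) c"
    and "X3 = H (p + q + r) 3 2 (c \<turnstile> a) b"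
  define Y2 Y3 where "Y2 = Y (p + q + r) 2 (b \<turnstile> (c \<turnstile> a))" and "Y3 = Y (p + q + r) 3 ((c \<turnstile> a) \<stileturn> b)"
  have M0: "X1 - (X2 + fscale E1 X3) \<in> BL" and M1: "X1 - (sg [a, b \<stileturn> c] + fscale (E1 * E2) Y2) \<in> BL"
    and M2: "X2 - (sg [a \<stileturn> b, c] + fscale E1 Y3) \<in> BL" and M3: "X3 - (sg [c \<turnstile> a, b] - Y3 + fscale E2 Y2) \<in> BL"
    using 0 1 2 3 unfolding eqB_def Y1 e m X1_def[symmetric] X2_def[symmetric] X3_def[symmetric] Y2_def[symmetric] Y3_def[symmetric]
    by (simp_all add: E1_def E2_def)
  have M4: "fscale E1 (X3 - (sg [c \<turnstile> a, b] - Y3 + fscale E2 Y2)) \<in> BL"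
    by (rule fs.subspace_scale[OF BL_sub M3])
  have "(X1 - (sg [a, b \<stileturn> c] + fscale (E1 * E2) Y2)) - (X2 - (sg [a \<stileturn> b, c] + fscale E1 Y3)) -
      fscale E1 (X3 - (sg [c \<turnstile> a, b] - Y3 + fscale E2 Y2)) - (X1 - (X2 + fscale E1 X3)) \<in> BL"
    by (rule fs.subspace_diff[OF BL_sub fs.subspace_diff[OF BL_sub fs.subspace_diff[OF BL_sub M1 M2] M4] M0])
  then show ?thesis
    by (simp add: fs.scale_right_diff_distrib fs.scale_right_distrib E1_def algebra_simps)
qed

text \<open>Hence \<open>sg\<close> is defined on Hochschild classes. The three kinds of relations
  in \<open>BH\<close> are met by bilinearity, by \<open>H_split\<close> and by
  \<open>bar_side\<close>.\<close>

lemma sg_BH: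
  assumes "q \<in> BH"
  shows "lin fscale sg q \<in> BL"
proof (rule lin_in_subspace[OF module_fscale BL_sub assms[unfolded BH_def]])
  interpret h: module_hom fscale fscale "lin fscale sg"
    by (rule module_hom_lin[OF module_fscale])
  fix u
  assume "u \<in> Rel 2 \<union> hom_image 3 hd2 \<union> Igen"
  then consider "u \<in> Rel 2" | "u \<in> hom_image 3 hd2" | "u \<in> Igen"
    by blast
  then show "lin fscale sg u \<in> BL"
  proof cases
    case 1
    then show ?thesis
      by (rule lin_Rel[OF module_fscale BL_sub mlin_sg])
  next
    case 2
    then obtain ds xs where "u = hd2 ds xs" "length ds = 3" "length xs = 3" and h: "list_all2 (\<lambda>x p. x \<in> part D p) xs ds"
      unfolding hom_image_def tlists_D by blast
    then obtain p q r a b c where e: "ds = [p, q, r]" "xs = [a, b, c]"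
      by (auto simp: numeral_3_eq_3 length_Suc_conv)
    have "a \<in> part D p" "b \<in> part D q" "c \<in> part D r"
      using h by (auto simp: e)
    from sg_hd2[OF this] show ?thesis
      by (simp add: \<open>u = _\<close> e hd2_def h.add h.diff h.scale module_fscale)
  next
    case 3
    then obtain a b c where u: "u = gen [a, b \<stileturn> c] - gen [a, b \<turnstile> c]"
      by (auto simp: Igen_def)
    have "pr (E 1 2 a) (E 2 1 (b \<stileturn> c)) \<approx> pr (E 1 2 a) (E 2 1 (b \<turnstile> c))"
      by (rule bar_side_gen[OF E12_L(1) I12(2,1)]) simp
    then have "sg [a, b \<stileturn> c] - sg [a, b \<turnstile> c] \<in> BL"
      by (simp add: sg_def rev_bar eqB_def)
    then show ?thesis
      by (simp add: u h.diff module_fscale)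
  qed
qed

text \<open>The sign \<open>ssign i\<close> depends on the degree of the entry; this is its linear
  extension to inhomogeneous entries.\<close>

definition tw :: "nat \<Rightarrow> 'd \<Rightarrow> 'd" where
  "tw i c = smult D (ssign i 0) (cmp 0 c) + smult D (ssign i 1) (cmp 1 c)"

lemma tw_simps: "tw i (a + b) = tw i a + tw i b" "tw i (smult D s a) = smult D s (tw i a)" "tw i 0 = 0"
  by (simp_all add: tw_def md.scale_right_distrib mult.commute)

lemma tw_hom: "c \<in> part D p \<Longrightarrow> tw i c = smult D (ssign i p) c"
  by (cases p) (simp_all add: tw_def cmp_hom)

text \<open>A linear section, modulo \<open>BL\<close>, of the bracket \<open>L \<otimes> L \<rightarrow> L\<close> away from the position \<open>(1, 1)\<close>.\<close>

definition thc :: "nat \<Rightarrow> nat \<Rightarrow> 'd \<Rightarrow> (nat \<Rightarrow> nat \<Rightarrow> 'd) list \<Rightarrow>\<^sub>0 'r" where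
  "thc i j c = (if i = j then (if i = 1 then 0 else - pr (E 1 i (tw i c)) (E i 1 \<one>)) else pr (E i j c) (hh j (third i j)))"

definition th :: "(nat \<Rightarrow> nat \<Rightarrow> 'd) \<Rightarrow> (nat \<Rightarrow> nat \<Rightarrow> 'd) list \<Rightarrow>\<^sub>0 'r" where
  "th x = (\<Sum>i\<in>I. \<Sum>j\<in>I. thc i j (x i j))"

lemma thc_add: "i \<in> I \<Longrightarrow> j \<in> I \<Longrightarrow> thc i j (a + b) \<approx> thc i j a + thc i j b"
proof -
  assume ij: "i \<in> I" "j \<in> I"
  consider "i = j" "i = 1" | "i = j" "i \<noteq> 1" | "i \<noteq> j"
    by blast
  then show ?thesis
  proof cases
    case 2
    have "pr (E 1 i (tw i a + tw i b)) (E i 1 \<one>) \<approx> pr (E 1 i (tw i a)) (E i 1 \<one>) + pr (E 1 i (tw i b)) (E i 1 \<one>)"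
      by (rule prE_add(2)) (use 2 ij I12 in auto)
    from eqB_neg[OF this] show ?thesis
      using 2 by (simp add: thc_def tw_simps)
  next
    case 3
    have "hh j (third i j) \<in> supermodule.carrier L"
      using third[of i j] ij by (intro hh_L) auto
    then show ?thesis
      using prE_add(2)[of "hh j (third i j)" i j a b] 3 ij by (simp add: thc_def)
  qed (simp add: thc_def)
qed

lemma thc_scale: "i \<in> I \<Longrightarrow> j \<in> I \<Longrightarrow> thc i j (smult D s a) \<approx> fscale s (thc i j a)"
proof -
  assume ij: "i \<in> I" "j \<in> I"
  consider "i = j" "i = 1" | "i = j" "i \<noteq> 1" | "i \<noteq> j"
    by blast
  then show ?thesis
  proof cases
    case 2
    have "pr (E 1 i (smult D s (tw i a))) (E i 1 \<one>) \<approx> fscale s (pr (E 1 i (tw i a)) (E i 1 \<one>))"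
      by (rule prE_add(4)) (use 2 ij I12 in auto)
    from eqB_neg[OF this] show ?thesis
      using 2 by (simp add: thc_def tw_simps)
  next
    case 3
    have "hh j (third i j) \<in> supermodule.carrier L"
      using third[of i j] ij by (intro hh_L) auto
    then show ?thesis
      using prE_add(4)[of "hh j (third i j)" i j s a] 3 ij by (simp add: thc_def)
  qed (simp add: thc_def)
qed

lemma thc_0: "i \<in> I \<Longrightarrow> j \<in> I \<Longrightarrow> thc i j 0 \<approx> 0"
  using thc_scale[of i j 0 0] by simp

lemma th_add: "th (x + y) \<approx> th x + th y"
  unfolding th_def plus_fun_apply sum.distrib[symmetric] by (intro eqB_sum thc_add)

lemma th_scale: "th (mat_scale D s x) \<approx> fscale s (th x)"
  unfolding th_def mat_scale_def fs.scale_sum_right by (intro eqB_sum thc_scale)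

lemma th_0: "th 0 \<approx> 0"
  using th_scale[of 0 0] by simp

lemma th_E:
  assumes "i \<in> I" "j \<in> I"
  shows "th (E i j c) \<approx> thc i j c"
proof -
  have "th (E i j c) \<approx> (\<Sum>u\<in>I. \<Sum>v\<in>I. if u = i then (if v = j then thc i j c else 0) else 0)"
    unfolding th_def using thc_0 by (intro eqB_sum) (auto simp: E_def)
  also have "\<dots> = (\<Sum>u\<in>I. if u = i then (\<Sum>v\<in>I. if v = j then thc i j c else 0) else 0)"
    by (intro sum.cong refl) auto
  also have "\<dots> = thc i j c"
    using assms by simp
  finally show ?thesis .
qed

lemma thc_diag:
  assumes "i \<in> I" "c \<in> part D p"
  shows "thc i i c \<approx> - fscale (ssign i p) (Y p i c)"
proof (cases "i = 1")
  case False
  have "pr (E 1 i (smult D (ssign i p) c)) (E i 1 \<one>) \<approx> fscale (ssign i p) (pr (E 1 i c) (E i 1 \<one>))"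
    by (rule prE_add(4)) (use False assms I12 in auto)
  from eqB_neg[OF this] show ?thesis
    using False tw_hom[OF assms(2), of i] by (simp add: thc_def Y_def H_def)
qed (simp add: thc_def Y_def)

lemma th_diff: "th (x - y) \<approx> th x - th y"
proof -
  have "th ((x - y) + y) - th y \<approx> (th (x - y) + th y) - th y"
    by (rule eqB_diff[OF th_add eqB_refl])
  then have "th x - th y \<approx> th (x - y)"
    by simp
  then show ?thesis
    by (rule eqB_sym)
qed

text \<open>The terms \<open>Y\<close> in \<open>H_sg\<close> depend only on the two diagonal
  entries of the bracket, and \<open>th\<close> is made to return just these. What remains is the
  common term \<open>sg\<close>.\<close>

lemma weight_zero:
  assumes ij: "i \<in> I" "j \<in> I" "i \<noteq> j" and ab: "a \<in> part D p" "b \<in> part D q"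
  shows "pr (E i j a) (E j i b) \<approx> th (br (E i j a) (E j i b)) + fscale (ssign i (p + q)) (sg [a, b])"
proof -
  let ?e = "eps ((par i + par j + p) * (par j + par i + q)) :: 'r"
  let ?s = "\<lambda>i. ssign i (p + q)"
  have ba: "b \<turnstile> a \<in> part D (p + q)" "a \<stileturn> b \<in> part D (p + q)"
    using rprod_degree[OF ab(2,1)] lprod_degree[OF ab] by (simp_all add: add.commute)
  have sgn: "?e * ?s j = ?s i * eps (p * q)"
    unfolding ssign_def by (cases "par i"; cases "par j"; cases "par 1"; cases p; cases q) simp_all
  have "th (br (E i j a) (E j i b)) \<approx> th (E i i (a \<stileturn> b)) - th (E j j (smult D ?e (b \<turnstile> a)))"
    unfolding br_E[OF ij(1,2,2,1) ab] using th_diff by simp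
  also have "\<dots> \<approx> - fscale (?s i) (Y (p + q) i (a \<stileturn> b)) - fscale ?e (- fscale (?s j) (Y (p + q) j (b \<turnstile> a)))"
  proof (rule eqB_diff)
    show "th (E i i (a \<stileturn> b)) \<approx> - fscale (?s i) (Y (p + q) i (a \<stileturn> b))"
      by (rule eqB_trans[OF th_E thc_diag]) (fact ij ba)+
    have "th (E j j (smult D ?e (b \<turnstile> a))) \<approx> fscale ?e (th (E j j (b \<turnstile> a)))"
      unfolding E_simps by (rule th_scale)
    also have "\<dots> \<approx> fscale ?e (- fscale (?s j) (Y (p + q) j (b \<turnstile> a)))"
      by (rule eqB_scale[OF eqB_trans[OF th_E thc_diag]]) (fact ij ba)+
    finally show "th (E j j (smult D ?e (b \<turnstile> a))) \<approx> fscale ?e (- fscale (?s j) (Y (p + q) j (b \<turnstile> a)))" .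
  qed
  finally have th: "th (br (E i j a) (E j i b)) \<approx>
      - fscale (?s i) (Y (p + q) i (a \<stileturn> b)) - fscale ?e (- fscale (?s j) (Y (p + q) j (b \<turnstile> a)))" .
  have "fscale (?s i) (H (p + q) i j a b) \<approx>
      fscale (?s i) (sg [a, b] - Y (p + q) i (a \<stileturn> b) + fscale (eps (p * q)) (Y (p + q) j (b \<turnstile> a)))"
    by (rule eqB_scale[OF H_sg[OF ij ab]])
  then have "pr (E i j a) (E j i b) \<approx>
      fscale (?s i) (sg [a, b] - Y (p + q) i (a \<stileturn> b) + fscale (eps (p * q)) (Y (p + q) j (b \<turnstile> a)))"
    by (simp add: H_def)
  also have "\<dots> = (- fscale (?s i) (Y (p + q) i (a \<stileturn> b)) - fscale ?e (- fscale (?s j) (Y (p + q) j (b \<turnstile> a)))) + fscale (?s i) (sg [a, b])"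
    by (simp only: fs.scale_right_diff_distrib fs.scale_right_distrib fs.scale_minus_right fs.scale_scale sgn) simp
  also have "\<dots> \<approx> th (br (E i j a) (E j i b)) + fscale (ssign i (p + q)) (sg [a, b])"
    by (rule eqB_add[OF eqB_sym[OF th] eqB_refl])
  finally show ?thesis .
qed

lemma root1_th:
  assumes "i \<in> I" "j \<in> I" "l \<in> I" "i \<noteq> j" "j \<noteq> l" "i \<noteq> l" "a \<in> part D p" "b \<in> part D q"
  shows "pr (E i j a) (E j l b) \<approx> th (br (E i j a) (E j l b))"
proof -
  have "pr (E i j a) (E j l b) \<approx> thc i l (a \<stileturn> b)"
    using root1[OF assms] assms by (simp add: thc_def)
  also have "\<dots> \<approx> th (E i l (a \<stileturn> b))"
    by (rule eqB_sym[OF th_E]) (fact assms)+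
  finally show ?thesis
    using assms by (simp add: br_E_gen)
qed

lemma root2_th:
  assumes ijk: "i \<in> I" "j \<in> I" "k \<in> I" "i \<noteq> j" "j \<noteq> k" "i \<noteq> k" and ab: "a \<in> part D p" "b \<in> part D q"
  shows "pr (E i j a) (E k i b) \<approx> th (br (E i j a) (E k i b))"
proof -
  define c where "c = - smult D (eps ((par i + par j + p) * (par k + par i + q))) (b \<turnstile> a)"
  have br: "br (E i j a) (E k i b) = E k j c"
    using ijk by (simp add: br_E[OF _ _ _ _ ab] c_def E_simps)
  have "pr (E i j a) (E k i b) \<approx> thc k j c"
    using root2[OF assms] ijk by (simp add: thc_def br)
  also have "\<dots> \<approx> th (E k j c)"
    by (rule eqB_sym[OF th_E]) (fact assms)+
  finally show ?thesis
    unfolding br .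
qed

lemma lin_sg_FL: "q \<in> FL 2 \<Longrightarrow> lin fscale sg q \<in> l.FL 2"
proof (rule lin_in_subspace[OF module_fscale l.FL_sub])
  assume "q \<in> FL 2"
  then show "q \<in> fs.span (gen ` tlists D 2)"
    by (simp add: FL_span)
  show "lin fscale sg x \<in> l.FL 2" if "x \<in> gen ` tlists D 2" for x
    using that by (auto simp: module_fscale sg_def intro!: fs.subspace_diff[OF l.FL_sub] genL_FL)
qed

text \<open>The correction term in \<open>sg\<close> cancels the entry of the bracket at
  \<open>(2, 2)\<close>. Consequently cycles for \<open>d_1\<close> are lifted to cycles for
  \<open>delta2\<close>.\<close>

lemma br_sg:
  assumes "q \<in> FL 2"
  shows "lin (mat_scale D) brl (lin fscale sg q) = E 1 1 (lin (smult D) hd1 q)"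
proof -
  interpret h: module_hom fscale "mat_scale D" "lin (mat_scale D) brl"
    by (rule module_hom_lin[OF module_mat])
  interpret s: module_hom fscale fscale "lin fscale sg"
    by (rule module_hom_lin[OF module_fscale])
  interpret d: module_hom fscale "smult D" "lin (smult D) hd1"
    by (rule module_hom_lin[OF module])
  have hom: "br (E 1 2 a) (E 2 1 b) - br (E 1 2 (rev a b)) (E 2 1 \<one>) = E 1 1 (hd1 [a, b])"
    if ab: "a \<in> part D p" "b \<in> part D q" for a b p q
  proof -
    have r: "rev a b \<in> part D (p + q)"
      by (rule rev_part[OF ab])
    have e: "eps ((par 1 + par 2 + p) * (par 2 + par 1 + q)) = (eps ((par 1 + par 2 + (p + q)) * (par 2 + par 1 + 0)) * eps (p * q) :: 'r)"
      by (cases "par 1"; cases "par 2"; cases p; cases q) simp_all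
    show ?thesis
      unfolding br_E[OF I12(1,2,2,1) ab] br_E[OF I12(1,2,2,1) r barunit_even] e
      by (simp add: hd1_def E_simps barunit rev_hom[OF ab] mult.commute)
  qed
  have 4: "br (E 1 2 a) (E 2 1 b) - br (E 1 2 (rev a b)) (E 2 1 \<one>) = E 1 1 (hd1 [a, b])" for a b
  proof -
    define F where "F a b = br (E 1 2 a) (E 2 1 b) - br (E 1 2 (rev a b)) (E 2 1 \<one>)" for a b
    have F: "F (a + a') b = F a b + F a' b" "F a (b + b') = F a b + F a b'" for a a' b b'
      using I12 by (simp_all add: F_def rev_simps E_simps br_add)
    have D: "hd1 [a + a', b] = hd1 [a, b] + hd1 [a', b]" "hd1 [a, b + b'] = hd1 [a, b] + hd1 [a, b']" for a a' b b'
      by (simp_all add: hd1_def mul_simps rev_simps)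
    have "F (cmp 0 a + cmp 1 a) (cmp 0 b + cmp 1 b) = E 1 1 (hd1 [cmp 0 a + cmp 1 a, cmp 0 b + cmp 1 b])"
      unfolding F D E_simps using hom[OF cmp_simps(3) cmp_simps(3)] unfolding F_def[symmetric] by simp
    then show ?thesis
      by (simp only: cmp_sum_eq F_def)
  qed
  show ?thesis
    using assms unfolding FL_span
  proof (induction q rule: fs.span_induct_alt)
    case base
    show ?case
      by (simp add: E_simps)
  next
    case (step c x y)
    then obtain a b where x: "x = gen [a, b]"
      by (auto simp: tlists_D length_Suc_conv numeral_2_eq_2)
    have "lin (mat_scale D) brl (lin fscale sg x) = E 1 1 (hd1 [a, b])"
      unfolding 4[symmetric] by (simp add: x module_fscale sg_def h.diff module_mat brl_def)
    then show ?case
      using step by (simp add: s.add s.scale h.add h.scale d.add d.scale E_simps x module)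
  qed
qed

end

text \<open>
  The exceptional weights: for \<open>t < r\<close> the class of \<open>E (wi t) (wj t) a \<otimes> E (wk t) (wl t) 1\<close>
  depends on \<open>a\<close> modulo \<open>J t\<close> only, and the cocycle \<open>\<Psi> t\<close> detects it.
\<close>

locale exceptional_weights = sl3_algebra D m n
  for D :: "('r::comm_ring_1, 'd::ab_group_add) superdialgebra" (structure) and m n :: nat +
  fixes r :: nat and wi wj wk wl :: "nat \<Rightarrow> nat"
    and J :: "nat \<Rightarrow> 'd set" and \<Psi> :: "nat \<Rightarrow> (nat \<Rightarrow> nat \<Rightarrow> 'd) \<Rightarrow> (nat \<Rightarrow> nat \<Rightarrow> 'd) \<Rightarrow> 'd"
  assumes w_in: "t < r \<Longrightarrow> wi t \<in> I \<and> wj t \<in> I \<and> wk t \<in> I \<and> wl t \<in> I"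
    and w_ne: "t < r \<Longrightarrow> wi t \<noteq> wj t \<and> wk t \<noteq> wl t \<and> wj t \<noteq> wk t \<and> wi t \<noteq> wl t"
    and J_sub: "t < r \<Longrightarrow> module.subspace (smult D) (J t)"
    and commuting: "\<lbrakk>i \<in> I; j \<in> I; k \<in> I; l \<in> I; i \<noteq> j; k \<noteq> l; j \<noteq> k; i \<noteq> l; a \<in> part D p; b \<in> part D q\<rbrakk> \<Longrightarrow>
      pr (E i j a) (E k l b) \<in> fs.span (BL \<union> {pr (E (wi t) (wj t) c) (E (wk t) (wl t) \<one>) | t c. t < r})"
    and J_kills: "\<lbrakk>t < r; a \<in> J t\<rbrakk> \<Longrightarrow> pr (E (wi t) (wj t) a) (E (wk t) (wl t) \<one>) \<in> BL"
    and Psi_add: "t < r \<Longrightarrow> \<Psi> t (x + y) z = \<Psi> t x z + \<Psi> t y z" "t < r \<Longrightarrow> \<Psi> t z (x + y) = \<Psi> t z x + \<Psi> t z y"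
    and Psi_scale: "t < r \<Longrightarrow> \<Psi> t (mat_scale D c x) z = smult D c (\<Psi> t x z)"
      "t < r \<Longrightarrow> \<Psi> t z (mat_scale D c x) = smult D c (\<Psi> t z x)"
    and Psi_degree: "\<lbrakk>t < r; x \<in> part L p; y \<in> part L q\<rbrakk> \<Longrightarrow>
      \<Psi> t x y \<in> part D (p + q + (par (wi t) + par (wj t) + par (wk t) + par (wl t)))"
    and Psi_cocycle: "\<lbrakk>t < r; x \<in> part L p; y \<in> part L q; z \<in> part L q'\<rbrakk> \<Longrightarrow>
      \<Psi> t x (br y z) - \<Psi> t (br x y) z + smult D (eps (q * q')) (\<Psi> t (br x z) y) \<in> J t"
    and Psi_weight: "\<lbrakk>t < r; s < r\<rbrakk> \<Longrightarrow>
      \<Psi> s (E (wi t) (wj t) a) (E (wk t) (wl t) \<one>) - (if s = t then a else 0) \<in> J s"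
    and Psi_12: "t < r \<Longrightarrow> \<Psi> t (E 1 2 a) (E 2 1 b) = 0"
begin

section \<open>Normal forms of tensors\<close>

definition om :: "nat \<Rightarrow> 'd \<Rightarrow> (nat \<Rightarrow> nat \<Rightarrow> 'd) list \<Rightarrow>\<^sub>0 'r" where
  "om t a = pr (E (wi t) (wj t) a) (E (wk t) (wl t) \<one>)"

lemma om_add: "t < r \<Longrightarrow> om t (a + b) \<approx> om t a + om t b"
  unfolding om_def using w_in[of t] w_ne[of t] by (intro prE_add(2) E_L) auto

lemma om_scale: "t < r \<Longrightarrow> om t (smult D c a) \<approx> fscale c (om t a)"
  unfolding om_def using w_in[of t] w_ne[of t] by (intro prE_add(4) E_L) auto

lemma om_0: "t < r \<Longrightarrow> om t 0 \<approx> 0"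
  using om_scale[of t 0 0] by simp

lemma om_FL: "t < r \<Longrightarrow> om t a \<in> l.FL 2"
  unfolding om_def using w_in[of t] w_ne[of t] by (intro genL_FL E_L) auto

lemma br_om: "t < r \<Longrightarrow> lin (mat_scale D) brl (om t a) = 0"
  unfolding om_def using w_in[of t] w_ne[of t] by (simp add: module_mat brl_def br_E_gen)

text \<open>The first summand is controlled by the bracket, the second by the trace cocycle, the
  third by the cocycles \<open>\<Psi>\<close>.\<close>

definition nf :: "(nat \<Rightarrow> nat \<Rightarrow> 'd) \<Rightarrow> ('d list \<Rightarrow>\<^sub>0 'r) \<Rightarrow> (nat \<Rightarrow> 'd) \<Rightarrow> (nat \<Rightarrow> nat \<Rightarrow> 'd) list \<Rightarrow>\<^sub>0 'r" where
  "nf x q f = th x + lin fscale sg q + (\<Sum>t<r. om t (f t))"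

text \<open>The first argument of \<open>nf\<close> is the bracket of \<open>u\<close> itself, so
  that for a cycle \<open>u\<close> the summand \<open>th\<close> is a boundary and only
  \<open>q\<close> and \<open>f\<close> are left.\<close>

definition "Sp = {u \<in> l.FL 2. \<exists>q\<in>FL 2. \<exists>f. u \<approx> nf (lin (mat_scale D) brl u) q f}"

lemma nf_add: "nf (x + y) (q + q') (f + f') \<approx> nf x q f + nf y q' f'"
proof -
  interpret s: module_hom fscale fscale "lin fscale sg"
    by (rule module_hom_lin[OF module_fscale])
  have "nf (x + y) (q + q') (f + f') \<approx> (th x + th y) + (lin fscale sg q + lin fscale sg q') + ((\<Sum>t<r. om t (f t)) + (\<Sum>t<r. om t (f' t)))"
    unfolding nf_def s.add sum.distrib[symmetric]
    by (rule eqB_add[OF eqB_add[OF th_add eqB_refl] eqB_sum]) (simp add: om_add)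
  also have "\<dots> = nf x q f + nf y q' f'"
    by (simp add: nf_def)
  finally show ?thesis .
qed

lemma nf_scale: "nf (mat_scale D c x) (fscale c q) (\<lambda>t. smult D c (f t)) \<approx> fscale c (nf x q f)"
proof -
  interpret s: module_hom fscale fscale "lin fscale sg"
    by (rule module_hom_lin[OF module_fscale])
  show ?thesis
    unfolding nf_def s.scale fs.scale_right_distrib fs.scale_sum_right
    by (intro eqB_add eqB_refl th_scale eqB_sum om_scale) simp
qed

lemma Sp_sub: "fs.subspace Sp"
proof -
  interpret b: module_hom fscale "mat_scale D" "lin (mat_scale D) brl"
    by (rule module_hom_lin[OF module_mat])
  have sc: "fscale c u \<in> Sp" if "u \<in> Sp" for c u
  proof -
    obtain q f where u: "u \<in> l.FL 2" "q \<in> FL 2" "u \<approx> nf (lin (mat_scale D) brl u) q f"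
      using \<open>u \<in> Sp\<close> unfolding Sp_def by blast
    have "fscale c u \<approx> nf (lin (mat_scale D) brl (fscale c u)) (fscale c q) (\<lambda>t. smult D c (f t))"
      unfolding b.scale by (rule eqB_trans[OF eqB_scale[OF u(3)] eqB_sym[OF nf_scale]])
    then show ?thesis
      unfolding Sp_def using fs.subspace_scale[OF l.FL_sub u(1)] fs.subspace_scale[OF FL_sub u(2)] by blast
  qed
  show ?thesis
  proof (rule fs.subspaceI)
    show "0 \<in> Sp"
    proof -
      have "(0 :: (nat \<Rightarrow> nat \<Rightarrow> 'd) list \<Rightarrow>\<^sub>0 'r) \<approx> nf 0 0 0"
      proof -
        have "nf 0 0 0 \<approx> 0 + lin fscale sg 0 + (\<Sum>t<r. 0)"
          unfolding nf_def by (intro eqB_add eqB_refl th_0 eqB_sum) (simp add: om_0)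
        then have "nf 0 0 0 \<approx> 0"
          by (simp add: lin_def)
        then show ?thesis
          by (rule eqB_sym)
      qed
      moreover have "lin (mat_scale D) brl 0 = 0"
        by (simp add: lin_def)
      ultimately show ?thesis
        unfolding Sp_def using fs.subspace_0[OF l.FL_sub] fs.subspace_0[OF FL_sub]
        by (intro CollectI conjI bexI[of _ 0] exI[of _ 0]) simp_all
    qed
    show "u + v \<in> Sp" if uv: "u \<in> Sp" "v \<in> Sp" for u v
    proof -
      obtain q f where u: "u \<in> l.FL 2" "q \<in> FL 2" "u \<approx> nf (lin (mat_scale D) brl u) q f"
        using uv(1) unfolding Sp_def by blast
      obtain q' f' where v: "v \<in> l.FL 2" "q' \<in> FL 2" "v \<approx> nf (lin (mat_scale D) brl v) q' f'"
        using uv(2) unfolding Sp_def by blast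
      have "u + v \<approx> nf (lin (mat_scale D) brl (u + v)) (q + q') (f + f')"
        unfolding b.add by (rule eqB_trans[OF eqB_add[OF u(3) v(3)] eqB_sym[OF nf_add]])
      then show ?thesis
        unfolding Sp_def using fs.subspace_add[OF l.FL_sub u(1) v(1)] fs.subspace_add[OF FL_sub u(2) v(2)] by blast
    qed
  qed (rule sc)
qed

lemma SpI:
  assumes "u \<in> l.FL 2" "q \<in> FL 2" "u \<approx> nf (lin (mat_scale D) brl u) q f"
  shows "u \<in> Sp"
  using assms unfolding Sp_def by blast

lemma BL_Sp: "u \<in> BL \<Longrightarrow> u \<in> Sp"
proof (rule SpI[of u 0 0])
  assume u: "u \<in> BL"
  then show "u \<in> l.FL 2"
    using BL_KL by (auto simp: KL_def)
  show "0 \<in> FL 2"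
    by (rule fs.subspace_0[OF FL_sub])
  have b: "lin (mat_scale D) brl u = 0"
    using u BL_KL by (auto simp: KL_def)
  have "nf 0 0 0 \<approx> 0 + lin fscale sg 0 + (\<Sum>t<r. 0)"
    unfolding nf_def by (intro eqB_add eqB_refl th_0 eqB_sum) (simp add: om_0)
  then have "nf 0 0 0 \<approx> 0"
    by (simp add: lin_def)
  moreover have "u \<approx> 0"
    using u by (simp add: eqB_0)
  ultimately show "u \<approx> nf (lin (mat_scale D) brl u) 0 0"
    unfolding b using eqB_trans eqB_sym by blast
qed

lemma Sp_cong:
  assumes "u \<approx> v" "v \<in> Sp"
  shows "u \<in> Sp"
  using fs.subspace_add[OF Sp_sub BL_Sp[OF assms(1)[unfolded eqB_def]] assms(2)] by simp

lemma th_Sp: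
  assumes "u \<in> l.FL 2" "u \<approx> th (lin (mat_scale D) brl u)"
  shows "u \<in> Sp"
proof (rule SpI[of u 0 0])
  have "nf (lin (mat_scale D) brl u) 0 0 \<approx> th (lin (mat_scale D) brl u) + lin fscale sg 0 + (\<Sum>t<r. 0)"
    unfolding nf_def by (intro eqB_add eqB_refl eqB_sum) (simp add: om_0)
  then have "nf (lin (mat_scale D) brl u) 0 0 \<approx> th (lin (mat_scale D) brl u)"
    by (simp add: lin_def)
  from eqB_trans[OF assms(2) eqB_sym[OF this]] show "u \<approx> nf (lin (mat_scale D) brl u) 0 0" .
qed (use assms fs.subspace_0[OF FL_sub] in auto)

lemma om_Sp:
  assumes "t < r"
  shows "om t c \<in> Sp"
proof (rule SpI[of _ 0 "\<lambda>s. if s = t then c else 0"])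
  have "nf 0 0 (\<lambda>s. if s = t then c else 0) \<approx> 0 + lin fscale sg 0 + (\<Sum>s<r. if s = t then om t c else 0)"
    unfolding nf_def by (intro eqB_add eqB_refl th_0 eqB_sum) (simp add: om_0)
  then have "nf 0 0 (\<lambda>s. if s = t then c else 0) \<approx> om t c"
    using assms by (simp add: lin_def)
  then show "om t c \<approx> nf (lin (mat_scale D) brl (om t c)) 0 (\<lambda>s. if s = t then c else 0)"
    unfolding br_om[OF assms] by (rule eqB_sym)
qed (use assms fs.subspace_0[OF FL_sub] om_FL in auto)

text \<open>The four cases are weight zero, the two kinds of weights that are roots, and commuting
  root vectors, the last being covered by the axiom \<open>commuting\<close>.\<close>

lemma EE_Sp_hom:
  assumes ijkl: "i \<in> I" "j \<in> I" "k \<in> I" "l \<in> I" "i \<noteq> j" "k \<noteq> l" and ab: "a \<in> part D p" "b \<in> part D q"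
  shows "pr (E i j a) (E k l b) \<in> Sp"
proof -
  have FL: "pr (E i j a) (E k l b) \<in> l.FL 2"
    using ijkl by (intro genL_FL E_L)
  have br: "lin (mat_scale D) brl (pr (E i j a) (E k l b)) = br (E i j a) (E k l b)"
    by (simp add: module_mat brl_def)
  consider "j = k" "i = l" | "j = k" "i \<noteq> l" | "j \<noteq> k" "i = l" | "j \<noteq> k" "i \<noteq> l"
    by blast
  then show ?thesis
  proof cases
    case 1
    let ?q = "fscale (ssign i (p + q)) (gen [a, b])"
    interpret s: module_hom fscale fscale "lin fscale sg"
      by (rule module_hom_lin[OF module_fscale])
    have "nf (br (E i j a) (E j i b)) ?q 0 \<approx> th (br (E i j a) (E j i b)) + fscale (ssign i (p + q)) (sg [a, b]) + (\<Sum>t<r. 0)"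
      unfolding nf_def s.scale lin_gen[OF module_fscale] by (intro eqB_add eqB_refl eqB_sum) (simp add: om_0)
    then have 2: "nf (br (E i j a) (E j i b)) ?q 0 \<approx> th (br (E i j a) (E j i b)) + fscale (ssign i (p + q)) (sg [a, b])"
      by simp
    have "pr (E i j a) (E k l b) \<approx> nf (lin (mat_scale D) brl (pr (E i j a) (E k l b))) ?q 0"
      unfolding br unfolding 1[symmetric] by (rule eqB_trans[OF weight_zero[OF ijkl(1,2,5) ab] eqB_sym[OF 2]])
    then show ?thesis
      by (rule SpI[OF FL fs.subspace_scale[OF FL_sub gen2_FL]])
  next
    case 2
    show ?thesis
      by (rule th_Sp[OF FL]) (use 2 ijkl root1_th[OF ijkl(1,2,4) _ _ _ ab] in \<open>simp add: module_mat brl_def\<close>)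
  next
    case 3
    show ?thesis
      by (rule th_Sp[OF FL]) (use 3 ijkl root2_th[OF ijkl(1,2,3) _ _ _ ab] in \<open>simp add: module_mat brl_def\<close>)
  next
    case 4
    have "fs.span (BL \<union> {pr (E (wi t) (wj t) c) (E (wk t) (wl t) \<one>) | t c. t < r}) \<subseteq> Sp"
      using BL_Sp om_Sp by (intro fs.span_minimal[OF _ Sp_sub]) (auto simp: om_def)
    then show ?thesis
      using commuting[OF ijkl(1-6) 4 ab] by blast
  qed
qed

lemma EE_Sp:
  assumes ijkl: "i \<in> I" "j \<in> I" "k \<in> I" "l \<in> I" "i \<noteq> j" "k \<noteq> l"
  shows "pr (E i j a) (E k l b) \<in> Sp"
proof -
  have 1: "pr (E i j (cmp p a)) (E k l b) \<in> Sp" for p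
  proof -
    have "pr (E i j (cmp p a)) (E k l (cmp 0 b + cmp 1 b)) \<in> Sp"
      by (rule Sp_cong[OF prE_add(1) fs.subspace_add[OF Sp_sub EE_Sp_hom[OF ijkl cmp_simps(3) cmp_simps(3)]
            EE_Sp_hom[OF ijkl cmp_simps(3) cmp_simps(3)]]]) (use ijkl in auto)
    then show ?thesis
      by (simp only: cmp_sum_eq)
  qed
  have "pr (E i j (cmp 0 a + cmp 1 a)) (E k l b) \<in> Sp"
    by (rule Sp_cong[OF prE_add(2) fs.subspace_add[OF Sp_sub 1 1]]) (use ijkl in auto)
  then show ?thesis
    by (simp only: cmp_sum_eq)
qed

lemma pr_span:
  assumes "x \<in> g.md.span A" "A \<subseteq> supermodule.carrier L" "y \<in> supermodule.carrier L"
  shows "(\<forall>a\<in>A. pr a y \<in> Sp) \<Longrightarrow> pr x y \<in> Sp" "(\<forall>a\<in>A. pr y a \<in> Sp) \<Longrightarrow> pr y x \<in> Sp"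
proof -
  have 0: "pr 0 y \<in> Sp" "pr y 0 \<in> Sp"
    using pr_zero[OF assms(3)] by (auto simp: eqB_0 intro: BL_Sp)
  show "pr x y \<in> Sp" if A: "\<forall>a\<in>A. pr a y \<in> Sp"
  proof -
    have "x \<in> supermodule.carrier L \<and> pr x y \<in> Sp"
      using assms(1)
    proof (induction x rule: g.md.span_induct_alt)
      case base
      show ?case
        using 0 L_closed(5) by blast
    next
      case (step c a x)
      then have c: "a \<in> supermodule.carrier L" "mat_scale D c a \<in> supermodule.carrier L" "x \<in> supermodule.carrier L"
        using assms(2) L_closed(4) by auto
      have "pr (mat_scale D c a) y \<in> Sp"
        by (rule Sp_cong[OF pr_scale(1)[OF c(1) assms(3)] fs.subspace_scale[OF Sp_sub]]) (use A step in blast)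
      then have "pr (mat_scale D c a + x) y \<in> Sp"
        using step by (intro Sp_cong[OF pr_add(1)[OF c(2,3) assms(3)] fs.subspace_add[OF Sp_sub]]) blast+
      then show ?case
        using L_closed(1)[OF c(2,3)] by (simp only: G_simps(2))
    qed
    then show ?thesis ..
  qed
  show "pr y x \<in> Sp" if A: "\<forall>a\<in>A. pr y a \<in> Sp"
  proof -
    have "x \<in> supermodule.carrier L \<and> pr y x \<in> Sp"
      using assms(1)
    proof (induction x rule: g.md.span_induct_alt)
      case base
      show ?case
        using 0 L_closed(5) by blast
    next
      case (step c a x)
      then have c: "a \<in> supermodule.carrier L" "mat_scale D c a \<in> supermodule.carrier L" "x \<in> supermodule.carrier L"
        using assms(2) L_closed(4) by auto
      have "pr y (mat_scale D c a) \<in> Sp"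
        by (rule Sp_cong[OF pr_scale(2)[OF c(1) assms(3)] fs.subspace_scale[OF Sp_sub]]) (use A step in blast)
      then have "pr y (mat_scale D c a + x) \<in> Sp"
        using step by (intro Sp_cong[OF pr_add(2)[OF c(2,3) assms(3)] fs.subspace_add[OF Sp_sub]]) blast+
      then show ?case
        using L_closed(1)[OF c(2,3)] by (simp only: G_simps(2))
    qed
    then show ?thesis ..
  qed
qed

lemma L_span': "supermodule.carrier L = g.md.span (homE \<union> homH)"
  using L_span N3 by simp

lemma E_homE:
  assumes "i \<in> I" "j \<in> I" "i \<noteq> j"
  shows "E i j a \<in> g.md.span homE"
proof -
  have "E i j (cmp p a) \<in> g.md.span homE" for p
    unfolding homE_def using assms cmp_simps(3) by (intro g.md.span_base) blast
  then have "E i j (cmp 0 a) + E i j (cmp 1 a) \<in> g.md.span homE"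
    by (intro g.md.span_add)
  then show ?thesis
    by (simp only: E_simps(1)[symmetric] cmp_sum_eq)
qed

lemma homE_L: "homE \<subseteq> supermodule.carrier L"
  using homEH_L by blast

text \<open>Lets a diagonal element be absorbed into a bracket without leaving the span of the root
  vectors.\<close>

lemma diag_E:
  assumes h: "h \<in> homH" and kl: "k \<in> I" "l \<in> I" "k \<noteq> l"
  shows "br h (E k l c) \<in> g.md.span homE"
proof -
  obtain i j a b p q where ij: "h = br (E i j a) (E j i b)" "i \<in> I" "j \<in> I" "i \<noteq> j" "a \<in> part D p" "b \<in> part D q"
    using h unfolding homH_def by blast
  have 1: "br (E u u d) (E k l c) \<in> g.md.span homE" if "u \<in> I" "d \<in> part D q" for u d q
  proof -
    have 2: "br (E u u d) (E k l (cmp p c)) \<in> g.md.span homE" for p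
      unfolding br_E[OF that(1) that(1) kl(1,2) that(2) cmp_simps(3)]
      using kl E_homE that by (auto intro!: g.md.span_diff g.md.span_zero g.md.span_neg)
    have "br (E u u d) (E k l (cmp 0 c) + E k l (cmp 1 c)) = br (E u u d) (E k l (cmp 0 c)) + br (E u u d) (E k l (cmp 1 c))"
      using that kl by (intro br_add) auto
    then have "br (E u u d) (E k l (cmp 0 c) + E k l (cmp 1 c)) \<in> g.md.span homE"
      using 2 g.md.span_add by (simp only:)
    then show ?thesis
      by (simp only: E_simps(1)[symmetric] cmp_sum_eq)
  qed
  have d: "a \<stileturn> b \<in> part D (p + q)" "smult D s (b \<turnstile> a) \<in> part D (q + p)" for s
    using lprod_degree[OF ij(5,6)] rprod_degree[OF ij(6,5)] part_closed(3) by auto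
  have "h = E i i (a \<stileturn> b) - E j j (smult D (eps ((par i + par j + p) * (par j + par i + q))) (b \<turnstile> a))"
    unfolding ij(1) br_E[OF ij(2,3,3,2) ij(5,6)] by simp
  then have "br h (E k l c) = br (E i i (a \<stileturn> b)) (E k l c) - br (E j j (smult D (eps ((par i + par j + p) * (par j + par i + q))) (b \<turnstile> a))) (E k l c)"
    using ij kl by (simp add: br_diff)
  also have "\<dots> \<in> g.md.span homE"
    by (rule g.md.span_diff[OF 1[OF ij(2) d(1)] 1[OF ij(3) d(2)]])
  finally show ?thesis .
qed

text \<open>Root vectors on the left are settled by \<open>EE_Sp\<close>. For a diagonal
  \<open>h\<close> on the left, \<open>E k l b\<close> is written as a bracket through a third
  index; in both Leibniz terms \<open>h\<close> then disappears into a bracket with a root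
  vector.\<close>

lemma xE_Sp:
  assumes x: "x \<in> supermodule.carrier L" and kl: "k \<in> I" "l \<in> I" "k \<noteq> l"
  shows "pr x (E k l b) \<in> Sp"
proof -
  have EL: "E k l b \<in> supermodule.carrier L"
    using kl by simp
  have span_E: "pr u (E v w c) \<in> Sp" if "u \<in> g.md.span homE" "v \<in> I" "w \<in> I" "v \<noteq> w" for u v w c
    by (rule pr_span(1)[OF that(1) homE_L]) (use that EE_Sp in \<open>auto simp: homE_def\<close>)
  have "pr h (E k l (cmp p b)) \<in> Sp" if h: "h \<in> homH" for h p
  proof -
    define w where "w = third k l"
    have w: "w \<in> I" "w \<noteq> k" "w \<noteq> l"
      using third by (auto simp: w_def)
    let ?y = "E k w (cmp p b)" and ?z = "E w l \<one>"
    have hL: "h \<in> supermodule.carrier L"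
      using h homEH_L by blast
    have "pr h (br ?y ?z) \<approx> pr (br h ?y) ?z - fscale (eps ((par k + par w + p) * (par w + par l + 0))) (pr (br h ?z) ?y)"
      using w kl by (intro leib hL E_partL cmp_simps(3) barunit_even) auto
    moreover have "pr (br h ?y) ?z - fscale (eps ((par k + par w + p) * (par w + par l + 0))) (pr (br h ?z) ?y) \<in> Sp"
      using w kl by (intro fs.subspace_diff[OF Sp_sub] fs.subspace_scale[OF Sp_sub] span_E diag_E h) auto
    ultimately have "pr h (br ?y ?z) \<in> Sp"
      by (rule Sp_cong)
    then show ?thesis
      using w kl by (simp add: br_E_gen barunit)
  qed
  then have "pr h (E k l (cmp 0 b + cmp 1 b)) \<in> Sp" if "h \<in> homH" for h
    using that kl homEH_L by (intro Sp_cong[OF prE_add(1) fs.subspace_add[OF Sp_sub]]) auto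
  then have "\<forall>h\<in>homE \<union> homH. pr h (E k l b) \<in> Sp"
    using span_E[OF g.md.span_base kl] by (auto simp: cmp_sum_eq)
  then show ?thesis
    using pr_span(1)[OF _ homEH_L EL] x L_span' by blast
qed

text \<open>The same device for the right factor: the elements of \<open>homH\<close> are brackets
  of root vectors, and the Leibniz relation moves \<open>x\<close> into brackets, for which
  \<open>xE_Sp\<close> permits arbitrary elements of \<open>L\<close>.\<close>

lemma FL_Sp: "l.FL 2 \<subseteq> Sp"
  unfolding l.FL_span
proof (rule fs.span_minimal[OF _ Sp_sub], safe)
  fix xs
  assume "xs \<in> tlists L 2"
  then obtain x y where xs: "xs = [x, y]" and xy: "x \<in> supermodule.carrier L" "y \<in> supermodule.carrier L"
    by (auto simp: tlists_def length_Suc_conv numeral_2_eq_2)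
  have "pr x h \<in> Sp" if h: "h \<in> homH" for h
  proof -
    obtain i j a b p q where ij: "h = br (E i j a) (E j i b)" "i \<in> I" "j \<in> I" "i \<noteq> j" "a \<in> part D p" "b \<in> part D q"
      using h unfolding homH_def by blast
    let ?y = "E i j a" and ?z = "E j i b"
    have "pr x (br ?y ?z) \<approx> pr (br x ?y) ?z - fscale (eps ((par i + par j + p) * (par j + par i + q))) (pr (br x ?z) ?y)"
      using ij by (intro leib xy E_partL) auto
    moreover have "pr (br x ?y) ?z - fscale (eps ((par i + par j + p) * (par j + par i + q))) (pr (br x ?z) ?y) \<in> Sp"
      using ij by (intro fs.subspace_diff[OF Sp_sub] fs.subspace_scale[OF Sp_sub] xE_Sp L_closed(6) xy E_L) auto
    ultimately show ?thesis
      unfolding ij(1) by (rule Sp_cong)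
  qed
  moreover have "pr x h \<in> Sp" if "h \<in> homE" for h
    using that xE_Sp[OF xy(1)] by (auto simp: homE_def)
  ultimately have "pr x y \<in> Sp"
    using pr_span(2)[OF _ homEH_L xy(1)] xy(2) L_span' by blast
  then show "gen xs \<in> Sp"
    by (simp add: xs)
qed

end

section \<open>The trace cocycle\<close>

context unital_superdialgebra
begin

definition eqH (infix "\<simeq>" 50) where "u \<simeq> v \<longleftrightarrow> u - v \<in> BH"

lemma eqH_refl [simp]: "u \<simeq> u"
  by (simp add: eqH_def fs.subspace_0[OF BH_sub])

lemma eqH_sym: "u \<simeq> v \<Longrightarrow> v \<simeq> u"
  using fs.subspace_neg[OF BH_sub] by (fastforce simp: eqH_def)

lemma eqH_trans [trans]: "u \<simeq> v \<Longrightarrow> v \<simeq> w \<Longrightarrow> u \<simeq> w"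
  unfolding eqH_def using fs.subspace_add[OF BH_sub, of "u - v" "v - w"] by simp

lemma eqH_trans_eq [trans]: "u = v \<Longrightarrow> v \<simeq> w \<Longrightarrow> u \<simeq> w" "u \<simeq> v \<Longrightarrow> v = w \<Longrightarrow> u \<simeq> w"
  by simp_all

lemma eqH_add: "u \<simeq> v \<Longrightarrow> u' \<simeq> v' \<Longrightarrow> u + u' \<simeq> v + v'"
  unfolding eqH_def using fs.subspace_add[OF BH_sub, of "u - v" "u' - v'"] by (simp add: algebra_simps)

lemma eqH_diff: "u \<simeq> v \<Longrightarrow> u' \<simeq> v' \<Longrightarrow> u - u' \<simeq> v - v'"
  unfolding eqH_def using fs.subspace_diff[OF BH_sub, of "u - v" "u' - v'"] by (simp add: algebra_simps)

lemma eqH_scale: "u \<simeq> v \<Longrightarrow> fscale c u \<simeq> fscale c v"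
  unfolding eqH_def using fs.subspace_scale[OF BH_sub, of "u - v" c] by (simp add: fs.scale_right_diff_distrib)

lemma eqH_sum: "(\<And>k. k \<in> A \<Longrightarrow> f k \<simeq> h k) \<Longrightarrow> sum f A \<simeq> sum h A"
  unfolding eqH_def by (simp add: sum_subtractf[symmetric] fs.subspace_sum[OF BH_sub])

lemma eqH_0: "u \<simeq> 0 \<longleftrightarrow> u \<in> BH"
  by (simp add: eqH_def)

lemma gen2_add: "gen [x + y, z] \<simeq> gen [x, z] + gen [y, z]" "gen [z, x + y] \<simeq> gen [z, x] + gen [z, y]"
  using Rel2_add Rel_BH by (auto simp: eqH_def diff_diff_eq)

lemma gen2_scale: "gen [smult D c x, z] \<simeq> fscale c (gen [x, z])" "gen [z, smult D c x] \<simeq> fscale c (gen [z, x])"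
  using Rel2_scale Rel_BH by (auto simp: eqH_def)

lemma gen2_zero: "gen [0, z] \<simeq> 0" "gen [z, 0] \<simeq> 0"
  using gen2_scale(1)[of 0 0 z] gen2_scale(2)[of z 0 0] by simp_all

lemma gen2_diff: "gen [x - y, z] \<simeq> gen [x, z] - gen [y, z]" "gen [z, x - y] \<simeq> gen [z, x] - gen [z, y]"
proof -
  have "gen [(x - y) + y, z] - gen [y, z] \<simeq> (gen [x - y, z] + gen [y, z]) - gen [y, z]"
    "gen [z, (x - y) + y] - gen [z, y] \<simeq> (gen [z, x - y] + gen [z, y]) - gen [z, y]"
    by (rule eqH_diff[OF gen2_add(1) eqH_refl], rule eqH_diff[OF gen2_add(2) eqH_refl])
  then have "gen [x, z] - gen [y, z] \<simeq> gen [x - y, z]" "gen [z, x] - gen [z, y] \<simeq> gen [z, x - y]"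
    by simp_all
  then show "gen [x - y, z] \<simeq> gen [x, z] - gen [y, z]" "gen [z, x - y] \<simeq> gen [z, x] - gen [z, y]"
    by (auto intro: eqH_sym)
qed

lemma gen2_sum: "finite A \<Longrightarrow> gen [\<Sum>k\<in>A. f k, z] \<simeq> (\<Sum>k\<in>A. gen [f k, z])"
  "finite A \<Longrightarrow> gen [z, \<Sum>k\<in>A. f k] \<simeq> (\<Sum>k\<in>A. gen [z, f k])"
proof -
  show "gen [\<Sum>k\<in>A. f k, z] \<simeq> (\<Sum>k\<in>A. gen [f k, z])" if "finite A"
    using that
  proof (induction A rule: finite_induct)
    case (insert x A)
    have "gen [f x + (\<Sum>k\<in>A. f k), z] \<simeq> gen [f x, z] + (\<Sum>k\<in>A. gen [f k, z])"
      by (rule eqH_trans[OF gen2_add(1) eqH_add[OF eqH_refl insert.IH]])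
    then show ?case
      using insert by simp
  qed (simp add: gen2_zero)
  show "gen [z, \<Sum>k\<in>A. f k] \<simeq> (\<Sum>k\<in>A. gen [z, f k])" if "finite A"
    using that
  proof (induction A rule: finite_induct)
    case (insert x A)
    have "gen [z, f x + (\<Sum>k\<in>A. f k)] \<simeq> gen [z, f x] + (\<Sum>k\<in>A. gen [z, f k])"
      by (rule eqH_trans[OF gen2_add(2) eqH_add[OF eqH_refl insert.IH]])
    then show ?case
      using insert by simp
  qed (simp add: gen2_zero)
qed

lemma gen2_bar: "gen [a, b \<turnstile> c] \<simeq> gen [a, b \<stileturn> c]"
proof -
  have "gen [a, b \<stileturn> c] - gen [a, b \<turnstile> c] \<in> BH"
    unfolding BH_def by (rule fs.span_base) (auto simp: Igen_def)
  then show ?thesis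
    by (intro eqH_sym[of _ "gen [a, b \<turnstile> c]"]) (simp only: eqH_def)
qed

text \<open>A boundary \<open>d_2\<close>, solved for its cyclic term.\<close>

lemma gen2_cycle:
  assumes "a \<in> part D p" "b \<in> part D q" "c \<in> part D s"
  shows "gen [a, b \<stileturn> c] - gen [a \<stileturn> b, c] \<simeq> fscale (eps (s * (p + q))) (gen [c \<turnstile> a, b])"
proof -
  have "hd2 [p, q, s] [a, b, c] \<in> hom_image 3 hd2"
    unfolding hom_image_def using assms
    by (intro CollectI exI[of _ "[p, q, s]"] exI[of _ "[a, b, c]"]) (simp add: tlists_D)
  then have "hd2 [p, q, s] [a, b, c] \<in> BH"
    unfolding BH_def by (intro fs.span_base) blast
  then have "- hd2 [p, q, s] [a, b, c] \<in> BH"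
    by (rule fs.subspace_neg[OF BH_sub])
  then show ?thesis
    by (simp add: eqH_def hd2_def algebra_simps)
qed

text \<open>The boundary \<open>d_2\<close> of \<open>c \<otimes> \<one> \<otimes> \<one>\<close> is
  \<open>c \<otimes> \<one>\<close>, since its first two terms cancel.\<close>

lemma gen2_one: "gen [c, \<one>] \<simeq> 0"
proof -
  have 1: "gen [c, \<one>] \<simeq> 0" if "c \<in> part D p" for c p
  proof -
    have "gen [c, \<one> \<stileturn> \<one>] - gen [c \<stileturn> \<one>, \<one>] \<simeq> fscale (eps (0 * (p + 0))) (gen [\<one> \<turnstile> c, \<one>])"
      by (rule gen2_cycle[OF that barunit_even barunit_even])
    then have "0 \<simeq> gen [c, \<one>]"
      by (simp add: barunit)
    then show ?thesis
      by (rule eqH_sym)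
  qed
  have "gen [cmp 0 c + cmp 1 c, \<one>] \<simeq> 0 + 0"
    by (rule eqH_trans[OF gen2_add(1) eqH_add[OF 1 1]]) (rule cmp_simps(3))+
  then show ?thesis
    by (simp add: cmp_sum_eq)
qed

end

context sl3_algebra
begin

section \<open>The supertrace pairing of two matrices\<close>

definition ph :: "bit list \<Rightarrow> (nat \<Rightarrow> nat \<Rightarrow> 'd) list \<Rightarrow> 'd list \<Rightarrow>\<^sub>0 'r" where
  "ph ds xs = (\<Sum>i\<in>I. \<Sum>j\<in>I. fscale (ssign i (ds ! 0 + ds ! 1)) (gen [(xs ! 0) i j, (xs ! 1) j i]))"

definition Phi :: "(nat \<Rightarrow> nat \<Rightarrow> 'd) list \<Rightarrow> 'd list \<Rightarrow>\<^sub>0 'r" where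
  "Phi xs = (\<Sum>ds | length ds = 2. ph ds (map2 l.cmp ds xs))"

lemma mlin_ph: "l.mlin 2 fscale BH (ph ds)"
proof -
  have 1: "fscale s (fscale c u) = fscale c (fscale s u)" for s c :: 'r and u :: "'d list \<Rightarrow>\<^sub>0 'r"
    by (simp add: mult.commute)
  have A: "ph ds [x + y, z] \<simeq> ph ds [x, z] + ph ds [y, z]" "ph ds [z, x + y] \<simeq> ph ds [z, x] + ph ds [z, y]" for x y z
    unfolding ph_def nth_Cons_0 nth_Cons_Suc One_nat_def plus_fun_apply sum.distrib[symmetric] fs.scale_right_distrib[symmetric]
    by (intro eqH_sum eqH_scale gen2_add)+
  have B: "ph ds [mat_scale D c x, z] \<simeq> fscale c (ph ds [x, z])" "ph ds [z, mat_scale D c x] \<simeq> fscale c (ph ds [z, x])" for x z c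
    unfolding ph_def nth_Cons_0 nth_Cons_Suc One_nat_def mat_scale_def fs.scale_sum_right 1[of c]
    by (intro eqH_sum eqH_scale gen2_scale)+
  show ?thesis
    by (rule l.mlin_lists2I) (use A B in \<open>simp_all add: eqH_def diff_diff_eq L_simps(2)\<close>)
qed

lemma mlin_Phi: "l.mlin 2 fscale BH Phi"
  unfolding Phi_def by (rule l.mlin_components[OF module_fscale BH_sub mlin_ph])

lemma Phi_hom:
  assumes "x \<in> part L p" "y \<in> part L q"
  shows "Phi [x, y] \<simeq> ph [p, q] [x, y]"
proof -
  have xs: "[x, y] \<in> tlists L 2" "list_all2 (\<lambda>x p. x \<in> part L p) [x, y] [p, q]"
    using assms by (auto simp: tlists_def L_part)
  have "Phi [x, y] = ph [p, q] (map2 l.cmp [p, q] [x, y]) + (\<Sum>es\<in>{es. length es = 2} - {[p, q]}. ph es (map2 l.cmp es [x, y]))"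
    unfolding Phi_def by (rule sum.remove) auto
  also have "\<dots> \<simeq> ph [p, q] [x, y] + (\<Sum>es\<in>{es. length es = 2} - {[p, q]}. 0)"
  proof (intro eqH_add eqH_sum)
    show "ph [p, q] (map2 l.cmp [p, q] [x, y]) \<simeq> ph [p, q] [x, y]"
      using l.map2_cmp_same[OF xs(2)] by simp
    fix es :: "bit list"
    assume es: "es \<in> {es. length es = 2} - {[p, q]}"
    then have "0 \<in> set (map2 l.cmp es [x, y])" "map2 l.cmp es [x, y] \<in> tlists L 2"
      using l.map2_cmp_other[OF xs(2)] l.map2_cmp_tlists[OF xs(1)] by auto
    then show "ph es (map2 l.cmp es [x, y]) \<simeq> 0"
      using l.mlin_zero[OF module_fscale mlin_ph] by (simp add: eqH_0)
  qed
  finally show ?thesis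
    by simp
qed

lemma sum3_rotate: "(\<Sum>i\<in>I. \<Sum>j\<in>I. \<Sum>k\<in>I. f i j k) = (\<Sum>i\<in>I. \<Sum>j\<in>I. \<Sum>k\<in>I. f k i j)"
proof -
  have "(\<Sum>i\<in>I. \<Sum>j\<in>I. \<Sum>k\<in>I. f k i j) = (\<Sum>i\<in>I. \<Sum>k\<in>I. \<Sum>j\<in>I. f k i j)"
    by (rule sum.cong[OF refl]) (rule sum.swap)
  also have "\<dots> = (\<Sum>k\<in>I. \<Sum>i\<in>I. \<Sum>j\<in>I. f k i j)"
    by (rule sum.swap)
  finally show ?thesis ..
qed

lemma entry_part: "x \<in> part L p \<Longrightarrow> x i j \<in> part D (par i + par j + p)"
  by (auto simp: L_part G_simps)

text \<open>\<open>gen2_cycle\<close> entry by entry, followed by a cyclic renaming of the indices.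
  The change from \<open>ssign i\<close> to \<open>ssign k\<close> compensates the index parities in
  the sign of the cyclic term.\<close>

lemma cycle_sum:
  assumes xyz: "x \<in> part L p" "y \<in> part L q" "z \<in> part L s"
  shows "(\<Sum>i\<in>I. \<Sum>j\<in>I. \<Sum>k\<in>I. fscale (ssign i (p + q + s)) (gen [x i j, y j k \<stileturn> z k i])) -
      (\<Sum>i\<in>I. \<Sum>j\<in>I. \<Sum>k\<in>I. fscale (ssign i (p + q + s)) (gen [x i j \<stileturn> y j k, z k i])) \<simeq>
      fscale (eps (s * (p + q))) (\<Sum>i\<in>I. \<Sum>j\<in>I. \<Sum>k\<in>I. fscale (ssign i (p + q + s)) (gen [z i j \<turnstile> x j k, y k i]))"
proof -
  have sgn: "ssign i (p + q + s) * eps ((par k + par i + s) * (par i + par j + p + (par j + par k + q))) =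
      eps (s * (p + q)) * ssign k (p + q + s)" for i j k
    unfolding ssign_def
    by (cases "par i"; cases "par j"; cases "par k"; cases "par 1"; cases p; cases q; cases s) simp_all
  have "(\<Sum>i\<in>I. \<Sum>j\<in>I. \<Sum>k\<in>I. fscale (ssign i (p + q + s)) (gen [x i j, y j k \<stileturn> z k i])) -
      (\<Sum>i\<in>I. \<Sum>j\<in>I. \<Sum>k\<in>I. fscale (ssign i (p + q + s)) (gen [x i j \<stileturn> y j k, z k i])) =
      (\<Sum>i\<in>I. \<Sum>j\<in>I. \<Sum>k\<in>I. fscale (ssign i (p + q + s)) (gen [x i j, y j k \<stileturn> z k i] - gen [x i j \<stileturn> y j k, z k i]))"
    by (simp add: sum_subtractf fs.scale_right_diff_distrib)
  also have "\<dots> \<simeq> (\<Sum>i\<in>I. \<Sum>j\<in>I. \<Sum>k\<in>I. fscale (ssign i (p + q + s))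
      (fscale (eps ((par k + par i + s) * (par i + par j + p + (par j + par k + q)))) (gen [z k i \<turnstile> x i j, y j k])))"
    by (intro eqH_sum eqH_scale gen2_cycle entry_part xyz)
  also have "\<dots> = (\<Sum>i\<in>I. \<Sum>j\<in>I. \<Sum>k\<in>I. fscale (eps (s * (p + q))) (fscale (ssign k (p + q + s)) (gen [z k i \<turnstile> x i j, y j k])))"
    by (simp only: fs.scale_scale sgn)
  also have "\<dots> = fscale (eps (s * (p + q))) (\<Sum>i\<in>I. \<Sum>j\<in>I. \<Sum>k\<in>I. fscale (ssign i (p + q + s)) (gen [z i j \<turnstile> x j k, y k i]))"
    unfolding fs.scale_sum_right
    by (rule sum3_rotate[of "\<lambda>i j k. fscale (eps (s * (p + q))) (fscale (ssign i (p + q + s)) (gen [z i j \<turnstile> x j k, y k i]))", symmetric])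
  finally show ?thesis .
qed

text \<open>Entries of the bracket contain \<open>z j k \<turnstile> y k i\<close>, here in the
  second tensor factor. There \<open>I\<close> is divided out, so both sums can be written with
  \<open>\<stileturn>\<close>.\<close>

lemma ph_right:
  assumes "y \<in> part L q" "z \<in> part L s"
  shows "ph [p, q + s] [x, br y z] \<simeq>
    (\<Sum>i\<in>I. \<Sum>j\<in>I. \<Sum>k\<in>I. fscale (ssign i (p + q + s)) (gen [x i j, y j k \<stileturn> z k i])) -
    fscale (eps (q * s)) (\<Sum>i\<in>I. \<Sum>j\<in>I. \<Sum>k\<in>I. fscale (ssign i (p + q + s)) (gen [x i j, z j k \<stileturn> y k i]))"
proof -
  have yz: "y \<in> part G q" "z \<in> part G s"
    using assms by (auto simp: L_part)
  have sw: "fscale (ssign i d) (fscale e u) = fscale e (fscale (ssign i d) u)" for i d e and u :: "'d list \<Rightarrow>\<^sub>0 'r"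
    by (simp add: mult.commute)
  have 1: "gen [a, br y z j i] \<simeq> (\<Sum>k\<in>I. gen [a, y j k \<stileturn> z k i]) - fscale (eps (q * s)) (\<Sum>k\<in>I. gen [a, z j k \<stileturn> y k i])" for a i j
  proof -
    have "gen [a, br y z j i] \<simeq> gen [a, \<Sum>k\<in>I. y j k \<stileturn> z k i] - gen [a, smult D (eps (q * s)) (\<Sum>k\<in>I. z j k \<turnstile> y k i)]"
      unfolding br_hom_entry[OF yz] by (rule gen2_diff)
    also have "\<dots> \<simeq> (\<Sum>k\<in>I. gen [a, y j k \<stileturn> z k i]) - fscale (eps (q * s)) (\<Sum>k\<in>I. gen [a, z j k \<stileturn> y k i])"
    proof (rule eqH_diff[OF gen2_sum(2)[OF finite_I]])
      show "gen [a, smult D (eps (q * s)) (\<Sum>k\<in>I. z j k \<turnstile> y k i)] \<simeq> fscale (eps (q * s)) (\<Sum>k\<in>I. gen [a, z j k \<stileturn> y k i])"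
        by (rule eqH_trans[OF gen2_scale(2) eqH_scale[OF eqH_trans[OF gen2_sum(2)[OF finite_I] eqH_sum[OF gen2_bar]]]])
    qed
    finally show ?thesis .
  qed
  have "ph [p, q + s] [x, br y z] \<simeq> (\<Sum>i\<in>I. \<Sum>j\<in>I. fscale (ssign i (p + q + s))
      ((\<Sum>k\<in>I. gen [x i j, y j k \<stileturn> z k i]) - fscale (eps (q * s)) (\<Sum>k\<in>I. gen [x i j, z j k \<stileturn> y k i])))"
    unfolding ph_def nth_Cons_0 nth_Cons_Suc One_nat_def add.assoc[symmetric] by (intro eqH_sum eqH_scale 1)
  then show ?thesis
    by (simp only: fs.scale_right_diff_distrib fs.scale_sum_right sum_subtractf sw)
qed

lemma ph_left:
  assumes "x \<in> part L p" "y \<in> part L q"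
  shows "ph [p + q, s] [br x y, z] \<simeq>
    (\<Sum>i\<in>I. \<Sum>j\<in>I. \<Sum>k\<in>I. fscale (ssign i (p + q + s)) (gen [x i j \<stileturn> y j k, z k i])) -
    fscale (eps (p * q)) (\<Sum>i\<in>I. \<Sum>j\<in>I. \<Sum>k\<in>I. fscale (ssign i (p + q + s)) (gen [y i j \<turnstile> x j k, z k i]))"
proof -
  have xy: "x \<in> part G p" "y \<in> part G q"
    using assms by (auto simp: L_part)
  have sw: "fscale (ssign i d) (fscale e u) = fscale e (fscale (ssign i d) u)" for i d e and u :: "'d list \<Rightarrow>\<^sub>0 'r"
    by (simp add: mult.commute)
  have 1: "gen [br x y i k, c] \<simeq> (\<Sum>j\<in>I. gen [x i j \<stileturn> y j k, c]) - fscale (eps (p * q)) (\<Sum>j\<in>I. gen [y i j \<turnstile> x j k, c])" for c i k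
  proof -
    have "gen [br x y i k, c] \<simeq> gen [\<Sum>j\<in>I. x i j \<stileturn> y j k, c] - gen [smult D (eps (p * q)) (\<Sum>j\<in>I. y i j \<turnstile> x j k), c]"
      unfolding br_hom_entry[OF xy] by (rule gen2_diff)
    also have "\<dots> \<simeq> (\<Sum>j\<in>I. gen [x i j \<stileturn> y j k, c]) - fscale (eps (p * q)) (\<Sum>j\<in>I. gen [y i j \<turnstile> x j k, c])"
    proof (rule eqH_diff[OF gen2_sum(1)[OF finite_I]])
      show "gen [smult D (eps (p * q)) (\<Sum>j\<in>I. y i j \<turnstile> x j k), c] \<simeq> fscale (eps (p * q)) (\<Sum>j\<in>I. gen [y i j \<turnstile> x j k, c])"
        by (rule eqH_trans[OF gen2_scale(1) eqH_scale[OF gen2_sum(1)[OF finite_I]]])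
    qed
    finally show ?thesis .
  qed
  have "ph [p + q, s] [br x y, z] \<simeq> (\<Sum>i\<in>I. \<Sum>k\<in>I. fscale (ssign i (p + q + s))
      ((\<Sum>j\<in>I. gen [x i j \<stileturn> y j k, z k i]) - fscale (eps (p * q)) (\<Sum>j\<in>I. gen [y i j \<turnstile> x j k, z k i])))"
    unfolding ph_def nth_Cons_0 nth_Cons_Suc One_nat_def by (intro eqH_sum eqH_scale 1)
  also have "\<dots> = (\<Sum>i\<in>I. \<Sum>k\<in>I. \<Sum>j\<in>I. fscale (ssign i (p + q + s)) (gen [x i j \<stileturn> y j k, z k i])) -
    fscale (eps (p * q)) (\<Sum>i\<in>I. \<Sum>k\<in>I. \<Sum>j\<in>I. fscale (ssign i (p + q + s)) (gen [y i j \<turnstile> x j k, z k i]))"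
    by (simp only: fs.scale_right_diff_distrib fs.scale_sum_right sum_subtractf sw)
  also have "\<dots> = (\<Sum>i\<in>I. \<Sum>j\<in>I. \<Sum>k\<in>I. fscale (ssign i (p + q + s)) (gen [x i j \<stileturn> y j k, z k i])) -
    fscale (eps (p * q)) (\<Sum>i\<in>I. \<Sum>j\<in>I. \<Sum>k\<in>I. fscale (ssign i (p + q + s)) (gen [y i j \<turnstile> x j k, z k i]))"
    by (rule arg_cong2[where f = "\<lambda>u v. u - fscale (eps (p * q)) v"]; rule sum.cong[OF refl]; rule sum.swap)
  finally show ?thesis .
qed

text \<open>After expansion six triple sums remain. \<open>cycle_sum\<close> relates three of them
  for the order \<open>x, y, z\<close> and the other three for the order
  \<open>x, z, y\<close>.\<close>

lemma Phi_d3: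
  assumes xyz: "x \<in> part L p" "y \<in> part L q" "z \<in> part L s"
  shows "Phi [x, br y z] - Phi [br x y, z] + fscale (eps (q * s)) (Phi [br x z, y]) \<in> BH"
proof -
  let ?A = "\<lambda>x y z. \<Sum>i\<in>I. \<Sum>j\<in>I. \<Sum>k\<in>I. fscale (ssign i (p + q + s)) (gen [x i j, y j k \<stileturn> z k i])"
  let ?B = "\<lambda>x y z. \<Sum>i\<in>I. \<Sum>j\<in>I. \<Sum>k\<in>I. fscale (ssign i (p + q + s)) (gen [x i j \<stileturn> y j k, z k i])"
  let ?C = "\<lambda>x y z. \<Sum>i\<in>I. \<Sum>j\<in>I. \<Sum>k\<in>I. fscale (ssign i (p + q + s)) (gen [x i j \<turnstile> y j k, z k i])"
  have br: "br y z \<in> part L (q + s)" "br x y \<in> part L (p + q)" "br x z \<in> part L (p + s)"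
    using xyz br_part L_closed(6) by (auto simp: L_part)
  have d: "p + s + q = p + q + s" by (simp only: ac_simps)
  define A1 A2 B1 B2 C1 C2 where "A1 = ?A x y z" and "A2 = ?A x z y" and "B1 = ?B x y z" and "B2 = ?B x z y"
    and "C1 = ?C z x y" and "C2 = ?C y x z"
  have 1: "Phi [x, br y z] \<simeq> A1 - fscale (eps (q * s)) A2"
    unfolding A1_def A2_def by (rule eqH_trans[OF Phi_hom[OF xyz(1) br(1)] ph_right[OF xyz(2,3)]])
  have 2: "Phi [br x y, z] \<simeq> B1 - fscale (eps (p * q)) C2"
    unfolding B1_def C2_def by (rule eqH_trans[OF Phi_hom[OF br(2) xyz(3)] ph_left[OF xyz(1,2)]])
  have 3: "Phi [br x z, y] \<simeq> B2 - fscale (eps (p * s)) C1"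
    using eqH_trans[OF Phi_hom[OF br(3) xyz(2)] ph_left[OF xyz(1,3)]] unfolding B2_def C1_def d .
  have 4: "A1 - B1 \<simeq> fscale (eps (s * (p + q))) C1"
    using cycle_sum[OF xyz] unfolding A1_def B1_def C1_def .
  have 5: "A2 - B2 \<simeq> fscale (eps (q * (p + s))) C2"
    using cycle_sum[OF xyz(1,3,2)] unfolding A2_def B2_def C2_def d .
  have e: "eps (q * s) * eps (p * s) = (eps (s * (p + q)) :: 'r)" "eps (q * s) * eps (q * (p + s)) = (eps (p * q) :: 'r)"
    by (cases p; cases q; cases s; simp)+
  have "Phi [x, br y z] - Phi [br x y, z] + fscale (eps (q * s)) (Phi [br x z, y]) \<simeq>
      (A1 - fscale (eps (q * s)) A2) - (B1 - fscale (eps (p * q)) C2) + fscale (eps (q * s)) (B2 - fscale (eps (p * s)) C1)"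
    by (intro eqH_add eqH_diff eqH_scale 1 2 3)
  also have "\<dots> = (A1 - B1) - fscale (eps (q * s)) (A2 - B2) + fscale (eps (p * q)) C2 - fscale (eps (s * (p + q))) C1"
    by (simp only: fs.scale_right_diff_distrib fs.scale_scale e) simp
  also have "\<dots> \<simeq> fscale (eps (s * (p + q))) C1 - fscale (eps (q * s)) (fscale (eps (q * (p + s))) C2)
      + fscale (eps (p * q)) C2 - fscale (eps (s * (p + q))) C1"
    by (intro eqH_add eqH_diff eqH_scale eqH_refl 4 5)
  also have "\<dots> = 0"
    by (simp only: fs.scale_scale e) simp
  finally show ?thesis
    by (simp only: eqH_0)
qed

lemma Phi_BL:
  assumes "u \<in> BL"
  shows "lin fscale Phi u \<in> BH"
proof (rule lin_in_subspace[OF module_fscale BH_sub assms[unfolded BL_def]])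
  interpret h: module_hom fscale fscale "lin fscale Phi"
    by (rule module_hom_lin[OF module_fscale])
  fix u
  assume "u \<in> l.Rel 2 \<union> l.hom_image 3 d3"
  then show "lin fscale Phi u \<in> BH"
  proof
    assume "u \<in> l.Rel 2"
    then show ?thesis
      by (rule l.lin_Rel[OF module_fscale BH_sub mlin_Phi])
  next
    assume "u \<in> l.hom_image 3 d3"
    then obtain p q s x y z where e: "x \<in> part L p" "y \<in> part L q" "z \<in> part L s" "u = d3 [p, q, s] [x, y, z]"
      unfolding hom_image_d3 by blast
    from Phi_d3[OF e(1-3)] show ?thesis
      by (simp add: e(4) d3_def h.add h.diff h.scale module_fscale)
  qed
qed

text \<open>The supertrace, up to the sign that normalizes the position 1.\<close>

definition str :: "(nat \<Rightarrow> nat \<Rightarrow> 'd) \<Rightarrow> 'd" where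
  "str x = (\<Sum>i\<in>I. tw i (x i i))"

lemma str_simps: "str (x + y) = str x + str y" "str (mat_scale D c x) = smult D c (str x)" "str 0 = 0"
  by (simp_all add: str_def tw_simps sum.distrib mat_scale_def md.scale_sum_right)

text \<open>The compatibility of the two differentials: the trace cocycle sends cycles to cycles. It
  is used a second time to see that supertraces of elements of \<open>L\<close> lie in
  \<open>[D, D]\<close>.\<close>

lemma hd1_ph:
  assumes xy: "x \<in> part L p" "y \<in> part L q"
  shows "lin (smult D) hd1 (ph [p, q] [x, y]) = str (br x y)"
proof -
  interpret d: module_hom fscale "smult D" "lin (smult D) hd1"
    by (rule module_hom_lin[OF module])
  have G: "x \<in> part G p" "y \<in> part G q"
    using xy by (auto simp: L_part)
  have h: "hd1 [x i j, y j i] = x i j \<stileturn> y j i - smult D (eps ((par i + par j + p) * (par j + par i + q))) (y j i \<turnstile> x i j)" for i j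
    by (simp add: hd1_def rev_hom[OF entry_part[OF xy(1)] entry_part[OF xy(2)]])
  have sgn: "ssign i (p + q) * eps ((par i + par j + p) * (par j + par i + q)) = ssign j (p + q) * eps (p * q)" for i j
    unfolding ssign_def by (cases "par i"; cases "par j"; cases "par 1"; cases p; cases q) simp_all
  have br: "br x y i i \<in> part D (p + q)" for i
  proof -
    have "br x y i i \<in> part D (par i + par i + (p + q))"
      using br_part[OF G] by (simp only: G_simps mem_Collect_eq)
    then show ?thesis
      by simp
  qed
  have "lin (smult D) hd1 (ph [p, q] [x, y]) = (\<Sum>i\<in>I. \<Sum>j\<in>I. smult D (ssign i (p + q)) (hd1 [x i j, y j i]))"
    by (simp add: ph_def d.sum d.scale module)
  also have "\<dots> = (\<Sum>i\<in>I. \<Sum>j\<in>I. smult D (ssign i (p + q)) (x i j \<stileturn> y j i))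
      - (\<Sum>i\<in>I. \<Sum>j\<in>I. smult D (ssign j (p + q)) (smult D (eps (p * q)) (y j i \<turnstile> x i j)))"
    unfolding h by (simp only: md.scale_right_diff_distrib md.scale_scale sgn sum_subtractf)
  also have "(\<Sum>i\<in>I. \<Sum>j\<in>I. smult D (ssign j (p + q)) (smult D (eps (p * q)) (y j i \<turnstile> x i j))) =
      (\<Sum>i\<in>I. \<Sum>j\<in>I. smult D (ssign i (p + q)) (smult D (eps (p * q)) (y i j \<turnstile> x j i)))"
    by (rule sum.swap)
  finally have 1: "lin (smult D) hd1 (ph [p, q] [x, y]) = (\<Sum>i\<in>I. \<Sum>j\<in>I. smult D (ssign i (p + q)) (x i j \<stileturn> y j i)) -
      (\<Sum>i\<in>I. \<Sum>j\<in>I. smult D (ssign i (p + q)) (smult D (eps (p * q)) (y i j \<turnstile> x j i)))" .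
  show ?thesis
    unfolding 1 str_def tw_hom[OF br]
    unfolding br_hom_entry[OF G]
    by (simp only: md.scale_right_diff_distrib md.scale_sum_right sum_subtractf)
qed

lemma hd1_Phi:
  assumes xy: "x \<in> supermodule.carrier L" "y \<in> supermodule.carrier L"
  shows "lin (smult D) hd1 (Phi [x, y]) = str (br x y)"
proof -
  interpret d: module_hom fscale "smult D" "lin (smult D) hd1"
    by (rule module_hom_lin[OF module])
  have c: "l.cmp p u \<in> part L p" "l.cmp p u \<in> supermodule.carrier G" if "u \<in> supermodule.carrier L" for p u
    using that l.component_in l.component_in_carrier L_G by auto
  have "lin (smult D) hd1 (Phi [x, y]) = (\<Sum>p\<in>UNIV. \<Sum>q\<in>UNIV. lin (smult D) hd1 (ph [p, q] [l.cmp p x, l.cmp q y]))"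
    by (simp add: Phi_def numeral_2_eq_2 sum_lists_bit d.sum sum_bit d.add)
  also have "\<dots> = (\<Sum>p\<in>UNIV. \<Sum>q\<in>UNIV. str (br (l.cmp p x) (l.cmp q y)))"
    using c xy by (intro sum.cong refl hd1_ph) auto
  also have "\<dots> = str (br (l.cmp 0 x + l.cmp 1 x) (l.cmp 0 y + l.cmp 1 y))"
    using c xy by (simp add: sum_bit br_add carrier_closed str_simps)
  finally show ?thesis
    using xy by (simp add: l.component_sum_eq)
qed

lemma hd1_lin_Phi:
  assumes "u \<in> l.FL 2"
  shows "lin fscale Phi u \<in> FL 2" "lin (smult D) hd1 (lin fscale Phi u) = str (lin (mat_scale D) brl u)"
proof -
  interpret b: module_hom fscale "mat_scale D" "lin (mat_scale D) brl"
    by (rule module_hom_lin[OF module_mat])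
  interpret s: module_hom fscale fscale "lin fscale Phi"
    by (rule module_hom_lin[OF module_fscale])
  interpret d: module_hom fscale "smult D" "lin (smult D) hd1"
    by (rule module_hom_lin[OF module])
  have "lin fscale Phi u \<in> FL 2 \<and> lin (smult D) hd1 (lin fscale Phi u) = str (lin (mat_scale D) brl u)"
    using assms unfolding l.FL_span
  proof (induction u rule: fs.span_induct_alt)
    case base
    show ?case
      using fs.subspace_0[OF FL_sub] by (simp add: str_simps del: zero_fun_apply)
  next
    case (step c u v)
    then obtain x y where x: "u = gen [x, y]" "x \<in> supermodule.carrier L" "y \<in> supermodule.carrier L"
      by (auto simp: tlists_def length_Suc_conv numeral_2_eq_2)
    have "Phi [x, y] \<in> FL 2"
      unfolding Phi_def ph_def by (intro fs.subspace_sum[OF FL_sub] fs.subspace_scale[OF FL_sub] gen2_FL)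
    then have "lin fscale Phi u \<in> FL 2" "lin (smult D) hd1 (lin fscale Phi u) = str (lin (mat_scale D) brl u)"
      using hd1_Phi[OF x(2,3)] by (simp_all add: x(1) module_fscale module_mat brl_def)
    then show ?case
      using step(2) fs.subspace_add[OF FL_sub] fs.subspace_scale[OF FL_sub]
      by (simp only: s.add s.scale b.add b.scale d.add d.scale str_simps)
  qed
  then show "lin fscale Phi u \<in> FL 2" "lin (smult D) hd1 (lin fscale Phi u) = str (lin (mat_scale D) brl u)"
    by auto
qed

text \<open>The parities of the positions \<open>(i, j)\<close> and \<open>(j, i)\<close> cancel, so
  each summand has the degree of the pair.\<close>

lemma Phi_part:
  assumes xy: "x \<in> part L p" "y \<in> part L q"
  shows "Phi [x, y] \<in> part (free_lists D 2) (p + q)"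
proof -
  have gens: "gen [a, b] \<in> part (free_lists D 2) (p + q)" if "a \<in> part D u" "b \<in> part D v" "u + v = p + q" for a b u v
    unfolding free_lists_def supermodule.simps
    by (rule fs.span_base) (use that in \<open>force simp: tlists_D intro!: exI[of _ "[u, v]"]\<close>)
  have "l.cmp d x i j \<in> part D (par i + par j + p)" "l.cmp d y i j \<in> part D (par i + par j + q)" for d i j
    using l.component_same[OF xy(1)] l.component_other[OF xy(1)] l.component_same[OF xy(2)] l.component_other[OF xy(2)]
      entry_part[OF xy(1)] entry_part[OF xy(2)] by (cases "d = p"; cases "d = q"; simp)+
  then have "gen [l.cmp d x i j, l.cmp e y j i] \<in> part (free_lists D 2) (p + q)" for d e i j
    by (rule gens) (cases "par i"; cases "par j"; cases p; cases q; simp)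
  moreover have sub: "fs.subspace (part (free_lists D 2) (p + q))"
    by (simp add: free_lists_def)
  ultimately show ?thesis
    by (simp add: Phi_def ph_def numeral_2_eq_2 sum_lists_bit)
      (intro fs.subspace_sum[OF sub[unfolded numeral_2_eq_2]] fs.subspace_scale[OF sub[unfolded numeral_2_eq_2]], simp)
qed

lemma Phi_E12: "Phi [E 1 2 a, E 2 1 b] \<simeq> gen [a, b]"
proof -
  have hom: "Phi [E 1 2 a, E 2 1 b] \<simeq> gen [a, b]" if "a \<in> part D p" "b \<in> part D q" for a b p q
  proof -
    let ?p = "par 1 + par 2 + p" and ?q = "par 2 + par 1 + q"
    have "Phi [E 1 2 a, E 2 1 b] \<simeq> ph [?p, ?q] [E 1 2 a, E 2 1 b]"
      by (intro Phi_hom E_partL I12 that) simp_all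
    also have "\<dots> \<simeq> (\<Sum>i\<in>I. \<Sum>j\<in>I. if i = 1 then if j = 2 then gen [a, b] else 0 else 0)"
      unfolding ph_def
    proof (intro eqH_sum)
      fix i j
      have "fscale c (gen [0 :: 'd, 0]) \<simeq> 0" "gen [0 :: 'd, 0] \<simeq> 0" for c
        using eqH_scale[OF gen2_zero(1), of c] gen2_zero by simp_all
      then show "fscale (ssign i ([?p, ?q] ! 0 + [?p, ?q] ! 1)) (gen [([E 1 2 a, E 2 1 b] ! 0) i j, ([E 1 2 a, E 2 1 b] ! 1) j i]) \<simeq>
          (if i = 1 then if j = 2 then gen [a, b] else 0 else 0)"
        by (auto simp: E_def)
    qed
    also have "\<dots> = (\<Sum>i\<in>I. if i = 1 then (\<Sum>j\<in>I. if j = 2 then gen [a, b] else 0) else 0)"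
      by (intro sum.cong refl) auto
    also have "\<dots> = gen [a, b]"
      using I12 by (simp del: One_nat_def)
    finally show ?thesis .
  qed
  have add: "Phi [E 1 2 (a + a'), E 2 1 b] \<simeq> Phi [E 1 2 a, E 2 1 b] + Phi [E 1 2 a', E 2 1 b]"
    "Phi [E 1 2 a, E 2 1 (b + b')] \<simeq> Phi [E 1 2 a, E 2 1 b] + Phi [E 1 2 a, E 2 1 b']" for a a' b b'
  proof -
    have "[] @ E 1 2 a # [E 2 1 b] \<in> tlists L 2" "[E 1 2 a] @ E 2 1 b # [] \<in> tlists L 2"
      by (simp_all add: tlists_def)
    then have "Phi ([] @ (E 1 2 a + E 1 2 a') # [E 2 1 b]) - Phi ([] @ E 1 2 a # [E 2 1 b]) - Phi ([] @ E 1 2 a' # [E 2 1 b]) \<in> BH"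
      "Phi ([E 1 2 a] @ (E 2 1 b + E 2 1 b') # []) - Phi ([E 1 2 a] @ E 2 1 b # []) - Phi ([E 1 2 a] @ E 2 1 b' # []) \<in> BH"
      using mlin_Phi E12_L unfolding l.mlin_def by blast+
    then show "Phi [E 1 2 (a + a'), E 2 1 b] \<simeq> Phi [E 1 2 a, E 2 1 b] + Phi [E 1 2 a', E 2 1 b]"
      "Phi [E 1 2 a, E 2 1 (b + b')] \<simeq> Phi [E 1 2 a, E 2 1 b] + Phi [E 1 2 a, E 2 1 b']"
      by (simp_all add: eqH_def E_simps diff_diff_eq)
  qed
  have 1: "Phi [E 1 2 (cmp p a), E 2 1 b] \<simeq> gen [cmp p a, b]" for p
  proof -
    have "Phi [E 1 2 (cmp p a), E 2 1 (cmp 0 b + cmp 1 b)] \<simeq> gen [cmp p a, cmp 0 b] + gen [cmp p a, cmp 1 b]"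
      by (rule eqH_trans[OF add(2) eqH_add[OF hom hom]]) (rule cmp_simps(3))+
    also have "\<dots> \<simeq> gen [cmp p a, cmp 0 b + cmp 1 b]"
      by (rule eqH_sym[OF gen2_add(2)])
    finally show ?thesis
      by (simp only: cmp_sum_eq)
  qed
  have "Phi [E 1 2 (cmp 0 a + cmp 1 a), E 2 1 b] \<simeq> gen [cmp 0 a, b] + gen [cmp 1 a, b]"
    by (rule eqH_trans[OF add(1) eqH_add[OF 1 1]])
  also have "\<dots> \<simeq> gen [cmp 0 a + cmp 1 a, b]"
    by (rule eqH_sym[OF gen2_add(1)])
  finally show ?thesis
    by (simp only: cmp_sum_eq)
qed

text \<open>The correction term of \<open>sg\<close> has \<open>\<one>\<close> as its second entry
  and therefore only contributes boundaries, by \<open>gen2_one\<close>.\<close>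

lemma Phi_sg:
  assumes "q \<in> FL 2"
  shows "lin fscale Phi (lin fscale sg q) \<simeq> q"
proof -
  interpret p: module_hom fscale fscale "lin fscale Phi"
    by (rule module_hom_lin[OF module_fscale])
  interpret s: module_hom fscale fscale "lin fscale sg"
    by (rule module_hom_lin[OF module_fscale])
  show ?thesis
    using assms unfolding FL_span
  proof (induction q rule: fs.span_induct_alt)
    case base
    show ?case
      by simp
  next
    case (step c x y)
    then obtain a b where x: "x = gen [a, b]"
      by (auto simp: tlists_D length_Suc_conv numeral_2_eq_2)
    have "lin fscale Phi (lin fscale sg x) = Phi [E 1 2 a, E 2 1 b] - Phi [E 1 2 (rev a b), E 2 1 \<one>]"
      by (simp add: x module_fscale sg_def p.diff)
    also have "\<dots> \<simeq> gen [a, b] - 0"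
      by (rule eqH_diff[OF Phi_E12 eqH_trans[OF Phi_E12 gen2_one]])
    finally have "lin fscale Phi (lin fscale sg x) \<simeq> x"
      by (simp add: x)
    then show ?case
      unfolding p.add s.add p.scale s.scale by (rule eqH_add[OF eqH_scale step(2)])
  qed
qed

text \<open>The pairing multiplies entries at opposite positions; \<open>j \<noteq> k\<close> leaves
  a zero in one factor of every summand.\<close>

lemma Phi_off:
  assumes "i \<in> I" "j \<in> I" "k \<in> I" "l \<in> I" "i \<noteq> j" "k \<noteq> l" "j \<noteq> k"
  shows "Phi [E i j a, E k l b] \<in> BH"
proof -
  have c: "l.cmp p x u v = cmp (par u + par v + p) (x u v)" if "x \<in> supermodule.carrier L" for p x u v
  proof -
    have "g.cmp p x \<in> part L p" "g.cmp (p + 1) x \<in> part L (p + 1)"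
      using g_cmp_L[OF that] g.component_in[OF L_G[OF that]] by (auto simp: L_part)
    moreover have "x = g.cmp p x + g.cmp (p + 1) x"
      using cmpG_sum[OF L_G[OF that]] by (cases p) (simp_all add: add.commute)
    ultimately have "l.cmp p x = g.cmp p x"
      using l.component_eqI by metis
    then show ?thesis
      by (simp add: g_cmp[OF L_G[OF that]])
  qed
  have ph: "ph ds (map2 l.cmp ds [E i j a, E k l b]) \<simeq> 0" if ds: "length ds = 2" for ds
  proof -
    obtain p q where e: "ds = [p, q]"
      using ds by (auto simp: numeral_2_eq_2 length_Suc_conv)
    have z: "fscale s (gen [0, d]) \<simeq> 0" "fscale s (gen [d, 0]) \<simeq> 0" for s d
      using eqH_scale[OF gen2_zero(1), of s d] eqH_scale[OF gen2_zero(2), of s d] by simp_all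
    have "fscale (ssign u (p + q)) (gen [l.cmp p (E i j a) u v, l.cmp q (E k l b) v u]) \<simeq> 0" for u v
      unfolding c[OF E_L[OF assms(1,2,5)]] c[OF E_L[OF assms(3,4,6)]]
      using assms z by (auto simp: E_def)
    then have "ph ds (map2 l.cmp ds [E i j a, E k l b]) \<simeq> (\<Sum>u\<in>I. \<Sum>v\<in>I. 0)"
      unfolding ph_def by (intro eqH_sum) (simp add: e)
    then show ?thesis
      by simp
  qed
  have "Phi [E i j a, E k l b] \<simeq> (\<Sum>ds | length (ds :: bit list) = 2. 0)"
    unfolding Phi_def by (intro eqH_sum ph) (rule CollectD)
  then show ?thesis
    by (simp add: eqH_0)
qed

end

section \<open>The comparison theorem\<close>

text \<open>The scalar action on pairs of representatives, so that the comparison map is a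
  \<open>module_hom\<close> before any quotient is formed.\<close>

definition pscale :: "('r::comm_ring_1, 'd::ab_group_add) superdialgebra \<Rightarrow> 'r \<Rightarrow>
    ('d list \<Rightarrow>\<^sub>0 'r) \<times> (nat \<Rightarrow> 'd) \<Rightarrow> ('d list \<Rightarrow>\<^sub>0 'r) \<times> (nat \<Rightarrow> 'd)" where
  "pscale D c y = (fscale c (fst y), \<lambda>t. smult D c (snd y t))"

lemma (in unital_superdialgebra) module_pscale: "module (pscale D)"
  by unfold_locales
    (simp_all add: pscale_def prod_eq_iff fun_eq_iff fs.scale_right_distrib fs.scale_left_distrib
      md.scale_right_distrib md.scale_left_distrib)

context exceptional_weights
begin

definition psi :: "nat \<Rightarrow> (nat \<Rightarrow> nat \<Rightarrow> 'd) list \<Rightarrow> 'd" where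
  "psi t xs = \<Psi> t (xs ! 0) (xs ! 1)"

text \<open>The target on the level of representatives. The exceptional summands come without a
  cycle condition, with the relations \<open>J t\<close> and with degrees shifted by the parity of
  the four indices.\<close>

definition "Kw = KH \<times> {f. \<forall>t\<ge>r. f t = 0}"
definition "Bw = BH \<times> {f. (\<forall>t<r. f t \<in> J t) \<and> (\<forall>t\<ge>r. f t = 0)}"
definition "Pw p = (part (free_lists D 2) p \<inter> KH) \<times>
  {f. (\<forall>t<r. f t \<in> part D (p + (par (wi t) + par (wj t) + par (wk t) + par (wl t)))) \<and> (\<forall>t\<ge>r. f t = 0)}"

definition \<phi> :: "((nat \<Rightarrow> nat \<Rightarrow> 'd) list \<Rightarrow>\<^sub>0 'r) \<Rightarrow> ('d list \<Rightarrow>\<^sub>0 'r) \<times> (nat \<Rightarrow> 'd)" where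
  "\<phi> u = (lin fscale Phi u, \<lambda>t. if t < r then lin (smult D) (psi t) u else 0)"

lemma hom_\<phi>: "module_hom fscale (pscale D) \<phi>"
proof -
  interpret p: module_hom fscale fscale "lin fscale Phi"
    by (rule module_hom_lin[OF module_fscale])
  have f: "module_hom fscale (smult D) (lin (smult D) (psi t))" for t
    by (rule module_hom_lin[OF module])
  show ?thesis
  proof (rule module_hom.intro[OF module_fscale module_pscale], rule module_hom_axioms.intro)
    show "\<phi> (x + y) = \<phi> x + \<phi> y" for x y
      by (simp add: \<phi>_def prod_eq_iff fun_eq_iff p.add module_hom.add[OF f])
    show "\<phi> (fscale c x) = pscale D c (\<phi> x)" for c x
      by (simp add: \<phi>_def pscale_def prod_eq_iff fun_eq_iff p.scale module_hom.scale[OF f])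
  qed
qed

lemma psi_J:
  assumes t: "t < r" and u: "u \<in> BL"
  shows "lin (smult D) (psi t) u \<in> J t"
proof (rule lin_in_subspace[OF module J_sub[OF t] u[unfolded BL_def]])
  interpret h: module_hom fscale "smult D" "lin (smult D) (psi t)"
    by (rule module_hom_lin[OF module])
  fix u
  assume "u \<in> l.Rel 2 \<union> l.hom_image 3 d3"
  then show "lin (smult D) (psi t) u \<in> J t"
  proof
    assume u: "u \<in> l.Rel 2"
    have "l.mlin 2 (smult D) {0} (psi t)"
      by (rule l.mlin_lists2I) (simp_all only: psi_def nth_Cons_0 nth_Cons_Suc One_nat_def Psi_add[OF t] Psi_scale[OF t] L_simps(2), simp_all)
    from l.lin_Rel[OF module md.subspace_single_0 this u] show ?thesis
      using md.subspace_0[OF J_sub[OF t]] by simp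
  next
    assume "u \<in> l.hom_image 3 d3"
    then obtain p q s x y z where e: "x \<in> part L p" "y \<in> part L q" "z \<in> part L s" "u = d3 [p, q, s] [x, y, z]"
      unfolding hom_image_d3 by blast
    from Psi_cocycle[OF t e(1-3)] show ?thesis
      by (simp add: e(4) d3_def h.add h.diff h.scale module psi_def)
  qed
qed

definition lft :: "('d list \<Rightarrow>\<^sub>0 'r) \<Rightarrow> (nat \<Rightarrow> 'd) \<Rightarrow> (nat \<Rightarrow> nat \<Rightarrow> 'd) list \<Rightarrow>\<^sub>0 'r" where
  "lft q f = lin fscale sg q + (\<Sum>t<r. om t (f t))"

lemma lft_FL: "q \<in> FL 2 \<Longrightarrow> lft q f \<in> l.FL 2"
  unfolding lft_def by (intro fs.subspace_add[OF l.FL_sub] fs.subspace_sum[OF l.FL_sub] lin_sg_FL om_FL) auto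

lemma lft_KL: "q \<in> KH \<Longrightarrow> lft q f \<in> KL"
proof -
  interpret b: module_hom fscale "mat_scale D" "lin (mat_scale D) brl"
    by (rule module_hom_lin[OF module_mat])
  assume q: "q \<in> KH"
  then have "lin (mat_scale D) brl (lft q f) = 0"
    unfolding lft_def b.add b.sum by (simp add: KH_def br_sg br_om E_simps)
  then show ?thesis
    using q lft_FL by (simp add: KL_def KH_def)
qed

text \<open>The two kinds of terms do not interfere: the trace cocycle kills \<open>om t\<close> as
  \<open>wj t \<noteq> wk t\<close>, and \<open>\<Psi> t\<close> vanishes at the positions used by
  \<open>sg\<close>.\<close>

lemma phi_lft:
  assumes q: "q \<in> FL 2"
  shows "lin fscale Phi (lft q f) - q \<in> BH" "t < r \<Longrightarrow> lin (smult D) (psi t) (lft q f) - f t \<in> J t"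
proof -
  interpret p: module_hom fscale fscale "lin fscale Phi"
    by (rule module_hom_lin[OF module_fscale])
  have "lin fscale Phi (om t (f t)) \<in> BH" if "t < r" for t
    using w_in[OF that] w_ne[OF that] by (simp add: om_def module_fscale Phi_off)
  then have "lin fscale Phi (lft q f) \<simeq> q + 0"
    unfolding lft_def p.add p.sum
    by (intro eqH_add Phi_sg q, unfold eqH_0, rule fs.subspace_sum[OF BH_sub]) simp
  then show "lin fscale Phi (lft q f) - q \<in> BH"
    by (simp add: eqH_def)
  show "lin (smult D) (psi t) (lft q f) - f t \<in> J t" if t: "t < r"
  proof -
    interpret h: module_hom fscale "smult D" "lin (smult D) (psi t)"
      by (rule module_hom_lin[OF module])
    interpret s: module_hom fscale fscale "lin fscale sg"
      by (rule module_hom_lin[OF module_fscale])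
    have 0: "lin (smult D) (psi t) (lin fscale sg q) = 0"
      using q unfolding FL_span
    proof (induction q rule: fs.span_induct_alt)
      case base
      show ?case
        by simp
    next
      case (step c x y)
      then obtain a b where x: "x = gen [a, b]"
        by (auto simp: tlists_D length_Suc_conv numeral_2_eq_2)
      have "lin (smult D) (psi t) (lin fscale sg x) = 0"
        using Psi_12[OF t] by (simp add: x module_fscale sg_def h.diff module psi_def)
      then show ?case
        using step by (simp add: s.add s.scale h.add h.scale)
    qed
    have 1: "lin (smult D) (psi t) (om s (f s)) - (if t = s then f s else 0) \<in> J t" if "s < r" for s
      using Psi_weight[OF that t, of "f s"] by (simp add: om_def module psi_def)
    have "(\<Sum>s<r. lin (smult D) (psi t) (om s (f s)) - (if t = s then f s else 0)) \<in> J t"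
      by (rule md.subspace_sum[OF J_sub[OF t]]) (use 1 in simp)
    then show ?thesis
      using t unfolding lft_def h.add h.sum 0 sum_subtractf by (simp add: sum.delta)
  qed
qed

lemma lft_BL:
  assumes "q \<in> BH" "\<And>t. t < r \<Longrightarrow> f t \<in> J t"
  shows "lft q f \<in> BL"
  unfolding lft_def
  by (intro fs.subspace_add[OF BL_sub] fs.subspace_sum[OF BL_sub] sg_BH assms(1))
    (use J_kills assms(2) in \<open>simp add: om_def\<close>)

lemma KL_lft:
  assumes "u \<in> KL"
  obtains q f where "q \<in> FL 2" "u \<approx> lft q f"
proof -
  have u: "u \<in> l.FL 2" "lin (mat_scale D) brl u = 0"
    using assms by (auto simp: KL_def)
  then obtain q f where q: "q \<in> FL 2" "u \<approx> nf 0 q f"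
    using FL_Sp unfolding Sp_def by force
  have "nf 0 q f \<approx> 0 + lft q f"
    unfolding nf_def lft_def add.assoc by (rule eqB_add[OF th_0 eqB_refl])
  then have "u \<approx> lft q f"
    using eqB_trans[OF q(2)] by simp
  then show ?thesis
    using that q by blast
qed

lemma om_part:
  assumes "t < r" "a \<in> part D (p + (par (wi t) + par (wj t) + par (wk t) + par (wl t)))"
  shows "om t a \<in> part (free_lists L 2) p"
proof -
  let ?p = "par (wi t) + par (wj t) + (p + (par (wi t) + par (wj t) + par (wk t) + par (wl t)))"
  let ?q = "par (wk t) + par (wl t) + 0"
  have 1: "E (wi t) (wj t) a \<in> part L ?p" "E (wk t) (wl t) \<one> \<in> part L ?q"
    using E_partL[OF _ _ _ assms(2), of "wi t" "wj t"] E_partL[OF _ _ _ barunit_even, of "wk t" "wl t"]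
      w_in[OF assms(1)] w_ne[OF assms(1)] by auto
  \<comment> \<open>Every index parity occurs twice.\<close>
  have "?p + ?q = p"
    by (cases "par (wi t)"; cases "par (wj t)"; cases "par (wk t)"; cases "par (wl t)"; cases p; simp)
  then have "\<exists>ds. list_all2 (\<lambda>x p. x \<in> part L p) [E (wi t) (wj t) a, E (wk t) (wl t) \<one>] ds \<and> sum_list ds = p"
    using 1 by (intro exI[of _ "[?p, ?q]"]) simp
  moreover have "[E (wi t) (wj t) a, E (wk t) (wl t) \<one>] \<in> tlists L 2"
    using 1 by (simp add: tlists_def L_part)
  ultimately show ?thesis
    unfolding om_def free_lists_def supermodule.simps by (intro fs.span_base) blast
qed

lemma sg_part:
  assumes "q \<in> part (free_lists D 2) p"
  shows "lin fscale sg q \<in> part (free_lists L 2) p"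
proof -
  have sub: "fs.subspace (part (free_lists L 2) p)"
    by (simp add: free_lists_def)
  have gens: "gen [x, y] \<in> part (free_lists L 2) p" if "x \<in> part L u" "y \<in> part L v" "u + v = p" for x y u v
  proof -
    have "\<exists>ds. list_all2 (\<lambda>x p. x \<in> part L p) [x, y] ds \<and> sum_list ds = p"
      using that by (intro exI[of _ "[u, v]"]) simp
    moreover have "[x, y] \<in> tlists L 2"
      using that by (simp add: tlists_def L_part)
    ultimately show ?thesis
      unfolding free_lists_def supermodule.simps by (intro fs.span_base) blast
  qed
  have "q \<in> fs.span {gen xs |xs. xs \<in> tlists D 2 \<and> (\<exists>ds. list_all2 (\<lambda>x p. x \<in> part D p) xs ds \<and> sum_list ds = p)}"
    using assms by (simp add: free_lists_def)
  then show ?thesis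
  proof (rule lin_in_subspace[OF module_fscale sub])
    fix u :: "'d list \<Rightarrow>\<^sub>0 'r"
    assume "u \<in> {gen xs |xs. xs \<in> tlists D 2 \<and> (\<exists>ds. list_all2 (\<lambda>x p. x \<in> part D p) xs ds \<and> sum_list ds = p)}"
    then obtain xs ds where xs: "u = gen xs" "xs \<in> tlists D 2" "list_all2 (\<lambda>x p. x \<in> part D p) xs ds" "sum_list ds = p"
      by blast
    then obtain a b where ab: "xs = [a, b]"
      by (auto simp: tlists_D length_Suc_conv numeral_2_eq_2)
    then obtain c d where cd: "ds = [c, d]" "a \<in> part D c" "b \<in> part D d" "c + d = p"
      using xs by (auto simp: list_all2_Cons1)
    have E12: "E 1 2 e \<in> part L (par 1 + par 2 + v)" "E 2 1 e \<in> part L (par 2 + par 1 + v)" if "e \<in> part D v" for e v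
      using E_partL[OF I12(1,2) _ that] E_partL[OF I12(2,1) _ that] by simp_all
    have "gen [E 1 2 a, E 2 1 b] \<in> part (free_lists L 2) p"
      by (rule gens[OF E12(1)[OF cd(2)] E12(2)[OF cd(3)]])
        (use cd(4) in \<open>cases "par 1"; cases "par 2"; cases c; cases d; simp\<close>)
    moreover have "gen [E 1 2 (rev a b), E 2 1 \<one>] \<in> part (free_lists L 2) p"
      by (rule gens[OF E12(1)[OF rev_part[OF cd(2,3)]] E12(2)[OF barunit_even]])
        (use cd(4) in \<open>cases "par 1"; cases "par 2"; cases c; cases d; simp\<close>)
    ultimately have "gen [E 1 2 a, E 2 1 b] - gen [E 1 2 (rev a b), E 2 1 \<one>] \<in> part (free_lists L 2) p"
      by (rule fs.subspace_diff[OF sub])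
    then show "lin fscale sg u \<in> part (free_lists L 2) p"
      by (simp add: xs(1) ab module_fscale sg_def)
  qed
qed

lemma phi_part:
  assumes "u \<in> part (free_lists L 2) p"
  shows "lin fscale Phi u \<in> part (free_lists D 2) p"
    "t < r \<Longrightarrow> lin (smult D) (psi t) u \<in> part D (p + (par (wi t) + par (wj t) + par (wk t) + par (wl t)))"
proof -
  let ?S = "{gen xs |xs. xs \<in> tlists L 2 \<and> (\<exists>ds. list_all2 (\<lambda>x p. x \<in> part L p) xs ds \<and> sum_list ds = p)}
    :: ((nat \<Rightarrow> nat \<Rightarrow> 'd) list \<Rightarrow>\<^sub>0 'r) set"
  have u: "u \<in> fs.span ?S"
    using assms by (simp add: free_lists_def)
  have S: "\<exists>x y c d. v = gen [x, y] \<and> x \<in> part L c \<and> y \<in> part L d \<and> c + d = p" if v: "v \<in> ?S" for v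
  proof -
    obtain xs ds where xs: "v = gen xs" "xs \<in> tlists L 2" "list_all2 (\<lambda>x p. x \<in> part L p) xs ds" "sum_list ds = p"
      using v by blast
    then obtain x y where xy: "xs = [x, y]"
      by (auto simp: tlists_def length_Suc_conv numeral_2_eq_2)
    then obtain c d where cd: "ds = [c, d]"
      using xs by (auto simp: list_all2_Cons1)
    show ?thesis
      using xs xy cd by auto
  qed
  show "lin fscale Phi u \<in> part (free_lists D 2) p"
  proof (rule lin_in_subspace[OF module_fscale _ u])
    show "fs.subspace (part (free_lists D 2) p)"
      by (simp add: free_lists_def)
    fix v
    assume "v \<in> ?S"
    from S[OF this] show "lin fscale Phi v \<in> part (free_lists D 2) p"
      using Phi_part by (auto simp: module_fscale)
  qed
  show "lin (smult D) (psi t) u \<in> part D (p + (par (wi t) + par (wj t) + par (wk t) + par (wl t)))" if t: "t < r"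
  proof (rule lin_in_subspace[OF module part_sub u])
    fix v
    assume "v \<in> ?S"
    from S[OF this] show "lin (smult D) (psi t) v \<in> part D (p + (par (wi t) + par (wj t) + par (wk t) + par (wl t)))"
      using Psi_degree[OF t] by (auto simp: module psi_def)
  qed
qed

text \<open>\<open>lft\<close> is a right inverse of \<open>\<phi>\<close> modulo \<open>Bw\<close>.
  For injectivity a cycle is replaced by some \<open>lft q f\<close>; if \<open>\<phi>\<close> sends
  it into \<open>Bw\<close>, then \<open>q\<close> and \<open>f\<close> consist of relations, and
  those lift to boundaries by \<open>lft_BL\<close>.\<close>

theorem comparison:
  assumes N: "presents N (pscale D) Kw Bw Pw cl"
  shows "HL2 L \<cong> N"
proof (rule presents_iso[OF presents_HL2 N hom_\<phi>])
  interpret p: module_hom fscale fscale "lin fscale Phi"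
    by (rule module_hom_lin[OF module_fscale])
  show K: "\<phi> u \<in> Kw" if "u \<in> KL" for u
    using hd1_lin_Phi[of u] that by (auto simp: \<phi>_def Kw_def KL_def KH_def str_simps simp del: zero_fun_apply)
  show "\<phi> u \<in> Bw \<longleftrightarrow> u \<in> BL" if u: "u \<in> KL" for u
  proof
    assume "u \<in> BL"
    then show "\<phi> u \<in> Bw"
      using Phi_BL psi_J by (auto simp: \<phi>_def Bw_def)
  next
    assume B: "\<phi> u \<in> Bw"
    obtain q f where q: "q \<in> FL 2" "u \<approx> lft q f"
      using KL_lft[OF u] .
    have d: "u - lft q f \<in> BL"
      using q by (simp add: eqB_def)
    have "lin fscale Phi u - lin fscale Phi (lft q f) \<in> BH"
      using Phi_BL[OF d] by (simp add: p.diff)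
    \<comment> \<open>A telescoping way to write \<open>q\<close> as a combination of three elements
      of \<open>BH\<close>; the same is done for \<open>f t\<close> and \<open>J t\<close>
      below.\<close>
    then have "lin fscale Phi u - (lin fscale Phi u - lin fscale Phi (lft q f)) - (lin fscale Phi (lft q f) - q) \<in> BH"
      using B phi_lft(1)[OF q(1), of f]
      by (intro fs.subspace_diff[OF BH_sub fs.subspace_diff[OF BH_sub]]) (simp_all add: \<phi>_def Bw_def)
    then have qB: "q \<in> BH"
      by simp
    have fJ: "f t \<in> J t" if t: "t < r" for t
    proof -
      interpret h: module_hom fscale "smult D" "lin (smult D) (psi t)"
        by (rule module_hom_lin[OF module])
      have "lin (smult D) (psi t) u \<in> J t"
        using B t by (auto simp: \<phi>_def Bw_def)
      then have "lin (smult D) (psi t) u - lin (smult D) (psi t) (u - lft q f) - (lin (smult D) (psi t) (lft q f) - f t) \<in> J t"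
        using psi_J[OF t d] phi_lft(2)[OF q(1) t, of f]
        by (intro md.subspace_diff[OF J_sub[OF t] md.subspace_diff[OF J_sub[OF t]]])
      then show ?thesis
        by (simp add: h.diff)
    qed
    have "(u - lft q f) + lft q f \<in> BL"
      by (rule fs.subspace_add[OF BL_sub d lft_BL[OF qB fJ]])
    then show "u \<in> BL"
      by simp
  qed
  have lift: "\<phi> (lft (fst y) (snd y)) - y \<in> Bw" if "y \<in> Kw" for y
  proof -
    have "fst y \<in> FL 2" "\<forall>t\<ge>r. snd y t = 0"
      using that by (auto simp: Kw_def KH_def)
    then show ?thesis
      using phi_lft[where q = "fst y" and f = "snd y"] by (auto simp: \<phi>_def Bw_def mem_Times_iff)
  qed
  show "\<exists>u\<in>KL. \<phi> u - y \<in> Bw" if "y \<in> Kw" for y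
  proof -
    have "fst y \<in> KH"
      using that by (auto simp: Kw_def)
    from lft_KL[OF this] lift[OF that] show ?thesis
      by blast
  qed
  have PK: "Pw p \<subseteq> Kw" for p
    by (auto simp: Pw_def Kw_def)
  show "\<exists>u\<in>part (free_lists L 2) p \<inter> KL. \<phi> u - y \<in> Bw" if y: "y \<in> Pw p" for y p
  proof -
    have y': "fst y \<in> KH" "fst y \<in> part (free_lists D 2) p"
      "\<And>t. t < r \<Longrightarrow> snd y t \<in> part D (p + (par (wi t) + par (wj t) + par (wk t) + par (wl t)))"
      using y by (auto simp: Pw_def)
    have "fs.subspace (part (free_lists L 2) p)"
      by (simp add: free_lists_def)
    then have "lft (fst y) (snd y) \<in> part (free_lists L 2) p"
      unfolding lft_def
      by (intro fs.subspace_add[OF _ sg_part[OF y'(2)]] fs.subspace_sum om_part y'(3)) auto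
    then show ?thesis
      using lft_KL[OF y'(1)] lift[OF subsetD[OF PK y]] by blast
  qed
  show "\<exists>y\<in>Pw p. \<phi> u - y \<in> Bw" if u: "u \<in> part (free_lists L 2) p \<inter> KL" for u p
  proof (rule bexI[of _ "\<phi> u"])
    have "0 \<in> Bw"
      using fs.subspace_0[OF BH_sub] md.subspace_0[OF J_sub] by (auto simp: Bw_def zero_prod_def)
    then show "\<phi> u - \<phi> u \<in> Bw"
      by simp
    show "\<phi> u \<in> Pw p"
      using phi_part[of u p] K[of u] u by (auto simp: \<phi>_def Pw_def Kw_def)
  qed
qed

end

section \<open>Presentations of direct sums\<close>

lemma presentsI:
  assumes "module s" "module.subspace s K" "module.subspace s B" "carrier M = cl ` K"
    and "\<And>x y. x \<in> K \<Longrightarrow> y \<in> K \<Longrightarrow> cl (x + y) = cl x + cl y" "\<And>x y. x \<in> K \<Longrightarrow> y \<in> K \<Longrightarrow> cl x = cl y \<longleftrightarrow> x - y \<in> B"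
    and "\<And>c x. x \<in> K \<Longrightarrow> smult M c (cl x) = cl (s c x)" "\<And>p. P p \<subseteq> K" "\<And>p. part M p = cl ` P p"
  shows "presents M s K B P cl"
  using assms unfolding presents_def by simp

lemma presents_module: "presents M s K B P cl \<Longrightarrow> module s"
  by (simp add: presents_def)

lemma presents_dsum:
  assumes M: "presents M s1 K1 B1 P1 c1" and N: "presents N s2 K2 B2 P2 c2"
  shows "presents (M \<oplus> N) (\<lambda>c (x, y). (s1 c x, s2 c y)) (K1 \<times> K2) (B1 \<times> B2) (\<lambda>p. P1 p \<times> P2 p) (map_prod c1 c2)"
proof -
  interpret m1: module s1 using M by (simp add: presents_def)
  interpret m2: module s2 using N by (simp add: presents_def)
  have mod: "module (\<lambda>c (x, y). (s1 c x, s2 c y))"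
    by unfold_locales (auto simp: m1.scale_right_distrib m2.scale_right_distrib m1.scale_left_distrib m2.scale_left_distrib)
  have sub: "module.subspace (\<lambda>c (x, y). (s1 c x, s2 c y)) (A \<times> C)" if "m1.subspace A" "m2.subspace C" for A C
    using that by (auto simp: module.subspace_def[OF mod] m1.subspace_def m2.subspace_def zero_prod_def)
  show ?thesis
  proof (rule presentsI[OF mod sub sub])
    show "supermodule.carrier (M \<oplus> N) = map_prod c1 c2 ` (K1 \<times> K2)"
      using M N by (simp add: dsum_def presents_def map_prod_surj_on[OF refl refl])
    show "part (M \<oplus> N) p = map_prod c1 c2 ` (P1 p \<times> P2 p)" for p
      using M N by (simp add: dsum_def presents_def map_prod_surj_on[OF refl refl])
  qed (use M N in \<open>auto simp: presents_def dsum_def subset_iff\<close>)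
qed

text \<open>From position \<open>r\<close> on \<open>mpower\<close> asks for the constant
  \<open>0\<close> of the type of \<open>M\<close>, which for a quotient is in general no coset;
  hence the case distinction in the class map.\<close>

lemma presents_mpower:
  fixes M :: "('r::comm_ring_1, 'b::comm_monoid_add) supermodule" and r :: nat
  assumes M: "presents M s K B P c"
  shows "presents (mpower M r) (\<lambda>a f t. s a (f t)) {f. (\<forall>t<r. f t \<in> K) \<and> (\<forall>t\<ge>r. f t = 0)}
    {f. (\<forall>t<r. f t \<in> B) \<and> (\<forall>t\<ge>r. f t = 0)} (\<lambda>p. {f. (\<forall>t<r. f t \<in> P p) \<and> (\<forall>t\<ge>r. f t = 0)})
    (\<lambda>f t. if t < r then c (f t) else 0)"
proof -
  interpret m: module s using M by (simp add: presents_def)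
  have mod: "module (\<lambda>a f t. s a (f t))"
    by unfold_locales (auto simp: fun_eq_iff m.scale_right_distrib m.scale_left_distrib)
  have sub: "module.subspace (\<lambda>a f t. s a (f t)) {f. (\<forall>t<r. f t \<in> A) \<and> (\<forall>t\<ge>r. f t = 0)}" if "m.subspace A" for A
    using that by (auto simp: module.subspace_def[OF mod] m.subspace_def)
  have img: "{f. (\<forall>t<r. f t \<in> c ` A) \<and> (\<forall>t\<ge>r. f t = 0)} =
      (\<lambda>f t. if t < r then c (f t) else 0) ` {f. (\<forall>t<r. f t \<in> A) \<and> (\<forall>t\<ge>r. f t = 0)}" for A
  proof (intro set_eqI iffI)
    fix f
    assume f: "f \<in> {f. (\<forall>t<r. f t \<in> c ` A) \<and> (\<forall>t\<ge>r. f t = 0)}"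
    then have "\<forall>t. t < r \<longrightarrow> (\<exists>a\<in>A. f t = c a)"
      by auto
    then obtain h where h: "\<And>t. t < r \<Longrightarrow> h t \<in> A \<and> f t = c (h t)"
      by metis
    show "f \<in> (\<lambda>f t. if t < r then c (f t) else 0) ` {f. (\<forall>t<r. f t \<in> A) \<and> (\<forall>t\<ge>r. f t = 0)}"
      by (rule image_eqI[of _ _ "\<lambda>t. if t < r then h t else 0"]) (use f h in \<open>auto simp: fun_eq_iff\<close>)
  qed auto
  have M': "m.subspace K" "m.subspace B" "carrier M = c ` K" "\<And>p. P p \<subseteq> K" "\<And>p. part M p = c ` P p"
    "\<And>x y. x \<in> K \<Longrightarrow> y \<in> K \<Longrightarrow> c (x + y) = c x + c y" "\<And>x y. x \<in> K \<Longrightarrow> y \<in> K \<Longrightarrow> c x = c y \<longleftrightarrow> x - y \<in> B"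
    "\<And>a x. x \<in> K \<Longrightarrow> smult M a (c x) = c (s a x)"
    using M by (auto simp: presents_def)
  show ?thesis
  proof (rule presentsI[OF mod sub[OF M'(1)] sub[OF M'(2)]], goal_cases)
    case 1
    show ?case
      unfolding img[symmetric] by (simp add: mpower_def M'(3))
  next
    case (2 x y)
    then show ?case
      using M'(6) by (auto simp: fun_eq_iff)
  next
    case (3 x y)
    have "(\<lambda>t. if t < r then c (x t) else 0) = (\<lambda>t. if t < r then c (y t) else 0) \<longleftrightarrow> (\<forall>t<r. c (x t) = c (y t))"
      by (auto simp: fun_eq_iff)
    then show ?case
      using 3 M'(7) by auto
  next
    case (4 a x)
    then show ?case
      using M'(8) by (auto simp: mpower_def fun_eq_iff)
  next
    case (5 p)
    then show ?case
      using M'(4) by blast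
  next
    case (6 p)
    show ?case
      unfolding img[symmetric] by (simp add: mpower_def M'(5))
  qed
qed

text \<open>A change of representatives along \<open>h\<close>, which may have a kernel on
  \<open>K\<close> as long as that lies in \<open>B\<close>.\<close>

lemma presents_transport:
  assumes N: "presents N s' K' B' P' cl" and h: "module_hom s s' h" and K: "module.subspace s K"
    and B: "module.subspace s B"
    and im: "h ` K = K'" "\<And>p. h ` P p = P' p" and P: "\<And>p. P p \<subseteq> K" and e: "\<And>x. x \<in> K \<Longrightarrow> h x \<in> B' \<longleftrightarrow> x \<in> B"
  shows "presents N s K B P (cl \<circ> h)"
proof -
  interpret h: module_hom s s' h by (rule h)
  have N': "carrier N = cl ` K'" "\<And>p. part N p = cl ` P' p"
    "\<And>x y. x \<in> K' \<Longrightarrow> y \<in> K' \<Longrightarrow> cl (x + y) = cl x + cl y" "\<And>x y. x \<in> K' \<Longrightarrow> y \<in> K' \<Longrightarrow> cl x = cl y \<longleftrightarrow> x - y \<in> B'"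
    "\<And>a x. x \<in> K' \<Longrightarrow> smult N a (cl x) = cl (s' a x)"
    using N by (auto simp: presents_def)
  show ?thesis
  proof (rule presentsI[OF h.m1.module_axioms K B])
    show "(cl \<circ> h) x = (cl \<circ> h) y \<longleftrightarrow> x - y \<in> B" if "x \<in> K" "y \<in> K" for x y
      using that N'(4)[of "h x" "h y"] e[of "x - y"] h.m1.subspace_diff[OF K] by (auto simp: im(1)[symmetric] h.diff)
  qed (use N' P in \<open>auto simp: im[symmetric] h.add h.scale image_comp\<close>)
qed

context unital_superdialgebra
begin

lemma comm_sub: "md.subspace (commutators D)" "md.subspace (commutator_ideal D)"
  by (simp_all add: commutators_def commutator_ideal_def)

text \<open>The submodule divided out in \<open>Dquot\<close>; for \<open>k = 0\<close> it is the
  commutator ideal.\<close>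

definition "CI k = smult D (of_nat k) ` UNIV + commutator_ideal D"

lemma CI_sub: "md.subspace (CI k)"
proof (rule md.subspaceI)
  have "smult D (of_nat k) 0 + 0 \<in> CI k"
    unfolding CI_def by (intro set_plus_intro imageI UNIV_I md.subspace_0[OF comm_sub(2)])
  then show "0 \<in> CI k"
    by simp
  show "x + y \<in> CI k" if xy: "x \<in> CI k" "y \<in> CI k" for x y
  proof -
    obtain a b u v where "x = smult D (of_nat k) a + u" "y = smult D (of_nat k) b + v" "u \<in> commutator_ideal D" "v \<in> commutator_ideal D"
      using xy unfolding CI_def set_plus_def by blast
    then have "x + y = smult D (of_nat k) (a + b) + (u + v)" "u + v \<in> commutator_ideal D"
      using md.subspace_add[OF comm_sub(2)] by (auto simp: md.scale_right_distrib)
    then show ?thesis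
      unfolding CI_def set_plus_def by blast
  qed
  show "smult D c x \<in> CI k" if x: "x \<in> CI k" for c x
  proof -
    obtain a u where "x = smult D (of_nat k) a + u" "u \<in> commutator_ideal D"
      using x unfolding CI_def set_plus_def by blast
    then have "smult D c x = smult D (of_nat k) (smult D c a) + smult D c u" "smult D c u \<in> commutator_ideal D"
      using md.subspace_scale[OF comm_sub(2)] by (auto simp: md.scale_right_distrib mult.commute)
    then show ?thesis
      unfolding CI_def set_plus_def by blast
  qed
qed

lemma CI_I: "commutator_ideal D \<subseteq> CI k" "smult D (of_nat k) a \<in> CI k"
proof -
  have "smult D (of_nat k) 0 + u \<in> CI k" if "u \<in> commutator_ideal D" for u
    unfolding CI_def by (intro set_plus_intro imageI UNIV_I that)
  then show "commutator_ideal D \<subseteq> CI k"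
    by auto
  have "smult D (of_nat k) a + 0 \<in> CI k"
    unfolding CI_def by (intro set_plus_intro imageI UNIV_I md.subspace_0[OF comm_sub(2)])
  then show "smult D (of_nat k) a \<in> CI k"
    by simp
qed

lemma CI_minimal:
  assumes S: "md.subspace S" and k: "\<And>a. smult D (of_nat k) a \<in> S" and c: "commutator_ideal D \<subseteq> S"
  shows "CI k \<subseteq> S"
  using md.subspace_add[OF S] k c unfolding CI_def set_plus_def by blast

lemma presents_Dquot: "presents (Dquot D k) (smult D) UNIV (CI k) (part D) (\<lambda>x. x +o CI k)"
  by (rule presentsI[OF module])
    (simp_all add: md.coset_add[OF CI_sub] md.coset_eq_iff[OF CI_sub] Dquot_def quot_def CI_def[symmetric]
      md.coset_scale[OF CI_sub] carrier CI_sub)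

definition "Fun r A = {f. (\<forall>t<r. f t \<in> A t) \<and> (\<forall>t\<ge>r. f t = (0 :: 'd))}"

lemma Fun_sub:
  assumes "fs.subspace K" "\<And>t. t < r \<Longrightarrow> md.subspace (A t)"
  shows "module.subspace (pscale D) (K \<times> Fun r A)"
  using assms
  by (auto simp: module.subspace_def[OF module_pscale] fs.subspace_def md.subspace_def pscale_def Fun_def zero_prod_def)

text \<open>\<open>Fun 0\<close> contains the zero function only, so the case without exceptional
  weights gets the same format as the others.\<close>

lemma presents_0:
  "presents (HHS1 D) (pscale D) (KH \<times> Fun 0 A) (BH \<times> Fun 0 A') (\<lambda>p. (part (free_lists D 2) p \<inter> KH) \<times> Fun 0 (A'' p)) (clH \<circ> fst)"
proof (rule presents_transport[OF presents_HHS1])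
  show "module_hom (pscale D) fscale fst"
    by (intro module_hom.intro module_pscale module_fscale module_hom_axioms.intro) (simp_all add: pscale_def)
  show "module.subspace (pscale D) (KH \<times> Fun 0 A)" "module.subspace (pscale D) (BH \<times> Fun 0 A')"
    by (intro Fun_sub KH_sub BH_sub; simp)+
qed (auto simp: Fun_def image_iff)

text \<open>\<open>Q\<close> stands for \<open>Dquot D k\<close> and for its parity shift, told
  apart by \<open>w\<close>.\<close>

lemma presents_k:
  assumes "\<And>p. part Q p = part (Dquot D k) (p + w)" "supermodule.carrier Q = supermodule.carrier (Dquot D k)" "smult Q = smult (Dquot D k)"
  shows "\<exists>cl. presents (HHS1 D \<oplus> mpower Q r) (pscale D) (KH \<times> Fun r (\<lambda>_. UNIV)) (BH \<times> Fun r (\<lambda>_. CI k))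
    (\<lambda>p. (part (free_lists D 2) p \<inter> KH) \<times> Fun r (\<lambda>_. part D (p + w))) cl"
proof -
  have "presents Q (smult D) UNIV (CI k) (\<lambda>p. part D (p + w)) (\<lambda>x. x +o CI k)"
    using presents_Dquot[of k] assms unfolding presents_def by simp
  from presents_dsum[OF presents_HHS1 presents_mpower[OF this, of r]]
  show ?thesis
    unfolding Fun_def
    by (intro exI) (simp add: pscale_def[abs_def] case_prod_unfold)
qed

text \<open>The comparison map collects all six slots in one function; \<open>h\<close> cuts it
  after four entries to match the two separate powers.\<close>

lemma presents_split:
  "\<exists>cl. presents (HHS1 D \<oplus> mpower (Dquot D 2) 4 \<oplus> mpower (Dquot D 0) 2) (pscale D) (KH \<times> Fun 6 (\<lambda>_. UNIV))
    (BH \<times> Fun 6 (\<lambda>t. if t < 4 then CI 2 else CI 0))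
    (\<lambda>p. (part (free_lists D 2) p \<inter> KH) \<times> Fun 6 (\<lambda>_. part D p)) cl"
proof -
  define h :: "('d list \<Rightarrow>\<^sub>0 'r) \<times> (nat \<Rightarrow> 'd) \<Rightarrow> ('d list \<Rightarrow>\<^sub>0 'r) \<times> (nat \<Rightarrow> 'd) \<times> (nat \<Rightarrow> 'd)" where
    "h y = (fst y, (\<lambda>t. if t < 4 then snd y t else 0), (\<lambda>t. if t < 2 then snd y (t + 4) else 0))" for y
  have im: "h ` (A \<times> Fun 6 (\<lambda>t. if t < 4 then S else S')) =
      A \<times> {f. (\<forall>t<4. f t \<in> S) \<and> (\<forall>t\<ge>4. f t = 0)} \<times> {f. (\<forall>t<2. f t \<in> S') \<and> (\<forall>t\<ge>2. f t = 0)}" for A S S'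
  proof (intro set_eqI iffI)
    fix y :: "('d list \<Rightarrow>\<^sub>0 'r) \<times> (nat \<Rightarrow> 'd) \<times> (nat \<Rightarrow> 'd)"
    assume "y \<in> A \<times> {f. (\<forall>t<4. f t \<in> S) \<and> (\<forall>t\<ge>4. f t = 0)} \<times> {f. (\<forall>t<2. f t \<in> S') \<and> (\<forall>t\<ge>2. f t = 0)}"
    then obtain a f g where y: "y = (a, f, g)" "a \<in> A" "\<And>t. t < 4 \<Longrightarrow> f t \<in> S" "\<And>t. t \<ge> 4 \<Longrightarrow> f t = 0"
      "\<And>t. t < 2 \<Longrightarrow> g t \<in> S'" "\<And>t. t \<ge> 2 \<Longrightarrow> g t = 0"
      by auto
    show "y \<in> h ` (A \<times> Fun 6 (\<lambda>t. if t < 4 then S else S'))"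
    proof (rule image_eqI[of _ _ "(a, \<lambda>t. if t < 4 then f t else g (t - 4))"])
      show "y = h (a, \<lambda>t. if t < 4 then f t else g (t - 4))"
        using y by (auto simp: h_def fun_eq_iff)
      show "(a, \<lambda>t. if t < 4 then f t else g (t - 4)) \<in> A \<times> Fun 6 (\<lambda>t. if t < 4 then S else S')"
        using y by (auto simp: Fun_def)
    qed
  next
    fix y
    assume "y \<in> h ` (A \<times> Fun 6 (\<lambda>t. if t < 4 then S else S'))"
    then obtain a f where y: "y = h (a, f)" "a \<in> A" and f: "\<And>t. t < 6 \<Longrightarrow> f t \<in> (if t < 4 then S else S')"
      by (auto simp: Fun_def)
    have "f t \<in> S" if "t < 4" for t
      using f[of t] that by simp
    moreover have "f (t + 4) \<in> S'" if "t < 2" for t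
      using f[of "t + 4"] that by simp
    ultimately show "y \<in> A \<times> {f. (\<forall>t<4. f t \<in> S) \<and> (\<forall>t\<ge>4. f t = 0)} \<times> {f. (\<forall>t<2. f t \<in> S') \<and> (\<forall>t\<ge>2. f t = 0)}"
      using y by (auto simp: h_def)
  qed
  note N = presents_dsum[OF presents_HHS1 presents_dsum[OF presents_mpower[OF presents_Dquot[of 2], of 4] presents_mpower[OF presents_Dquot[of 0], of 2]]]
  have "presents (HHS1 D \<oplus> mpower (Dquot D 2) 4 \<oplus> mpower (Dquot D 0) 2) (pscale D)
      (KH \<times> Fun 6 (\<lambda>t. if t < 4 then UNIV else UNIV)) (BH \<times> Fun 6 (\<lambda>t. if t < 4 then CI 2 else CI 0))
    (\<lambda>p. (part (free_lists D 2) p \<inter> KH) \<times> Fun 6 (\<lambda>t. if t < 4 then part D p else part D p))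
    (map_prod clH (map_prod (\<lambda>f t. if t < 4 then f t +o CI 2 else 0) (\<lambda>f t. if t < 2 then f t +o CI 0 else 0)) \<circ> h)"
  proof (rule presents_transport[OF N _ _ _ im im])
    show "module_hom (pscale D) (\<lambda>c (x, y). (fscale c x, case y of (x, y) \<Rightarrow> (\<lambda>t. smult D c (x t), \<lambda>t. smult D c (y t)))) h"
      by (intro module_hom.intro module_pscale presents_module[OF N] module_hom_axioms.intro)
        (auto simp: h_def pscale_def fun_eq_iff)
    show "module.subspace (pscale D) (KH \<times> Fun 6 (\<lambda>t. if t < 4 then UNIV else UNIV))"
      "module.subspace (pscale D) (BH \<times> Fun 6 (\<lambda>t. if t < 4 then CI 2 else CI 0))"
      using CI_sub by (intro Fun_sub KH_sub BH_sub; simp)+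
    show "(part (free_lists D 2) p \<inter> KH) \<times> Fun 6 (\<lambda>t. if t < 4 then part D p else part D p) \<subseteq> KH \<times> Fun 6 (\<lambda>t. if t < 4 then UNIV else UNIV)" for p
      by (auto simp: Fun_def)
    fix y :: "('d list \<Rightarrow>\<^sub>0 'r) \<times> (nat \<Rightarrow> 'd)"
    assume "y \<in> KH \<times> Fun 6 (\<lambda>t. if t < 4 then UNIV else UNIV :: 'd set)"
    then have y: "\<forall>t\<ge>6. snd y t = 0"
      by (auto simp: Fun_def)
    have 2: "(\<forall>t<2. snd y (t + 4) \<in> CI 0) \<longleftrightarrow> (\<forall>t<6. \<not> t < 4 \<longrightarrow> snd y t \<in> CI 0)"
    proof (intro iffI allI impI)
      fix t :: nat
      assume a: "\<forall>t<2. snd y (t + 4) \<in> CI 0" and t: "t < 6" "\<not> t < 4"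
      then show "snd y t \<in> CI 0"
        using a[rule_format, of "t - 4"] by simp
    qed auto
    show "h y \<in> BH \<times> {f. (\<forall>t<4. f t \<in> CI 2) \<and> (\<forall>t\<ge>4. f t = 0)} \<times> {f. (\<forall>t<2. f t \<in> CI 0) \<and> (\<forall>t\<ge>2. f t = 0)} \<longleftrightarrow>
        y \<in> BH \<times> Fun 6 (\<lambda>t. if t < 4 then CI 2 else CI 0)"
      using y 2 by (auto simp: h_def Fun_def mem_Times_iff split: if_splits)
  qed
  then show ?thesis
    by (intro exI) (simp only: if_cancel)
qed

end

section \<open>Products modulo the commutator ideal\<close>

context unital_superdialgebra
begin

lemma comm_hom: "a \<in> part D p \<Longrightarrow> b \<in> part D q \<Longrightarrow> a \<stileturn> b - smult D (eps (p * q)) (b \<turnstile> a) \<in> commutators D"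
  unfolding commutators_def by (rule md.span_base) blast

lemma comm_mult: "x \<in> commutators D \<Longrightarrow> x \<stileturn> d \<in> commutator_ideal D"
  unfolding commutator_ideal_def by (rule md.span_base) (auto simp: carrier)

lemma comm_ideal: "x \<in> commutators D \<Longrightarrow> x \<in> commutator_ideal D"
  using comm_mult[of x \<one>] by (simp add: barunit)

lemma ideal_mult:
  assumes "x \<in> commutator_ideal D"
  shows "x \<stileturn> d \<in> commutator_ideal D"
  using assms unfolding commutator_ideal_def
proof (induction x rule: md.span_induct_alt)
  case base
  show ?case
    by (simp add: mul_simps md.span_zero)
next
  case (step c x y)
  then obtain w e where "x = w \<stileturn> e" "w \<in> commutators D"
    by blast
  then have "x \<stileturn> d = w \<stileturn> (e \<stileturn> d)" "w \<in> commutators D" "e \<stileturn> d \<in> supermodule.carrier D"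
    by (simp_all add: lprod_assoc)
  then have "x \<stileturn> d \<in> md.span {x \<stileturn> d |x d. x \<in> commutators D \<and> d \<in> supermodule.carrier D}"
    by (intro md.span_base) blast
  then show ?case
    using step(2) md.span_add md.span_scale by (simp add: mul_simps)
qed

lemma hd1_commutators: "hd1 [a, b] \<in> commutators D"
proof -
  have h: "hd1 [a, b] \<in> commutators D" if "a \<in> part D p" "b \<in> part D q" for a b p q
    using comm_hom[OF that] by (simp add: hd1_def rev_hom[OF that])
  have D: "hd1 [a + a', b] = hd1 [a, b] + hd1 [a', b]" "hd1 [a, b + b'] = hd1 [a, b] + hd1 [a, b']" for a a' b b'
    by (simp_all add: hd1_def mul_simps rev_simps)
  have "hd1 [cmp 0 a + cmp 1 a, cmp 0 b + cmp 1 b] \<in> commutators D"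
    unfolding D using h[OF cmp_simps(3) cmp_simps(3)] by (intro md.subspace_add[OF comm_sub(1)])
  then show ?thesis
    by (simp only: cmp_sum_eq)
qed

text \<open>The normal form for products of three entries. The cocycle identities below become
  linear relations between values of \<open>tau\<close> with one fixed order of arguments.\<close>

definition tau :: "'d \<Rightarrow> 'd \<Rightarrow> 'd \<Rightarrow> 'd" where
  "tau a b c = (a \<stileturn> b) \<stileturn> c"

lemma tau_simps:
  "tau (a + a') b c = tau a b c + tau a' b c" "tau a (b + b') c = tau a b c + tau a b' c" "tau a b (c + c') = tau a b c + tau a b c'"
  "tau (a - a') b c = tau a b c - tau a' b c" "tau a (b - b') c = tau a b c - tau a b' c" "tau a b (c - c') = tau a b c - tau a b c'"
  "tau (- a) b c = - tau a b c" "tau a (- b) c = - tau a b c" "tau a b (- c) = - tau a b c"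
  "tau (smult D s a) b c = smult D s (tau a b c)" "tau a (smult D s b) c = smult D s (tau a b c)" "tau a b (smult D s c) = smult D s (tau a b c)"
  "tau 0 b c = 0" "tau a 0 c = 0" "tau a b 0 = 0"
  by (simp_all add: tau_def mul_simps)

lemma tau_left:
  assumes "a \<in> part D p" "b \<in> part D q"
  shows "(b \<turnstile> a) \<stileturn> c - smult D (eps (p * q)) (tau a b c) \<in> commutator_ideal D"
proof -
  have "smult D (- eps (p * q)) ((a \<stileturn> b - smult D (eps (p * q)) (b \<turnstile> a)) \<stileturn> c) \<in> commutator_ideal D"
    by (intro md.subspace_scale[OF comm_sub(2)] comm_mult comm_hom assms)
  then show ?thesis
    by (simp add: tau_def mul_simps md.scale_right_diff_distrib)
qed

text \<open>Modulo the ideal \<open>b\<close> passes around \<open>a \<stileturn> c\<close> to the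
  far left; by the mixed associativity it then stands next to \<open>a\<close> and can be passed
  around \<open>a\<close> alone.\<close>

lemma tau_swap:
  assumes "b \<in> part D q" "c \<in> part D s"
  shows "tau a c b - smult D (eps (q * s)) (tau a b c) \<in> commutator_ideal D"
proof -
  have hom: "tau a c b - smult D (eps (q * s)) (tau a b c) \<in> commutator_ideal D" if a: "a \<in> part D p" for a p
  proof -
    have 1: "(a \<stileturn> c) \<stileturn> b - smult D (eps ((p + s) * q)) (b \<turnstile> (a \<stileturn> c)) \<in> commutator_ideal D"
      by (intro comm_ideal comm_hom lprod_degree assms a)
    have 2: "(b \<turnstile> a) \<stileturn> c - smult D (eps (p * q)) (tau a b c) \<in> commutator_ideal D"
      by (rule tau_left[OF a assms(1)])
    have e: "eps ((p + s) * q) * eps (p * q) = (eps (q * s) :: 'r)"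
      by (cases p; cases q; cases s) simp_all
    have "((a \<stileturn> c) \<stileturn> b - smult D (eps ((p + s) * q)) (b \<turnstile> (a \<stileturn> c))) +
        smult D (eps ((p + s) * q)) ((b \<turnstile> a) \<stileturn> c - smult D (eps (p * q)) (tau a b c)) \<in> commutator_ideal D"
      by (rule md.subspace_add[OF comm_sub(2) 1 md.subspace_scale[OF comm_sub(2) 2]])
    then show ?thesis
      by (simp add: md.scale_right_diff_distrib e dialgebra(2) tau_def)
  qed
  have "(tau (cmp 0 a) c b - smult D (eps (q * s)) (tau (cmp 0 a) b c)) + (tau (cmp 1 a) c b - smult D (eps (q * s)) (tau (cmp 1 a) b c)) \<in> commutator_ideal D"
    by (rule md.subspace_add[OF comm_sub(2) hom hom]) (rule cmp_simps(3))+
  then have "tau (cmp 0 a + cmp 1 a) c b - smult D (eps (q * s)) (tau (cmp 0 a + cmp 1 a) b c) \<in> commutator_ideal D"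
    by (simp add: tau_simps md.scale_right_distrib algebra_simps)
  then show ?thesis
    by (simp only: cmp_sum_eq)
qed

text \<open>Follows from \<open>tau_swap\<close>, because to the right of
  \<open>b \<stileturn>\<close> the two products agree.\<close>

lemma comm_right:
  assumes "w \<in> commutators D"
  shows "b \<stileturn> w \<in> commutator_ideal D"
  using assms unfolding commutators_def
proof (induction w rule: md.span_induct_alt)
  case base
  show ?case
    by (simp add: mul_simps md.subspace_0[OF comm_sub(2)])
next
  case (step c w y)
  then obtain u v p q where w: "w = u \<stileturn> v - smult D (eps (p * q)) (v \<turnstile> u)" "u \<in> part D p" "v \<in> part D q"
    by blast
  have "tau b u v - smult D (eps (q * p)) (tau b v u) \<in> commutator_ideal D"
    by (rule tau_swap[OF w(3,2)])
  then have "b \<stileturn> w \<in> commutator_ideal D"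
    by (simp add: w(1) mul_simps tau_def lprod_assoc dialgebra(1) mult.commute)
  then show ?case
    using step md.subspace_add[OF comm_sub(2)] md.subspace_scale[OF comm_sub(2)] by (simp add: mul_simps)
qed

text \<open>The elements that are negligible modulo \<open>S\<close> in every slot of
  \<open>tau\<close>. Traces of elements of \<open>L\<close> turn out to be of this kind.\<close>

definition "neg3 S = {w. \<forall>b c. tau w b c \<in> S \<and> tau b w c \<in> S \<and> tau b c w \<in> S}"

lemma neg3_commutators: "commutator_ideal D \<subseteq> S \<Longrightarrow> w \<in> commutators D \<Longrightarrow> w \<in> neg3 S"
  using comm_right ideal_mult[OF comm_right] ideal_mult[OF comm_mult] unfolding neg3_def tau_def by blast

lemma neg3_multiple: "(\<And>u. smult D k u \<in> S) \<Longrightarrow> smult D k w \<in> neg3 S"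
  unfolding neg3_def by (simp add: tau_simps)

lemma neg3_sub: "md.subspace S \<Longrightarrow> md.subspace (neg3 S)"
  unfolding neg3_def md.subspace_def by (simp add: tau_simps)

lemma neg3D: "w \<in> neg3 S \<Longrightarrow> tau w b c \<in> S" "w \<in> neg3 S \<Longrightarrow> tau b w c \<in> S" "w \<in> neg3 S \<Longrightarrow> tau b c w \<in> S"
  by (auto simp: neg3_def)

end

context sl3_algebra
begin

text \<open>Off-diagonal matrix units have supertrace zero, and for their brackets
  \<open>hd1_Phi\<close> exhibits the supertrace as a value of \<open>d_1\<close>, that is, as a sum
  of supercommutators.\<close>

lemma str_commutators: "x \<in> supermodule.carrier L \<Longrightarrow> str x \<in> commutators D"
proof -
  assume x: "x \<in> supermodule.carrier L"
  have "supermodule.carrier L \<subseteq> {x. str x \<in> commutators D}"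
  proof -
    have L: "supermodule.carrier L = g.md.span (homE \<union> homH)"
      using L_span N3 by simp
    have "g.md.subspace {x. str x \<in> commutators D}"
      using md.subspace_0[OF comm_sub(1)] md.subspace_add[OF comm_sub(1)] md.subspace_scale[OF comm_sub(1)]
      by (intro g.md.subspaceI) (simp_all only: str_simps mem_Collect_eq G_simps(2))
    moreover have "str u \<in> commutators D" if "u \<in> homE" for u
    proof -
      have "str u = 0"
        using that by (auto simp: homE_def str_def E_def tw_simps intro!: sum.neutral)
      then show ?thesis
        using md.subspace_0[OF comm_sub(1)] by simp
    qed
    moreover have "str u \<in> commutators D" if "u \<in> homH" for u
    proof -
      obtain i j a b where u: "u = br (E i j a) (E j i b)" "i \<in> I" "j \<in> I" "i \<noteq> j"
        using \<open>u \<in> homH\<close> unfolding homH_def by blast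
      interpret d: module_hom fscale "smult D" "lin (smult D) hd1"
        by (rule module_hom_lin[OF module])
      have "str u = lin (smult D) hd1 (Phi [E i j a, E j i b])"
        using u by (simp add: hd1_Phi)
      also have "\<dots> \<in> commutators D"
        unfolding Phi_def ph_def d.sum d.scale lin_gen[OF module]
        by (intro md.subspace_sum[OF comm_sub(1)] md.subspace_scale[OF comm_sub(1)] hd1_commutators)
      finally show ?thesis .
    qed
    ultimately show ?thesis
      unfolding L by (intro g.md.span_minimal) auto
  qed
  then show ?thesis
    using x by blast
qed

lemma str_hom:
  assumes "x \<in> part L p"
  shows "(\<Sum>k\<in>I. smult D (ssign k p) (x k k)) \<in> commutators D"
proof -
  have "tw k (x k k) = smult D (ssign k p) (x k k)" for k
    using entry_part[OF assms, of k k] by (intro tw_hom) simp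
  then have "str x = (\<Sum>k\<in>I. smult D (ssign k p) (x k k))"
    by (simp add: str_def)
  then show ?thesis
    using str_commutators[of x] assms by (simp add: L_part)
qed

text \<open>The polarized minor with the rows \<open>i, k\<close> and the columns \<open>j, l\<close>.\<close>

definition psi4 :: "nat \<Rightarrow> nat \<Rightarrow> nat \<Rightarrow> nat \<Rightarrow> (nat \<Rightarrow> nat \<Rightarrow> 'd) \<Rightarrow> (nat \<Rightarrow> nat \<Rightarrow> 'd) \<Rightarrow> 'd" where
  "psi4 i j k l x y = x i j \<stileturn> y k l + x k l \<stileturn> y i j - x i l \<stileturn> y k j - x k j \<stileturn> y i l"

text \<open>The sign twist that makes \<open>psi4\<close> a cocycle when \<open>i, k\<close> and \<open>j, l\<close> have opposite parities.\<close>

definition ptw :: "'d \<Rightarrow> 'd" where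
  "ptw a = cmp 0 a - cmp 1 a"

lemma ptw_hom: "a \<in> part D p \<Longrightarrow> ptw a = smult D (eps p) a"
  by (cases p) (simp_all add: ptw_def cmp_hom)

lemma ptw_simps: "ptw (a + b) = ptw a + ptw b" "ptw (smult D c a) = smult D c (ptw a)" "ptw 0 = 0" "ptw \<one> = \<one>"
  using ptw_hom[OF barunit_even] by (simp_all add: ptw_def md.scale_right_diff_distrib)

text \<open>Under these parities all entries of \<open>y\<close> that occur have degree
  \<open>1 + q\<close>, so the twist acts by a single sign.\<close>

lemma psi4_ptw:
  assumes "y \<in> part L q" "par i = par k" "par j = par l" "par j = par i + 1"
  shows "psi4 i j k l x (\<lambda>u v. ptw (y u v)) = smult D (eps (1 + q)) (psi4 i j k l x y)"
proof -
  have e: "ptw (y i j) = smult D (eps (1 + q)) (y i j)" "ptw (y k l) = smult D (eps (1 + q)) (y k l)"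
    "ptw (y i l) = smult D (eps (1 + q)) (y i l)" "ptw (y k j) = smult D (eps (1 + q)) (y k j)"
    using ptw_hom[OF entry_part[OF assms(1), of i j]] ptw_hom[OF entry_part[OF assms(1), of k l]]
      ptw_hom[OF entry_part[OF assms(1), of i l]] ptw_hom[OF entry_part[OF assms(1), of k j]] assms(2-4)
    by (cases "par i"; cases q; simp)+
  show ?thesis
    unfolding psi4_def e by (simp add: mul_simps md.scale_right_diff_distrib md.scale_right_distrib)
qed

definition psi_row :: "nat \<Rightarrow> nat \<Rightarrow> nat \<Rightarrow> (nat \<Rightarrow> nat \<Rightarrow> 'd) \<Rightarrow> (nat \<Rightarrow> nat \<Rightarrow> 'd) \<Rightarrow> 'd" where
  "psi_row i j l x y = x i j \<stileturn> y i l - x i l \<stileturn> y i j"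

definition psi_col :: "nat \<Rightarrow> nat \<Rightarrow> nat \<Rightarrow> (nat \<Rightarrow> nat \<Rightarrow> 'd) \<Rightarrow> (nat \<Rightarrow> nat \<Rightarrow> 'd) \<Rightarrow> 'd" where
  "psi_col j i k x y = x i j \<stileturn> y k j - x k j \<stileturn> y i j"

section \<open>Cocycle identities modulo a submodule that contains the commutator ideal\<close>

context
  fixes S :: "'d set"
  assumes S: "md.subspace S" and CS: "commutator_ideal D \<subseteq> S"
begin

definition eqS (infix "\<sim>" 50) where "u \<sim> v \<longleftrightarrow> u - v \<in> S"

lemma eqS_refl [simp]: "u \<sim> u"
  by (simp add: eqS_def md.subspace_0[OF S])

lemma eqS_trans [trans]: "u \<sim> v \<Longrightarrow> v \<sim> w \<Longrightarrow> u \<sim> w"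
  unfolding eqS_def using md.subspace_add[OF S, of "u - v" "v - w"] by simp

lemma eqS_trans_eq [trans]: "u = v \<Longrightarrow> v \<sim> w \<Longrightarrow> u \<sim> w" "u \<sim> v \<Longrightarrow> v = w \<Longrightarrow> u \<sim> w"
  by simp_all

lemma eqS_add: "u \<sim> v \<Longrightarrow> u' \<sim> v' \<Longrightarrow> u + u' \<sim> v + v'"
  unfolding eqS_def using md.subspace_add[OF S, of "u - v" "u' - v'"] by (simp add: algebra_simps)

lemma eqS_diff: "u \<sim> v \<Longrightarrow> u' \<sim> v' \<Longrightarrow> u - u' \<sim> v - v'"
  unfolding eqS_def using md.subspace_diff[OF S, of "u - v" "u' - v'"] by (simp add: algebra_simps)

lemma eqS_scale: "u \<sim> v \<Longrightarrow> smult D c u \<sim> smult D c v"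
  unfolding eqS_def using md.subspace_scale[OF S, of "u - v" c] by (simp add: md.scale_right_diff_distrib)

lemma eqS_sum: "(\<And>k. k \<in> A \<Longrightarrow> f k \<sim> h k) \<Longrightarrow> sum f A \<sim> sum h A"
  unfolding eqS_def by (simp add: sum_subtractf[symmetric] md.subspace_sum[OF S])

text \<open>This and the next two lemmas bring the factors into the order \<open>x, y, z\<close>, in
  which the terms of the cocycle condition can be compared. Each exchange is one use of
  \<open>tau_left\<close> or \<open>tau_swap\<close>.\<close>

lemma br_left:
  assumes xy: "x \<in> part L p" "y \<in> part L q"
  shows "br x y i j \<stileturn> c \<sim> (\<Sum>k\<in>I. tau (x i k) (y k j) c -
    smult D (eps (p * q) * eps ((par k + par j + p) * (par i + par k + q))) (tau (x k j) (y i k) c))"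
proof -
  have G: "x \<in> part G p" "y \<in> part G q"
    using xy by (auto simp: L_part)
  have "br x y i j \<stileturn> c = (\<Sum>k\<in>I. tau (x i k) (y k j) c - smult D (eps (p * q)) ((y i k \<turnstile> x k j) \<stileturn> c))"
    unfolding br_hom_entry[OF G] by (simp add: mul_simps lmul_sum tau_def sum_subtractf md.scale_sum_right)
  also have "\<dots> \<sim> (\<Sum>k\<in>I. tau (x i k) (y k j) c -
    smult D (eps (p * q)) (smult D (eps ((par k + par j + p) * (par i + par k + q))) (tau (x k j) (y i k) c)))"
  proof (intro eqS_sum eqS_diff eqS_refl eqS_scale)
    fix k
    show "(y i k \<turnstile> x k j) \<stileturn> c \<sim> smult D (eps ((par k + par j + p) * (par i + par k + q))) (tau (x k j) (y i k) c)"
      using tau_left[OF entry_part[OF xy(1), of k j] entry_part[OF xy(2), of i k], of c] CS by (auto simp: eqS_def)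
  qed
  finally show ?thesis
    by simp
qed

lemma br_right:
  assumes yz: "y \<in> part L q" "z \<in> part L s"
  shows "a \<stileturn> br y z i j \<sim> (\<Sum>k\<in>I. tau a (y i k) (z k j) -
    smult D (eps (q * s) * eps ((par k + par j + q) * (par i + par k + s))) (tau a (y k j) (z i k)))"
proof -
  have G: "y \<in> part G q" "z \<in> part G s"
    using yz by (auto simp: L_part)
  have "a \<stileturn> br y z i j = (\<Sum>k\<in>I. tau a (y i k) (z k j) - smult D (eps (q * s)) (tau a (z i k) (y k j)))"
    unfolding br_hom_entry[OF G]
    by (simp add: mul_simps lmul_sum tau_def lprod_assoc dialgebra(1)[symmetric] sum_subtractf md.scale_sum_right)
  also have "\<dots> \<sim> (\<Sum>k\<in>I. tau a (y i k) (z k j) -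
    smult D (eps (q * s)) (smult D (eps ((par k + par j + q) * (par i + par k + s))) (tau a (y k j) (z i k))))"
  proof (intro eqS_sum eqS_diff eqS_refl eqS_scale)
    fix k
    show "tau a (z i k) (y k j) \<sim> smult D (eps ((par k + par j + q) * (par i + par k + s))) (tau a (y k j) (z i k))"
      using tau_swap[OF entry_part[OF yz(1), of k j] entry_part[OF yz(2), of i k], of a] CS by (auto simp: eqS_def)
  qed
  finally show ?thesis
    by simp
qed

lemma br_left':
  assumes xz: "x \<in> part L p" "z \<in> part L s" and c: "c \<in> part D d"
  shows "br x z i j \<stileturn> c \<sim> (\<Sum>k\<in>I. smult D (eps (d * (par k + par j + s))) (tau (x i k) c (z k j)) -
    smult D (eps (p * s) * eps ((par k + par j + p) * (par i + par k + s)) * eps (d * (par i + par k + s))) (tau (x k j) c (z i k)))"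
proof -
  have sw: "tau a (z u v) c \<sim> smult D (eps (d * (par u + par v + s))) (tau a c (z u v))" for a u v
    using tau_swap[OF c entry_part[OF xz(2), of u v], of a] CS by (auto simp: eqS_def)
  note br_left[OF xz, of i j c]
  also have "(\<Sum>k\<in>I. tau (x i k) (z k j) c -
    smult D (eps (p * s) * eps ((par k + par j + p) * (par i + par k + s))) (tau (x k j) (z i k) c)) \<sim>
    (\<Sum>k\<in>I. smult D (eps (d * (par k + par j + s))) (tau (x i k) c (z k j)) -
      smult D (eps (p * s) * eps ((par k + par j + p) * (par i + par k + s))) (smult D (eps (d * (par i + par k + s))) (tau (x k j) c (z i k))))"
    by (intro eqS_sum eqS_diff eqS_scale sw)
  finally show ?thesis
    by simp
qed

text \<open>When all signs are trivial (either since \<open>2 = 0\<close> modulo \<open>S\<close> or in the purely even case) the products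
  of brackets are as for commutative associative algebras.\<close>

lemma br_mod2:
  assumes 2: "\<And>u. smult D 2 u \<in> S" and xyz: "x \<in> part L p" "y \<in> part L q" "z \<in> part L s"
  shows "br x y i j \<stileturn> c \<sim> (\<Sum>k\<in>I. tau (x i k) (y k j) c + tau (x k j) (y i k) c)"
    "a \<stileturn> br y z i j \<sim> (\<Sum>k\<in>I. tau a (y i k) (z k j) + tau a (y k j) (z i k))"
    "br x z i j \<stileturn> y u v \<sim> (\<Sum>k\<in>I. tau (x i k) (y u v) (z k j) + tau (x k j) (y u v) (z i k))"
proof -
  have n: "- u \<sim> u" for u
  proof -
    have "smult D (- 1) (smult D 2 u) \<in> S"
      by (rule md.subspace_scale[OF S 2])
    moreover have "smult D (- 1) (smult D 2 u) = - u - u"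
      by (simp add: md.scale_left_distrib[of 1 1, simplified])
    ultimately show ?thesis
      by (simp add: eqS_def)
  qed
  have e: "smult D (eps e) u \<sim> u" for e u
    using n by (cases e) simp_all
  have e2: "smult D (eps e * eps e') u \<sim> u" for e e' u
    using eqS_trans[OF e[of e "smult D (eps e') u"] e[of e' u]] by simp
  have e3: "smult D (eps e * eps e' * eps e'') u \<sim> u" for e e' e'' u
    using eqS_trans[OF e2[of e e' "smult D (eps e'') u"] e[of e'' u]] by simp
  have m: "a - b \<sim> a' + b'" if "a \<sim> a'" "b \<sim> b'" for a b a' b'
    using eqS_add[OF that(1) eqS_trans[OF n[of b] that(2)]] by simp
  show "br x y i j \<stileturn> c \<sim> (\<Sum>k\<in>I. tau (x i k) (y k j) c + tau (x k j) (y i k) c)"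
    by (rule eqS_trans[OF br_left[OF xyz(1,2)]]) (intro eqS_sum m eqS_refl e2)
  show "a \<stileturn> br y z i j \<sim> (\<Sum>k\<in>I. tau a (y i k) (z k j) + tau a (y k j) (z i k))"
    by (rule eqS_trans[OF br_right[OF xyz(2,3)]]) (intro eqS_sum m eqS_refl e2)
  show "br x z i j \<stileturn> y u v \<sim> (\<Sum>k\<in>I. tau (x i k) (y u v) (z k j) + tau (x k j) (y u v) (z i k))"
    by (rule eqS_trans[OF br_left'[OF xyz(1,3) entry_part[OF xyz(2)]]]) (intro eqS_sum m e e3)
qed

text \<open>The supertrace lies in \<open>[D, D]\<close>, and modulo 2 it is the trace.\<close>

lemma trace_mod2:
  assumes 2: "\<And>u. smult D 2 u \<in> S" and x: "x \<in> part L p"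
  shows "(\<Sum>k\<in>I. x k k) \<in> neg3 S"
proof -
  have "x k k - smult D (ssign k p) (x k k) \<in> neg3 S" for k
  proof (cases "(par k + par 1) * (1 + p)")
    case zero
    have "ssign k p = 1"
      unfolding ssign_def zero by simp
    then show ?thesis
      using md.subspace_0[OF neg3_sub[OF S]] by simp
  next
    case one
    have "ssign k p = - 1"
      unfolding ssign_def one by simp
    then have "x k k - smult D (ssign k p) (x k k) = smult D 2 (x k k)"
      by (simp add: md.scale_left_distrib[of 1 1, simplified])
    then show ?thesis
      using neg3_multiple[of 2 S, OF 2] by simp
  qed
  then have "(\<Sum>k\<in>I. x k k - smult D (ssign k p) (x k k)) + (\<Sum>k\<in>I. smult D (ssign k p) (x k k)) \<in> neg3 S"
    by (intro md.subspace_add[OF neg3_sub[OF S] md.subspace_sum[OF neg3_sub[OF S]] neg3_commutators[OF CS str_hom[OF x]]])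
  then show ?thesis
    by (simp add: sum_subtractf)
qed

text \<open>Let \<open>Q\<close> be the block of a matrix \<open>A\<close> with rows
  \<open>i, k\<close> and columns \<open>j, l\<close>, and let \<open>P\<close>, \<open>T\<close> be
  the diagonal blocks for \<open>i, k\<close> and \<open>j, l\<close>. Rows and columns being
  complementary, the corresponding block of \<open>A^2\<close> is \<open>P Q + Q T\<close>, and the
  derivative of \<open>det\<close> at \<open>Q\<close> in this direction is
  \<open>(tr P + tr T) det Q = tr A det Q\<close>. The polarization of this identity is the equality
  in the middle of the calculation; every term that it leaves contains a trace and so vanishes
  modulo \<open>S\<close>.\<close>

lemma psi4_cocycle_mod2:
  assumes 2: "\<And>u. smult D 2 u \<in> S" and xyz: "x \<in> part L p" "y \<in> part L q" "z \<in> part L s"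
    and I4: "I = {i, j, k, l}" "i \<noteq> j" "i \<noteq> k" "i \<noteq> l" "j \<noteq> k" "j \<noteq> l" "k \<noteq> l"
  shows "psi4 i j k l x (br y z) - psi4 i j k l (br x y) z + smult D (eps (q * s)) (psi4 i j k l (br x z) y) \<in> S"
proof -
  have n: "- u \<sim> u" for u
  proof -
    have "smult D (- 1) (smult D 2 u) \<in> S"
      by (rule md.subspace_scale[OF S 2])
    moreover have "smult D (- 1) (smult D 2 u) = - u - u"
      by (simp add: md.scale_left_distrib[of 1 1, simplified])
    ultimately show ?thesis
      by (simp add: eqS_def)
  qed
  have e: "smult D (eps e) u \<sim> u" for e u
    using n by (cases e) simp_all
  have sum4: "(\<Sum>w\<in>I. f w) = f i + f j + f k + f l" for f :: "nat \<Rightarrow> 'd"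
    using I4 by (simp add: add.assoc)
  note B = br_mod2[OF 2 xyz]
  let ?R = "\<lambda>a u v. \<Sum>w\<in>I. tau a (y u w) (z w v) + tau a (y w v) (z u w)"
  let ?L = "\<lambda>u v c. \<Sum>w\<in>I. tau (x u w) (y w v) c + tau (x w v) (y u w) c"
  let ?M = "\<lambda>u v a b. \<Sum>w\<in>I. tau (x u w) (y a b) (z w v) + tau (x w v) (y a b) (z u w)"
  let ?X = "\<Sum>w\<in>I. x w w" and ?Y = "\<Sum>w\<in>I. y w w" and ?Z = "\<Sum>w\<in>I. z w w"
  have "psi4 i j k l x (br y z) - psi4 i j k l (br x y) z + smult D (eps (q * s)) (psi4 i j k l (br x z) y) \<sim>
    psi4 i j k l x (br y z) + psi4 i j k l (br x y) z + psi4 i j k l (br x z) y"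
    using eqS_add[OF eqS_add[OF eqS_refl n[of "psi4 i j k l (br x y) z"]] e[of "q * s" "psi4 i j k l (br x z) y"], of "psi4 i j k l x (br y z)"]
    by simp
  also have "\<dots> \<sim> (?R (x i j) k l + ?R (x k l) i j - ?R (x i l) k j - ?R (x k j) i l) +
      (?L i j (z k l) + ?L k l (z i j) - ?L i l (z k j) - ?L k j (z i l)) +
      (?M i j k l + ?M k l i j - ?M i l k j - ?M k j i l)"
    unfolding psi4_def by (intro eqS_add eqS_diff B)
  also have "\<dots> = (tau ?X (y i j) (z k l) + tau ?X (y k l) (z i j) - tau ?X (y i l) (z k j) - tau ?X (y k j) (z i l)) +
      (tau (x i j) ?Y (z k l) + tau (x k l) ?Y (z i j) - tau (x i l) ?Y (z k j) - tau (x k j) ?Y (z i l)) +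
      (tau (x i j) (y k l) ?Z + tau (x k l) (y i j) ?Z - tau (x i l) (y k j) ?Z - tau (x k j) (y i l) ?Z)"
    unfolding sum4 tau_simps by (simp add: algebra_simps)
  also have "\<dots> \<sim> 0"
    unfolding eqS_def diff_0_right
    by (intro md.subspace_add[OF S] md.subspace_diff[OF S] neg3D(1)[OF trace_mod2[OF 2 xyz(1)]]
        neg3D(2)[OF trace_mod2[OF 2 xyz(2)]] neg3D(3)[OF trace_mod2[OF 2 xyz(3)]])
  finally show ?thesis
    by (simp add: eqS_def)
qed

text \<open>Here 2 may be nonzero and signs matter. With rows of one parity and columns of the
  other, the two diagonal blocks enter the determinant identity behind
  \<open>psi4_cocycle_mod2\<close> with the relative sign that they have in the supertrace. Hence
  the identity holds without dividing out a multiple of \<open>D\<close>.\<close>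

lemma psi4_cocycle_super:
  assumes xyz: "x \<in> part L p" "y \<in> part L q" "z \<in> part L s"
    and I4: "I = {i, j, k, l}" "i \<noteq> j" "i \<noteq> k" "i \<noteq> l" "j \<noteq> k" "j \<noteq> l" "k \<noteq> l"
    and par: "par i = par k" "par j = par l" "par j = par i + 1"
  shows "smult D (eps (1 + (q + s))) (psi4 i j k l x (br y z)) - smult D (eps (1 + s)) (psi4 i j k l (br x y) z)
    + smult D (eps (q * s)) (smult D (eps (1 + q)) (psi4 i j k l (br x z) y)) \<in> S"
proof -
  have sum4: "(\<Sum>w\<in>I. f w) = f i + f j + f k + f l" for f :: "nat \<Rightarrow> 'd"
    using I4 by (simp add: add.assoc)
  let ?R = "\<lambda>a u v. \<Sum>w\<in>I. tau a (y u w) (z w v) -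
    smult D (eps (q * s) * eps ((par w + par v + q) * (par u + par w + s))) (tau a (y w v) (z u w))"
  let ?L = "\<lambda>u v c. \<Sum>w\<in>I. tau (x u w) (y w v) c -
    smult D (eps (p * q) * eps ((par w + par v + p) * (par u + par w + q))) (tau (x w v) (y u w) c)"
  let ?M = "\<lambda>u v a b. \<Sum>w\<in>I. smult D (eps ((par a + par b + q) * (par w + par v + s))) (tau (x u w) (y a b) (z w v)) -
    smult D (eps (p * s) * eps ((par w + par v + p) * (par u + par w + s)) * eps ((par a + par b + q) * (par u + par w + s)))
      (tau (x w v) (y a b) (z u w))"
  \<comment> \<open>The supertrace, rescaled so that its coefficients at \<open>i\<close> and
    \<open>k\<close> do not depend on the degree.\<close>
  define X where "X = smult D (ssign i 0 * ssign i p) (\<Sum>w\<in>I. smult D (ssign w p) (x w w))"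
  define Y where "Y = smult D (ssign i 0 * ssign i q) (\<Sum>w\<in>I. smult D (ssign w q) (y w w))"
  define Z where "Z = smult D (ssign i 0 * ssign i s) (\<Sum>w\<in>I. smult D (ssign w s) (z w w))"
  have XYZ: "X \<in> neg3 S" "Y \<in> neg3 S" "Z \<in> neg3 S"
    unfolding X_def Y_def Z_def
    using md.subspace_scale[OF neg3_sub[OF S] neg3_commutators[OF CS str_hom[OF xyz(1)]]]
      md.subspace_scale[OF neg3_sub[OF S] neg3_commutators[OF CS str_hom[OF xyz(2)]]]
      md.subspace_scale[OF neg3_sub[OF S] neg3_commutators[OF CS str_hom[OF xyz(3)]]] by simp_all
  have sg: "ssign i 0 * ssign i d * ssign i d = ssign i 0" "ssign i 0 * ssign i d * ssign k d = ssign i 0"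
    "ssign i 0 * ssign i d * ssign j d = ssign i 0 * eps (1 + d)" "ssign i 0 * ssign i d * ssign l d = ssign i 0 * eps (1 + d)" for d
    unfolding ssign_def par(1)[symmetric] par(2)[symmetric] par(3) by (cases "par i"; cases "par 1"; cases d; simp)+
  have "smult D (eps (1 + (q + s))) (psi4 i j k l x (br y z)) - smult D (eps (1 + s)) (psi4 i j k l (br x y) z)
      + smult D (eps (q * s)) (smult D (eps (1 + q)) (psi4 i j k l (br x z) y)) \<sim>
    smult D (eps (1 + (q + s))) (?R (x i j) k l + ?R (x k l) i j - ?R (x i l) k j - ?R (x k j) i l) -
    smult D (eps (1 + s)) (?L i j (z k l) + ?L k l (z i j) - ?L i l (z k j) - ?L k j (z i l)) +
    smult D (eps (q * s)) (smult D (eps (1 + q)) (?M i j k l + ?M k l i j - ?M i l k j - ?M k j i l))"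
    unfolding psi4_def
    by (intro eqS_add eqS_diff eqS_scale br_left br_right br_left' xyz entry_part)
  also have "\<dots> = smult D (ssign i 0) (
      smult D (eps s) (tau X (y i j) (z k l) + tau X (y k l) (z i j) - tau X (y i l) (z k j) - tau X (y k j) (z i l)) -
      smult D (eps (q + s)) (tau (x i j) Y (z k l) + tau (x k l) Y (z i j) - tau (x i l) Y (z k j) - tau (x k j) Y (z i l)) +
      smult D (eps q) (tau (x i j) (y k l) Z + tau (x k l) (y i j) Z - tau (x i l) (y k j) Z - tau (x k j) (y i l) Z))"
  proof -
    have ss: "ssign i 0 * (ssign i 0 * c) = c" for c
      by (simp add: mult.assoc[symmetric])
    show ?thesis
      unfolding X_def Y_def Z_def sum4 tau_simps md.scale_right_distrib md.scale_scale sg par(1)[symmetric] par(2)[symmetric] par(3)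
      by (cases "par i"; cases p; cases q; cases s; simp add: tau_simps ss md.scale_right_distrib md.scale_right_diff_distrib algebra_simps)
  qed
  also have "\<dots> \<sim> 0"
    unfolding eqS_def diff_0_right
    by (intro md.subspace_scale[OF S] md.subspace_add[OF S] md.subspace_diff[OF S] neg3D(1)[OF XYZ(1)]
        neg3D(2)[OF XYZ(2)] neg3D(3)[OF XYZ(3)])
  finally show ?thesis
    by (simp add: eqS_def)
qed

lemma br_even:
  assumes xyz: "x \<in> part L p" "y \<in> part L q" "z \<in> part L s" and par: "\<And>k. k \<in> I \<Longrightarrow> par k = 0"
    and ij: "i \<in> I" "j \<in> I" "u \<in> I" "v \<in> I"
  shows "br x y i j \<stileturn> c \<sim> (\<Sum>k\<in>I. tau (x i k) (y k j) c - tau (x k j) (y i k) c)"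
    "a \<stileturn> br y z i j \<sim> (\<Sum>k\<in>I. tau a (y i k) (z k j) - tau a (y k j) (z i k))"
    "br x z i j \<stileturn> y u v \<sim> smult D (eps (q * s)) (\<Sum>k\<in>I. tau (x i k) (y u v) (z k j) - tau (x k j) (y u v) (z i k))"
proof -
  have e: "eps (a * b) * (eps (a * b) * c) = (c :: 'r)" for a b c
    by (simp add: mult.assoc[symmetric])
  show "br x y i j \<stileturn> c \<sim> (\<Sum>k\<in>I. tau (x i k) (y k j) c - tau (x k j) (y i k) c)"
    by (rule eqS_trans_eq(2)[OF br_left[OF xyz(1,2)]], rule sum.cong) (simp_all add: par ij)
  show "a \<stileturn> br y z i j \<sim> (\<Sum>k\<in>I. tau a (y i k) (z k j) - tau a (y k j) (z i k))"
    by (rule eqS_trans_eq(2)[OF br_right[OF xyz(2,3)]], rule sum.cong) (simp_all add: par ij)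
  show "br x z i j \<stileturn> y u v \<sim> smult D (eps (q * s)) (\<Sum>k\<in>I. tau (x i k) (y u v) (z k j) - tau (x k j) (y u v) (z i k))"
    unfolding md.scale_sum_right
    by (rule eqS_trans_eq(2)[OF br_left'[OF xyz(1,3) entry_part[OF xyz(2)]]], rule sum.cong)
      (simp_all add: par ij md.scale_right_diff_distrib)
qed

lemma trace_even:
  assumes "x \<in> part L p" and par: "\<And>k. k \<in> I \<Longrightarrow> par k = 0"
  shows "(\<Sum>k\<in>I. x k k) \<in> neg3 S"
proof -
  have "(\<Sum>k\<in>I. smult D (ssign k p) (x k k)) = (\<Sum>k\<in>I. x k k)"
    by (intro sum.cong refl) (use par I12 in \<open>simp add: ssign_def\<close>)
  then show ?thesis
    using neg3_commutators[OF CS str_hom[OF assms(1)]] by simp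
qed

text \<open>Let \<open>v\<close> be the part of row \<open>i\<close> of a matrix \<open>A\<close> in
  the columns \<open>j, k\<close>, and \<open>T\<close> the block with rows and columns
  \<open>j, k\<close>. The bracket acts on \<open>v\<close> through \<open>T\<close> and through
  \<open>A i i\<close>; on an alternating form in two such rows \<open>T\<close> acts by
  \<open>tr T\<close>, and \<open>A i i\<close> by its double with the opposite sign. Together this
  is \<open>tr A - 3 A i i\<close>, whence the modulus 3. Columns are the transposed case.\<close>

lemma psi3_cocycle:
  assumes 3: "\<And>u. smult D 3 u \<in> S" and xyz: "x \<in> part L p" "y \<in> part L q" "z \<in> part L s"
    and I3: "I = {i, j, k}" "i \<noteq> j" "i \<noteq> k" "j \<noteq> k" and par: "\<And>k. k \<in> I \<Longrightarrow> par k = 0"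
  shows "psi_row i j k x (br y z) - psi_row i j k (br x y) z + smult D (eps (q * s)) (psi_row i j k (br x z) y) \<in> S"
    and "psi_col i j k x (br y z) - psi_col i j k (br x y) z + smult D (eps (q * s)) (psi_col i j k (br x z) y) \<in> S"
proof -
  have sum3: "(\<Sum>w\<in>I. f w) = f i + f j + f k" for f :: "nat \<Rightarrow> 'd"
    using I3 by (simp add: add.assoc)
  have in3: "i \<in> I" "j \<in> I" "k \<in> I"
    using I3 by auto
  let ?R = "\<lambda>a u v. \<Sum>w\<in>I. tau a (y u w) (z w v) - tau a (y w v) (z u w)"
  let ?L = "\<lambda>u v c. \<Sum>w\<in>I. tau (x u w) (y w v) c - tau (x w v) (y u w) c"
  let ?M = "\<lambda>u v a b. \<Sum>w\<in>I. tau (x u w) (y a b) (z w v) - tau (x w v) (y a b) (z u w)"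
  let ?T = "\<lambda>x. (\<Sum>w\<in>I. x w w) - smult D 3 (x i i)"
  have T: "?T w \<in> neg3 S" if "w \<in> part L d" for w d
    by (rule md.subspace_diff[OF neg3_sub[OF S] trace_even[OF that par] neg3_multiple[OF 3]])
  have t3: "smult D 3 u = u + u + u" for u
    using md.scale_left_distrib[of 1 "1 + 1" u] md.scale_left_distrib[of 1 1 u] by simp
  have ee: "smult D (eps (q * s)) (smult D (eps (q * s)) u - smult D (eps (q * s)) v) = u - v" for u v
    by (simp add: md.scale_right_diff_distrib)
  note B = br_even(1)[where u = i and v = i, OF xyz(1-3) par] br_even(2)[where u = i and v = i, OF xyz(1-3) par]
    br_even(3)[OF xyz(1-3) par]
  have "psi_row i j k x (br y z) - psi_row i j k (br x y) z + smult D (eps (q * s)) (psi_row i j k (br x z) y) \<sim>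
    (?R (x i j) i k - ?R (x i k) i j) - (?L i j (z i k) - ?L i k (z i j)) +
    smult D (eps (q * s)) (smult D (eps (q * s)) (?M i j i k) - smult D (eps (q * s)) (?M i k i j))"
    unfolding psi_row_def by (intro eqS_add eqS_diff eqS_scale B in3)
  also have "\<dots> = (tau (?T x) (y i j) (z i k) - tau (?T x) (y i k) (z i j)) -
      (tau (x i j) (?T y) (z i k) - tau (x i k) (?T y) (z i j)) + (tau (x i j) (y i k) (?T z) - tau (x i k) (y i j) (?T z))"
    unfolding ee sum3 t3 tau_simps by (simp add: algebra_simps)
  also have "\<dots> \<sim> 0"
    unfolding eqS_def diff_0_right
    by (intro md.subspace_add[OF S] md.subspace_diff[OF S] neg3D(1)[OF T[OF xyz(1)]]
        neg3D(2)[OF T[OF xyz(2)]] neg3D(3)[OF T[OF xyz(3)]])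
  finally show "psi_row i j k x (br y z) - psi_row i j k (br x y) z + smult D (eps (q * s)) (psi_row i j k (br x z) y) \<in> S"
    by (simp add: eqS_def)
  have "psi_col i j k x (br y z) - psi_col i j k (br x y) z + smult D (eps (q * s)) (psi_col i j k (br x z) y) \<sim>
    (?R (x j i) k i - ?R (x k i) j i) - (?L j i (z k i) - ?L k i (z j i)) +
    smult D (eps (q * s)) (smult D (eps (q * s)) (?M j i k i) - smult D (eps (q * s)) (?M k i j i))"
    unfolding psi_col_def by (intro eqS_add eqS_diff eqS_scale B in3)
  also have "\<dots> = - (tau (?T x) (y j i) (z k i) - tau (?T x) (y k i) (z j i)) +
      (tau (x j i) (?T y) (z k i) - tau (x k i) (?T y) (z j i)) - (tau (x j i) (y k i) (?T z) - tau (x k i) (y j i) (?T z))"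
    unfolding ee sum3 t3 tau_simps by (simp add: algebra_simps)
  also have "\<dots> \<sim> 0"
    unfolding eqS_def diff_0_right
    by (intro md.subspace_add[OF S] md.subspace_neg[OF S] md.subspace_diff[OF S] neg3D(1)[OF T[OF xyz(1)]]
        neg3D(2)[OF T[OF xyz(2)]] neg3D(3)[OF T[OF xyz(3)]])
  finally show "psi_col i j k x (br y z) - psi_col i j k (br x y) z + smult D (eps (q * s)) (psi_col i j k (br x z) y) \<in> S"
    by (simp add: eqS_def)
qed

end

end

section \<open>Relations between commuting root vectors\<close>

context sl3_algebra
begin

lemma eqB_scaled [trans]: "u \<approx> fscale s v \<Longrightarrow> v \<approx> fscale s' w \<Longrightarrow> u \<approx> fscale (s * s') w"
  using eqB_trans[OF _ eqB_scale] by fastforce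

lemma br_L_part: "x \<in> part L p \<Longrightarrow> y \<in> part L q \<Longrightarrow> br x y \<in> part L (p + q)"
  using br_part L_closed(6) by (auto simp: L_part)

text \<open>\<open>E k l (b \<stileturn> c)\<close> is a bracket through the row index
  \<open>i\<close> of the other factor, and \<open>E i j a\<close> has zero bracket with
  \<open>E i l c\<close>, so one Leibniz term remains. The columns may coincide, which covers two
  entries of one column.\<close>

lemma exchange_rows:
  assumes I: "i \<in> I" "j \<in> I" "k \<in> I" "l \<in> I" and ne: "i \<noteq> j" "i \<noteq> k" "i \<noteq> l" "j \<noteq> k" "k \<noteq> l"
    and abc: "a \<in> part D p" "b \<in> part D q" "c \<in> part D s"
  shows "pr (E i j a) (E k l (b \<stileturn> c)) \<approx>
    fscale (- eps ((par i + par j + p) * (par k + par i + q))) (pr (E k j (b \<turnstile> a)) (E i l c))"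
proof -
  let ?x = "E i j a" and ?y = "E k i b" and ?z = "E i l c" and ?e = "eps ((par i + par j + p) * (par k + par i + q)) :: 'r"
  have yz: "?y \<in> part L (par k + par i + q)" "?z \<in> part L (par i + par l + s)"
    using I ne abc by (auto intro: E_partL)
  have b: "br ?y ?z = E k l (b \<stileturn> c)" "br ?x ?z = 0"
    using I ne by (simp_all add: br_E_gen)
  have bxy: "br ?x ?y = mat_scale D (- ?e) (E k j (b \<turnstile> a))"
    using I ne by (simp add: br_E[OF _ _ _ _ abc(1,2)] E_simps[symmetric])
  have "pr ?x (br ?y ?z) \<approx> pr (br ?x ?y) ?z - fscale (eps ((par k + par i + q) * (par i + par l + s))) (pr (br ?x ?z) ?y)"
    using I ne by (intro leib yz E_L) auto
  also have "\<dots> \<approx> fscale (- ?e) (pr (E k j (b \<turnstile> a)) ?z) - fscale (eps ((par k + par i + q) * (par i + par l + s))) 0"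
    unfolding b(2) bxy using I ne by (intro eqB_diff eqB_scale pr_scale(1) pr_zero(1) E_L) auto
  finally show ?thesis
    by (simp add: b(1))
qed

text \<open>Here \<open>E k l (b \<stileturn> c)\<close> is a bracket through the column index
  \<open>j\<close>. The rows may coincide, which covers two entries of one row.\<close>

lemma exchange_columns:
  assumes I: "i \<in> I" "j \<in> I" "k \<in> I" "l \<in> I" and ne: "i \<noteq> j" "i \<noteq> l" "j \<noteq> k" "j \<noteq> l" "k \<noteq> l"
    and abc: "a \<in> part D p" "b \<in> part D q" "c \<in> part D s"
  shows "pr (E i j a) (E k l (b \<stileturn> c)) \<approx>
    fscale (- eps ((par k + par j + q) * (par j + par l + s))) (pr (E i l (a \<stileturn> c)) (E k j b))"
proof -
  let ?x = "E i j a" and ?y = "E k j b" and ?z = "E j l c" and ?e = "eps ((par k + par j + q) * (par j + par l + s)) :: 'r"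
  have yz: "?y \<in> part L (par k + par j + q)" "?z \<in> part L (par j + par l + s)"
    using I ne abc by (auto intro: E_partL)
  have b: "br ?y ?z = E k l (b \<stileturn> c)" "br ?x ?z = E i l (a \<stileturn> c)" "br ?x ?y = 0"
    using I ne by (simp_all add: br_E_gen)
  have "pr ?x (br ?y ?z) \<approx> pr (br ?x ?y) ?z - fscale ?e (pr (br ?x ?z) ?y)"
    using I ne by (intro leib yz E_L) auto
  also have "\<dots> \<approx> 0 - fscale ?e (pr (br ?x ?z) ?y)"
    unfolding b(3) using I ne by (intro eqB_diff eqB_refl pr_zero(1) E_L) auto
  finally show ?thesis
    by (simp add: b(1,2))
qed

text \<open>The exchange relations are stated for \<open>\<stileturn>\<close>, for which
  \<open>\<one>\<close> need not be a unit on the left.\<close>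

lemma bar_1:
  assumes "x \<in> supermodule.carrier L" "k \<in> I" "l \<in> I" "k \<noteq> l"
  shows "pr x (E k l b) \<approx> pr x (E k l (\<one> \<stileturn> b))"
  using eqB_sym[OF bar_side_gen[OF assms, of \<one> b]] by (simp add: barunit)

lemma columns_right_1:
  assumes I: "i \<in> I" "j \<in> I" "k \<in> I" "l \<in> I" and ne: "i \<noteq> j" "i \<noteq> l" "j \<noteq> k" "j \<noteq> l" "k \<noteq> l" and a: "a \<in> part D p"
  shows "pr (E i l a) (E k j \<one>) \<approx> fscale (- eps ((par k + par l) * (par l + par j))) (pr (E i j a) (E k l \<one>))"
  using exchange_columns[OF I(1,4,3,2) ne(2,1) _ _ _ a barunit_even barunit_even] ne by (simp add: barunit)

text \<open>Exchanging columns twice restores the positions and carries \<open>c\<close> over to the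
  first factor.\<close>

lemma columns_one:
  assumes I: "i \<in> I" "j \<in> I" "k \<in> I" "l \<in> I" and ne: "i \<noteq> j" "i \<noteq> l" "j \<noteq> k" "j \<noteq> l" "k \<noteq> l"
    and ac: "a \<in> part D p" "c \<in> part D s"
  shows "pr (E i j a) (E k l c) \<approx>
    fscale (- eps ((par k + par j) * (par j + par l + s)) * - eps ((par k + par l) * (par l + par j))) (pr (E i j (a \<stileturn> c)) (E k l \<one>))"
proof -
  have "pr (E i j a) (E k l c) \<approx> pr (E i j a) (E k l (\<one> \<stileturn> c))"
    using I ne by (intro bar_1 E_L) auto
  also have "\<dots> \<approx> fscale (- eps ((par k + par j) * (par j + par l + s))) (pr (E i l (a \<stileturn> c)) (E k j \<one>))"
    using exchange_columns[OF I ne ac(1) barunit_even ac(2)] by simp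
  finally show ?thesis
    by (rule eqB_scaled[OF _ columns_right_1[OF I ne lprod_degree[OF ac]]])
qed

lemma rows_right_1:
  assumes I: "i \<in> I" "j \<in> I" "k \<in> I" "l \<in> I" and ne: "i \<noteq> j" "i \<noteq> k" "i \<noteq> l" "j \<noteq> k" "k \<noteq> l" and a: "a \<in> part D p"
  shows "pr (E k j a) (E i l \<one>) \<approx> fscale (- eps ((par k + par j + p) * (par i + par k))) (pr (E i j a) (E k l \<one>))"
  using exchange_rows[OF I(3,2,1,4) _ _ ne(5) _ _ a barunit_even barunit_even] ne by (simp add: barunit)

text \<open>The \<open>a\<close> with trivial class form a submodule, so it suffices to test
  multiples by \<open>K\<close> and the products of a supercommutator with a third element, all of
  them homogeneous.\<close>

lemma commutator_ideal_kernel: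
  assumes x: "x \<in> supermodule.carrier L" "i \<in> I" "j \<in> I" "i \<noteq> j"
    and K: "\<And>a p. a \<in> part D p \<Longrightarrow> fscale (of_nat K) (pr (E i j a) x) \<approx> 0"
    and c: "\<And>a b c p q s. \<lbrakk>a \<in> part D p; b \<in> part D q; c \<in> part D s\<rbrakk> \<Longrightarrow>
      pr (E i j ((a \<stileturn> b) \<stileturn> c)) x \<approx> fscale (eps (p * q)) (pr (E i j ((b \<turnstile> a) \<stileturn> c)) x)"
    and a: "a \<in> CI K"
  shows "pr (E i j a) x \<in> BL"
proof -
  define S where "S = {a. pr (E i j a) x \<approx> 0}"
  have add: "a + b \<in> S" if "a \<in> S" "b \<in> S" for a b
    using eqB_trans[OF prE_add(2)[OF x] eqB_add[of _ 0 _ 0]] that by (simp add: S_def)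
  have scale: "smult D c a \<in> S" if "a \<in> S" for a c
    using eqB_trans[OF prE_add(4)[OF x] eqB_scale[of _ 0]] that by (simp add: S_def)
  have z: "0 \<in> S"
    using pr_zero[OF x(1)] by (simp add: S_def E_simps)
  have S: "md.subspace S"
    using add scale z by (intro md.subspaceI) auto
  have k: "smult D (of_nat K) a \<in> S" for a
  proof -
    have "smult D (of_nat K) (cmp p a) \<in> S" for p
      using eqB_trans[OF prE_add(4)[OF x] K[OF cmp_simps(3)]] by (simp add: S_def)
    then have "smult D (of_nat K) (cmp 0 a) + smult D (of_nat K) (cmp 1 a) \<in> S"
      by (intro add)
    then show ?thesis
      by (simp add: md.scale_right_distrib[symmetric] cmp_sum_eq)
  qed
  have hom: "(a \<stileturn> b - smult D (eps (p * q)) (b \<turnstile> a)) \<stileturn> c \<in> S"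
    if "a \<in> part D p" "b \<in> part D q" "c \<in> part D s" for a b c p q s
  proof -
    have "pr (E i j ((a \<stileturn> b) \<stileturn> c - smult D (eps (p * q)) ((b \<turnstile> a) \<stileturn> c))) x \<approx>
        pr (E i j ((a \<stileturn> b) \<stileturn> c)) x - fscale (eps (p * q)) (pr (E i j ((b \<turnstile> a) \<stileturn> c)) x)"
      unfolding E_simps
      by (rule eqB_trans[OF pr_diff(1) eqB_diff[OF eqB_refl pr_scale(1)]]) (use x L_closed in auto)
    also have "\<dots> \<approx> 0"
      using c[OF that] by (simp add: eqB_def)
    finally show ?thesis
      by (simp add: S_def mul_simps)
  qed
  have "x \<stileturn> d \<in> S" if "x \<in> commutators D" for x d
    using that unfolding commutators_def
  proof (induction x rule: md.span_induct_alt)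
    case base
    show ?case
      by (simp add: mul_simps z)
  next
    case (step r x y)
    then obtain a b p q where ab: "x = a \<stileturn> b - smult D (eps (p * q)) (b \<turnstile> a)" "a \<in> part D p" "b \<in> part D q"
      by blast
    have "x \<stileturn> (cmp 0 d + cmp 1 d) \<in> S"
      unfolding mul_simps unfolding ab(1) by (intro add hom[OF ab(2,3) cmp_simps(3)])
    then have "x \<stileturn> d \<in> S"
      by (simp add: cmp_sum_eq)
    then show ?case
      using step(2) add scale by (simp add: mul_simps)
  qed
  then have "commutator_ideal D \<subseteq> S"
    unfolding commutator_ideal_def by (intro md.span_minimal S) auto
  then have "CI K \<subseteq> S"
    by (intro CI_minimal S k)
  then show ?thesis
    using a by (auto simp: S_def eqB_0)
qed

text \<open>With five indices one is left over for \<open>comm_disjoint\<close>. In type (2, 1) a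
  pair that uses all three indices lies in one row or column, and its indices have both parities; a
  Cartan element that mixes parities then has weight 1 or -1 on it.\<close>

lemma perfect_commuting:
  assumes mn: "m + n \<ge> 5 \<or> m = 2 \<and> n = 1"
    and I: "i \<in> I" "j \<in> I" "k \<in> I" "l \<in> I" and ne: "i \<noteq> j" "k \<noteq> l" "j \<noteq> k" "i \<noteq> l"
    and ab: "a \<in> part D p" "b \<in> part D q"
  shows "pr (E i j a) (E k l b) \<approx> 0"
proof (cases "I \<subseteq> {i, j, k, l}")
  case False
  then obtain w where "w \<in> I" "w \<noteq> i" "w \<noteq> j" "w \<noteq> k" "w \<noteq> l"
    by blast
  then show ?thesis
    using comm_disjoint[OF I(1,2) ne(1) I(3,4) ne(2-4)] ab by blast
next
  case True
  \<comment> \<open>If no index is left over, there are at most four, and the hypothesis leaves type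
    (2, 1).\<close>
  have "card I \<le> card {i, j, k, l}"
    using True by (intro card_mono) auto
  also have "\<dots> \<le> 4"
    by (simp add: card_insert_if)
  finally have mn: "m = 2" "n = 1"
    using mn by (auto simp: I_def)
  have I3: "I = {1..3}"
    unfolding I_def by (simp add: mn)
  have par: "par x = par y \<longleftrightarrow> (x \<le> 2 \<longleftrightarrow> y \<le> 2)" for x y
    by (simp add: idx_def mn)
  have c: "1 \<le> i" "i \<le> 3" "1 \<le> j" "j \<le> 3" "1 \<le> k" "k \<le> 3" "1 \<le> l" "l \<le> 3"
    using I unfolding I3 by auto
  have "x \<in> {i, j, k, l}" if "1 \<le> x" "x \<le> 3" for x
    using that True unfolding I3 by auto
  from this[of 1] this[of 2] this[of 3]
  have m: "1 \<in> {i, j, k, l}" "2 \<in> {i, j, k, l}" "3 \<in> {i, j, k, l}"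
    by simp_all
  show ?thesis
  proof (cases "i = k")
    case True
    have jl: "j \<noteq> l"
      using m True unfolding insert_iff empty_iff by presburger
    have "par j \<noteq> par i \<or> par l \<noteq> par i"
      unfolding par using c ne True jl by presburger
    then obtain v where v: "v \<in> I" "v \<noteq> i" "par v \<noteq> par i" "v = j \<or> v = l"
      using I ne by metis
    then have "eps (par i + par v) = (- 1 :: 'r)"
      by (cases "par i"; cases "par v"; simp)
    then have "wt i v j - wt i v i + wt i v l - wt i v k = - 1"
      using v ne True jl by (auto simp: wt_def)
    then have "fscale (- 1) (pr (E i j a) (E k l b)) \<approx> 0"
      using comm_weight[OF I(1,2) ne(1) I(3,4) ne(2) I(1) v(1) _ ne(3,4) ab] v(2) by simp
    then show ?thesis
      using eqB_scale[of _ 0 "- 1"] by fastforce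
  next
    case False
    have jl: "j = l"
      using c ne False by presburger
    have "par i \<noteq> par j \<or> par k \<noteq> par j"
      unfolding par using c ne False by presburger
    then obtain v where v: "v \<in> I" "v \<noteq> j" "par v \<noteq> par j" "v = i \<or> v = k"
      using I ne by metis
    then have "eps (par j + par v) = (- 1 :: 'r)"
      by (cases "par j"; cases "par v"; simp)
    then have "wt j v j - wt j v i + wt j v l - wt j v k = 1"
      using v ne False jl by (auto simp: wt_def)
    then show ?thesis
      using comm_weight[OF I(1,2) ne(1) I(3,4) ne(2) I(2) v(1) _ ne(3,4) ab] v(2) by simp
  qed
qed

text \<open>For \<open>r = 0\<close> all axioms but \<open>commuting\<close> are vacuous.\<close>

lemma exceptional_weights_none:
  assumes "m + n \<ge> 5 \<or> m = 2 \<and> n = 1"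
  shows "exceptional_weights D m n 0 (\<lambda>_. 1) (\<lambda>_. 2) (\<lambda>_. 1) (\<lambda>_. 3) (\<lambda>_. {}) (\<lambda>_ _ _. 0)"
proof (unfold_locales, goal_cases)
  case (4 i j k l a p b q)
  then show ?case
    using perfect_commuting[OF assms 4] fs.span_base by (auto simp: eqB_0)
qed simp_all

section \<open>Four distinct indices\<close>

lemma weight4_double:
  assumes I: "i \<in> I" "j \<in> I" "k \<in> I" "l \<in> I" and ne: "i \<noteq> j" "i \<noteq> k" "i \<noteq> l" "j \<noteq> k" "j \<noteq> l" "k \<noteq> l"
    and par: "\<not> (par i = par k \<and> par j = par l \<and> par i \<noteq> par j)" and ab: "a \<in> part D p" "b \<in> part D q"
  shows "fscale 2 (pr (E i j a) (E k l b)) \<approx> 0"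
proof -
  \<comment> \<open>\<open>hh i v\<close> has weight -2 if \<open>v\<close> is one of the columns
    and has the parity of \<open>i\<close>, or if \<open>v\<close> is the other row and has the
    opposite parity. The excluded parities are those for which there is no such
    \<open>v\<close>.\<close>
  obtain v where v: "v \<in> I" "i \<noteq> v" "wt i v j - wt i v i + wt i v l - wt i v k = - 2"
  proof -
    consider "par i = par j" | "par i \<noteq> par k" | "par i = par l"
      using par by (cases "par i"; cases "par j"; cases "par k"; cases "par l"; simp)
    then show thesis
    proof cases
      case 1
      then show thesis
        using that[OF I(2) ne(1)] ne by (cases "par j"; simp add: wt_def)
    next
      case 2
      then show thesis
        using that[OF I(3) ne(2)] ne by (cases "par i"; cases "par k"; simp add: wt_def)
    next
      case 3
      then show thesis
        using that[OF I(4) ne(3)] ne by (cases "par l"; simp add: wt_def)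
    qed
  qed
  have "fscale (- 2) (pr (E i j a) (E k l b)) \<approx> 0"
    using comm_weight[OF I(1,2) ne(1) I(3,4) ne(6) I(1) v(1,2) ne(4,3) ab] v(3) by simp
  then show ?thesis
    using eqB_scale[of _ 0 "- 1"] by fastforce
qed

lemma weight4_commutes:
  assumes I: "i \<in> I" "j \<in> I" "k \<in> I" "l \<in> I" and ne: "i \<noteq> j" "i \<noteq> k" "i \<noteq> l" "j \<noteq> k" "j \<noteq> l" "k \<noteq> l"
    and abc: "a \<in> part D p" "b \<in> part D q" "c \<in> part D s"
  shows "pr (E i j ((a \<stileturn> b) \<stileturn> c)) (E k l \<one>) \<approx> fscale (eps (p * q)) (pr (E i j ((b \<turnstile> a) \<stileturn> c)) (E k l \<one>))"
proof -
  let ?F = "\<lambda>u. pr (E i j u) (E k l \<one>)"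
  have ba: "b \<turnstile> a \<in> part D (q + p)" "(b \<turnstile> a) \<stileturn> c \<in> part D (q + p + s)"
    using abc by (auto intro: lprod_degree rprod_degree)
  let ?s1 = "- eps ((par k + par j) * (par j + par l + (q + s))) * - eps ((par k + par l) * (par l + par j)) :: 'r"
  let ?s2 = "- eps ((par i + par j + p) * (par k + par i + q)) :: 'r"
  let ?s3 = "- eps ((par i + par j) * (par j + par l + s)) * - eps ((par i + par l) * (par l + par j)) :: 'r"
  let ?s4 = "- eps ((par k + par j + (q + p + s)) * (par i + par k)) :: 'r"
  have 1: "pr (E i j a) (E k l (b \<stileturn> c)) \<approx> fscale ?s1 (?F (a \<stileturn> (b \<stileturn> c)))"
    by (rule columns_one[OF I ne(1,3,4,5,6) abc(1) lprod_degree[OF abc(2,3)]])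
  have "pr (E i j a) (E k l (b \<stileturn> c)) \<approx> fscale ?s2 (pr (E k j (b \<turnstile> a)) (E i l c))"
    by (rule exchange_rows[OF I ne(1-4,6) abc])
  also have "pr (E k j (b \<turnstile> a)) (E i l c) \<approx> fscale ?s3 (pr (E k j ((b \<turnstile> a) \<stileturn> c)) (E i l \<one>))"
    using ne by (intro columns_one[OF I(3,2,1,4) _ _ _ _ _ ba(1) abc(3)]) auto
  also have "pr (E k j ((b \<turnstile> a) \<stileturn> c)) (E i l \<one>) \<approx> fscale ?s4 (?F ((b \<turnstile> a) \<stileturn> c))"
    by (rule rows_right_1[OF I ne(1-4,6) ba(2)])
  finally have 2: "pr (E i j a) (E k l (b \<stileturn> c)) \<approx> fscale (?s2 * ?s3 * ?s4) (?F ((b \<turnstile> a) \<stileturn> c))"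
    by this
  have "?s1 * ?s1 = 1"
    by (cases "(par k + par j) * (par j + par l + (q + s))"; cases "(par k + par l) * (par l + par j)"; simp only: eps_simps; simp)
  then have "?F (a \<stileturn> (b \<stileturn> c)) \<approx> fscale ?s1 (pr (E i j a) (E k l (b \<stileturn> c)))"
    using eqB_sym[OF eqB_scale[OF 1, of ?s1]] by simp
  from eqB_scaled[OF this 2] have "?F (a \<stileturn> (b \<stileturn> c)) \<approx> fscale (?s1 * (?s2 * ?s3 * ?s4)) (?F ((b \<turnstile> a) \<stileturn> c))" .
  \<comment> \<open>All index parities cancel except for the comparison of the two rows.\<close>
  also have "?s1 * (?s2 * ?s3 * ?s4) = eps (par i + par k) * eps (p * q)"
    by (cases "par i"; cases "par j"; cases "par k"; cases "par l"; cases p; cases q; cases s; simp)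
  finally have 3: "?F ((a \<stileturn> b) \<stileturn> c) \<approx> fscale (eps (par i + par k) * eps (p * q)) (?F ((b \<turnstile> a) \<stileturn> c))"
    by (simp add: lprod_assoc)
  show ?thesis
  proof (cases "par i = par k")
    case True
    then have "par i + par k = 0"
      by (cases "par k") simp_all
    then show ?thesis
      using 3 by simp
  next
    case False
    then have s: "eps (par i + par k) = (- 1 :: 'r)"
      by (cases "par i"; cases "par k"; simp)
    have "fscale (eps (p * q)) (fscale 2 (?F ((b \<turnstile> a) \<stileturn> c))) \<approx> fscale (eps (p * q)) 0"
      using False by (intro eqB_scale weight4_double[OF I ne _ ba(2) barunit_even]) simp
    from eqB_diff[OF 3 this] show ?thesis
      unfolding s eqB_def by (simp add: fs.scale_left_distrib[of 1 1, simplified] fs.scale_right_distrib)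
  qed
qed

text \<open>Thus for each weight one arrangement of its rows and columns represents all of
  them.\<close>

lemma weight4_span:
  assumes I: "i \<in> I" "j \<in> I" "k \<in> I" "l \<in> I" and ne: "i \<noteq> j" "i \<noteq> k" "i \<noteq> l" "j \<noteq> k" "j \<noteq> l" "k \<noteq> l"
    and W: "fs.subspace W" "BL \<subseteq> W"
    and P: "\<And>a b p q. a \<in> part D p \<Longrightarrow> b \<in> part D q \<Longrightarrow> pr (E i j a) (E k l b) \<in> W"
    and ab: "a \<in> part D p" "b \<in> part D q"
  shows "pr (E i l a) (E k j b) \<in> W" "pr (E k j a) (E i l b) \<in> W"
proof -
  have eq: "u \<in> W" if "u \<approx> fscale s v" "v \<in> W" for u v s
    using fs.subspace_add[OF W(1), of "u - fscale s v" "fscale s v"] fs.subspace_scale[OF W(1)] that W(2)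
    by (auto simp: eqB_def)
  have w: "pr (E i j c) (E k l \<one>) \<in> W" if "c \<in> part D s" for c s
    by (rule P[OF that barunit_even])
  note ab' = lprod_degree[OF ab]
  have "pr (E i l (a \<stileturn> b)) (E k j \<one>) \<in> W"
    by (rule eq[OF columns_right_1[OF I ne(1,3,4,5,6) ab'] w[OF ab']])
  from eq[OF columns_one[OF I(1,4,3,2) _ _ _ _ _ ab] this] show "pr (E i l a) (E k j b) \<in> W"
    using ne by simp
  have "pr (E k j (a \<stileturn> b)) (E i l \<one>) \<in> W"
    by (rule eq[OF rows_right_1[OF I ne(1-4,6) ab'] w[OF ab']])
  from eq[OF columns_one[OF I(3,2,1,4) _ _ _ _ _ ab] this] show "pr (E k j a) (E i l b) \<in> W"
    using ne by simp
qed

lemma weight4_kernel: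
  assumes I: "i \<in> I" "j \<in> I" "k \<in> I" "l \<in> I" and ne: "i \<noteq> j" "i \<noteq> k" "i \<noteq> l" "j \<noteq> k" "j \<noteq> l" "k \<noteq> l"
    and K: "K = 0 \<or> K = 2 \<and> \<not> (par i = par k \<and> par j = par l \<and> par i \<noteq> par j)" and a: "a \<in> CI K"
  shows "pr (E i j a) (E k l \<one>) \<in> BL"
proof (rule commutator_ideal_kernel[OF E_L[OF I(3,4) ne(6)] I(1,2) ne(1) _ weight4_commutes[OF I ne] a])
  show "fscale (of_nat K) (pr (E i j a) (E k l \<one>)) \<approx> 0" if "a \<in> part D p" for a p
    using K weight4_double[OF I ne _ that barunit_even] by auto
qed

text \<open>The six exceptional weights correspond to the sets \<open>{w4i t, w4k t}\<close> of two rows, with the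
  complementary columns.\<close>

definition "w4i = (\<lambda>t. [1, 1, 2, 2, 1, 3] ! t :: nat)"
definition "w4j = (\<lambda>t. [2, 2, 1, 1, 3, 1] ! t :: nat)"
definition "w4k = (\<lambda>t. [3, 4, 3, 4, 2, 4] ! t :: nat)"
definition "w4l = (\<lambda>t. [4, 3, 4, 3, 4, 2] ! t :: nat)"

text \<open>The weights on which every Cartan element \<open>hh u v\<close> acts by zero, so that
  nothing forces 2 to vanish. In type (2, 2) these are the slots 4 and 5.\<close>

definition alternating :: "nat \<Rightarrow> bool" where
  "alternating t \<longleftrightarrow> par (w4i t) = par (w4k t) \<and> par (w4j t) = par (w4l t) \<and> par (w4i t) \<noteq> par (w4j t)"

lemma less_6: "t < 6 \<longleftrightarrow> t = 0 \<or> t = 1 \<or> t = 2 \<or> t = 3 \<or> t = 4 \<or> t = (5 :: nat)"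
  by auto

lemma w4_simps:
  "w4i 0 = 1" "w4i (Suc 0) = 1" "w4i 2 = 2" "w4i 3 = 2" "w4i 4 = 1" "w4i 5 = 3"
  "w4j 0 = 2" "w4j (Suc 0) = 2" "w4j 2 = 1" "w4j 3 = 1" "w4j 4 = 3" "w4j 5 = 1"
  "w4k 0 = 3" "w4k (Suc 0) = 4" "w4k 2 = 3" "w4k 3 = 4" "w4k 4 = 2" "w4k 5 = 4"
  "w4l 0 = 4" "w4l (Suc 0) = 3" "w4l 2 = 4" "w4l 3 = 3" "w4l 4 = 4" "w4l 5 = 2"
  by (simp_all add: w4i_def w4j_def w4k_def w4l_def nth_Cons')

lemma w4_distinct:
  assumes "t < 6"
  shows "{w4i t, w4j t, w4k t, w4l t} = {1, 2, 3, 4}" "w4i t \<noteq> w4j t" "w4i t \<noteq> w4k t" "w4i t \<noteq> w4l t"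
    "w4j t \<noteq> w4k t" "w4j t \<noteq> w4l t" "w4k t \<noteq> w4l t"
  using assms unfolding less_6 by (elim disjE; simp add: w4_simps; blast)+

definition psi4_slot :: "nat \<Rightarrow> (nat \<Rightarrow> nat \<Rightarrow> 'd) \<Rightarrow> (nat \<Rightarrow> nat \<Rightarrow> 'd) \<Rightarrow> 'd" where
  "psi4_slot t x y = psi4 (w4i t) (w4j t) (w4k t) (w4l t) x (if alternating t then (\<lambda>u v. ptw (y u v)) else y)"

lemma commuting4:
  assumes mn: "m + n = 4" and I: "i \<in> I" "j \<in> I" "k \<in> I" "l \<in> I" and ne: "i \<noteq> j" "k \<noteq> l" "j \<noteq> k" "i \<noteq> l"
    and ab: "a \<in> part D p" "b \<in> part D q"
  shows "pr (E i j a) (E k l b) \<in> fs.span (BL \<union> {pr (E (w4i t) (w4j t) c) (E (w4k t) (w4l t) \<one>) | t c. t < 6})"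
    (is "_ \<in> ?W")
proof -
  have I4: "I = {1, 2, 3, 4}"
    unfolding I_def mn by auto
  have W: "fs.subspace ?W" "BL \<subseteq> ?W"
    by (rule fs.subspace_span) (auto intro: fs.span_base)
  define Q where "Q i j k l \<longleftrightarrow> (\<forall>a b p q. a \<in> part D p \<longrightarrow> b \<in> part D q \<longrightarrow> pr (E i j a) (E k l b) \<in> ?W)" for i j k l
  have swap: "Q i l k j" "Q k j i l" if Q: "Q i j k l" and I: "i \<in> I" "j \<in> I" "k \<in> I" "l \<in> I" and "distinct [i, j, k, l]" for i j k l
  proof -
    have ne: "i \<noteq> j" "i \<noteq> k" "i \<noteq> l" "j \<noteq> k" "j \<noteq> l" "k \<noteq> l"
      using that by auto
    have P: "pr (E i j a) (E k l b) \<in> ?W" if "a \<in> part D p" "b \<in> part D q" for a b p q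
      using Q that unfolding Q_def by blast
    show "Q i l k j" "Q k j i l"
      unfolding Q_def by (intro allI impI, rule weight4_span[OF I ne W P], assumption+)+
  qed
  have slot: "Q (w4i t) (w4j t) (w4k t) (w4l t)" if t: "t < 6" for t
  proof -
    have i: "w4i t \<in> I" "w4j t \<in> I" "w4k t \<in> I" "w4l t \<in> I"
      using w4_distinct(1)[OF t] unfolding I4 by blast+
    have "pr (E (w4i t) (w4j t) a) (E (w4k t) (w4l t) b) \<in> ?W" if "a \<in> part D p" "b \<in> part D q" for a b p q
    proof -
      define s :: 'r where "s = - eps ((par (w4k t) + par (w4j t)) * (par (w4j t) + par (w4l t) + q)) *
        - eps ((par (w4k t) + par (w4l t)) * (par (w4l t) + par (w4j t)))"
      define v where "v = pr (E (w4i t) (w4j t) (a \<stileturn> b)) (E (w4k t) (w4l t) \<one>)"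
      have u: "pr (E (w4i t) (w4j t) a) (E (w4k t) (w4l t) b) - fscale s v \<in> ?W"
        using columns_one[OF i w4_distinct(2,4,5,6,7)[OF t] that] W(2) by (auto simp: eqB_def s_def v_def)
      have "v \<in> ?W"
        unfolding v_def by (rule fs.span_base) (use t in blast)
      from fs.span_add[OF u fs.span_scale[OF this, of s]] show ?thesis
        by (simp only: diff_add_cancel)
    qed
    then show ?thesis
      by (simp add: Q_def)
  qed
  show ?thesis
  proof (cases "distinct [i, j, k, l]")
    case True
    note s = slot[of 0] slot[of 1] slot[of 2] slot[of 3] slot[of 4] slot[of 5]
    have s': "Q 1 2 3 4" "Q 1 2 4 3" "Q 2 1 3 4" "Q 2 1 4 3" "Q 1 3 2 4" "Q 3 1 4 2"
      using s by (simp_all add: w4_simps)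
    have u: "Q i l k j \<and> Q k j i l \<and> Q k l i j" if "Q i j k l" "distinct [i, j, k, l]" "set [i, j, k, l] \<subseteq> I" for i j k l
      using swap[of i j k l] swap(1)[of k j i l] that by auto
    \<comment> \<open>From each slot the exchanges of rows and of columns reach four arrangements;
      six slots account for all 24 orders of the indices.\<close>
    note r = s' s'[THEN u, unfolded I4, simplified]
    have "Q i j k l"
      using I True unfolding I4 insert_iff empty_iff
      by (elim disjE; simp add: r[unfolded One_nat_def])
    then show ?thesis
      using ab unfolding Q_def by blast
  next
    case False
    \<comment> \<open>A repeated index leaves one of the four indices free for
      \<open>comm_disjoint\<close>.\<close>
    have "\<not> I \<subseteq> {i, j, k, l}"
    proof
      assume "I \<subseteq> {i, j, k, l}"
      then have "card I \<le> card (set [i, j, k, l])"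
        by (intro card_mono) auto
      also have "\<dots> < length [i, j, k, l]"
        using False card_distinct[of "[i, j, k, l]"] card_length[of "[i, j, k, l]"] by linarith
      finally show False
        unfolding I4 by simp
    qed
    then obtain w where "w \<in> I" "w \<noteq> i" "w \<noteq> j" "w \<noteq> k" "w \<noteq> l"
      by blast
    then have "pr (E i j a) (E k l b) \<approx> 0"
      using comm_disjoint[OF I(1,2) ne(1) I(3,4) ne(2-4)] ab by blast
    then show ?thesis
      using W(2) by (auto simp: eqB_0)
  qed
qed

lemma psi4_simps:
  "psi4 i j k l (x + x') y = psi4 i j k l x y + psi4 i j k l x' y"
  "psi4 i j k l x (y + y') = psi4 i j k l x y + psi4 i j k l x y'"
  "psi4 i j k l (mat_scale D c x) y = smult D c (psi4 i j k l x y)"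
  "psi4 i j k l x (mat_scale D c y) = smult D c (psi4 i j k l x y)"
  by (simp_all add: psi4_def mat_scale_def mul_simps md.scale_right_distrib md.scale_right_diff_distrib)

lemma psi4_part:
  assumes "x \<in> part L p" "y \<in> part L q"
  shows "psi4 i j k l x y \<in> part D (p + q + (par i + par j + par k + par l))"
proof -
  have "x a b \<stileturn> y c d \<in> part D (p + q + (par i + par j + par k + par l))"
    if "par a + par b + par c + par d = par i + par j + par k + par l" for a b c d
  proof -
    have "(par a + par b + p) + (par c + par d + q) = p + q + (par i + par j + par k + par l)"
      unfolding that[symmetric] by (simp only: ac_simps)
    then show ?thesis
      using lprod_degree[OF entry_part[OF assms(1), of a b] entry_part[OF assms(2), of c d]] by (simp only:)
  qed
  then show ?thesis
    unfolding psi4_def by (intro part_closed) (simp_all add: ac_simps)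
qed

lemma exceptional_weights4:
  assumes mn: "m + n = 4" and J: "\<And>t. t < 6 \<Longrightarrow> J t = (if alternating t then CI 0 else CI 2)"
  shows "exceptional_weights D m n 6 w4i w4j w4k w4l J psi4_slot"
proof (unfold_locales, goal_cases)
  have I4: "I = {1, 2, 3, 4}"
    unfolding I_def mn by auto
  have w4: "w4i t \<in> I" "w4j t \<in> I" "w4k t \<in> I" "w4l t \<in> I" "I = {w4i t, w4j t, w4k t, w4l t}" if t: "t < 6" for t
    using w4_distinct(1)[OF t] unfolding I4 by blast+
  note dist = w4_distinct(2-7)
  {
    case (1 t)
    then show ?case
      using w4 by simp
  next
    case (2 t)
    then show ?case
      using dist by simp
  next
    case (3 t)
    then show ?case
      by (simp add: J CI_sub)
  next
    case (4 i j k l a p b q)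
    then show ?case
      by (rule commuting4[OF mn])
  next
    case (5 t a)
    then have a: "a \<in> CI (if alternating t then 0 else 2)"
      by (simp add: J split: if_splits)
    show ?case
      by (rule weight4_kernel[OF w4(1-4)[OF 5(1)] dist[OF 5(1)] _ a]) (simp add: alternating_def)
  next
    case (6 t x y z)
    then show ?case
      by (simp add: psi4_slot_def psi4_simps del: plus_fun_apply)
  next
    case (7 t z x y)
    have "(\<lambda>u v. ptw ((x + y) u v)) = (\<lambda>u v. ptw (x u v)) + (\<lambda>u v. ptw (y u v))"
      by (simp add: fun_eq_iff ptw_simps)
    then show ?case
      by (simp add: psi4_slot_def psi4_simps del: plus_fun_apply)
  next
    case (8 t c x z)
    then show ?case
      by (simp add: psi4_slot_def psi4_simps)
  next
    case (9 t z c x)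
    have "(\<lambda>u v. ptw (mat_scale D c x u v)) = mat_scale D c (\<lambda>u v. ptw (x u v))"
      by (simp add: fun_eq_iff mat_scale_def ptw_simps)
    then show ?case
      by (simp add: psi4_slot_def psi4_simps)
  next
    case (10 t x p y q)
    then show ?case
    proof (cases "alternating t")
      case True
      then have a: "par (w4i t) = par (w4k t)" "par (w4j t) = par (w4l t)" "par (w4j t) = par (w4i t) + 1"
        unfolding alternating_def by (cases "par (w4i t)"; cases "par (w4j t)"; simp)+
      show ?thesis
        using True psi4_part[OF 10(2,3)] part_closed(3) by (simp add: psi4_slot_def psi4_ptw[OF 10(3) a])
    qed (simp add: psi4_slot_def psi4_part)
  next
    case (11 t x p y q z s)
    then show ?case
    proof (cases "alternating t")
      case True
      then have a: "par (w4i t) = par (w4k t)" "par (w4j t) = par (w4l t)" "par (w4j t) = par (w4i t) + 1"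
        unfolding alternating_def by (cases "par (w4i t)"; cases "par (w4j t)"; simp)+
      have "br y z \<in> part L (q + s)"
        using br_L_part[OF 11(3,4)] .
      then show ?thesis
        using True psi4_cocycle_super[OF CI_sub CI_I(1) 11(2-4) w4(5)[OF 11(1)] dist[OF 11(1)] a] 11
        by (simp add: psi4_slot_def J psi4_ptw[OF _ a])
    next
      case False
      then show ?thesis
        using psi4_cocycle_mod2[OF CI_sub CI_I(1) CI_I(2)[of 2, simplified] 11(2-4) w4(5)[OF 11(1)] dist[OF 11(1)]] 11
        by (simp add: psi4_slot_def J)
    qed
  next
    case (12 t s a)
    then have z: "0 \<in> J s"
      using md.subspace_0[OF CI_sub] by (simp add: J)
    \<comment> \<open>A minor only sees pairs of positions in its own two rows and two columns,
      hence no other slot.\<close>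
    have "psi4 (w4i s) (w4j s) (w4k s) (w4l s) (E (w4i t) (w4j t) a) (E (w4k t) (w4l t) \<one>) = (if s = t then a else 0)"
      using 12 unfolding less_6 by (elim disjE; simp add: w4_simps psi4_def E_def mul_simps barunit)
    moreover have "(\<lambda>u v. ptw (E (w4k t) (w4l t) \<one> u v)) = E (w4k t) (w4l t) \<one>"
      by (simp add: fun_eq_iff E_def ptw_simps)
    ultimately show ?case
      using z by (cases "s = t") (simp_all add: psi4_slot_def)
  next
    case (13 t a b)
    then show ?case
      unfolding less_6 by (elim disjE; simp add: w4_simps psi4_slot_def psi4_def E_def mul_simps ptw_simps)
  }
qed

section \<open>Three indices of even parity\<close>

lemma commuting3_cases:
  assumes mn: "m = 3" "n = 0"
    and I: "i \<in> I" "j \<in> I" "k \<in> I" "l \<in> I" and ne: "i \<noteq> j" "k \<noteq> l" "j \<noteq> k" "i \<noteq> l"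
  shows "i = k \<and> j \<noteq> l \<or> i \<noteq> k \<and> j = l \<or> (\<exists>w\<in>I. w \<notin> {i, j, k, l})"
proof -
  have I3: "x \<in> I \<longleftrightarrow> 1 \<le> x \<and> x \<le> 3" for x
    unfolding I_def by (simp add: mn)
  show ?thesis
  proof (cases "i = k \<and> j = l")
    case True
    \<comment> \<open>Both factors sit at one position, so a third index is free.\<close>
    then show ?thesis
      using third[of i j] by auto
  next
    case False
    then have "i = k \<and> j \<noteq> l \<or> i \<noteq> k \<and> j = l"
      using I ne unfolding I3 by presburger
    then show ?thesis
      by blast
  qed
qed

context
  assumes even: "\<And>i. i \<in> I \<Longrightarrow> par i = 0"
begin

lemma E_even: "i \<in> I \<Longrightarrow> j \<in> I \<Longrightarrow> i \<noteq> j \<Longrightarrow> a \<in> part D p \<Longrightarrow> E i j a \<in> part L p"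
  using E_partL[of i j a p] even by simp

lemma row_one:
  assumes I: "i \<in> I" "j \<in> I" "l \<in> I" and ne: "i \<noteq> j" "i \<noteq> l" "j \<noteq> l" and ac: "a \<in> part D p" "c \<in> part D s"
  shows "pr (E i j a) (E i l c) \<approx> pr (E i j (a \<stileturn> c)) (E i l \<one>)"
  using columns_one[OF I(1,2,1,3) ne(1,2) _ ne(3,2) ac] ne(1) even I by simp

lemma row_swap:
  assumes I: "i \<in> I" "j \<in> I" "l \<in> I" and ne: "i \<noteq> j" "i \<noteq> l" "j \<noteq> l" and a: "a \<in> part D p"
  shows "pr (E i l a) (E i j \<one>) \<approx> fscale (- 1) (pr (E i j a) (E i l \<one>))"
  using columns_right_1[OF I(1,2,1,3) ne(1,2) _ ne(3,2) a] ne(1) even I by simp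

text \<open>The bracket of \<open>E i j c\<close> and \<open>E j i \<one>\<close> is
  \<open>E i i c - E j j c\<close>, a Cartan element with a coefficient. It acts on
  \<open>E i j a\<close> from both sides and on \<open>E i l b\<close> from one side, three times in
  all: for \<open>b = c = \<one>\<close> the relation says that 3 kills the class of
  \<open>a\<close>.\<close>

lemma row_cycle:
  assumes I: "i \<in> I" "j \<in> I" "l \<in> I" and ne: "i \<noteq> j" "i \<noteq> l" "j \<noteq> l"
    and abc: "a \<in> part D p" "b \<in> part D q" "c \<in> part D s"
  shows "fscale 2 (pr (E i j ((a \<stileturn> c) \<stileturn> b)) (E i l \<one>)) + fscale (eps (p * s)) (pr (E i j ((c \<turnstile> a) \<stileturn> b)) (E i l \<one>)) \<approx> 0"
proof -
  let ?x = "E i j a" and ?y = "E i l b" and ?z = "br (E i j c) (E j i \<one>)"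
  have z: "?z = E i i c - E j j c"
    using I even by (simp add: br_E[OF _ _ _ _ abc(3) barunit_even] barunit)
  have p: "?x \<in> part L p" "?y \<in> part L q" "?z \<in> part L s"
    using E_even[OF I(1,2) ne(1) abc(1)] E_even[OF I(1,3) ne(2) abc(2)]
      br_L_part[OF E_even[OF I(1,2) ne(1) abc(3)] E_even[OF I(2,1) ne(1)[symmetric] barunit_even]] by simp_all
  have G: "E u v d \<in> supermodule.carrier G" if "u \<in> I" "v \<in> I" for u v d
    using that by simp
  have yz: "br ?y ?z = mat_scale D (- eps (q * s)) (E i l (c \<turnstile> b))"
    unfolding z using I ne even by (simp add: br_diff br_E[OF _ _ _ _ abc(2,3)] E_simps[symmetric])
  have xz: "br ?x ?z = - (E i j (a \<stileturn> c) + mat_scale D (eps (p * s)) (E i j (c \<turnstile> a)))"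
    unfolding z using I ne even by (simp add: br_diff br_E[OF _ _ _ _ abc(1,3)] E_simps algebra_simps)
  have xy: "br ?x ?y = 0"
    using I ne by (simp add: br_E_gen)
  note EL = E_L[OF I(1,2) ne(1)] E_L[OF I(1,3) ne(2)]
  have ca: "a \<stileturn> c \<in> part D (p + s)" "c \<turnstile> a \<in> part D (s + p)"
    using abc by (auto intro: lprod_degree rprod_degree)
  let ?F = "\<lambda>u. pr (E i j u) (E i l \<one>)"
  have zL: "?z \<in> supermodule.carrier L"
    using p(3) L_part by blast
  have "fscale (- eps (q * s)) (?F (a \<stileturn> (c \<stileturn> b))) \<approx> fscale (- eps (q * s)) (pr ?x (E i l (c \<stileturn> b)))"
    by (rule eqB_scale[OF eqB_sym[OF row_one[OF I ne abc(1) lprod_degree[OF abc(3,2)]]]])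
  also have "\<dots> \<approx> fscale (- eps (q * s)) (pr ?x (E i l (c \<turnstile> b)))"
    by (rule eqB_scale[OF bar_side_gen[OF EL(1) I(1,3) ne(2)]])
  also have "\<dots> \<approx> pr ?x (br ?y ?z)"
    unfolding yz by (rule eqB_sym[OF pr_scale(2)[OF EL(2,1)]])
  also have "\<dots> \<approx> pr (br ?x ?y) ?z - fscale (eps (q * s)) (pr (br ?x ?z) ?y)"
    by (rule leib[OF EL(1) p(2,3)])
  also have "\<dots> \<approx> 0 - fscale (eps (q * s)) (- (pr (E i j (a \<stileturn> c)) ?y + fscale (eps (p * s)) (pr (E i j (c \<turnstile> a)) ?y)))"
    unfolding xy xz
    by (intro eqB_diff eqB_scale pr_zero(1)[OF zL] eqB_trans[OF pr_neg(1) eqB_neg] eqB_trans[OF pr_add(1) eqB_add]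
        eqB_refl pr_scale(1) L_closed EL)
  also have "\<dots> \<approx> 0 - fscale (eps (q * s)) (- (?F ((a \<stileturn> c) \<stileturn> b) + fscale (eps (p * s)) (?F ((c \<turnstile> a) \<stileturn> b))))"
    by (intro eqB_diff eqB_scale eqB_neg eqB_add eqB_refl row_one[OF I ne ca(1) abc(2)] row_one[OF I ne ca(2) abc(2)])
  finally have "fscale (- eps (q * s)) (fscale (- eps (q * s)) (?F (a \<stileturn> (c \<stileturn> b)))) \<approx> fscale (- eps (q * s))
      (0 - fscale (eps (q * s)) (- (?F ((a \<stileturn> c) \<stileturn> b) + fscale (eps (p * s)) (?F ((c \<turnstile> a) \<stileturn> b)))))"
    by (rule eqB_scale)
  then show ?thesis
    by (simp add: eqB_def lprod_assoc fs.scale_left_distrib[of 1 1, simplified] fs.scale_right_distrib fs.scale_right_diff_distrib algebra_simps)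
qed

text \<open>Exchanging rows twice restores the positions, but places \<open>c\<close> to the left of
  \<open>a\<close>. This is why the relations for columns are written with
  \<open>\<turnstile>\<close>.\<close>

lemma col_one:
  assumes I: "i \<in> I" "j \<in> I" "k \<in> I" and ne: "i \<noteq> j" "i \<noteq> k" "j \<noteq> k" and ac: "a \<in> part D p" "c \<in> part D s"
  shows "pr (E i j a) (E k j c) \<approx> fscale (eps (p * s)) (pr (E i j (c \<turnstile> a)) (E k j \<one>))"
proof -
  have ca: "c \<turnstile> a \<in> part D (s + p)"
    by (rule rprod_degree[OF ac(2,1)])
  have "pr (E i j a) (E k j (c \<stileturn> \<one>)) \<approx> fscale (- eps (p * s)) (pr (E k j (c \<turnstile> a)) (E i j \<one>))"
    using exchange_rows[OF I(1,2,3,2) ne(1,2,1,3) _ ac barunit_even] ne(3) even I by simp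
  also have "pr (E k j (c \<turnstile> a)) (E i j \<one>) \<approx> fscale (- 1) (pr (E i j (c \<turnstile> a)) (E k j \<one>))"
    using rows_right_1[OF I(1,2,3,2) ne(1,2,1,3) _ ca] ne(3) even I by simp
  finally show ?thesis
    by (simp add: barunit)
qed

lemma col_swap:
  assumes I: "i \<in> I" "j \<in> I" "k \<in> I" and ne: "i \<noteq> j" "i \<noteq> k" "j \<noteq> k" and a: "a \<in> part D p"
  shows "pr (E k j a) (E i j \<one>) \<approx> fscale (- 1) (pr (E i j a) (E k j \<one>))"
  using rows_right_1[OF I(1,2,3,2) ne(1,2,1,3) _ a] ne(3) even I by simp

lemma col_cycle:
  assumes I: "i \<in> I" "j \<in> I" "k \<in> I" and ne: "i \<noteq> j" "i \<noteq> k" "j \<noteq> k"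
    and abc: "a \<in> part D p" "b \<in> part D q" "c \<in> part D s"
  shows "fscale (2 * eps (p * s)) (pr (E i j (b \<turnstile> (c \<turnstile> a))) (E k j \<one>)) + pr (E i j (b \<turnstile> (a \<stileturn> c))) (E k j \<one>) \<approx> 0"
proof -
  let ?x = "E i j a" and ?y = "E k j b" and ?z = "br (E j i c) (E i j \<one>)"
  have z: "?z = E j j c - E i i c"
    using I even by (simp add: br_E[OF _ _ _ _ abc(3) barunit_even] barunit)
  have p: "?x \<in> part L p" "?y \<in> part L q" "?z \<in> part L s"
    using E_even[OF I(1,2) ne(1) abc(1)] E_even[OF I(3,2) ne(3)[symmetric] abc(2)]
      br_L_part[OF E_even[OF I(2,1) ne(1)[symmetric] abc(3)] E_even[OF I(1,2) ne(1) barunit_even]] by simp_all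
  have yz: "br ?y ?z = E k j (b \<stileturn> c)"
    unfolding z using I ne even by (simp add: br_diff br_E[OF _ _ _ _ abc(2,3)])
  have xz: "br ?x ?z = E i j (a \<stileturn> c) + mat_scale D (eps (p * s)) (E i j (c \<turnstile> a))"
    unfolding z using I ne even by (simp add: br_diff br_E[OF _ _ _ _ abc(1,3)] E_simps[symmetric])
  have xy: "br ?x ?y = 0"
    using I ne by (simp add: br_E_gen)
  note EL = E_L[OF I(1,2) ne(1)] E_L[OF I(3,2) ne(3)[symmetric]]
  have ca: "a \<stileturn> c \<in> part D (p + s)" "c \<turnstile> a \<in> part D (s + p)" "b \<stileturn> c \<in> part D (q + s)"
    using abc by (auto intro: lprod_degree rprod_degree)
  have zL: "?z \<in> supermodule.carrier L"
    using p(3) L_part by blast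
  let ?F = "\<lambda>u. pr (E i j u) (E k j \<one>)"
  have "fscale (eps (p * (q + s))) (?F ((b \<stileturn> c) \<turnstile> a)) \<approx> pr ?x (br ?y ?z)"
    unfolding yz by (rule eqB_sym[OF col_one[OF I ne abc(1) ca(3)]])
  also have "\<dots> \<approx> pr (br ?x ?y) ?z - fscale (eps (q * s)) (pr (br ?x ?z) ?y)"
    by (rule leib[OF EL(1) p(2,3)])
  also have "\<dots> \<approx> 0 - fscale (eps (q * s)) (pr (E i j (a \<stileturn> c)) ?y + fscale (eps (p * s)) (pr (E i j (c \<turnstile> a)) ?y))"
    unfolding xy xz
    by (intro eqB_diff eqB_scale pr_zero(1)[OF zL] eqB_trans[OF pr_add(1) eqB_add] eqB_refl pr_scale(1) L_closed EL)
  also have "\<dots> \<approx> 0 - fscale (eps (q * s)) (fscale (eps ((p + s) * q)) (?F (b \<turnstile> (a \<stileturn> c))) +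
      fscale (eps (p * s)) (fscale (eps ((s + p) * q)) (?F (b \<turnstile> (c \<turnstile> a)))))"
    by (intro eqB_diff eqB_scale eqB_add eqB_refl col_one[OF I ne ca(1) abc(2)] col_one[OF I ne ca(2) abc(2)])
  finally have "fscale (eps (p * q)) (fscale (eps (p * (q + s))) (?F ((b \<stileturn> c) \<turnstile> a))) \<approx> fscale (eps (p * q))
      (0 - fscale (eps (q * s)) (fscale (eps ((p + s) * q)) (?F (b \<turnstile> (a \<stileturn> c))) +
        fscale (eps (p * s)) (fscale (eps ((s + p) * q)) (?F (b \<turnstile> (c \<turnstile> a))))))"
    by (rule eqB_scale)
  then show ?thesis
    unfolding eqB_def dialgebra(3) rprod_assoc
    by (cases p; cases q; cases s)
      (simp_all add: fs.scale_left_distrib[of 1 1, simplified] fs.scale_right_distrib fs.scale_right_diff_distrib algebra_simps)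
qed

text \<open>Once \<open>3\<close> annihilates the weight space, the factor \<open>2\<close> in the cyclic relations is \<open>- 1\<close>.\<close>

lemma row_kernel:
  assumes I: "i \<in> I" "j \<in> I" "l \<in> I" and ne: "i \<noteq> j" "i \<noteq> l" "j \<noteq> l" and a: "a \<in> CI 3"
  shows "pr (E i j a) (E i l \<one>) \<in> BL"
proof -
  have 3: "fscale 3 (pr (E i j a) (E i l \<one>)) \<approx> 0" if "a \<in> part D p" for a p
    using row_cycle[OF I ne that barunit_even barunit_even] fs.scale_left_distrib[of "2 :: 'r" 1 "pr (E i j a) (E i l \<one>)"] by (simp add: barunit)
  show ?thesis
  proof (rule commutator_ideal_kernel[OF E_L[OF I(1,3) ne(2)] I(1,2) ne(1) _ _ a])
    show "fscale (of_nat 3) (pr (E i j a) (E i l \<one>)) \<approx> 0" if "a \<in> part D p" for a p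
      using 3[OF that] by simp
    show "pr (E i j ((a \<stileturn> b) \<stileturn> c)) (E i l \<one>) \<approx> fscale (eps (p * q)) (pr (E i j ((b \<turnstile> a) \<stileturn> c)) (E i l \<one>))"
      if abc: "a \<in> part D p" "b \<in> part D q" "c \<in> part D s" for a b c p q s
    proof -
      have h: "(a \<stileturn> b) \<stileturn> c \<in> part D (p + q + s)"
        using abc by (intro lprod_degree)
      have "u \<approx> v" if "fscale 3 u \<approx> 0" "fscale 2 u + v \<approx> 0" for u v
        using eqB_diff[OF that] fs.scale_left_distrib[of 2 1 u] by (simp add: eqB_def)
      from this[OF 3[OF h] row_cycle[OF I ne abc(1,3,2)]] show ?thesis .
    qed
  qed
qed

text \<open>Modulo 3, \<open>col_cycle\<close> lets \<open>a\<close> and \<open>c\<close> commute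
  under a left factor \<open>b\<close>; for \<open>b = \<one>\<close> it exchanges
  \<open>a \<stileturn> c\<close> with \<open>c \<turnstile> a\<close> up to sign. In
  \<open>(a \<stileturn> b) \<stileturn> c\<close> the factor \<open>c\<close> is therefore moved to
  the far left, \<open>a\<close> and \<open>b\<close> are exchanged under it, and \<open>c\<close>
  is moved back.\<close>

lemma col_kernel:
  assumes I: "i \<in> I" "j \<in> I" "k \<in> I" and ne: "i \<noteq> j" "i \<noteq> k" "j \<noteq> k" and a: "a \<in> CI 3"
  shows "pr (E i j a) (E k j \<one>) \<in> BL"
proof -
  let ?F = "\<lambda>u. pr (E i j u) (E k j \<one>)"
  have 3: "fscale 3 (?F a) \<approx> 0" if "a \<in> part D p" for a p
    using col_cycle[OF I ne that barunit_even barunit_even] fs.scale_left_distrib[of "2 :: 'r" 1 "?F a"] by (simp add: barunit)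
  have c: "?F (b \<turnstile> (a \<stileturn> c)) \<approx> fscale (eps (p * s)) (?F (b \<turnstile> (c \<turnstile> a)))"
    if abc: "a \<in> part D p" "b \<in> part D q" "c \<in> part D s" for a b c p q s
  proof -
    have h: "b \<turnstile> (c \<turnstile> a) \<in> part D (q + (s + p))"
      using abc by (intro rprod_degree)
    have "v \<approx> fscale e u" if "fscale 3 u \<approx> 0" "fscale (2 * e) u + v \<approx> 0" for u v and e :: 'r
      using eqB_diff[OF that(2) eqB_scale[OF that(1), of e]] fs.scale_left_distrib[of "2 * e" e u]
      by (simp add: eqB_def algebra_simps)
    from this[OF 3[OF h] col_cycle[OF I ne abc]] show ?thesis .
  qed
  have r: "?F (a \<stileturn> b) \<approx> fscale (eps (p * q)) (?F (b \<turnstile> a))" if "a \<in> part D p" "b \<in> part D q" for a b p q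
    using c[OF that(1) barunit_even that(2)] by (simp add: barunit)
  show ?thesis
  proof (rule commutator_ideal_kernel[OF E_L[OF I(3,2) ne(3)[symmetric]] I(1,2) ne(1) _ _ a])
    show "fscale (of_nat 3) (?F a) \<approx> 0" if "a \<in> part D p" for a p
      using 3[OF that] by simp
    show "?F ((a \<stileturn> b) \<stileturn> c) \<approx> fscale (eps (p * q)) (?F ((b \<turnstile> a) \<stileturn> c))"
      if abc: "a \<in> part D p" "b \<in> part D q" "c \<in> part D s" for a b c p q s
    proof -
      have "?F ((a \<stileturn> b) \<stileturn> c) \<approx> fscale (eps ((p + q) * s)) (?F (c \<turnstile> (a \<stileturn> b)))"
        by (rule r[OF lprod_degree[OF abc(1,2)] abc(3)])
      also have "?F (c \<turnstile> (a \<stileturn> b)) \<approx> fscale (eps (p * q)) (?F (c \<turnstile> (b \<turnstile> a)))"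
        by (rule c[OF abc(1,3,2)])
      also have "?F (c \<turnstile> (b \<turnstile> a)) \<approx> fscale (eps ((p + q) * s)) (?F ((b \<turnstile> a) \<stileturn> c))"
        using eqB_scale[OF r[OF rprod_degree[OF abc(2,1)] abc(3)], of "eps ((p + q) * s)", THEN eqB_sym] by (simp add: add.commute)
      finally show ?thesis
        by (cases p; cases q; cases s; simp)
    qed
  qed
qed

end

text \<open>Two entries of one row for \<open>t < 3\<close>, two entries of one column otherwise.\<close>

definition "w3i = (\<lambda>t. [1, 2, 3, 2, 1, 1] ! t :: nat)"
definition "w3j = (\<lambda>t. [2, 1, 1, 1, 2, 3] ! t :: nat)"
definition "w3k = (\<lambda>t. [1, 2, 3, 3, 3, 2] ! t :: nat)"
definition "w3l = (\<lambda>t. [3, 3, 2, 1, 2, 3] ! t :: nat)"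

lemma w3_simps:
  "w3i 0 = 1" "w3i (Suc 0) = 2" "w3i 2 = 3" "w3i 3 = 2" "w3i 4 = 1" "w3i 5 = 1"
  "w3j 0 = 2" "w3j (Suc 0) = 1" "w3j 2 = 1" "w3j 3 = 1" "w3j 4 = 2" "w3j 5 = 3"
  "w3k 0 = 1" "w3k (Suc 0) = 2" "w3k 2 = 3" "w3k 3 = 3" "w3k 4 = 3" "w3k 5 = 2"
  "w3l 0 = 3" "w3l (Suc 0) = 3" "w3l 2 = 2" "w3l 3 = 1" "w3l 4 = 2" "w3l 5 = 3"
  by (simp_all add: w3i_def w3j_def w3k_def w3l_def nth_Cons')

lemma w3_row:
  assumes "t < 3"
  shows "{w3i t, w3j t, w3l t} = {1, 2, 3}" "w3i t \<noteq> w3j t" "w3i t \<noteq> w3l t" "w3j t \<noteq> w3l t" "w3k t = w3i t"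
proof -
  have "t = 0 \<or> t = 1 \<or> t = 2"
    using assms by auto
  then show "{w3i t, w3j t, w3l t} = {1, 2, 3}" "w3i t \<noteq> w3j t" "w3i t \<noteq> w3l t" "w3j t \<noteq> w3l t" "w3k t = w3i t"
    by (elim disjE; simp add: w3_simps; blast)+
qed

lemma w3_col:
  assumes "t < 6" "\<not> t < 3"
  shows "{w3j t, w3i t, w3k t} = {1, 2, 3}" "w3i t \<noteq> w3j t" "w3i t \<noteq> w3k t" "w3j t \<noteq> w3k t" "w3l t = w3j t"
proof -
  have "t = 3 \<or> t = 4 \<or> t = 5"
    using assms by auto
  then show "{w3j t, w3i t, w3k t} = {1, 2, 3}" "w3i t \<noteq> w3j t" "w3i t \<noteq> w3k t" "w3j t \<noteq> w3k t" "w3l t = w3j t"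
    by (elim disjE; simp add: w3_simps; blast)+
qed

definition psi3_slot :: "nat \<Rightarrow> (nat \<Rightarrow> nat \<Rightarrow> 'd) \<Rightarrow> (nat \<Rightarrow> nat \<Rightarrow> 'd) \<Rightarrow> 'd" where
  "psi3_slot t x y = (if t < 3 then psi_row (w3i t) (w3j t) (w3l t) x y else psi_col (w3j t) (w3i t) (w3k t) x y)"

lemma psi3_simps:
  "psi_row i j k (x + x') y = psi_row i j k x y + psi_row i j k x' y"
  "psi_row i j k x (y + y') = psi_row i j k x y + psi_row i j k x y'"
  "psi_row i j k (mat_scale D c x) y = smult D c (psi_row i j k x y)"
  "psi_row i j k x (mat_scale D c y) = smult D c (psi_row i j k x y)"
  "psi_col i j k (x + x') y = psi_col i j k x y + psi_col i j k x' y"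
  "psi_col i j k x (y + y') = psi_col i j k x y + psi_col i j k x y'"
  "psi_col i j k (mat_scale D c x) y = smult D c (psi_col i j k x y)"
  "psi_col i j k x (mat_scale D c y) = smult D c (psi_col i j k x y)"
  by (simp_all add: psi_row_def psi_col_def mat_scale_def mul_simps md.scale_right_distrib md.scale_right_diff_distrib)

lemma commuting3:
  assumes mn: "m = 3" "n = 0" and I: "i \<in> I" "j \<in> I" "k \<in> I" "l \<in> I" and ne: "i \<noteq> j" "k \<noteq> l" "j \<noteq> k" "i \<noteq> l"
    and ab: "a \<in> part D p" "b \<in> part D q"
  shows "pr (E i j a) (E k l b) \<in> fs.span (BL \<union> {pr (E (w3i t) (w3j t) c) (E (w3k t) (w3l t) \<one>) | t c. t < 6})"
    (is "_ \<in> ?W")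
proof -
  have I3: "I = {1, 2, 3}"
    unfolding I_def by (auto simp: mn)
  have even: "par i = 0" if "i \<in> I" for i
    using that unfolding I_def by (simp add: idx_def mn)
  have BW: "u \<in> ?W" if "u \<approx> fscale s v" "v \<in> ?W" for u v s
  proof -
    have "u - fscale s v \<in> ?W"
      by (rule fs.span_base) (use that(1) in \<open>simp add: eqB_def\<close>)
    from fs.span_add[OF this fs.span_scale[OF that(2), of s]] show ?thesis
      by (simp only: diff_add_cancel)
  qed
  have slot: "pr (E (w3i t) (w3j t) c) (E (w3k t) (w3l t) \<one>) \<in> ?W" if "t < 6" for t c
    by (rule fs.span_base) (use that in blast)
  note slots = slot[of 0, simplified w3_simps, simplified] slot[of 1, simplified, simplified w3_simps]
    slot[of 2, simplified w3_simps, simplified] slot[of 3, simplified w3_simps, simplified]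
    slot[of 4, simplified w3_simps, simplified] slot[of 5, simplified w3_simps, simplified]
  consider "i = k" "j \<noteq> l" | "i \<noteq> k" "j = l" | w where "w \<in> I" "w \<notin> {i, j, k, l}"
    using commuting3_cases[OF mn I ne] by blast
  then show ?thesis
  proof cases
    case 1
    have F: "pr (E i j (a \<stileturn> b)) (E i l \<one>) \<in> ?W"
    \<comment> \<open>The condition describes the order of \<open>j\<close> and \<open>l\<close>
      that is listed among the slots; the other order follows by \<open>row_swap\<close>.\<close>
    proof (cases "(i = 1 \<or> i = 2) \<and> l = 3 \<or> i = 3 \<and> l = 2")
      case True
      then show ?thesis
        using I ne 1 slots unfolding I3 by auto
    next
      case False
      then have "pr (E i l (a \<stileturn> b)) (E i j \<one>) \<in> ?W"
        using I ne 1 slots unfolding I3 by auto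
      then show ?thesis
        using BW[OF row_swap[OF even I(1,4,2) ne(4,1) _ lprod_degree[OF ab]]] 1 by auto
    qed
    have "pr (E i j a) (E i l b) \<approx> fscale 1 (pr (E i j (a \<stileturn> b)) (E i l \<one>))"
      using row_one[OF even I(1,2,4) ne(1,4) 1(2) ab] by simp
    from BW[OF this F] show ?thesis
      using 1 by simp
  next
    case 2
    have F: "pr (E i j (b \<turnstile> a)) (E k j \<one>) \<in> ?W"
    proof (cases "(j = 1 \<or> j = 2) \<and> k = 3 \<or> j = 3 \<and> k = 2")
      case True
      then show ?thesis
        using I ne 2 slots unfolding I3 by auto
    next
      case False
      then have "pr (E k j (b \<turnstile> a)) (E i j \<one>) \<in> ?W"
        using I ne 2 slots unfolding I3 by auto
      then show ?thesis
        using BW[OF col_swap[OF even I(3,2,1) _ _ _ rprod_degree[OF ab(2,1)]]] 2 ne by auto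
    qed
    from BW[OF col_one[OF even I(1,2,3) ne(1) 2(1) ne(3) ab] F] show ?thesis
      using 2 by simp
  next
    case 3
    then have "pr (E i j a) (E k l b) \<approx> 0"
      using comm_disjoint[OF I(1,2) ne(1) I(3,4) ne(2-4)] ab by auto
    then show ?thesis
      by (intro fs.span_base) (simp add: eqB_0)
  qed
qed

lemma exceptional_weights3:
  assumes mn: "m = 3" "n = 0"
  shows "exceptional_weights D m n 6 w3i w3j w3k w3l (\<lambda>_. CI 3) psi3_slot"
proof (unfold_locales, goal_cases)
  have I3: "I = {1, 2, 3}"
    unfolding I_def by (auto simp: mn)
  have even: "par i = 0" if "i \<in> I" for i
    using that unfolding I_def by (simp add: idx_def mn)
  have row: "I = {w3i t, w3j t, w3l t}" "w3i t \<in> I" "w3j t \<in> I" "w3l t \<in> I" if "t < 3" for t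
    using w3_row(1)[OF that] unfolding I3 by blast+
  have col: "I = {w3j t, w3i t, w3k t}" "w3i t \<in> I" "w3j t \<in> I" "w3k t \<in> I" if "t < 6" "\<not> t < 3" for t
    using w3_col(1)[OF that] unfolding I3 by blast+
  have w3: "w3i t \<in> I" "w3j t \<in> I" "w3k t \<in> I" "w3l t \<in> I" if "t < 6" for t
    using that row[of t] col[of t] w3_row(5)[of t] w3_col(5)[of t] by (cases "t < 3"; simp)+
  {
    case (1 t)
    then show ?case
      using w3 by simp
  next
    case (2 t)
    then show ?case
      using w3_row[of t] w3_col[of t] by (cases "t < 3"; simp; blast)
  next
    case (3 t)
    show ?case
      by (rule CI_sub)
  next
    case (4 i j k l a p b q)
    then show ?case
      by (rule commuting3[OF mn])
  next
    case (5 t a)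
    show ?case
    proof (cases "t < 3")
      case True
      then show ?thesis
        using row_kernel[OF even row(2-4)[OF True] w3_row(2-4)[OF True] 5(2)] w3_row(5)[OF True] by simp
    next
      case False
      note c = 5(1) False
      show ?thesis
        using col_kernel[OF even col(2-4)[OF c] w3_col(2-4)[OF c] 5(2)] w3_col(5)[OF c] by simp
    qed
  next
    case (6 t x y z)
    then show ?case
      by (simp add: psi3_slot_def psi3_simps del: plus_fun_apply)
  next
    case (7 t z x y)
    then show ?case
      by (simp add: psi3_slot_def psi3_simps del: plus_fun_apply)
  next
    case (8 t c x z)
    then show ?case
      by (simp add: psi3_slot_def psi3_simps)
  next
    case (9 t z c x)
    then show ?case
      by (simp add: psi3_slot_def psi3_simps)
  next
    case (10 t x p y q)
    have h: "x a b \<stileturn> y c d \<in> part D (p + q)" if "a \<in> I" "b \<in> I" "c \<in> I" "d \<in> I" for a b c d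
      using lprod_degree[OF entry_part[OF 10(2), of a b] entry_part[OF 10(3), of c d]] that even by simp
    have "psi3_slot t x y \<in> part D (p + q)"
      unfolding psi3_slot_def psi_row_def psi_col_def using w3[OF 10(1)] h by (auto intro!: part_closed(2))
    then show ?case
      using w3[OF 10(1)] even by simp
  next
    case (11 t x p y q z s)
    note C = psi3_cocycle[OF CI_sub CI_I(1) CI_I(2)[of 3, simplified] 11(2-4)]
    show ?case
    proof (cases "t < 3")
      case True
      then show ?thesis
        using C(1)[OF row(1)[OF True] w3_row(2-4)[OF True] even] by (simp add: psi3_slot_def)
    next
      case False
      note c = 11(1) False
      show ?thesis
        using C(2)[OF col(1)[OF c] w3_col(2)[OF c, symmetric] w3_col(4,3)[OF c] even] False by (simp add: psi3_slot_def)
    qed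
  next
    case (12 t s a)
    have "psi3_slot s (E (w3i t) (w3j t) a) (E (w3k t) (w3l t) \<one>) = (if s = t then a else 0)"
      using 12 unfolding less_6
      by (elim disjE; simp add: w3_simps psi3_slot_def psi_row_def psi_col_def E_def mul_simps barunit)
    then show ?case
      using md.subspace_0[OF CI_sub] by simp
  next
    case (13 t a b)
    then show ?case
      unfolding less_6 by (elim disjE; simp add: w3_simps psi3_slot_def psi_row_def psi_col_def E_def mul_simps)
  }
qed

end

section \<open>The five cases\<close>

context exceptional_weights
begin

text \<open>In each of the five cases all exceptional weights have the same parity \<open>w\<close>,
  which accounts for the parity shift of the whole power.\<close>

lemma comparison_Fun:
  assumes N: "presents N (pscale D) (KH \<times> Fun r (\<lambda>_. UNIV)) (BH \<times> Fun r J)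
      (\<lambda>p. (part (free_lists D 2) p \<inter> KH) \<times> Fun r (\<lambda>_. part D (p + w))) cl"
    and w: "\<And>t. t < r \<Longrightarrow> par (wi t) + par (wj t) + par (wk t) + par (wl t) = w"
  shows "HL2 L \<cong> N"
proof (rule comparison)
  have "Kw = KH \<times> Fun r (\<lambda>_. UNIV)" "Bw = BH \<times> Fun r J"
    "Pw = (\<lambda>p. (part (free_lists D 2) p \<inter> KH) \<times> Fun r (\<lambda>_. part D (p + w)))"
    by (auto simp: Kw_def Bw_def Pw_def Fun_def w fun_eq_iff)
  then show "presents N (pscale D) Kw Bw Pw cl"
    using N by simp
qed

end

theorem theorem6p1:
  fixes D :: "('r::comm_ring_1, 'd::ab_group_add) superdialgebra"
    and B :: "'d set" and m n :: nat
  assumes "unital_superdialgebra D"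
    and "is_basis D B" and "barunit D \<in> B"
  shows "(m + n \<ge> 5 \<or> (m = 2 \<and> n = 1) \<longrightarrow> HL2 (sl m n D) \<cong> HHS1 D) \<and>
    (m = 3 \<and> n = 0 \<longrightarrow> HL2 (sl m n D) \<cong> HHS1 D \<oplus> mpower (Dquot D 3) 6) \<and>
    (m = 4 \<and> n = 0 \<longrightarrow> HL2 (sl m n D) \<cong> HHS1 D \<oplus> mpower (Dquot D 2) 6) \<and>
    (m = 3 \<and> n = 1 \<longrightarrow> HL2 (sl m n D) \<cong> HHS1 D \<oplus> mpower (Pi_shift (Dquot D 2)) 6) \<and>
    (m = 2 \<and> n = 2 \<longrightarrow> HL2 (sl m n D) \<cong> HHS1 D \<oplus> mpower (Dquot D 2) 4 \<oplus> mpower (Dquot D 0) 2)"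
proof (intro conjI impI)
  interpret unital_superdialgebra D
    by (rule assms(1))
  have sl3: "sl3_algebra D m n" if "m + n \<ge> 3"
    using that by unfold_locales
  show "HL2 (sl m n D) \<cong> HHS1 D" if mn: "m + n \<ge> 5 \<or> (m = 2 \<and> n = 1)"
  proof -
    interpret sl3_algebra D m n
      by (rule sl3) (use mn in auto)
    interpret w: exceptional_weights D m n 0 "\<lambda>_. 1" "\<lambda>_. 2" "\<lambda>_. 1" "\<lambda>_. 3" "\<lambda>_. {}" "\<lambda>_ _ _. 0"
      by (rule exceptional_weights_none[OF mn])
    show ?thesis
      by (rule w.comparison_Fun[OF presents_0]) simp
  qed
  show "HL2 (sl m n D) \<cong> HHS1 D \<oplus> mpower (Dquot D 3) 6" if mn: "m = 3 \<and> n = 0"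
  proof -
    interpret sl3_algebra D m n
      by (rule sl3) (use mn in auto)
    interpret w: exceptional_weights D m n 6 w3i w3j w3k w3l "\<lambda>_. CI 3" psi3_slot
      by (rule exceptional_weights3) (use mn in auto)
    obtain cl where "presents (HHS1 D \<oplus> mpower (Dquot D 3) 6) (pscale D) (KH \<times> Fun 6 (\<lambda>_. UNIV)) (BH \<times> Fun 6 (\<lambda>_. CI 3))
        (\<lambda>p. (part (free_lists D 2) p \<inter> KH) \<times> Fun 6 (\<lambda>_. part D (p + 0))) cl"
      using presents_k[of "Dquot D 3" 3 0 6] by auto
    then show ?thesis
      by (rule w.comparison_Fun) (use mn in \<open>simp add: less_6, elim disjE; simp add: w3_simps idx_def\<close>)
  qed
  \<comment> \<open>In types (4, 0) and (3, 1) at most one index is odd, so no weight is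
    \<open>alternating\<close> and the relations are \<open>CI 2\<close> throughout. The two types
    differ in the parity of the sum of the four indices.\<close>
  have four: "HL2 (sl m n D) \<cong> HHS1 D \<oplus> mpower Q 6"
    if mn: "m = 4 \<and> n = 0 \<or> m = 3 \<and> n = 1"
      and Q: "\<And>p. part Q p = part (Dquot D 2) (p + (if n = 0 then 0 else 1))"
        "supermodule.carrier Q = supermodule.carrier (Dquot D 2)" "smult Q = smult (Dquot D 2)" for Q
  proof -
    interpret sl3_algebra D m n
      by (rule sl3) (use mn in auto)
    have "\<not> alternating t" if "t < 6" for t
      using mn that unfolding less_6 alternating_def by (elim disjE conjE; simp add: w4_simps idx_def)
    then interpret w: exceptional_weights D m n 6 w4i w4j w4k w4l "\<lambda>_. CI 2" psi4_slot
      by (intro exceptional_weights4) (use mn in auto)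
    have s: "par (w4i t) + par (w4j t) + par (w4k t) + par (w4l t) = (if n = 0 then 0 else 1)" if "t < 6" for t
      using mn that unfolding less_6 by (elim disjE conjE; simp add: w4_simps idx_def)
    obtain cl where "presents (HHS1 D \<oplus> mpower Q 6) (pscale D) (KH \<times> Fun 6 (\<lambda>_. UNIV)) (BH \<times> Fun 6 (\<lambda>_. CI 2))
        (\<lambda>p. (part (free_lists D 2) p \<inter> KH) \<times> Fun 6 (\<lambda>_. part D (p + (if n = 0 then 0 else 1)))) cl"
      using presents_k[of Q 2 "if n = 0 then 0 else 1" 6, OF Q] by auto
    then show ?thesis
      by (rule w.comparison_Fun[OF _ s])
  qed
  show "HL2 (sl m n D) \<cong> HHS1 D \<oplus> mpower (Dquot D 2) 6" if "m = 4 \<and> n = 0"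
    using that by (intro four) auto
  show "HL2 (sl m n D) \<cong> HHS1 D \<oplus> mpower (Pi_shift (Dquot D 2)) 6" if "m = 3 \<and> n = 1"
    using that by (intro four) (auto simp: Pi_shift_def)
  show "HL2 (sl m n D) \<cong> HHS1 D \<oplus> mpower (Dquot D 2) 4 \<oplus> mpower (Dquot D 0) 2" if mn: "m = 2 \<and> n = 2"
  proof -
    interpret sl3_algebra D m n
      by (rule sl3) (use mn in auto)
    \<comment> \<open>The alternating weights have rows \<open>{1, 2}\<close> or
      \<open>{3, 4}\<close>; \<open>w4i\<close> and its companions list them last, which fits
      \<open>presents_split\<close>.\<close>
    have "alternating t \<longleftrightarrow> \<not> t < 4" if "t < 6" for t
      using mn that unfolding less_6 alternating_def by (elim disjE conjE; simp add: w4_simps idx_def)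
    then interpret w: exceptional_weights D m n 6 w4i w4j w4k w4l "\<lambda>t. if t < 4 then CI 2 else CI 0" psi4_slot
      by (intro exceptional_weights4) (use mn in auto)
    have s: "par (w4i t) + par (w4j t) + par (w4k t) + par (w4l t) = 0" if "t < 6" for t
      using mn that unfolding less_6 by (elim disjE conjE; simp add: w4_simps idx_def)
    obtain cl where "presents (HHS1 D \<oplus> mpower (Dquot D 2) 4 \<oplus> mpower (Dquot D 0) 2) (pscale D)
        (KH \<times> Fun 6 (\<lambda>_. UNIV)) (BH \<times> Fun 6 (\<lambda>t. if t < 4 then CI 2 else CI 0))
        (\<lambda>p. (part (free_lists D 2) p \<inter> KH) \<times> Fun 6 (\<lambda>_. part D (p + 0))) cl"
      using presents_split by auto
    then show ?thesis
      by (rule w.comparison_Fun[OF _ s])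
  qed
qed

end
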